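(* Let $Q=(0,\ell)$ be a bounded interval and consider the one-dimensional wave equation $\partial_t^2u=c(\varepsilon t)^2\partial_x^2u+a(\varepsilon t)u^3$ for $x\in Q$, $t\ge 0$, with homogeneous Dirichlet boundary conditions $u=0$ on $\partial Q$ and with initial values satisfying $\|\partial_xu(\cdot,0)\|\le C_0\varepsilon$ and $\|\partial_tu(\cdot,0)\|\le C_0\varepsilon$, where $C_0$ is independent of $\varepsilon$. Fix an integer $N\ge 1$ arbitrarily. Then there exist $\varepsilon_N>0$ and a constant $C_N$ such that for all $0<\varepsilon\le\varepsilon_N$ the problem admits a solution $(u(\cdot,t),\partial_tu(\cdot,t))\in H^1_0(Q)\times L_2(Q)$ over long times $0\le t\le\varepsilon^{-N}$, and $$|I(t)-I(0)|\le C_N\varepsilon^3\quad\text{for } 0\le t\le\varepsilon^{-N},$$ where $$I(t)=\frac1{2c(\varepsilon t)}\Bigl(\|\partial_tu(\cdot,t)\|^2+c(\varepsilon t)^2\|\partial_xu(\cdot,t)\|^2\Bigr),$$ and $C_N$ is independent of $\varepsilon\le\varepsilon_N$ and $t\le\varepsilon^{-N}$.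
   Context: $\|\cdot\|$ is the $L_2(Q)$ norm. The functions $c,a:[0,\infty)\to\mathbb R$ are smooth and bounded together with all their derivatives, and $c(\tau)\ge c_0>0$ for all $\tau\ge0$. The functions $c$, $a$ do not depend on $\varepsilon$; the (real-valued) initial data may depend on $\varepsilon$. *)

theory Defs
  imports "HOL-Analysis.Analysis"
begin

text \<open>Elements of the function spaces below are functions, not classes modulo almost everywhere
  equality; equality of such functions therefore has to be stated almost everywhere.\<close>

definition L2_space :: "real set \<Rightarrow> (real \<Rightarrow> real) set" where
  "L2_space Q = {f \<in> borel_measurable (lebesgue_on Q). integrable (lebesgue_on Q) (\<lambda>x. (f x)\<^sup>2)}"

definition L2_norm :: "real set \<Rightarrow> (real \<Rightarrow> real) \<Rightarrow> real" where
  "L2_norm Q f = sqrt (LINT x|lebesgue_on Q. (f x)\<^sup>2)"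

definition test_functions :: "real set \<Rightarrow> (real \<Rightarrow> real) set" where
  "test_functions Q = {\<phi>. (\<forall>k. (deriv ^^ k) \<phi> differentiable_on UNIV) \<and>
     compact (closure {x. \<phi> x \<noteq> 0}) \<and> closure {x. \<phi> x \<noteq> 0} \<subseteq> Q}"

definition has_weak_derivative :: "real set \<Rightarrow> (real \<Rightarrow> real) \<Rightarrow> (real \<Rightarrow> real) \<Rightarrow> bool" where
  "has_weak_derivative Q f g \<longleftrightarrow> g \<in> L2_space Q \<and>
     (\<forall>\<phi>\<in>test_functions Q.
        (LINT x|lebesgue_on Q. f x * deriv \<phi> x) = - (LINT x|lebesgue_on Q. g x * \<phi> x))"

text \<open>On an open set the weak derivative is unique up to almost everywhere equality, so the choice
  made here affects no integral.\<close>

definition weak_derivative :: "real set \<Rightarrow> (real \<Rightarrow> real) \<Rightarrow> real \<Rightarrow> real" where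
  "weak_derivative Q f = (SOME g. has_weak_derivative Q f g)"

definition H1_space :: "real set \<Rightarrow> (real \<Rightarrow> real) set" where
  "H1_space Q = {f \<in> L2_space Q. \<exists>g. has_weak_derivative Q f g}"

definition H1_norm :: "real set \<Rightarrow> (real \<Rightarrow> real) \<Rightarrow> real" where
  "H1_norm Q f = sqrt ((L2_norm Q f)\<^sup>2 + (L2_norm Q (weak_derivative Q f))\<^sup>2)"

definition H10_space :: "real set \<Rightarrow> (real \<Rightarrow> real) set" where
  "H10_space Q = {f \<in> H1_space Q. \<exists>\<phi>. (\<forall>n. \<phi> n \<in> test_functions Q) \<and>
     (\<lambda>n::nat. H1_norm Q (\<lambda>x. \<phi> n x - f x)) \<longlonglongrightarrow> 0}"

text \<open>All derivatives are taken within the half-line, hence one-sided at \<open>0\<close>; the values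
  of the functions \<open>D k\<close> at negative arguments are irrelevant.\<close>

definition smooth_bounded :: "(real \<Rightarrow> real) \<Rightarrow> bool" where
  "smooth_bounded f \<longleftrightarrow> (\<exists>D :: nat \<Rightarrow> real \<Rightarrow> real. D 0 = f \<and>
     (\<forall>k. \<forall>\<tau>\<ge>0. (D k has_real_derivative D (Suc k) \<tau>) (at \<tau> within {0..})) \<and>
     (\<forall>k. bounded (D k ` {0..})))"

text \<open>Weak solutions on \<open>[0, T]\<close> of
  \<open>u\<^sub>t\<^sub>t = c(\<epsilon>t)\<^sup>2 u\<^sub>x\<^sub>x + a(\<epsilon>t) u\<^sup>3\<close>, with \<open>v\<close> the time derivative of
  \<open>u\<close>: \<open>u\<close> is continuous with values in \<open>H10\<close>, it is continuously differentiable with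
  values in \<open>L2\<close>, and the equation holds in the dual space of \<open>H10\<close>, that is, after pairing
  with any element of \<open>H10\<close>. The boundary condition is membership in \<open>H10\<close>.\<close>

definition wave_solution ::
  "real set \<Rightarrow> (real \<Rightarrow> real) \<Rightarrow> (real \<Rightarrow> real) \<Rightarrow> real \<Rightarrow> real \<Rightarrow> (real \<Rightarrow> real) \<Rightarrow> (real \<Rightarrow> real) \<Rightarrow>
   (real \<Rightarrow> real \<Rightarrow> real) \<Rightarrow> (real \<Rightarrow> real \<Rightarrow> real) \<Rightarrow> bool" where
  "wave_solution Q c a \<epsilon> T u0 u1 u v \<longleftrightarrow>
     (\<forall>t\<in>{0..T}.
        u t \<in> H10_space Q \<and> v t \<in> L2_space Q \<and>
        ((\<lambda>s. H1_norm Q (\<lambda>x. u s x - u t x)) \<longlongrightarrow> 0) (at t within {0..T}) \<and>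
        ((\<lambda>s. L2_norm Q (\<lambda>x. v s x - v t x)) \<longlongrightarrow> 0) (at t within {0..T}) \<and>
        ((\<lambda>s. L2_norm Q (\<lambda>x. (u s x - u t x) / (s - t) - v t x)) \<longlongrightarrow> 0) (at t within {0..T}) \<and>
        (\<forall>\<phi>\<in>H10_space Q.
           ((\<lambda>s. LINT x|lebesgue_on Q. v s x * \<phi> x) has_real_derivative
              (- (c (\<epsilon> * t))\<^sup>2 *
                 (LINT x|lebesgue_on Q. weak_derivative Q (u t) x * weak_derivative Q \<phi> x) +
               a (\<epsilon> * t) * (LINT x|lebesgue_on Q. (u t x) ^ 3 * \<phi> x)))
           (at t within {0..T}))) \<and>
     (AE x in lebesgue_on Q. u 0 x = u0 x) \<and> (AE x in lebesgue_on Q. v 0 x = u1 x)"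

definition adiabatic_invariant ::
  "real set \<Rightarrow> (real \<Rightarrow> real) \<Rightarrow> real \<Rightarrow> (real \<Rightarrow> real \<Rightarrow> real) \<Rightarrow> (real \<Rightarrow> real \<Rightarrow> real) \<Rightarrow> real \<Rightarrow> real" where
  "adiabatic_invariant Q c \<epsilon> u v t =
     1 / (2 * c (\<epsilon> * t)) *
       ((L2_norm Q (v t))\<^sup>2 + (c (\<epsilon> * t))\<^sup>2 * (L2_norm Q (weak_derivative Q (u t)))\<^sup>2)"

end

theory Submission imports Defs "HOL-Computational_Algebra.Polynomial"
begin

text \<open>The Liouville substitution $u=\varepsilon\,c(\varepsilon t)^{-1/2}z(s,x)$, $s=\int_0^t c$, turns the equation into
$z_{ss}=z_{xx}+\varepsilon^2(Bz+Az^3)$ with coefficients that vary on the scale $1/\varepsilon$, and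
$I=\frac12\varepsilon^2(\|z_s\|^2+\|z_x\|^2)+O(\varepsilon^3)$. In d'Alembert's form the solution is a single
$2\ell$-periodic profile $P(s,\cdot)$ with $\partial_sP=O(\varepsilon^2)$, so that all motion with period $T=2\ell$ has been
removed, and $I$ is governed by $\|P\|^2$.

Since each further difference of $P$ over the time $T$ is smaller by a factor $\varepsilon$, the sequence
$P(s+jT)$, $j\le M$, can be interpolated by a polynomial in $r=j$ that satisfies the equation up to
$O(\varepsilon^{M+3})$. The interpolated family depends on the fast phase $s$ and the slow variable $r$ separately, and invariance of the
averaged action functional under shifts of $s$ yields a quantity $J=T\|P\|^2/2+O(\varepsilon^2)$ with
$J'=O(\varepsilon^{M+3})$. Hence $\|P\|^2$ changes by $O(\varepsilon^2)$ up to times $\varepsilon^{-M-1}$; a truncation of the cubic term and a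
bootstrap give existence on the same interval.\<close>

text \<open>Differentiating again in s is no remedy: the fast phase enters through the reflection z
  -> 2s - z, so each s-derivative of the field falls on P, and P is merely square integrable.
  Differences over T avoid this. Since 2(s + jT) - z equals 2s - z modulo T, the states at s, s + T,
  ..., s + MT are compared at one frozen phase, without any derivative in x. This rests on complete
  resonance: all solutions of the linear equation share the period T. The powers of eps: t <= eps^-N
  means s <= c1 eps^-N, where c1 bounds c, hence s <= eps^-(N+1) for small eps, and M = N suffices.
  The drift O(eps^2) of the squared norm of P contributes only O(eps^4) to I. The eps^3 of the
  statement comes from the substitution itself, namely from the cross term between the leading
  velocity eps z_s and the correction eps^2 g g' z, with g = c^(-1/2).\<close>

lemmas HK_cong = Henstock_Kurzweil_Integration.integral_cong
lemmas HK_add = Henstock_Kurzweil_Integration.integral_add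
lemmas HK_diff = Henstock_Kurzweil_Integration.integral_diff

section \<open>Square integrable functions\<close>

lemma integrable_lebesgue_on_iff_abs:
 assumes "S \<in> sets lebesgue"
 shows "integrable (lebesgue_on S) f \<longleftrightarrow> f absolutely_integrable_on S"
 using assms by (simp add: integrable_restrict_space set_integrable_def)

lemma L2_measurable: "f \<in> L2_space S ==> f \<in> borel_measurable (lebesgue_on S)"
 by (simp add: L2_space_def)

lemma L2_sq_integrable: "f \<in> L2_space S ==> integrable (lebesgue_on S) (%x. (f x)^2)"
 by (simp add: L2_space_def)

lemma L2_mult_integrable:
 assumes "f \<in> L2_space S" "g \<in> L2_space S"
 shows "integrable (lebesgue_on S) (%x. f x * g x)"
proof (rule Bochner_Integration.integrable_bound)
 show "integrable (lebesgue_on S) (%x. (f x)^2 + (g x)^2)"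
  using assms by (simp add: L2_sq_integrable)
 show "(%x. f x * g x) \<in> borel_measurable (lebesgue_on S)"
  using assms[THEN L2_measurable] by measurable
 have "\<bar>a * b\<bar> <= a^2 + b^2" for a b :: real
 proof -
  have "2 * (\<bar>a\<bar> * \<bar>b\<bar>) <= a^2 + b^2" using sum_squares_bound[of "\<bar>a\<bar>" "\<bar>b\<bar>"] by simp
  moreover have "0 <= \<bar>a\<bar> * \<bar>b\<bar>" by simp
  ultimately show ?thesis unfolding abs_mult by linarith
 qed
 then show "AE x in lebesgue_on S. norm (f x * g x) <= norm ((f x)^2 + (g x)^2)"
  by (simp add: abs_mult)
qed

lemma L2_add: "f \<in> L2_space S ==> g \<in> L2_space S ==> (%x. f x + g x) \<in> L2_space S"
 using L2_mult_integrable[of f S g] by (auto simp: L2_space_def power2_sum mult.assoc)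

lemma L2_cmult: "f \<in> L2_space S ==> (%x. c * f x) \<in> L2_space S"
 by (auto simp: L2_space_def power_mult_distrib)

lemma L2_uminus: "f \<in> L2_space S ==> (%x. - f x) \<in> L2_space S"
 using L2_cmult[of f S "-1"] by simp

lemma L2_diff: "f \<in> L2_space S ==> g \<in> L2_space S ==> (%x. f x - g x) \<in> L2_space S"
 using L2_add[OF _ L2_uminus, of f S g] by simp

lemma L2_divide: "f \<in> L2_space S ==> (%x. f x / c) \<in> L2_space S"
 using L2_cmult[of f S "1/c"] by simp

lemma L2_zero: "(%x. 0) \<in> L2_space S"
 by (simp add: L2_space_def)

lemma L2_norm_sq: "(L2_norm S f)^2 = (LINT x|lebesgue_on S. (f x)^2)"
 by (simp add: L2_norm_def)

lemma L2_norm_nonneg [simp]: "L2_norm S f >= 0"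
 by (simp add: L2_norm_def)

lemma L2_norm_cmult: "L2_norm S (%x. c * f x) = \<bar>c\<bar> * L2_norm S f"
 by (simp add: L2_norm_def power_mult_distrib real_sqrt_mult)

lemma L2_norm_uminus: "L2_norm S (%x. - f x) = L2_norm S f"
 by (simp add: L2_norm_def)

lemma L2_norm_commute: "L2_norm S (%x. f x - g x) = L2_norm S (%x. g x - f x)"
 by (simp add: L2_norm_def power2_commute)

lemma L2_norm_zero [simp]: "L2_norm S (%x. 0) = 0"
 by (simp add: L2_norm_def)

lemma L2_norm_cong_AE:
 assumes "f \<in> borel_measurable (lebesgue_on S)" "g \<in> borel_measurable (lebesgue_on S)"
  and "AE x in lebesgue_on S. f x = g x"
 shows "L2_norm S f = L2_norm S g"
proof -
 have "(LINT x|lebesgue_on S. (f x)^2) = (LINT x|lebesgue_on S. (g x)^2)"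
  using assms by (intro integral_cong_AE) auto
 then show ?thesis by (simp add: L2_norm_def)
qed

lemma L2_norm_eq_0:
 assumes "f \<in> L2_space S" "L2_norm S f = 0"
 shows "AE x in lebesgue_on S. f x = 0"
proof -
 have "(LINT x|lebesgue_on S. (f x)^2) = 0" using assms(2) by (simp flip: L2_norm_sq)
 then show ?thesis
  using integral_nonneg_eq_0_iff_AE[OF L2_sq_integrable[OF assms(1)]] by simp
qed

lemma L2_cong_AE:
 assumes "f \<in> L2_space S" "g \<in> borel_measurable (lebesgue_on S)"
  and "AE x in lebesgue_on S. f x = g x"
 shows "g \<in> L2_space S"
proof -
 have "integrable (lebesgue_on S) (%x. (g x)^2)"
  using assms L2_measurable[OF assms(1)]
  by (subst integrable_cong_AE[where g="%x. (f x)^2"]) (auto simp: L2_sq_integrable)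
 then show ?thesis using assms by (simp add: L2_space_def)
qed

lemma L2_cauchy_schwarz:
 assumes f: "f \<in> L2_space S" and g: "g \<in> L2_space S"
 shows "\<bar>LINT x|lebesgue_on S. f x * g x\<bar> <= L2_norm S f * L2_norm S g"
proof -
 let ?M = "lebesgue_on S"
 define a b c where "a = (LINT x|?M. (f x)^2)" "b = (LINT x|?M. f x * g x)" "c = (LINT x|?M. (g x)^2)"
 have nn: "a >= 0" "c >= 0" by (simp_all add: a_b_c_def)
 have q: "a - 2 * t * b + t^2 * c >= 0" for t
 proof -
  have "0 <= (LINT x|?M. (f x - t * g x)^2)" by simp
  also have "... = (LINT x|?M. (f x)^2 - 2 * t * (f x * g x) + t^2 * (g x)^2)"
   by (intro Bochner_Integration.integral_cong) (auto simp: power2_diff power_mult_distrib)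
  also have "... = a - 2 * t * b + t^2 * c"
   using f g by (simp add: a_b_c_def L2_sq_integrable L2_mult_integrable)
  finally show ?thesis .
 qed
 have "b^2 <= a * c"
 \<comment> \<open>The quadratic \<open>q\<close> is smallest at t = b / c; for c = 0 the function g
   vanishes almost everywhere and so does the product.\<close>
 proof (cases "c = 0")
  case True
  then have "L2_norm S g = 0" by (simp add: L2_norm_def a_b_c_def)
  then have "AE x in ?M. f x * g x = 0" using L2_norm_eq_0[OF g] by auto
  then have "b = 0" unfolding a_b_c_def by (rule integral_eq_zero_AE)
  then show ?thesis using True by simp
 next
  case False
  then have "c > 0" using nn by simp
  then show ?thesis using q[of "b / c"] by (simp add: power2_eq_square field_simps)
 qed
 then have "\<bar>b\<bar> <= sqrt (a * c)" by (rule real_le_rsqrt[of "\<bar>b\<bar>", simplified])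
 then show ?thesis by (simp add: L2_norm_def a_b_c_def real_sqrt_mult)
qed

lemma L2_norm_add_sq:
 assumes "f \<in> L2_space S" "g \<in> L2_space S"
 shows "(L2_norm S (%x. f x + g x))^2 =
  (L2_norm S f)^2 + 2 * (LINT x|lebesgue_on S. f x * g x) + (L2_norm S g)^2"
proof -
 have "(LINT x|lebesgue_on S. (f x + g x)^2) =
   (LINT x|lebesgue_on S. (f x)^2 + 2 * (f x * g x) + (g x)^2)"
  by (intro Bochner_Integration.integral_cong) (auto simp: power2_sum)
 then show ?thesis using assms by (simp add: L2_norm_sq L2_sq_integrable L2_mult_integrable)
qed

lemma L2_norm_triangle:
 assumes "f \<in> L2_space S" "g \<in> L2_space S"
 shows "L2_norm S (%x. f x + g x) <= L2_norm S f + L2_norm S g"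
proof (rule power2_le_imp_le)
 show "(L2_norm S (%x. f x + g x))^2 <= (L2_norm S f + L2_norm S g)^2"
  using L2_cauchy_schwarz[OF assms] L2_norm_add_sq[OF assms] by (simp add: power2_sum)
qed simp

lemma L2_norm_triangle_diff:
 assumes "f \<in> L2_space S" "g \<in> L2_space S"
 shows "L2_norm S (%x. f x - g x) <= L2_norm S f + L2_norm S g"
 using L2_norm_triangle[OF assms(1) L2_uminus[OF assms(2)]] by (simp add: L2_norm_uminus)

lemma L2_norm_triangle':
 assumes "f \<in> L2_space S" "g \<in> L2_space S" "h \<in> L2_space S"
 shows "L2_norm S (%x. f x - h x) <= L2_norm S (%x. f x - g x) + L2_norm S (%x. g x - h x)"
 using L2_norm_triangle[OF L2_diff[OF assms(1,2)] L2_diff[OF assms(2,3)]] by simp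

lemma L2_norm_reverse_triangle:
 assumes "f \<in> L2_space S" "g \<in> L2_space S"
 shows "\<bar>L2_norm S f - L2_norm S g\<bar> <= L2_norm S (%x. f x - g x)"
 using L2_norm_triangle'[OF assms L2_zero] L2_norm_triangle'[OF assms(2,1) L2_zero]
  L2_norm_commute[of S f g] by simp

lemma L2_norm_le_of_integral:
 assumes "(LINT x|lebesgue_on S. (f x)^2) <= c^2" "c >= 0"
 shows "L2_norm S f <= c"
 using assms by (simp add: L2_norm_def real_le_lsqrt)

lemma L2_bounded:
 assumes S: "S \<in> lmeasurable" and f: "f \<in> borel_measurable (lebesgue_on S)"
  and b: "!!x. x \<in> S ==> \<bar>f x\<bar> <= B" and B: "B >= 0"
 shows "f \<in> L2_space S" "L2_norm S f <= B * sqrt (measure lebesgue S)"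
proof -
 have Sl: "S \<in> sets lebesgue" using S by blast
 have le: "(f x)^2 <= B^2" if "x \<in> S" for x using power_mono[OF b[OF that] abs_ge_zero, of 2] by simp
 have c: "integrable (lebesgue_on S) (%x. B^2)"
  using S by (intro finite_measure.integrable_const finite_measure_lebesgue_on)
 have i: "integrable (lebesgue_on S) (%x. (f x)^2)"
  by (rule Bochner_Integration.integrable_bound[OF c])
   (use f le Sl in \<open>auto simp: AE_restrict_space_iff\<close>)
 then show "f \<in> L2_space S" using f by (simp add: L2_space_def)
 have "(LINT x|lebesgue_on S. (f x)^2) <= (LINT x|lebesgue_on S. B^2)"
  by (rule integral_mono[OF i c]) (use le in auto)
 also have "... = measure lebesgue S * B^2" using Sl
  by (simp add: measure_restrict_space)
 finally show "L2_norm S f <= B * sqrt (measure lebesgue S)" using B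
  by (intro L2_norm_le_of_integral) (auto simp: power_mult_distrib mult.commute)
qed

lemma L2_continuous:
 assumes "continuous_on {a..b} f"
 shows "f \<in> L2_space {a..b::real}"
proof -
 have "bounded (f ` {a..b})" using assms compact_continuous_image compact_Icc compact_imp_bounded by blast
 then have "\<exists>B. \<forall>x\<in>{a..b}. \<bar>f x\<bar> <= B" unfolding bounded_iff by simp
 then obtain B where B: "!!x. x \<in> {a..b} ==> \<bar>f x\<bar> <= B" by blast
 show ?thesis
  by (rule L2_bounded(1)[where B="max B 0"])
   (use B assms in \<open>force intro: continuous_imp_measurable_on_sets_lebesgue\<close>)+
qed

lemma L2_norm_interval_le:
 assumes f: "continuous_on {a..b} f" and "!!x. x \<in> {a..b} ==> \<bar>f x\<bar> <= B" "B >= 0" "a <= b"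
 shows "L2_norm {a..b::real} f <= B * sqrt (b - a)"
proof -
 have "L2_norm {a..b} f <= B * sqrt (measure lebesgue {a..b})"
  by (rule L2_bounded(2)) (use assms in \<open>auto intro: continuous_imp_measurable_on_sets_lebesgue\<close>)
 then show ?thesis using assms by simp
qed

lemma L2_subset:
 assumes "f \<in> L2_space S" "S' \<subseteq> S" "S \<in> sets lebesgue" "S' \<in> sets lebesgue"
 shows "f \<in> L2_space S'" "L2_norm S' f <= L2_norm S f"
proof -
 have m: "f \<in> borel_measurable (lebesgue_on S')"
  using L2_measurable[OF assms(1)] assms(2) by (rule measurable_restrict_mono)
 have i: "integrable (lebesgue_on S') (%x. (f x)^2)"
  using set_integrable_subset[OF _ assms(4,2), of "%x. (f x)^2"] L2_sq_integrable[OF assms(1)] assms(3,4)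
  by (simp add: integrable_lebesgue_on_iff_abs)
 show "f \<in> L2_space S'" using m i by (simp add: L2_space_def)
 have "(LINT x|lebesgue_on S'. (f x)^2) = integral S' (%x. (f x)^2)"
  using i assms(4) by (rule lebesgue_integral_eq_integral)
 also have "... <= integral S (%x. (f x)^2)"
  by (rule integral_subset_le[OF assms(2) integrable_on_lebesgue_on[OF i assms(4)]
     integrable_on_lebesgue_on[OF L2_sq_integrable[OF assms(1)] assms(3)]]) simp
 also have "... = (LINT x|lebesgue_on S. (f x)^2)"
  using L2_sq_integrable[OF assms(1)] assms(3) by (rule lebesgue_integral_eq_integral[symmetric])
 finally show "L2_norm S' f <= L2_norm S f" by (simp add: L2_norm_def)
qed

lemma L2_integrable:
 assumes "f \<in> L2_space S" "S \<in> lmeasurable"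
 shows "integrable (lebesgue_on S) f"
proof -
 have "(%x. 1) \<in> L2_space S" by (rule L2_bounded(1)[where B=1]) (use assms in auto)
 from L2_mult_integrable[OF assms(1) this] show ?thesis by simp
qed

subsection \<open>Convergence and differentiation in the mean\<close>

lemma tendsto_of_norm_bound:
 fixes f g :: "'a => real"
 assumes "(g \<longlongrightarrow> 0) F" "\<forall>\<^sub>F x in F. \<bar>f x\<bar> <= g x"
 shows "(f \<longlongrightarrow> 0) F"
 using assms by (intro Lim_null_comparison[of f g]) auto

lemma L2_lim_norm:
 assumes "((%s. L2_norm S (%x. A s x - a x)) \<longlongrightarrow> 0) F"
  and "\<forall>\<^sub>F s in F. A s \<in> L2_space S" and "a \<in> L2_space S"
 shows "((%s. L2_norm S (A s)) \<longlongrightarrow> L2_norm S a) F"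
proof -
 have "((%s. L2_norm S (A s) - L2_norm S a) \<longlongrightarrow> 0) F"
  using assms(1) by (rule tendsto_of_norm_bound)
   (use assms(2,3) in \<open>auto elim!: eventually_mono intro: L2_norm_reverse_triangle\<close>)
 then show ?thesis using Lim_null by blast
qed

text \<open>The difference of the pairings splits into A s - a against B s and a against B s - b;
  Cauchy-Schwarz bounds both, and the norms of B s converge. The general filter lets the same lemma
  serve limits of functions and of difference quotients.\<close>

lemma L2_lim_inner:
 assumes A: "((%s. L2_norm S (%x. A s x - a x)) \<longlongrightarrow> 0) F"
  and B: "((%s. L2_norm S (%x. B s x - b x)) \<longlongrightarrow> 0) F"
  and A2: "\<forall>\<^sub>F s in F. A s \<in> L2_space S" and a: "a \<in> L2_space S"
  and B2: "\<forall>\<^sub>F s in F. B s \<in> L2_space S" and b: "b \<in> L2_space S"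
 shows "((%s. LINT x|lebesgue_on S. A s x * B s x) \<longlongrightarrow> (LINT x|lebesgue_on S. a x * b x)) F"
proof -
 let ?N = "L2_norm S"
 have lim: "((%s. ?N (%x. A s x - a x) * ?N (B s) + ?N a * ?N (%x. B s x - b x)) \<longlongrightarrow>
   0 * ?N b + ?N a * 0) F"
  by (intro tendsto_intros A B L2_lim_norm[OF B B2 b])
 have "((%s. (LINT x|lebesgue_on S. A s x * B s x) - (LINT x|lebesgue_on S. a x * b x)) \<longlongrightarrow> 0) F"
 proof (rule tendsto_of_norm_bound)
  show "((%s. ?N (%x. A s x - a x) * ?N (B s) + ?N a * ?N (%x. B s x - b x)) \<longlongrightarrow> 0) F"
   using lim by simp
  show "\<forall>\<^sub>F s in F. \<bar>(LINT x|lebesgue_on S. A s x * B s x) - (LINT x|lebesgue_on S. a x * b x)\<bar>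
    <= ?N (%x. A s x - a x) * ?N (B s) + ?N a * ?N (%x. B s x - b x)"
   using A2 B2
  proof eventually_elim
   case (elim s)
   have "(LINT x|lebesgue_on S. A s x * B s x) - (LINT x|lebesgue_on S. a x * b x) =
    (LINT x|lebesgue_on S. (A s x - a x) * B s x) + (LINT x|lebesgue_on S. a x * (B s x - b x))"
    using elim a b by (simp add: algebra_simps L2_mult_integrable)
   then show ?case
    using L2_cauchy_schwarz[OF L2_diff[OF elim(1) a] elim(2)]
     L2_cauchy_schwarz[OF a L2_diff[OF elim(2) b]] by linarith
  qed
 qed
 then show ?thesis using Lim_null by blast
qed

text \<open>Norm derivative of an L2-valued curve, written exactly as the third limit in
  \<open>wave_solution\<close>, so that the calculus below applies to the notion of solution
  directly.\<close>

definition has_L2_derivative ::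
 "real set => (real => real => real) => (real => real) => real => real set => bool" where
 "has_L2_derivative S A A' t I \<longleftrightarrow>
   ((%s. L2_norm S (%x. (A s x - A t x) / (s - t) - A' x)) \<longlongrightarrow> 0) (at t within I)"

lemma L2_cmult_limit:
 assumes "((%s. L2_norm S (A s)) \<longlongrightarrow> 0) F" "(k \<longlongrightarrow> c) F"
 shows "((%s. L2_norm S (%x. k s * A s x)) \<longlongrightarrow> 0) F"
 using tendsto_mult[OF tendsto_rabs[OF assms(2)] assms(1)] by (simp add: L2_norm_cmult)

lemma L2_add_limit:
 assumes "((%s. L2_norm S (A s)) \<longlongrightarrow> 0) F" "((%s. L2_norm S (B s)) \<longlongrightarrow> 0) F"
  and "\<forall>\<^sub>F s in F. A s \<in> L2_space S \<and> B s \<in> L2_space S"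
 shows "((%s. L2_norm S (%x. A s x + B s x)) \<longlongrightarrow> 0) F"
 by (rule tendsto_of_norm_bound[OF _ eventually_mono[OF assms(3)]])
  (use tendsto_add[OF assms(1,2)] L2_norm_triangle in auto)

lemma eventually_at_within_in: fixes t :: real shows "\<forall>\<^sub>F s in at t within I. s \<in> I \<and> s \<noteq> t"
 by (auto simp: eventually_at_filter)

lemma L2_deriv_continuous:
 assumes d: "has_L2_derivative S A A' t I" and A: "!!s. s \<in> I ==> A s \<in> L2_space S"
  and t: "t \<in> I" and A': "A' \<in> L2_space S"
 shows "((%s. L2_norm S (%x. A s x - A t x)) \<longlongrightarrow> 0) (at t within I)"
proof -
 let ?F = "at t within I"
 have k: "((%s. s - t) \<longlongrightarrow> 0) ?F" by (auto intro!: tendsto_eq_intros)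
 have 1: "((%s. L2_norm S (%x. (s - t) * ((A s x - A t x) / (s - t) - A' x))) \<longlongrightarrow> 0) ?F"
  by (rule L2_cmult_limit[OF d[unfolded has_L2_derivative_def] k])
 have 2: "((%s. L2_norm S (%x. (s - t) * A' x)) \<longlongrightarrow> 0) ?F"
  unfolding L2_norm_cmult using tendsto_mult[OF tendsto_rabs[OF k] tendsto_const[of "L2_norm S A'"]] by simp
 have 3: "((%s. L2_norm S (%x. (s - t) * ((A s x - A t x) / (s - t) - A' x) + (s - t) * A' x)) \<longlongrightarrow> 0) ?F"
  by (rule L2_add_limit[OF 1 2], rule eventually_mono[OF eventually_at_within_in[where t=t and I=I]])
   (intro conjI L2_cmult L2_diff L2_divide A' A t; simp)
 show ?thesis
  by (rule Lim_transform_eventually[OF 3], rule eventually_mono[OF eventually_at_within_in[where t=t and I=I]])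
   (simp add: right_diff_distrib diff_divide_distrib)
qed

text \<open>Product rule: the increment is (A s - A t) paired with B s plus A t paired with (B s - B
  t). The first pairing converges because a differentiable curve is norm continuous.\<close>

lemma L2_deriv_inner:
 assumes dA: "has_L2_derivative S A A' t I" and A: "!!s. s \<in> I ==> A s \<in> L2_space S" and A': "A' \<in> L2_space S"
  and dB: "has_L2_derivative S B B' t I" and B: "!!s. s \<in> I ==> B s \<in> L2_space S" and B': "B' \<in> L2_space S"
  and t: "t \<in> I"
 shows "((%s. LINT x|lebesgue_on S. A s x * B s x) has_real_derivative
   (LINT x|lebesgue_on S. A' x * B t x) + (LINT x|lebesgue_on S. A t x * B' x)) (at t within I)"
proof -
 let ?F = "at t within I" and ?M = "lebesgue_on S"
 note ev = eventually_at_within_in[where t=t and I=I]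
 have cA: "((%s. L2_norm S (%x. A t x - A t x)) \<longlongrightarrow> 0) ?F" by simp
 have 1: "((%s. LINT x|?M. ((A s x - A t x) / (s - t)) * B s x) \<longlongrightarrow> (LINT x|?M. A' x * B t x)) ?F"
  by (rule L2_lim_inner[OF dA[unfolded has_L2_derivative_def] L2_deriv_continuous[OF dB B t B']])
   (use A B A' t in \<open>auto intro!: L2_diff L2_divide eventually_mono[OF ev]\<close>)
 have 2: "((%s. LINT x|?M. A t x * ((B s x - B t x) / (s - t))) \<longlongrightarrow> (LINT x|?M. A t x * B' x)) ?F"
  by (rule L2_lim_inner[OF cA dB[unfolded has_L2_derivative_def]])
   (use A B B' t in \<open>auto intro!: L2_diff L2_divide eventually_mono[OF ev]\<close>)
 have 3: "((%s. (LINT x|?M. ((A s x - A t x) / (s - t)) * B s x) + (LINT x|?M. A t x * ((B s x - B t x) / (s - t))))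
   \<longlongrightarrow> (LINT x|?M. A' x * B t x) + (LINT x|?M. A t x * B' x)) ?F"
  by (rule tendsto_add[OF 1 2])
 show ?thesis unfolding has_field_derivative_iff
 proof (rule Lim_transform_eventually[OF 3], rule eventually_mono[OF ev])
  fix s assume s: "s \<in> I \<and> s \<noteq> t"
  have "(LINT x|?M. A s x * B s x) - (LINT x|?M. A t x * B t x) =
    (LINT x|?M. (A s x - A t x) * B s x) + (LINT x|?M. A t x * (B s x - B t x))"
   using s A B t by (simp add: algebra_simps L2_mult_integrable)
  then have "((LINT x|?M. A s x * B s x) - (LINT x|?M. A t x * B t x)) / (s - t) =
    (LINT x|?M. (A s x - A t x) * B s x) / (s - t) + (LINT x|?M. A t x * (B s x - B t x)) / (s - t)"
   by (simp add: add_divide_distrib)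
  then show "(LINT x|?M. ((A s x - A t x) / (s - t)) * B s x) + (LINT x|?M. A t x * ((B s x - B t x) / (s - t)))
    = ((LINT x|?M. A s x * B s x) - (LINT x|?M. A t x * B t x)) / (s - t)"
   by simp
 qed
qed

lemma L2_deriv_const: "has_L2_derivative S (%s. a) (%x. 0) t I"
 by (simp add: has_L2_derivative_def)

lemma L2_deriv_add:
 assumes "has_L2_derivative S A A' t I" "!!s. s \<in> I ==> A s \<in> L2_space S" "A' \<in> L2_space S"
  and "has_L2_derivative S B B' t I" "!!s. s \<in> I ==> B s \<in> L2_space S" "B' \<in> L2_space S"
  and "t \<in> I"
 shows "has_L2_derivative S (%s x. A s x + B s x) (%x. A' x + B' x) t I"
proof -
 have "((%s. L2_norm S (%x. ((A s x - A t x) / (s - t) - A' x) + ((B s x - B t x) / (s - t) - B' x))) \<longlongrightarrow> 0)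
   (at t within I)"
  by (rule L2_add_limit[OF assms(1,4)[unfolded has_L2_derivative_def]])
   (use assms in \<open>auto intro!: eventually_mono[OF eventually_at_within_in[where t=t and I=I]] L2_diff L2_divide\<close>)
 moreover have "((a - b) / d - e) + ((a' - b') / d - e') = (a + a' - (b + b')) / d - (e + e')" for a b d e a' b' e' :: real
  by (simp add: add_divide_distrib diff_divide_distrib)
 ultimately show ?thesis by (simp only: has_L2_derivative_def)
qed

text \<open>Product and chain rule together, in the form needed for u = k(t) z(\<sigma>(t)).
  Injectivity of \<sigma> keeps \<sigma> s - \<sigma> t away from zero, so the difference quotient
  of A along \<sigma> makes sense.\<close>

lemma L2_deriv_scale_comp:
 assumes dA: "has_L2_derivative S A A' (\<sigma> t) J" and A: "!!s. s \<in> J ==> A s \<in> L2_space S" and A': "A' \<in> L2_space S"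
  and k: "(k has_real_derivative k') (at t within I)"
  and \<sigma>: "(\<sigma> has_real_derivative \<sigma>') (at t within I)" "inj_on \<sigma> I" "\<sigma> ` I \<subseteq> J"
  and t: "t \<in> I"
 shows "has_L2_derivative S (%s x. k s * A (\<sigma> s) x) (%x. k' * A (\<sigma> t) x + k t * \<sigma>' * A' x) t I"
proof -
 let ?F = "at t within I"
 note ev = eventually_at_within_in[where t=t and I=I]
 have \<sigma>c: "(\<sigma> \<longlongrightarrow> \<sigma> t) ?F" using DERIV_continuous[OF \<sigma>(1)] by (simp add: continuous_within)
 have kc: "(k \<longlongrightarrow> k t) ?F" using DERIV_continuous[OF k] by (simp add: continuous_within)
 have ne: "\<forall>\<^sub>F s in ?F. \<sigma> s \<in> J \<and> \<sigma> s \<noteq> \<sigma> t"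
  using ev by (rule eventually_mono) (use \<sigma> t in \<open>auto dest: inj_onD\<close>)
 have fl: "filterlim \<sigma> (at (\<sigma> t) within J) ?F"
  using \<sigma>c ne by (simp add: filterlim_at)
 have dA': "((%s. L2_norm S (%x. (A (\<sigma> s) x - A (\<sigma> t) x) / (\<sigma> s - \<sigma> t) - A' x)) \<longlongrightarrow> 0) ?F"
  using filterlim_compose[OF dA[unfolded has_L2_derivative_def] fl] .
 have q\<sigma>: "((%s. (\<sigma> s - \<sigma> t) / (s - t)) \<longlongrightarrow> \<sigma>') ?F" using \<sigma>(1) by (simp add: has_field_derivative_iff)
 have qk: "((%s. (k s - k t) / (s - t) - k') \<longlongrightarrow> 0) ?F"
  using k unfolding has_field_derivative_iff by (rule LIM_zero)
 have q2: "((%s. k s * ((\<sigma> s - \<sigma> t) / (s - t))) \<longlongrightarrow> k t * \<sigma>') ?F" by (intro tendsto_intros kc q\<sigma>)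
 have q3: "((%s. k s * ((\<sigma> s - \<sigma> t) / (s - t)) - k t * \<sigma>') \<longlongrightarrow> 0) ?F" by (rule LIM_zero[OF q2])
 have AL: "\<forall>\<^sub>F s in ?F. A (\<sigma> s) \<in> L2_space S" using ne by (rule eventually_mono) (auto intro: A)
 have At: "A (\<sigma> t) \<in> L2_space S" using A \<sigma> t by blast
 have 1: "((%s. L2_norm S (%x. k s * ((\<sigma> s - \<sigma> t) / (s - t)) *
   ((A (\<sigma> s) x - A (\<sigma> t) x) / (\<sigma> s - \<sigma> t) - A' x))) \<longlongrightarrow> 0) ?F"
  by (rule L2_cmult_limit[OF dA' q2])
 have 2: "((%s. L2_norm S (%x. (k s * ((\<sigma> s - \<sigma> t) / (s - t)) - k t * \<sigma>') * A' x)) \<longlongrightarrow> 0) ?F"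
  unfolding L2_norm_cmult using tendsto_mult[OF tendsto_rabs[OF q3] tendsto_const[of "L2_norm S A'"]] by simp
 have 3: "((%s. L2_norm S (%x. ((k s - k t) / (s - t) - k') * A (\<sigma> t) x)) \<longlongrightarrow> 0) ?F"
  unfolding L2_norm_cmult using tendsto_mult[OF tendsto_rabs[OF qk] tendsto_const[of "L2_norm S (A (\<sigma> t))"]] by simp
 have 4: "((%s. L2_norm S (%x. (k s * ((\<sigma> s - \<sigma> t) / (s - t)) * ((A (\<sigma> s) x - A (\<sigma> t) x) / (\<sigma> s - \<sigma> t) - A' x)
   + (k s * ((\<sigma> s - \<sigma> t) / (s - t)) - k t * \<sigma>') * A' x) + ((k s - k t) / (s - t) - k') * A (\<sigma> t) x)) \<longlongrightarrow> 0) ?F"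
  by (intro L2_add_limit 1 2 3; rule eventually_mono[OF AL]; intro conjI L2_add L2_cmult L2_diff L2_divide A' At; assumption)
 show ?thesis unfolding has_L2_derivative_def
 proof (rule Lim_transform_eventually[OF 4], rule eventually_mono[OF eventually_conj[OF ne ev]])
  fix s assume s: "(\<sigma> s \<in> J \<and> \<sigma> s \<noteq> \<sigma> t) \<and> s \<in> I \<and> s \<noteq> t"
  show "L2_norm S (%x. (k s * ((\<sigma> s - \<sigma> t) / (s - t)) * ((A (\<sigma> s) x - A (\<sigma> t) x) / (\<sigma> s - \<sigma> t) - A' x)
   + (k s * ((\<sigma> s - \<sigma> t) / (s - t)) - k t * \<sigma>') * A' x) + ((k s - k t) / (s - t) - k') * A (\<sigma> t) x) =
   L2_norm S (%x. (k s * A (\<sigma> s) x - k t * A (\<sigma> t) x) / (s - t) - (k' * A (\<sigma> t) x + k t * \<sigma>' * A' x))"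
  proof (rule arg_cong[where f="L2_norm S"], rule ext)
   fix x
   have "k s * ((\<sigma> s - \<sigma> t) / (s - t)) * ((A (\<sigma> s) x - A (\<sigma> t) x) / (\<sigma> s - \<sigma> t)) =
     k s * (A (\<sigma> s) x - A (\<sigma> t) x) / (s - t)" using s by simp
   then show "(k s * ((\<sigma> s - \<sigma> t) / (s - t)) * ((A (\<sigma> s) x - A (\<sigma> t) x) / (\<sigma> s - \<sigma> t) - A' x)
    + (k s * ((\<sigma> s - \<sigma> t) / (s - t)) - k t * \<sigma>') * A' x) + ((k s - k t) / (s - t) - k') * A (\<sigma> t) x =
    (k s * A (\<sigma> s) x - k t * A (\<sigma> t) x) / (s - t) - (k' * A (\<sigma> t) x + k t * \<sigma>' * A' x)"
    by (simp add: right_diff_distrib left_diff_distrib diff_divide_distrib)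
  qed
 qed
qed

subsection \<open>Approximation by continuous functions\<close>

lemma lmeasurable_Icc: "{a..b::real} \<in> lmeasurable"
 by (simp add: lmeasurable_cbox[of a b, simplified])

lemma L2_truncate_approx:
 assumes f: "f \<in> L2_space S"
 shows "(%k. L2_norm S (%x. f x - max (- real k) (min (real k) (f x)))) \<longlonglongrightarrow> 0"
proof -
 let ?M = "lebesgue_on S"
 let ?d = "%k x. f x - max (- real k) (min (real k) (f x))"
 have m: "f \<in> borel_measurable ?M" using f by (rule L2_measurable)
 have "(%k. LINT x|?M. (?d k x)^2) \<longlonglongrightarrow> (LINT x|?M. 0)"
 proof (rule integral_dominated_convergence[where w="%x. (f x)^2"])
  show "(%x. (?d k x)^2) \<in> borel_measurable ?M" for k using m by measurable
  show "integrable ?M (%x. (f x)^2)" using f by (rule L2_sq_integrable)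
  show "AE x in ?M. (%k. (?d k x)^2) \<longlonglongrightarrow> 0"
  proof (rule AE_I2)
   fix x
   obtain k0 :: nat where k0: "\<bar>f x\<bar> <= real k0" using real_arch_simple by blast
   have "\<forall>\<^sub>F k in sequentially. (?d k x)^2 = 0"
    using eventually_ge_at_top[of k0] by eventually_elim (use k0 in auto)
   then show "(%k. (?d k x)^2) \<longlonglongrightarrow> 0" by (rule tendsto_eventually)
  qed
  show "AE x in ?M. norm ((?d k x)^2) <= (f x)^2" for k
  proof (rule AE_I2)
   fix x
   have "\<bar>?d k x\<bar> <= \<bar>f x\<bar>" by (auto simp: max_def min_def)
   from power_mono[OF this abs_ge_zero, of 2]
   show "norm ((?d k x)^2) <= (f x)^2" by (simp only: power2_abs real_norm_def abs_power2)
  qed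
 qed simp
 from tendsto_real_sqrt[OF this] show ?thesis by (simp add: L2_norm_def)
qed

text \<open>First truncate f; the truncation is an almost everywhere limit of continuous functions,
  and dominated convergence on the bounded interval turns this into convergence in the mean.\<close>

lemma L2_continuous_approx:
 assumes f: "f \<in> L2_space {a..b::real}" and e: "e > 0"
 obtains g where "continuous_on UNIV g" "L2_norm {a..b} (%x. f x - g x) < e"
proof -
 let ?S = "{a..b}" and ?M = "lebesgue_on {a..b}"
 let ?tr = "%k y. max (- real k) (min (real k) y)"
 have mf: "f \<in> borel_measurable ?M" using f by (rule L2_measurable)
 obtain k where k: "L2_norm ?S (%x. f x - ?tr k (f x)) < e / 2"
  using L2_truncate_approx[OF f, THEN LIMSEQ_D, of "e/2"] e by auto
 define F where "F = (%x. if x \<in> ?S then ?tr k (f x) else 0)"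
 have mk: "(%x. ?tr k (f x)) \<in> borel_measurable ?M" using mf by measurable
 have "F \<in> borel_measurable lebesgue" unfolding F_def
  by (rule borel_measurable_if_I[OF mk]) simp
 then have "F measurable_on UNIV" by (rule lebesgue_measurable_imp_measurable_on_real) simp
 then obtain N g where N: "negligible N" and g: "!!n. continuous_on UNIV (g n)"
  and lim: "!!x. x \<notin> N ==> (%n. g n x) \<longlonglongrightarrow> F x"
  unfolding measurable_on_def by auto
 \<comment> \<open>Truncating the continuous approximants at the same level supplies the constant
   dominating function and keeps them continuous.\<close>
 define h where "h = (%n x. ?tr k (g n x))"
 have hc: "continuous_on UNIV (h n)" for n
  unfolding h_def by (intro continuous_intros g)
 have mh: "h n \<in> borel_measurable ?M" for n
  by (rule continuous_imp_measurable_on_sets_lebesgue[OF continuous_on_subset[OF hc]]) auto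
 have trL2: "(%x. ?tr k (f x)) \<in> L2_space ?S"
  by (rule L2_bounded(1)[OF lmeasurable_Icc mk, where B="real k"]) auto
 have hL2: "h n \<in> L2_space ?S" for n
  by (rule L2_bounded(1)[OF lmeasurable_Icc mh, where B="real k"]) (auto simp: h_def)
 have "(%n. LINT x|?M. (?tr k (f x) - h n x)^2) \<longlonglongrightarrow> (LINT x|?M. 0)"
 proof (rule integral_dominated_convergence[where w="%x. (2 * real k)^2"])
  show "(%x. (?tr k (f x) - h n x)^2) \<in> borel_measurable ?M" for n
   using mk mh[of n] by measurable
  show "integrable ?M (%x. (2 * real k)^2)"
   by (intro finite_measure.integrable_const finite_measure_lebesgue_on lmeasurable_Icc)
  have "N \<in> null_sets lebesgue" using N by (simp add: negligible_iff_null_sets)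
  then have "AE x in lebesgue. x \<notin> N" by (rule AE_not_in)
  then have "AE x in lebesgue. x \<in> ?S \<longrightarrow> (%n. (?tr k (f x) - h n x)^2) \<longlonglongrightarrow> 0"
  proof eventually_elim
   case (elim x)
   show ?case
   proof
    assume x: "x \<in> ?S"
    have "(%n. (?tr k (f x) - h n x)^2) \<longlonglongrightarrow> (?tr k (f x) - ?tr k (F x))^2"
     unfolding h_def by (intro tendsto_intros lim elim)
    then show "(%n. (?tr k (f x) - h n x)^2) \<longlonglongrightarrow> 0"
     using x by (simp add: F_def)
   qed
  qed
  then show "AE x in ?M. (%n. (?tr k (f x) - h n x)^2) \<longlonglongrightarrow> 0"
   by (simp add: AE_restrict_space_iff)
  show "AE x in ?M. norm ((?tr k (f x) - h n x)^2) <= (2 * real k)^2" for n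
  proof (rule AE_I2)
   fix x
   have "\<bar>?tr k (f x) - h n x\<bar> <= 2 * real k" unfolding h_def by (auto simp: max_def min_def)
   from power_mono[OF this abs_ge_zero, of 2]
   show "norm ((?tr k (f x) - h n x)^2) <= (2 * real k)^2" by (simp only: power2_abs real_norm_def abs_power2)
  qed
 qed simp
 from tendsto_real_sqrt[OF this] have "(%n. L2_norm ?S (%x. ?tr k (f x) - h n x)) \<longlonglongrightarrow> 0"
  by (simp add: L2_norm_def)
 then obtain n where n: "L2_norm ?S (%x. ?tr k (f x) - h n x) < e / 2"
  using LIMSEQ_D[of _ 0 "e/2"] e by fastforce
 have "L2_norm ?S (%x. f x - h n x) < e"
  using L2_norm_triangle'[OF f trL2 hL2[of n]] k n by linarith
 with hc[of n] show ?thesis by (rule that)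
qed

subsection \<open>Translations and primitives\<close>

definition locL2 :: "(real => real) => bool" where
 "locL2 f \<longleftrightarrow> (\<forall>a b. f \<in> L2_space {a..b})"

text \<open>The primitive vanishing at 0, on the whole line: for either sign of y one of the two
  intervals is empty or a point.\<close>

definition prim :: "(real => real) => real => real" where
 "prim f y = integral {0..y} f - integral {y..0} f"

definition loc_int :: "(real => real) => bool" where
 "loc_int f \<longleftrightarrow> (\<forall>a b. f integrable_on {a..b})"

lemma locL2_D: "locL2 f ==> f \<in> L2_space {a..b}"
 by (simp add: locL2_def)

lemma loc_int_D: "loc_int f ==> f integrable_on {a..b}"
 by (simp add: loc_int_def)

lemma locL2_abs: "locL2 f ==> f absolutely_integrable_on {a..b}"
 using L2_integrable[OF locL2_D lmeasurable_Icc, of f a b] by (simp add: integrable_lebesgue_on_iff_abs)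

lemma locL2_sq_abs: "locL2 f ==> (%x. (f x)^2) absolutely_integrable_on {a..b}"
 using L2_sq_integrable[OF locL2_D, of f a b] by (simp add: integrable_lebesgue_on_iff_abs)

lemma locL2_loc_int: "locL2 f ==> loc_int f"
 using locL2_abs[of f] by (auto simp: loc_int_def absolutely_integrable_on_def)

lemma locL2_sq_loc_int: "locL2 f ==> loc_int (%x. (f x)^2)"
 using locL2_sq_abs[of f] by (auto simp: loc_int_def absolutely_integrable_on_def)

lemma LINT_eq_integral:
 fixes f :: "real => real"
 shows "integrable (lebesgue_on {a..b}) f ==> (LINT x|lebesgue_on {a..b::real}. f x) = integral {a..b} f"
 by (rule lebesgue_integral_eq_integral) auto

lemma L2_norm_sq_integral: "f \<in> L2_space {a..b} ==> (L2_norm {a..b} f)^2 = integral {a..b} (%x. (f x)^2)"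
 by (simp add: L2_norm_sq LINT_eq_integral L2_sq_integrable)

text \<open>Translations and reflections are handled by gauge integrals, so membership in the
  Lebesgue space is reduced to three gauge integrability statements.\<close>

lemma L2_I_integrable:
 assumes "f integrable_on {a..b}" "(%x. \<bar>f x\<bar>) integrable_on {a..b}" "(%x. (f x)^2) integrable_on {a..b::real}"
 shows "f \<in> L2_space {a..b}"
proof -
 have "f absolutely_integrable_on {a..b}" "(%x. (f x)^2) absolutely_integrable_on {a..b}"
  using assms by (auto simp: absolutely_integrable_on_def)
 then have "integrable (lebesgue_on {a..b}) f" "integrable (lebesgue_on {a..b}) (%x. (f x)^2)"
  by (auto simp: integrable_lebesgue_on_iff_abs)
 then show ?thesis by (auto simp: L2_space_def)
qed

lemma L2_abs_integrable:
 assumes "f \<in> L2_space {a..b::real}"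
 shows "(%x. \<bar>f x\<bar>) integrable_on {a..b}"
 using L2_integrable[OF assms lmeasurable_Icc]
 by (simp add: integrable_lebesgue_on_iff_abs absolutely_integrable_on_def)

lemma L2_integral_cauchy_schwarz:
 assumes f: "f \<in> L2_space {a..b}" and ab: "a <= b"
 shows "(integral {a..b} f)^2 <= (b - a) * integral {a..b} (%x. (f x)^2)"
  "\<bar>integral {a..b} f\<bar> <= sqrt (b - a) * L2_norm {a..b} f"
proof -
 have o: "(%x. 1) \<in> L2_space {a..b}" "L2_norm {a..b} (%x. 1) = sqrt (b - a)"
  using ab by (auto simp: L2_continuous L2_norm_def measure_restrict_space)
 show *: "\<bar>integral {a..b} f\<bar> <= sqrt (b - a) * L2_norm {a..b} f"
  using L2_cauchy_schwarz[OF f o(1)] LINT_eq_integral[OF L2_integrable[OF f lmeasurable_Icc]] o(2)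
  by (simp add: mult.commute)
 have "(integral {a..b} f)^2 <= (sqrt (b - a) * L2_norm {a..b} f)^2"
  using power_mono[OF * abs_ge_zero, of 2] by simp
 then show "(integral {a..b} f)^2 <= (b - a) * integral {a..b} (%x. (f x)^2)"
  using ab L2_norm_sq_integral[OF f] by (simp add: power_mult_distrib)
qed

lemma integral_shift:
 fixes f :: "real => real"
 shows "integral {a..b::real} (%x. f (x + c)) = integral {a+c..b+c} f"
 using integral_shift_Icc_real[of a b f c] by (simp add: o_def add.commute)

lemma integrable_shift:
 fixes f :: "real => real"
 shows "(%x. f (x + c)) integrable_on {a..b::real} \<longleftrightarrow> f integrable_on {a+c..b+c}"
 using integrable_on_shift_Icc_real[of f c a b] by (simp add: o_def add.commute)

lemma integral_flip:
 fixes f :: "real => real"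
 shows "integral {a..b::real} (%x. f (c - x)) = integral {c-b..c-a} f"
 using Henstock_Kurzweil_Integration.integral_reflect_real[of "-a" "-b" "%x. f (x + c)"] integral_shift[of "-b" "-a" f c] by simp

lemma integrable_flip:
 fixes f :: "real => real"
 shows "(%x. f (c - x)) integrable_on {a..b::real} \<longleftrightarrow> f integrable_on {c-b..c-a}"
 using Henstock_Kurzweil_Integration.integrable_reflect_real[of "%x. f (x + c)" "-a" "-b"] integrable_shift[of f c "-b" "-a"] by simp

lemma L2_shift:
 assumes "f \<in> L2_space {a+c..b+c}"
 shows "(%x. f (x + c)) \<in> L2_space {a..b}" "L2_norm {a..b} (%x. f (x + c)) = L2_norm {a+c..b+c} f"
proof -
 have i: "f integrable_on {a+c..b+c}" "(%x. \<bar>f x\<bar>) integrable_on {a+c..b+c}" "(%x. (f x)^2) integrable_on {a+c..b+c}"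
  using L2_integrable[OF assms lmeasurable_Icc] L2_sq_integrable[OF assms] L2_abs_integrable[OF assms]
  by (auto intro: integrable_on_lebesgue_on)
 show *: "(%x. f (x + c)) \<in> L2_space {a..b}"
  by (rule L2_I_integrable)
   (use i integrable_shift[of f c a b] integrable_shift[of "%x. \<bar>f x\<bar>" c a b] integrable_shift[of "%x. (f x)^2" c a b] in auto)
 have "(L2_norm {a..b} (%x. f (x + c)))^2 = (L2_norm {a+c..b+c} f)^2"
  using L2_norm_sq_integral[OF *] L2_norm_sq_integral[OF assms] integral_shift[of a b "%x. (f x)^2" c] by simp
 then show "L2_norm {a..b} (%x. f (x + c)) = L2_norm {a+c..b+c} f"
  using L2_norm_nonneg power2_eq_iff_nonneg by blast
qed

lemma L2_flip:
 assumes "f \<in> L2_space {c-b..c-a}"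
 shows "(%x. f (c - x)) \<in> L2_space {a..b}" "L2_norm {a..b} (%x. f (c - x)) = L2_norm {c-b..c-a} f"
proof -
 have i: "f integrable_on {c-b..c-a}" "(%x. \<bar>f x\<bar>) integrable_on {c-b..c-a}" "(%x. (f x)^2) integrable_on {c-b..c-a}"
  using L2_integrable[OF assms lmeasurable_Icc] L2_sq_integrable[OF assms] L2_abs_integrable[OF assms]
  by (auto intro: integrable_on_lebesgue_on)
 show *: "(%x. f (c - x)) \<in> L2_space {a..b}"
  by (rule L2_I_integrable)
   (use i integrable_flip[of f c a b] integrable_flip[of "%x. \<bar>f x\<bar>" c a b] integrable_flip[of "%x. (f x)^2" c a b] in auto)
 have "(L2_norm {a..b} (%x. f (c - x)))^2 = (L2_norm {c-b..c-a} f)^2"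
  using L2_norm_sq_integral[OF *] L2_norm_sq_integral[OF assms] integral_flip[of a b "%x. (f x)^2" c] by simp
 then show "L2_norm {a..b} (%x. f (c - x)) = L2_norm {c-b..c-a} f"
  using L2_norm_nonneg power2_eq_iff_nonneg by blast
qed

lemma locL2_shift: "locL2 f ==> locL2 (%x. f (x + c))"
 using L2_shift(1) by (auto simp: locL2_def)

lemma locL2_flip: "locL2 f ==> locL2 (%x. f (c - x))"
 using L2_flip(1) by (auto simp: locL2_def)

lemma locL2_add: "locL2 f ==> locL2 g ==> locL2 (%x. f x + g x)"
 by (auto simp: locL2_def intro: L2_add)

lemma locL2_diff: "locL2 f ==> locL2 g ==> locL2 (%x. f x - g x)"
 by (auto simp: locL2_def intro: L2_diff)

lemma locL2_cmult: "locL2 f ==> locL2 (%x. c * f x)"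
 by (auto simp: locL2_def intro: L2_cmult)

lemma locL2_continuous: "continuous_on UNIV f ==> locL2 f"
 by (auto simp: locL2_def intro: L2_continuous continuous_on_subset)

lemma loc_int_continuous: "continuous_on UNIV f ==> loc_int f"
 by (auto simp: loc_int_def intro: integrable_continuous_real continuous_on_subset)

lemma prim_0 [simp]: "prim f 0 = 0"
 by (simp add: prim_def)

lemma prim_diff:
 assumes f: "loc_int f" and ab: "a <= b"
 shows "prim f b - prim f a = integral {a..b} f"
proof -
 note i = loc_int_D[OF f]
 have z: "integral {x..y} f = 0" if "y <= x" for x y :: real
  using that by (cases "x = y") auto
 show ?thesis
  using Henstock_Kurzweil_Integration.integral_combine[of 0 a b f]
   Henstock_Kurzweil_Integration.integral_combine[of a 0 b f]
   Henstock_Kurzweil_Integration.integral_combine[of a b 0 f] i ab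
  by (cases "0 <= a"; cases "0 <= b") (auto simp: prim_def z)
qed

lemma prim_continuous:
 assumes f: "loc_int f"
 shows "continuous_on UNIV (prim f)"
proof -
 have c: "continuous_on {-n..n} (prim f)" if "n > 0" for n :: real
 proof (rule continuous_on_eq)
  show "continuous_on {-n..n} (%x. prim f (-n) + integral {-n..x} f)"
   by (intro continuous_intros indefinite_integral_continuous_1 loc_int_D f)
  show "prim f (-n) + integral {-n..x} f = prim f x" if "x \<in> {-n..n}" for x
   using prim_diff[OF f, of "-n" x] that by simp
 qed
 have "isCont (prim f) x" for x
  by (rule continuous_on_interior[OF c[of "\<bar>x\<bar> + 1"]]) (auto simp: abs_if)
 then show ?thesis by (simp add: continuous_at_imp_continuous_on)
qed

lemma prim_deriv:
 assumes f: "continuous_on UNIV f"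
 shows "(prim f has_real_derivative f x) (at x)"
proof -
 have "((%y. integral {x-1..y} f) has_real_derivative f x) (at x within {x-1..x+1})"
  by (rule integral_has_real_derivative) (auto intro: continuous_on_subset[OF f])
 then have "((%y. prim f (x-1) + integral {x-1..y} f) has_real_derivative f x) (at x within {x-1..x+1})"
  by (auto intro!: derivative_eq_intros)
 then have "(prim f has_real_derivative f x) (at x within {x-1..x+1})"
 proof (rule has_field_derivative_transform_within[where d=1])
  show "prim f (x-1) + integral {x-1..y} f = prim f y" if "y \<in> {x-1..x+1}" for y
   using prim_diff[OF loc_int_continuous[OF f], of "x-1" y] that by simp
 qed simp_all
 then show ?thesis by (simp add: at_within_Icc_at)
qed

lemma prim_add:
 assumes "loc_int f" "loc_int g"
 shows "prim (%x. f x + g x) y = prim f y + prim g y"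
 unfolding prim_def using assms[THEN loc_int_D] by (simp add: integral_add)

lemma prim_cmult: "prim (%x. c * f x) y = c * prim f y"
 by (simp add: prim_def right_diff_distrib)

lemma prim_abs_le:
 assumes f: "loc_int f" and g: "loc_int g" and le: "!!x. \<bar>f x\<bar> <= g x" and ab: "a <= b"
 shows "\<bar>prim f b - prim f a\<bar> <= prim g b - prim g a"
 unfolding prim_diff[OF f ab] prim_diff[OF g ab]
 using integral_norm_bound_integral[OF loc_int_D[OF f] loc_int_D[OF g]] le by simp

lemma prim_lipschitz:
 assumes f: "loc_int f" and b: "!!x. \<bar>f x\<bar> <= B"
 shows "\<bar>prim f y - prim f x\<bar> <= B * \<bar>y - x\<bar>"
proof -
 have l: "loc_int (%x. B)" by (rule loc_int_continuous) simp
 have B: "B >= 0" using b[of 0] by simp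
 have *: "\<bar>prim f y - prim f x\<bar> <= B * (y - x)" if "x <= y" for x y
  using prim_abs_le[OF f l b that] prim_diff[OF l that] that by (simp add: mult.commute)
 show ?thesis using *[of x y] *[of y x] by (cases "x <= y") (auto simp: abs_minus_commute)
qed

lemma prim_mono:
 assumes f: "loc_int f" and nn: "!!x. f x >= 0" and ab: "a <= b"
 shows "prim f a <= prim f b"
 using prim_diff[OF f ab] integral_nonneg[OF loc_int_D[OF f], of a b] nn by simp

text \<open>By Cauchy-Schwarz the squared increment is at most k times the increment over [x, x + k]
  of \<rho>, the primitive of f squared. Integrating \<rho>(x + k) - \<rho>(x) over [a, b] leaves
  only two end pieces of length k, which monotonicity of \<rho> controls.\<close>

lemma L2_prim_difference:
 assumes f: "locL2 f" and k: "k > 0" and ab: "a <= b"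
 shows "L2_norm {a..b} (%x. prim f (x + k) - prim f x) <= k * L2_norm {a..b+k} f"
proof -
 define \<rho> where "\<rho> = prim (%x. (f x)^2)"
 have li: "loc_int f" "loc_int (%x. (f x)^2)" using f by (auto intro: locL2_loc_int locL2_sq_loc_int)
 have \<rho>c: "continuous_on UNIV \<rho>" unfolding \<rho>_def by (rule prim_continuous[OF li(2)])
 have \<rho>m: "\<rho> x <= \<rho> y" if "x <= y" for x y unfolding \<rho>_def by (rule prim_mono[OF li(2) _ that]) simp
 have pc: "continuous_on UNIV (prim f)" by (rule prim_continuous[OF li(1)])
 have c: "continuous_on UNIV (%x. prim f (x + k) - prim f x)"
  by (intro continuous_intros continuous_on_compose2[OF pc]) auto
 have c\<rho>: "continuous_on UNIV (%x. \<rho> (x + k) - \<rho> x)" "continuous_on UNIV (%x. \<rho> (x + k))"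
  by (intro continuous_intros continuous_on_compose2[OF \<rho>c]; auto)+
 have ptw: "(prim f (x + k) - prim f x)^2 <= k * (\<rho> (x + k) - \<rho> x)" for x
 proof -
  have "(integral {x..x+k} f)^2 <= (x + k - x) * integral {x..x+k} (%x. (f x)^2)"
   by (rule L2_integral_cauchy_schwarz(1)[OF locL2_D[OF f]]) (use k in simp)
  then show ?thesis using prim_diff[OF li(1), of x "x+k"] prim_diff[OF li(2), of x "x+k"] k
   by (simp add: \<rho>_def)
 qed
 have li\<rho>: "loc_int \<rho>" by (rule loc_int_continuous[OF \<rho>c])
 have "integral {a..b} (%x. \<rho> (x + k) - \<rho> x) = integral {a+k..b+k} \<rho> - integral {a..b} \<rho>"
  using HK_diff[of "%x. \<rho> (x + k)" "{a..b}" \<rho>] loc_int_D[OF li\<rho>]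
   loc_int_D[OF loc_int_continuous[OF c\<rho>(2)]] integral_shift[of a b \<rho> k] by simp
 also have "... = (prim \<rho> (b+k) - prim \<rho> b) - (prim \<rho> (a+k) - prim \<rho> a)"
  using prim_diff[OF li\<rho>, of "a+k" "b+k"] prim_diff[OF li\<rho> ab] ab by simp
 also have "... = integral {b..b+k} \<rho> - integral {a..a+k} \<rho>"
  using prim_diff[OF li\<rho>, of b "b+k"] prim_diff[OF li\<rho>, of a "a+k"] k by simp
 also have "... <= k * \<rho> (b + k) - k * \<rho> a"
 proof -
  have "integral {b..b+k} \<rho> <= integral {b..b+k} (%x. \<rho> (b + k))"
   by (rule integral_le) (use loc_int_D[OF li\<rho>] \<rho>m in auto)
  moreover have "integral {a..a+k} (%x. \<rho> a) <= integral {a..a+k} \<rho>"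
   by (rule integral_le) (use loc_int_D[OF li\<rho>] \<rho>m in auto)
  ultimately show ?thesis using k by simp
 qed
 also have "... = k * integral {a..b+k} (%x. (f x)^2)"
  using prim_diff[OF li(2), of a "b+k"] ab k by (simp add: \<rho>_def flip: right_diff_distrib)
 finally have I: "integral {a..b} (%x. \<rho> (x + k) - \<rho> x) <= k * (L2_norm {a..b+k} f)^2"
  by (simp add: L2_norm_sq_integral[OF locL2_D[OF f]])
 have cL2: "(%x. prim f (x + k) - prim f x) \<in> L2_space {a..b}"
  by (rule locL2_D[OF locL2_continuous[OF c]])
 have "(L2_norm {a..b} (%x. prim f (x + k) - prim f x))^2 =
   integral {a..b} (%x. (prim f (x + k) - prim f x)^2)"
  by (rule L2_norm_sq_integral[OF cL2])
 also have "... <= integral {a..b} (%x. k * (\<rho> (x + k) - \<rho> x))"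
  by (rule integral_le)
   (use ptw in \<open>auto intro!: loc_int_D loc_int_continuous continuous_intros c c\<rho>\<close>)
 also have "... = k * integral {a..b} (%x. \<rho> (x + k) - \<rho> x)" by simp
 also have "... <= k * (k * (L2_norm {a..b+k} f)^2)" using I k by simp
 finally have "(L2_norm {a..b} (%x. prim f (x + k) - prim f x))^2 <= (k * L2_norm {a..b+k} f)^2"
  by (simp add: power2_eq_square mult_ac)
 then show ?thesis by (rule power2_le_imp_le) (use k in simp)
qed

text \<open>A negative step is a positive step seen from the translated interval; the margin 1 makes
  the right-hand norm independent of k.\<close>

lemma L2_prim_difference_abs:
 assumes f: "locL2 f" and k: "\<bar>k\<bar> <= 1" and ab: "a <= b"
 shows "L2_norm {a..b} (%x. prim f (x + k) - prim f x) <= \<bar>k\<bar> * L2_norm {a-1..b+1} f"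
proof (cases "k = 0")
 case False
 have pc: "continuous_on UNIV (prim f)" by (rule prim_continuous[OF locL2_loc_int[OF f]])
 show ?thesis
 proof (cases "k > 0")
  case True
  then have "L2_norm {a..b} (%x. prim f (x + k) - prim f x) <= k * L2_norm {a..b+k} f"
   by (rule L2_prim_difference[OF f _ ab])
  also have "... <= k * L2_norm {a-1..b+1} f"
   using True k by (intro mult_left_mono L2_subset(2)[OF locL2_D[OF f]]) auto
  finally show ?thesis using True by simp
 next
  case neg: False
  have c: "continuous_on UNIV (%x. prim f (x + - k) - prim f x)"
   by (intro continuous_intros continuous_on_compose2[OF pc]) auto
  have "L2_norm {a..b} (%x. prim f (x + k) - prim f x) =
    L2_norm {a..b} (%x. prim f (x + k + - k) - prim f (x + k))"
   by (subst L2_norm_commute) simp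
  also have "... = L2_norm {a+k..b+k} (%x. prim f (x + - k) - prim f x)"
   using L2_shift(2)[OF locL2_D[OF locL2_continuous[OF c]]] .
  also have "... <= - k * L2_norm {a+k..b+k+ - k} f"
   by (rule L2_prim_difference[OF f]) (use neg False ab in auto)
  also have "... <= - k * L2_norm {a-1..b+1} f"
   using neg k by (intro mult_left_mono L2_subset(2)[OF locL2_D[OF f]]) auto
  finally show ?thesis using neg by simp
 qed
qed simp

text \<open>A continuous approximation is uniformly continuous on the interval enlarged by 1, and
  the remainder is small in norm before and after a shift by less than 1.\<close>

lemma L2_translation_continuous:
 assumes f: "locL2 f"
 shows "((%h. L2_norm {a..b} (%x. f (x + h) - f x)) \<longlongrightarrow> 0) (nhds 0)"
proof (cases "a <= b")
 case ab: True
 show ?thesis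
 proof (rule tendstoI)
  fix e :: real assume e: "e > 0"
  let ?I = "{a-1..b+1}"
  obtain g where g: "continuous_on UNIV g" "L2_norm ?I (%x. f x - g x) < e / 4"
   using L2_continuous_approx[OF locL2_D[OF f], of "e/4"] e by auto
  define r where "r = (%x. f x - g x)"
  have r: "locL2 r" unfolding r_def by (intro locL2_diff f locL2_continuous g)
  have "uniformly_continuous_on ?I g"
   by (rule compact_uniformly_continuous[OF continuous_on_subset[OF g(1)]]) auto
  moreover define \<eta> where "\<eta> = e / (4 * (sqrt (b - a) + 1))"
  have \<eta>: "\<eta> > 0" using e ab by (simp add: \<eta>_def add_nonneg_pos)
  ultimately obtain d where d: "d > 0" "!!x y. x \<in> ?I ==> y \<in> ?I ==> \<bar>y - x\<bar> < d ==> \<bar>g y - g x\<bar> < \<eta>"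
   unfolding uniformly_continuous_on_def dist_real_def by metis
  have "\<forall>\<^sub>F h in nhds 0. \<bar>h\<bar> < min d 1"
   using d(1) by (auto simp: eventually_nhds_metric dist_real_def intro!: exI[of _ "min d 1"])
  then show "\<forall>\<^sub>F h in nhds 0. dist (L2_norm {a..b} (%x. f (x + h) - f x)) 0 < e"
  proof eventually_elim
   case (elim h)
   have gs: "continuous_on UNIV (%x. g (x + h) - g x)"
    by (intro continuous_intros continuous_on_compose2[OF g(1)]) auto
   have rs: "locL2 (%x. r (x + h))" by (rule locL2_shift[OF r])
   have 1: "L2_norm {a..b} (%x. g (x + h) - g x) <= \<eta> * sqrt (b - a)"
    by (rule L2_norm_interval_le[OF continuous_on_subset[OF gs]])
     (use elim d(2) \<eta> ab in \<open>auto intro!: less_imp_le[OF d(2)]\<close>)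
   have 2: "\<eta> * sqrt (b - a) <= e / 4"
   proof -
    have "\<eta> * sqrt (b - a) <= \<eta> * (sqrt (b - a) + 1)" using \<eta> by simp
    also have "... = e / 4"
    proof -
     have "sqrt (b - a) + 1 \<noteq> 0" using ab real_sqrt_ge_zero[of "b - a"] by linarith
     then show ?thesis by (simp add: \<eta>_def del: distrib_left distrib_left_numeral)
    qed
    finally show ?thesis .
   qed
   have 3: "L2_norm {a..b} (%x. r (x + h)) <= e / 4"
   proof -
    have "L2_norm {a..b} (%x. r (x + h)) = L2_norm {a+h..b+h} r"
     by (rule L2_shift(2)[OF locL2_D[OF r]])
    also have "... <= L2_norm ?I r" using elim by (intro L2_subset(2)[OF locL2_D[OF r]]) auto
    finally show ?thesis using g(2) by (simp add: r_def)
   qed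
   have 4: "L2_norm {a..b} r <= e / 4"
    using L2_subset(2)[OF locL2_D[OF r, of "a-1" "b+1"], of "{a..b}"] g(2) by (simp add: r_def)
   have "L2_norm {a..b} (%x. f (x + h) - f x) =
    L2_norm {a..b} (%x. (g (x + h) - g x) + (r (x + h) - r x))"
    by (simp add: r_def)
   also have "... <= L2_norm {a..b} (%x. g (x + h) - g x) + L2_norm {a..b} (%x. r (x + h) - r x)"
    by (rule L2_norm_triangle) (use rs r locL2_continuous[OF gs] in \<open>auto intro: L2_diff locL2_D\<close>)
   also have "L2_norm {a..b} (%x. r (x + h) - r x) <= L2_norm {a..b} (%x. r (x + h)) + L2_norm {a..b} r"
    by (rule L2_norm_triangle_diff) (use rs r in \<open>auto intro: locL2_D\<close>)
   finally have "L2_norm {a..b} (%x. f (x + h) - f x) < e" using 1 2 3 4 e by linarith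
   then show ?case by simp
  qed
 qed
next
 case False
 then have "L2_norm {a..b} (%x. f (x + h) - f x) = 0" for h by (simp add: L2_norm_def lebesgue_integral_eq_integral)
 then show ?thesis by simp
qed

text \<open>For continuous f this is the mean value theorem with uniform continuity. The general
  case follows by density, because difference quotients of primitives are bounded by the norm of f
  uniformly in h (\<open>L2_prim_difference_abs\<close>).\<close>

lemma L2_deriv_translation_0:
 assumes f: "locL2 f" and ab: "a <= b"
 shows "((%h. L2_norm {a..b} (%x. (prim f (x + h) - prim f x) / h - f x)) \<longlongrightarrow> 0) (at 0)"
proof (rule tendstoI)
 fix e :: real assume e: "e > 0"
 let ?I = "{a-1..b+1}"
 obtain g where g: "continuous_on UNIV g" "L2_norm ?I (%x. f x - g x) < e / 4"
  using L2_continuous_approx[OF locL2_D[OF f], of "e/4"] e by auto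
 define r where "r = (%x. f x - g x)"
 have r: "locL2 r" unfolding r_def by (intro locL2_diff f locL2_continuous g)
 have "uniformly_continuous_on ?I g"
  by (rule compact_uniformly_continuous[OF continuous_on_subset[OF g(1)]]) auto
 moreover define \<eta> where "\<eta> = e / (4 * (sqrt (b - a) + 1))"
 have \<eta>: "\<eta> > 0" using e ab by (simp add: \<eta>_def add_nonneg_pos)
 ultimately obtain d where d: "d > 0" "!!x y. x \<in> ?I ==> y \<in> ?I ==> \<bar>y - x\<bar> < d ==> \<bar>g y - g x\<bar> < \<eta>"
  unfolding uniformly_continuous_on_def dist_real_def by metis
 have "\<forall>\<^sub>F h in at 0. h \<noteq> 0 \<and> \<bar>h\<bar> < min d 1"
  using d(1) by (auto simp: eventually_at dist_real_def intro!: exI[of _ "min d 1"])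
 then show "\<forall>\<^sub>F h in at 0. dist (L2_norm {a..b} (%x. (prim f (x + h) - prim f x) / h - f x)) 0 < e"
 proof eventually_elim
  case (elim h)
  have pg: "continuous_on UNIV (prim g)" and pr: "continuous_on UNIV (prim r)"
   by (rule prim_continuous[OF loc_int_continuous[OF g(1)]], rule prim_continuous[OF locL2_loc_int[OF r]])
  have gs: "continuous_on UNIV (%x. (prim g (x + h) - prim g x) / h - g x)"
   using elim by (intro continuous_intros continuous_on_compose2[OF pg] g) auto
  have rs: "continuous_on UNIV (%x. (prim r (x + h) - prim r x) / h)"
   using elim by (intro continuous_intros continuous_on_compose2[OF pr]) auto
  have pt: "\<bar>(prim g (x + h) - prim g x) / h - g x\<bar> <= \<eta>" if x: "x \<in> {a..b}" for x
  proof -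
   have "\<exists>z. min x (x + h) < z \<and> z < max x (x + h) \<and> prim g (max x (x+h)) - prim g (min x (x+h))
     = (max x (x+h) - min x (x+h)) * g z"
    by (rule MVT2) (use elim prim_deriv[OF g(1)] in auto)
   then obtain z where z: "min x (x + h) < z" "z < max x (x + h)"
    and eq: "prim g (max x (x+h)) - prim g (min x (x+h)) = (max x (x+h) - min x (x+h)) * g z"
    by blast
   have "(prim g (x + h) - prim g x) / h = g z"
    using eq elim by (cases "h > 0") (auto simp: max_def min_def field_simps split: if_splits)
   moreover have "\<bar>g z - g x\<bar> < \<eta>" by (rule d(2)) (use z x elim in auto)
   ultimately show ?thesis by simp
  qed
  have 1: "L2_norm {a..b} (%x. (prim g (x + h) - prim g x) / h - g x) <= \<eta> * sqrt (b - a)"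
   by (rule L2_norm_interval_le[OF continuous_on_subset[OF gs]]) (use pt \<eta> ab in auto)
  have 2: "\<eta> * sqrt (b - a) <= e / 4"
  proof -
   have "\<eta> * sqrt (b - a) <= \<eta> * (sqrt (b - a) + 1)" using \<eta> by simp
   also have "... = e / 4"
    proof -
     have "sqrt (b - a) + 1 \<noteq> 0" using ab real_sqrt_ge_zero[of "b - a"] by linarith
     then show ?thesis by (simp add: \<eta>_def del: distrib_left distrib_left_numeral)
    qed
   finally show ?thesis .
  qed
  have 3: "L2_norm {a..b} (%x. (prim r (x + h) - prim r x) / h) <= e / 4"
  proof -
   have "L2_norm {a..b} (%x. (1 / h) * (prim r (x + h) - prim r x)) <= \<bar>1 / h\<bar> * (\<bar>h\<bar> * L2_norm ?I r)"
    unfolding L2_norm_cmult using elim by (intro mult_left_mono L2_prim_difference_abs r ab) auto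
   also have "... = L2_norm ?I r" using elim by simp
   finally show ?thesis using g(2) by (simp add: r_def)
  qed
  have 4: "L2_norm {a..b} r <= e / 4"
   using L2_subset(2)[OF locL2_D[OF r, of "a-1" "b+1"], of "{a..b}"] g(2) by (simp add: r_def)
  have fe: "prim f y = prim g y + prim r y" for y
   using prim_add[OF loc_int_continuous[OF g(1)] locL2_loc_int[OF r], of y] by (simp add: r_def)
  have "L2_norm {a..b} (%x. (prim f (x + h) - prim f x) / h - f x) =
   L2_norm {a..b} (%x. ((prim g (x + h) - prim g x) / h - g x) + ((prim r (x + h) - prim r x) / h - r x))"
   by (rule arg_cong[where f="L2_norm {a..b}"]) (auto simp: fe r_def add_divide_distrib diff_divide_distrib)
  also have "... <= L2_norm {a..b} (%x. (prim g (x + h) - prim g x) / h - g x) +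
    L2_norm {a..b} (%x. (prim r (x + h) - prim r x) / h - r x)"
   by (rule L2_norm_triangle)
    (use r locL2_continuous[OF gs] locL2_continuous[OF rs] in \<open>auto intro: L2_diff locL2_D\<close>)
  also have "L2_norm {a..b} (%x. (prim r (x + h) - prim r x) / h - r x) \<le>
    L2_norm {a..b} (%x. (prim r (x + h) - prim r x) / h) + L2_norm {a..b} r"
   by (rule L2_norm_triangle_diff) (use r locL2_continuous[OF rs] in \<open>auto intro: locL2_D\<close>)
  finally have "L2_norm {a..b} (%x. (prim f (x + h) - prim f x) / h - f x) < e" using 1 2 3 4 e by linarith
  then show ?case by simp
 qed
qed

lemma L2_translation_continuous_at:
 assumes f: "locL2 f"
 shows "((%s. L2_norm {a..b} (%x. f (x + s) - f (x + t))) \<longlongrightarrow> 0) (at t within I)"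
proof -
 have "((%s. s - t) \<longlongrightarrow> 0) (at t within I)" by (auto intro!: tendsto_eq_intros)
 then have fl: "filterlim (%s. s - t) (nhds 0) (at t within I)" .
 have eq: "L2_norm {a+t..b+t} (%x. f (x + (s - t)) - f x) = L2_norm {a..b} (%x. f (x + s) - f (x + t))" for s
  using L2_shift(2)[OF locL2_D[OF locL2_diff[OF locL2_shift[OF f] f]], of a b t "s - t"] by (simp add: algebra_simps)
 show ?thesis using filterlim_compose[OF L2_translation_continuous[OF f] fl, of "a+t" "b+t"] by (simp add: eq)
qed

lemma L2_deriv_translation:
 assumes f: "locL2 f" and ab: "a <= b"
 shows "has_L2_derivative {a..b} (%s x. prim f (x + s)) (%x. f (x + t)) t I"
proof -
 have fl: "filterlim (%s. s - t) (at 0) (at t within I)"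
  by (auto simp: filterlim_at eventually_at_filter intro!: tendsto_eq_intros)
 have pc: "continuous_on UNIV (prim f)" by (rule prim_continuous[OF locL2_loc_int[OF f]])
 have l: "locL2 (%x. prim f (x + h))" for h by (rule locL2_shift[OF locL2_continuous[OF pc]])
 have eq: "L2_norm {a+t..b+t} (%x. (prim f (x + (s - t)) - prim f x) / (s - t) - f x) =
   L2_norm {a..b} (%x. (prim f (x + s) - prim f (x + t)) / (s - t) - f (x + t))" for s
 proof -
  have "(%x. (prim f (x + (s - t)) - prim f x) / (s - t) - f x) \<in> L2_space {a+t..b+t}"
   by (intro L2_diff L2_divide locL2_D[OF l] locL2_D[OF f] locL2_D[OF locL2_continuous[OF pc]])
  from L2_shift(2)[OF this] show ?thesis by (simp add: algebra_simps)
 qed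
 show ?thesis unfolding has_L2_derivative_def
  using filterlim_compose[OF L2_deriv_translation_0[OF f, of "a+t" "b+t"] fl] ab by (simp add: eq)
qed

subsection \<open>Periodic functions\<close>

definition periodic :: "real => (real => real) => bool" where
 "periodic T f \<longleftrightarrow> (\<forall>x. f (x + T) = f x)"

lemma periodic_D: "periodic T f ==> f (x + T) = f x"
 by (simp add: periodic_def)

lemma periodic_nat: "periodic T f ==> f (x + real n * T) = f x"
proof (induction n)
 case (Suc n)
 have "f (x + real (Suc n) * T) = f ((x + real n * T) + T)" by (simp add: algebra_simps)
 then show ?case using Suc periodic_D by metis
qed simp

lemma periodic_loc_int:
 assumes T: "T > 0" and p: "periodic T f" and i: "f integrable_on {0..T}"
 shows "loc_int f"
proof -
 have 1: "f integrable_on {real n * T..real n * T + T}" for n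
  using integrable_shift[of f "real n * T" 0 T] i periodic_nat[OF p] by (simp add: add.commute)
 have 2: "f integrable_on {- (real n * T)..- (real n * T) + T}" for n
  using integrable_shift[of f "real n * T" "- (real n * T)" "- (real n * T) + T"] i periodic_nat[OF p] by simp
 have 3: "f integrable_on {- (real n * T)..real n * T}" for n
 proof (induction n)
  case (Suc n)
  have a: "f integrable_on {- (real (Suc n) * T)..- (real n * T)}"
   using 2[of "Suc n"] by (simp add: algebra_simps)
  have b: "f integrable_on {real n * T..real (Suc n) * T}"
   using 1[of n] by (simp add: algebra_simps)
  have nT: "0 <= real n * T" using T by simp
  have le: "real n * T <= real (Suc n) * T" using T by (simp add: algebra_simps)
  have "f integrable_on {- (real n * T)..real (Suc n) * T}"
   by (rule Henstock_Kurzweil_Integration.integrable_combine[OF _ _ Suc b]) (use nT le in auto)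
  from Henstock_Kurzweil_Integration.integrable_combine[OF _ _ a this] show ?case using nT le by auto
 qed (use integrable_on_refl[of f 0] in simp)
 show ?thesis unfolding loc_int_def
 proof (intro allI)
  fix a b :: real
  obtain n :: nat where n: "max \<bar>a\<bar> \<bar>b\<bar> / T <= real n" using real_arch_simple by blast
  then have "max \<bar>a\<bar> \<bar>b\<bar> <= real n * T" using T by (simp add: divide_le_eq)
  then show "f integrable_on {a..b}"
   by (intro integrable_subinterval_real[OF 3[of n]]) auto
 qed
qed

lemma periodic_locL2:
 assumes T: "T > 0" and p: "periodic T f" and i: "f \<in> L2_space {0..T}"
 shows "locL2 f"
proof -
 have a: "f integrable_on {0..T}" "(%x. \<bar>f x\<bar>) integrable_on {0..T}" "(%x. (f x)^2) integrable_on {0..T}"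
  using L2_integrable[OF i lmeasurable_Icc] L2_sq_integrable[OF i] L2_abs_integrable[OF i]
  by (auto intro: integrable_on_lebesgue_on)
 have "periodic T (%x. \<bar>f x\<bar>)" "periodic T (%x. (f x)^2)" using p by (auto simp: periodic_def)
 then have "loc_int f" "loc_int (%x. \<bar>f x\<bar>)" "loc_int (%x. (f x)^2)"
  using periodic_loc_int[OF T p a(1)] periodic_loc_int[OF T _ a(2)] periodic_loc_int[OF T _ a(3)] by auto
 then show ?thesis by (auto simp: locL2_def loc_int_def intro: L2_I_integrable)
qed

lemma periodic_prim_diff:
 assumes p: "periodic T f" and i: "loc_int f"
 shows "prim f (y + T) - prim f y = prim f T"
proof -
 have *: "prim f (b + T) - prim f (a + T) = prim f b - prim f a" if "a <= b" for a b
  using prim_diff[OF i, of "a+T" "b+T"] prim_diff[OF i that] integral_shift[of a b f T] that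
  by (simp add: periodic_D[OF p])
 show ?thesis using *[of 0 y] *[of y 0] by (cases "0 <= y") auto
qed

lemma periodic_integral:
 assumes p: "periodic T f" and i: "loc_int f" and T: "T >= 0"
 shows "integral {c..c+T} f = integral {0..T} f"
 using periodic_prim_diff[OF p i, of c] prim_diff[OF i, of c "c+T"] prim_diff[OF i, of 0 T] T by simp

lemma periodic_integral_flip:
 assumes "periodic T f" "loc_int f" "T >= 0"
 shows "integral {0..T} (%z. f (c - z)) = integral {0..T} f"
 using integral_flip[of 0 T f c] periodic_integral[OF assms, of "c - T"] by simp

lemma periodic_prim:
 assumes "periodic T f" "loc_int f" "T >= 0" "integral {0..T} f = 0"
 shows "periodic T (prim f)"
 unfolding periodic_def
proof
 fix x
 have "prim f T = 0" using prim_diff[OF assms(2), of 0 T] assms(3,4) by simp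
 then show "prim f (x + T) = prim f x" using periodic_prim_diff[OF assms(1,2), of x] by simp
qed

lemma periodic_L2_norm:
 assumes p: "periodic T f" and i: "locL2 f" and T: "T >= 0"
 shows "L2_norm {c..c+T} f = L2_norm {0..T} f"
proof -
 have "periodic T (%x. (f x)^2)" using p by (simp add: periodic_def)
 from periodic_integral[OF this locL2_sq_loc_int[OF i] T, of c]
 have "(L2_norm {c..c+T} f)^2 = (L2_norm {0..T} f)^2"
  by (simp add: L2_norm_sq_integral[OF locL2_D[OF i]])
 then show ?thesis using L2_norm_nonneg power2_eq_iff_nonneg by blast
qed

text \<open>Mean zero makes the primitive periodic. Hence x may be moved past y and then back by
  whole periods until it lies within one period to the right of y, where Cauchy-Schwarz
  applies.\<close>

lemma periodic_abs_prim_le: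
 assumes p: "periodic T f" and i: "locL2 f" and T: "T > 0" and z: "integral {0..T} f = 0"
 shows "\<bar>prim f x - prim f y\<bar> <= sqrt T * L2_norm {0..T} f"
proof -
 have li: "loc_int f" by (rule locL2_loc_int[OF i])
 note pp = periodic_prim[OF p li less_imp_le[OF T] z]
 obtain n :: nat where n: "(y - x) / T <= real n" using real_arch_simple by blast
 define x1 where "x1 = x + real n * T"
 have x1: "x1 >= y" using n T by (simp add: x1_def field_simps)
 define m where "m = nat \<lfloor>(x1 - y) / T\<rfloor>"
 have m: "real m <= (x1 - y) / T" "(x1 - y) / T < real m + 1"
  using x1 T by (auto simp: m_def of_nat_nat)
 define x2 where "x2 = x1 - real m * T"
 have x2: "y <= x2" "x2 <= y + T" using m T by (auto simp: x2_def field_simps)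
 have "prim f x = prim f x1" unfolding x1_def using periodic_nat[OF pp] by simp
 also have "... = prim f x2" using periodic_nat[OF pp, of x2 m] by (simp add: x2_def)
 finally have "\<bar>prim f x - prim f y\<bar> = \<bar>integral {y..x2} f\<bar>" using prim_diff[OF li x2(1)] by simp
 also have "... <= sqrt (x2 - y) * L2_norm {y..x2} f"
  by (rule L2_integral_cauchy_schwarz(2)[OF locL2_D[OF i] x2(1)])
 also have "... <= sqrt T * L2_norm {y..y+T} f"
  using x2 T by (intro mult_mono L2_subset(2)[OF locL2_D[OF i]]) auto
 finally show ?thesis using periodic_L2_norm[OF p i, of y] T by simp
qed

lemma prim_neg: "prim f (- y) = - prim (%x. f (- x)) y"
 using integral_flip[of 0 y f 0] integral_flip[of y 0 f 0] by (simp add: prim_def)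

text \<open>After reflection the curve is a translation with velocity -m, so it is an instance of
  \<open>L2_deriv_scale_comp\<close> with \<sigma> s = - m s.\<close>

lemma L2_deriv_flip:
 assumes f: "locL2 f" and ab: "a <= b" and m: "m > 0" and t: "t \<in> I"
 shows "has_L2_derivative {a..b} (%s x. prim f (m * s - x)) (%x. m * f (m * t - x)) t I"
proof -
 define g where "g = (%x. f (0 - x))"
 have g: "locL2 g" unfolding g_def by (rule locL2_flip[OF f])
 have pg: "continuous_on UNIV (prim g)" by (rule prim_continuous[OF locL2_loc_int[OF g]])
 have "has_L2_derivative {a..b} (%s x. (- 1) * prim g (x + (- m * s)))
   (%x. 0 * prim g (x + (- m * t)) + (- 1) * (- m) * g (x + (- m * t))) t I"
 proof (rule L2_deriv_scale_comp[where J=UNIV and \<sigma>="%s. - m * s" and A="%h x. prim g (x + h)" and k="%s. - 1"])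
  show "has_L2_derivative {a..b} (%h x. prim g (x + h)) (%x. g (x + - m * t)) (- m * t) UNIV"
   by (rule L2_deriv_translation[OF g ab])
  show "(%x. prim g (x + s)) \<in> L2_space {a..b}" for s
   by (rule locL2_D[OF locL2_shift[OF locL2_continuous[OF pg]]])
  show "(%x. g (x + - m * t)) \<in> L2_space {a..b}" by (rule locL2_D[OF locL2_shift[OF g]])
  show "((%s. - m * s) has_real_derivative - m) (at t within I)" by (auto intro!: derivative_eq_intros)
  show "inj_on (%s. - m * s) I" using m by (auto simp: inj_on_def)
 qed (use t in \<open>auto intro!: derivative_eq_intros\<close>)
 moreover have "(- 1) * prim g (x + (- m * s)) = prim f (m * s - x)" for s x
  using prim_neg[of f "x - m * s"] by (simp add: g_def)
 ultimately show ?thesis by (simp add: g_def algebra_simps)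
qed

lemma continuous_on_slice:
 assumes c: "continuous_on (I \<times> J) (%(s, x). f s x)" and s: "s \<in> I"
 shows "continuous_on J (f s)"
proof -
 have "continuous_on J ((%(s, x). f s x) \<circ> (%x. (s, x)))"
  by (intro continuous_on_compose continuous_intros continuous_on_subset[OF c]) (use s in auto)
 then show ?thesis by (simp add: o_def)
qed

text \<open>Joint continuity over the compact interval makes the convergence s -> t uniform in
  x.\<close>

lemma L2_lim_jointly_continuous:
 fixes f :: "'a::topological_space => real => real"
 assumes c: "continuous_on (I \<times> {a..b}) (%(s, x). f s x)" and t: "t \<in> I" and ab: "a <= b"
 shows "((%s. L2_norm {a..b} (%x. f s x - f t x)) \<longlongrightarrow> 0) (at t within I)"
proof (rule tendstoI)
 fix e :: real assume e: "e > 0"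
 \<comment> \<open>The summand 1 keeps the denominator positive when a = b and makes the final
   inequality strict.\<close>
 define \<eta> where "\<eta> = e / (2 * (sqrt (b - a) + 1))"
 have sq: "sqrt (b - a) >= 0" using ab by simp
 have aux: "q < 2 * (q + 1)" if "q >= 0" for q :: real using that by simp
 have aux2: "2 * (q + 1) \<noteq> 0" if "q >= 0" for q :: real
  by (rule less_imp_neq[THEN not_sym]) (use that in simp)
 have aux3: "e / q * q = e" if "q \<noteq> 0" for q :: real using that by simp
 have \<eta>: "\<eta> > 0" using e sq by (simp add: \<eta>_def add_nonneg_pos)
 obtain X where X: "t \<in> X" "open X" "\<forall>s\<in>X \<inter> I. \<forall>x\<in>{a..b}. dist (f s x) (f t x) <= \<eta>"
  using continuous_on_prod_compactE[OF c compact_Icc t \<eta>] by auto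
 have cs: "continuous_on {a..b} (f s)" if "s \<in> I" for s
  by (rule continuous_on_slice[OF c that])
 have "\<forall>\<^sub>F s in at t within I. s \<in> X \<and> s \<in> I"
  using X by (auto simp: eventually_at_filter eventually_nhds)
 then show "\<forall>\<^sub>F s in at t within I. dist (L2_norm {a..b} (%x. f s x - f t x)) 0 < e"
 proof eventually_elim
  case (elim s)
  have "L2_norm {a..b} (%x. f s x - f t x) <= \<eta> * sqrt (b - a)"
   by (rule L2_norm_interval_le) (use X elim cs t \<eta> ab in \<open>auto simp: dist_real_def intro!: continuous_intros\<close>)
  also have "... < \<eta> * (2 * (sqrt (b - a) + 1))" by (rule mult_strict_left_mono[OF aux[OF sq] \<eta>])
  also have "... = e"
   unfolding \<eta>_def by (rule aux3[OF aux2[OF sq]])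
  finally show ?case by simp
 qed
qed

text \<open>The mean value inequality for f s x - s f' t x bounds the error of the difference
  quotient by the oscillation of f' near t, which is uniformly small in x.\<close>

lemma L2_deriv_jointly_continuous:
 fixes f f' :: "real => real => real"
 assumes D: "!!s x. s \<in> I ==> x \<in> {a..b} ==> ((%s. f s x) has_real_derivative f' s x) (at s within I)"
  and c: "continuous_on (I \<times> {a..b}) (%(s, x). f' s x)" and cf: "!!s. s \<in> I ==> continuous_on {a..b} (f s)"
  and I: "convex I" and t: "t \<in> I" and ab: "a <= b"
 shows "has_L2_derivative {a..b} f (f' t) t I"
 unfolding has_L2_derivative_def
proof (rule tendstoI)
 fix e :: real assume e: "e > 0"
 define \<eta> where "\<eta> = e / (2 * (sqrt (b - a) + 1))"
 have sq: "sqrt (b - a) >= 0" using ab by simp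
 have aux: "q < 2 * (q + 1)" if "q >= 0" for q :: real using that by simp
 have aux2: "2 * (q + 1) \<noteq> 0" if "q >= 0" for q :: real
  by (rule less_imp_neq[THEN not_sym]) (use that in simp)
 have aux3: "e / q * q = e" if "q \<noteq> 0" for q :: real using that by simp
 have \<eta>: "\<eta> > 0" using e sq by (simp add: \<eta>_def add_nonneg_pos)
 obtain X where X: "t \<in> X" "open X" "\<forall>s\<in>X \<inter> I. \<forall>x\<in>{a..b}. dist (f' s x) (f' t x) <= \<eta>"
  using continuous_on_prod_compactE[OF c compact_Icc t \<eta>] by auto
 obtain d where d: "d > 0" "ball t d \<subseteq> X" using X open_contains_ball by blast
 have cs: "continuous_on {a..b} (f' t)"
  by (rule continuous_on_slice[OF c t])
 have "\<forall>\<^sub>F s in at t within I. s \<in> ball t d \<and> s \<in> I \<and> s \<noteq> t"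
  using d by (auto simp: eventually_at dist_commute intro!: exI[of _ d])
 then show "\<forall>\<^sub>F s in at t within I. dist (L2_norm {a..b} (%x. (f s x - f t x) / (s - t) - f' t x)) 0 < e"
 proof eventually_elim
  case (elim s)
  have b: "\<bar>(f s x - f t x) / (s - t) - f' t x\<bar> <= \<eta>" if x: "x \<in> {a..b}" for x
  proof -
   define J where "J = ball t d \<inter> I"
   have J: "convex J" using I by (auto simp: J_def intro: convex_Int)
   have "\<bar>(f s x - f' t x * s) - (f t x - f' t x * t)\<bar> <= \<eta> * \<bar>s - t\<bar>"
   proof (rule field_differentiable_bound[OF J, where f="%s. f s x - f' t x * s" and f'="%s. f' s x - f' t x", unfolded real_norm_def])
    fix z assume z: "z \<in> J"
    then have zI: "z \<in> I" by (simp add: J_def)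
    have "((%s. f s x - f' t x * s) has_field_derivative f' z x - f' t x) (at z within I)"
     using D[OF zI x] by (auto intro!: derivative_eq_intros)
    then show "((%s. f s x - f' t x * s) has_field_derivative f' z x - f' t x) (at z within J)"
     by (rule DERIV_subset) (auto simp: J_def)
    show "\<bar>f' z x - f' t x\<bar> <= \<eta>" using X(3) z x d by (auto simp: J_def dist_real_def)
   qed (use elim d t in \<open>auto simp: J_def\<close>)
   then have "\<bar>(f s x - f t x) - f' t x * (s - t)\<bar> <= \<eta> * \<bar>s - t\<bar>" by (simp add: algebra_simps)
   moreover have "(f s x - f t x) / (s - t) - f' t x = ((f s x - f t x) - f' t x * (s - t)) / (s - t)"
    using elim by (simp add: diff_divide_distrib)
   ultimately show ?thesis using elim by (simp add: abs_divide divide_le_eq)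
  qed
  have "L2_norm {a..b} (%x. (f s x - f t x) / (s - t) - f' t x) <= \<eta> * sqrt (b - a)"
   by (rule L2_norm_interval_le[OF _ b]) (use elim cf t cs \<eta> ab in \<open>auto intro!: continuous_intros\<close>)
  also have "... < \<eta> * (2 * (sqrt (b - a) + 1))" by (rule mult_strict_left_mono[OF aux[OF sq] \<eta>])
  also have "... = e"
   unfolding \<eta>_def by (rule aux3[OF aux2[OF sq]])
  finally show ?case by simp
 qed
qed

section \<open>Slowly varying sequences and interpolation\<close>

definition fdiff :: "real => (real => real) => real => real" where
 "fdiff T f s = f (s + T) - f s"

lemma fdiff_pow_Suc: "(fdiff T ^^ Suc j) f s = (fdiff T ^^ j) f (s + T) - (fdiff T ^^ j) f s"
 by (simp add: fdiff_def)

lemma fdiff_pow_Suc': "(fdiff T ^^ Suc j) f = (fdiff T ^^ j) (fdiff T f)"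
 by (simp add: funpow_Suc_right del: funpow.simps)

lemma fdiff_pow_add: "(fdiff T ^^ j) (%s. f s + g s) s = (fdiff T ^^ j) f s + (fdiff T ^^ j) g s"
 by (induction j arbitrary: s) (simp_all add: fdiff_def)

lemma fdiff_pow_cmult: "(fdiff T ^^ j) (%s. c * f s) s = c * (fdiff T ^^ j) f s"
 by (induction j arbitrary: s) (simp_all add: fdiff_def right_diff_distrib)

lemma fdiff_pow_diff: "(fdiff T ^^ j) (%s. f s - g s) s = (fdiff T ^^ j) f s - (fdiff T ^^ j) g s"
 by (induction j arbitrary: s) (simp_all add: fdiff_def)

lemma fdiff_pow_const: "(fdiff T ^^ j) (%s. c) s = (if j = 0 then c else 0)"
 by (induction j arbitrary: s) (simp_all add: fdiff_def)

lemma fdiff_pow_shift: "(fdiff T ^^ j) (%s. f (s + c)) s = (fdiff T ^^ j) f (s + c)"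
 by (induction j arbitrary: s) (simp_all add: fdiff_def algebra_simps)

lemma fdiff_pow_deriv:
 assumes T: "T >= 0" and D: "!!s. s >= 0 ==> (f has_real_derivative f' s) (at s within {0..})" and s: "s >= 0"
 shows "((fdiff T ^^ j) f has_real_derivative (fdiff T ^^ j) f' s) (at s within {0..})"
 using s
proof (induction j arbitrary: s)
 case (Suc j)
 have "((fdiff T ^^ j) f has_real_derivative (fdiff T ^^ j) f' (s + T)) (at (s + T) within (%s. s + T) ` {0..})"
  by (rule DERIV_subset[OF Suc.IH]) (use Suc.prems T in auto)
 moreover have "((%s. s + T) has_real_derivative 1) (at s within {0..})" by (auto intro!: derivative_eq_intros)
 ultimately have "((%s. (fdiff T ^^ j) f (s + T)) has_real_derivative (fdiff T ^^ j) f' (s + T)) (at s within {0..})"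
  using DERIV_image_chain by (fastforce simp: o_def)
 then show ?case using Suc.IH[OF Suc.prems] unfolding fdiff_pow_Suc[abs_def]
  by (auto intro!: derivative_eq_intros)
qed (use D in simp)

text \<open>The i-th difference at s reads f at s, s + T, ..., s + iT, so the condition on s says
  that all these nodes lie in [0, X]. One power of eps per difference replaces one power per
  derivative.\<close>

definition slow :: "real => real => real => nat => real => (real => real) => bool" where
 "slow T eps X m A f \<longleftrightarrow>
  (\<forall>i\<le>m. \<forall>s. 0 <= s \<and> s + real i * T <= X \<longrightarrow> \<bar>(fdiff T ^^ i) f s\<bar> <= A * eps ^ i)"

lemma slow_D: "slow T eps X m A f ==> i <= m ==> 0 <= s ==> s + real i * T <= X ==> \<bar>(fdiff T ^^ i) f s\<bar> <= A * eps ^ i"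
 by (auto simp: slow_def)

lemma slow_mono: "slow T eps X m A f ==> m' <= m ==> X' <= X ==> slow T eps X' m' A f"
 by (auto simp: slow_def)

lemma slow_fdiff: "slow T eps X (Suc m) A f ==> slow T eps (X - T) m (A * eps) (fdiff T f)"
 unfolding slow_def
proof (intro allI impI)
 fix i s assume h: "\<forall>i\<le>Suc m. \<forall>s. 0 <= s \<and> s + real i * T <= X \<longrightarrow> \<bar>(fdiff T ^^ i) f s\<bar> <= A * eps ^ i"
  and i: "i <= m" and s: "0 <= s \<and> s + real i * T <= X - T"
 then have "\<bar>(fdiff T ^^ Suc i) f s\<bar> <= A * eps ^ Suc i"
  by (intro h[rule_format]) (auto simp: algebra_simps)
 then show "\<bar>(fdiff T ^^ i) (fdiff T f) s\<bar> <= A * eps * eps ^ i"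
  by (simp only: fdiff_pow_Suc') (simp add: mult.assoc)
qed

lemma slow_shift: "slow T eps X m A f ==> T >= 0 ==> slow T eps (X - T) m A (%s. f (s + T))"
 unfolding slow_def by (auto simp: fdiff_pow_shift algebra_simps)

text \<open>Discrete Leibniz rule: the difference of f g is the difference of f times the shifted g
  plus f times the difference of g. Each order doubles the constant and shortens the window by
  T.\<close>

lemma slow_mult_aux:
 assumes "slow T eps X i A f" "slow T eps X i B g" "T >= 0" "0 <= s" "s + real i * T <= X"
 shows "\<bar>(fdiff T ^^ i) (%s. f s * g s) s\<bar> <= 2 ^ i * A * B * eps ^ i"
 using assms
proof (induction i arbitrary: A B f g X)
 case 0
 have "\<bar>f s\<bar> <= A" "\<bar>g s\<bar> <= B"
  using slow_D[OF 0(1), of 0 s] slow_D[OF 0(2), of 0 s] 0 by auto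
 then show ?case by (simp add: abs_mult mult_mono')
next
 case (Suc i)
 have sd: "s + real i * T <= X - T" using Suc.prems(5) by (simp add: algebra_simps)
 have le: "X - T <= X" using Suc.prems(3) by simp
 note f1 = slow_fdiff[OF Suc.prems(1)] and g1 = slow_fdiff[OF Suc.prems(2)]
 note g0 = slow_shift[OF slow_mono[OF Suc.prems(2), of i X] Suc.prems(3)]
 note f0 = slow_mono[OF Suc.prems(1), of i "X - T"]
 have a: "\<bar>(fdiff T ^^ i) (%s. fdiff T f s * g (s + T)) s\<bar> <= 2 ^ i * (A * eps) * B * eps ^ i"
  by (rule Suc.IH[OF f1 g0 Suc.prems(3,4) sd]) auto
 have b: "\<bar>(fdiff T ^^ i) (%s. f s * fdiff T g s) s\<bar> <= 2 ^ i * A * (B * eps) * eps ^ i"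
  by (rule Suc.IH[OF f0 g1 Suc.prems(3,4) sd]) (use le in auto)
 have "fdiff T (%s. f s * g s) = (%s. fdiff T f s * g (s + T) + f s * fdiff T g s)"
  by (simp add: fdiff_def fun_eq_iff algebra_simps)
 then have "\<bar>(fdiff T ^^ Suc i) (%s. f s * g s) s\<bar> \<le>
   \<bar>(fdiff T ^^ i) (%s. fdiff T f s * g (s + T)) s\<bar> + \<bar>(fdiff T ^^ i) (%s. f s * fdiff T g s) s\<bar>"
  unfolding fdiff_pow_Suc' by (simp add: fdiff_pow_add)
 also have "... <= 2 ^ i * (A * eps) * B * eps ^ i + 2 ^ i * A * (B * eps) * eps ^ i" using a b by linarith
 finally show ?case by (simp add: algebra_simps)
qed

lemma slow_mult:
 assumes "slow T eps X m A f" "slow T eps X m B g" "T >= 0" "A >= 0" "B >= 0" "eps >= 0"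
 shows "slow T eps X m (2 ^ m * A * B) (%s. f s * g s)"
 unfolding slow_def
proof (intro allI impI)
 fix i s assume i: "i <= m" and s: "0 <= s \<and> s + real i * T <= X"
 have "\<bar>(fdiff T ^^ i) (%s. f s * g s) s\<bar> <= 2 ^ i * A * B * eps ^ i"
  by (rule slow_mult_aux) (use assms i s in \<open>auto intro: slow_mono\<close>)
 also have "... <= 2 ^ m * A * B * eps ^ i"
  using assms i by (intro mult_right_mono power_increasing) auto
 finally show "\<bar>(fdiff T ^^ i) (%s. f s * g s) s\<bar> <= 2 ^ m * A * B * eps ^ i" .
qed

lemma slow_add:
 assumes "slow T eps X m A f" "slow T eps X m B g"
 shows "slow T eps X m (A + B) (%s. f s + g s)"
 unfolding slow_def
proof (intro allI impI)
 fix i s assume i: "i <= m" and s: "0 <= s \<and> s + real i * T <= X"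
 show "\<bar>(fdiff T ^^ i) (%s. f s + g s) s\<bar> <= (A + B) * eps ^ i"
  using slow_D[OF assms(1) i, of s] slow_D[OF assms(2) i, of s] s
  by (simp add: fdiff_pow_add distrib_right)
qed

lemma slow_cmult:
 assumes "slow T eps X m A f"
 shows "slow T eps X m (\<bar>c\<bar> * A) (%s. c * f s)"
 unfolding slow_def
proof (intro allI impI)
 fix i s assume i: "i <= m" and s: "0 <= s \<and> s + real i * T <= X"
 show "\<bar>(fdiff T ^^ i) (%s. c * f s) s\<bar> <= \<bar>c\<bar> * A * eps ^ i"
  using slow_D[OF assms(1) i, of s] s
  by (simp add: fdiff_pow_cmult abs_mult mult.assoc mult_left_mono)
qed

text \<open>\<open>D 0\<close> together with all its derivatives on the half-line. The factor eps ^
  i expresses that \<open>D 0\<close> is a function of eps s, with bounds K that do not depend on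
  eps.\<close>

definition der_chain :: "real => (nat => real) => (nat => real => real) => bool" where
 "der_chain eps K D \<longleftrightarrow> (\<forall>i. \<forall>s\<ge>0. (D i has_real_derivative D (Suc i) s) (at s within {0..}) \<and> \<bar>D i s\<bar> <= K i * eps ^ i)"

lemma mvt_bound:
 fixes f f' :: "real => real"
 assumes D: "!!s. s \<in> {a..b} ==> (f has_real_derivative f' s) (at s within {a..b})"
  and B: "!!s. s \<in> {a..b} ==> \<bar>f' s\<bar> <= B" and "x \<in> {a..b}" "y \<in> {a..b}"
 shows "\<bar>f y - f x\<bar> <= B * \<bar>y - x\<bar>"
 using field_differentiable_bound[OF convex_real_interval(5)[of a b] D, of B y x] B assms(3,4) by simp

text \<open>Differences commute with derivatives, so each difference costs one derivative and a
  factor T by the mean value inequality.\<close>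

lemma der_chain_fdiff:
 assumes c: "der_chain eps K D" and T: "T >= 0" and s: "s >= 0"
 shows "\<bar>(fdiff T ^^ j) (D i) s\<bar> <= T ^ j * K (i + j) * eps ^ (i + j)"
 using s
proof (induction j arbitrary: i s)
 case 0
 then show ?case using c by (auto simp: der_chain_def)
next
 case (Suc j)
 have "\<bar>(fdiff T ^^ j) (D i) (s + T) - (fdiff T ^^ j) (D i) s\<bar> \<le>
   (T ^ j * K (Suc i + j) * eps ^ (Suc i + j)) * \<bar>(s + T) - s\<bar>"
 proof (rule mvt_bound[where a=s and b="s+T" and f'="(fdiff T ^^ j) (D (Suc i))"])
  fix \<sigma> assume \<sigma>: "\<sigma> \<in> {s..s+T}"
  show "((fdiff T ^^ j) (D i) has_real_derivative (fdiff T ^^ j) (D (Suc i)) \<sigma>) (at \<sigma> within {s..s+T})"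
   by (rule DERIV_subset[OF fdiff_pow_deriv[OF T]]) (use c \<sigma> Suc.prems in \<open>auto simp: der_chain_def\<close>)
  show "\<bar>(fdiff T ^^ j) (D (Suc i)) \<sigma>\<bar> <= T ^ j * K (Suc i + j) * eps ^ (Suc i + j)"
   by (rule Suc.IH) (use \<sigma> Suc.prems in auto)
 qed (use T in auto)
 then show ?case using T unfolding fdiff_pow_Suc by (simp add: mult_ac)
qed

lemma der_chain_slow:
 assumes c: "der_chain eps K D" and T: "T >= 0" and e: "eps >= 0"
 shows "slow T eps X m (\<Sum>j\<le>m. T ^ j * \<bar>K j\<bar>) (D 0)"
 unfolding slow_def
proof (intro allI impI)
 fix i s assume i: "i <= m" and s: "0 <= s \<and> s + real i * T <= X"
 have "\<bar>(fdiff T ^^ i) (D 0) s\<bar> <= T ^ i * K i * eps ^ i"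
  using der_chain_fdiff[OF c T, of s i 0] s by simp
 also have "... <= T ^ i * \<bar>K i\<bar> * eps ^ i" using T e by (intro mult_right_mono mult_left_mono) auto
 also have "T ^ i * \<bar>K i\<bar> <= (\<Sum>j\<le>m. T ^ j * \<bar>K j\<bar>)"
  using i T by (intro member_le_sum[of i "{..m}" "%j. T ^ j * \<bar>K j\<bar>"]) auto
 finally show "\<bar>(fdiff T ^^ i) (D 0) s\<bar> <= (\<Sum>j\<le>m. T ^ j * \<bar>K j\<bar>) * eps ^ i"
  using e by (simp add: mult_right_mono)
qed

subsection \<open>Newton interpolation\<close>

text \<open>Newton's forward interpolation polynomial in r for the data f (s + jT), j = 0, ..., M: r
  is a continuous count of periods, while s keeps the phase.\<close>

definition nint :: "nat => real => real => (real => real) => real => real" where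
 "nint M T r f s = (\<Sum>j\<le>M. (r gchoose j) * (fdiff T ^^ j) f s)"

text \<open>The binomial expansion of the k-th power of 1 + \<open>fdiff T\<close>; the induction
  step is Pascal's rule.\<close>

lemma newton_forward: "f (s + real k * T) = (\<Sum>j\<le>k. real (k choose j) * (fdiff T ^^ j) f s)"
proof (induction k arbitrary: f)
 case (Suc k)
 let ?g = "%j. (fdiff T ^^ j) f s"
 have "f (s + real (Suc k) * T) = f (s + real k * T) + fdiff T f (s + real k * T)"
  by (simp add: fdiff_def algebra_simps)
 also have "... = (\<Sum>j\<le>k. real (k choose j) * ?g j) + (\<Sum>j\<le>k. real (k choose j) * ?g (Suc j))"
  by (simp only: Suc.IH[of f] Suc.IH[of "fdiff T f"] fdiff_pow_Suc')
 also have "(\<Sum>j\<le>k. real (k choose j) * ?g j) = ?g 0 + (\<Sum>j\<le>k. real (k choose Suc j) * ?g (Suc j))"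
 proof -
  have "(\<Sum>j\<le>k. real (k choose j) * ?g j) = (\<Sum>j\<le>Suc k. real (k choose j) * ?g j)" by simp
  also have "... = ?g 0 + (\<Sum>j\<le>k. real (k choose Suc j) * ?g (Suc j))"
   by (subst sum.atMost_Suc_shift) simp
  finally show ?thesis .
 qed
 also have "?g 0 + (\<Sum>j\<le>k. real (k choose Suc j) * ?g (Suc j)) + (\<Sum>j\<le>k. real (k choose j) * ?g (Suc j)) =
   ?g 0 + (\<Sum>j\<le>k. real (Suc k choose Suc j) * ?g (Suc j))"
  by (simp add: sum.distrib[symmetric] algebra_simps)
 also have "... = (\<Sum>j\<le>Suc k. real (Suc k choose j) * ?g j)"
  by (subst sum.atMost_Suc_shift) simp
 finally show ?case .
qed simp

lemma nint_nat:
 assumes "k <= M"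
 shows "nint M T (real k) f s = f (s + real k * T)"
proof -
 have "nint M T (real k) f s = (\<Sum>j\<le>M. real (k choose j) * (fdiff T ^^ j) f s)"
  by (simp add: nint_def binomial_gbinomial)
 also have "... = (\<Sum>j\<le>k. real (k choose j) * (fdiff T ^^ j) f s)"
  by (rule sum.mono_neutral_right) (use assms in auto)
 finally show ?thesis by (simp add: newton_forward[of f s k T])
qed

section \<open>Iterated derivatives on an interval and the interpolation error\<close>

fun nth_deriv :: "real set => nat => (real => real) => (real => real) => bool" where
 "nth_deriv S 0 f g \<longleftrightarrow> (\<forall>x\<in>S. f x = g x)"
| "nth_deriv S (Suc n) f g \<longleftrightarrow> (\<exists>f'. (\<forall>x\<in>S. (f has_real_derivative f' x) (at x within S)) \<and> nth_deriv S n f' g)"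

lemma nth_deriv_diff:
 "nth_deriv S n f g ==> nth_deriv S n f2 g2 ==> nth_deriv S n (%x. f x - f2 x) (%x. g x - g2 x)"
proof (induction n arbitrary: f f2)
 case (Suc n)
 then obtain f' f2' where "\<forall>x\<in>S. (f has_real_derivative f' x) (at x within S)" "nth_deriv S n f' g"
  "\<forall>x\<in>S. (f2 has_real_derivative f2' x) (at x within S)" "nth_deriv S n f2' g2" by auto
 then show ?case using Suc.IH[of f' f2']
  by (auto intro!: exI[of _ "%x. f' x - f2' x"] derivative_intros)
qed simp

lemma funpow_pderiv_eq_0: "degree (p :: real poly) < n ==> (pderiv ^^ n) p = 0"
proof (induction n arbitrary: p)
 case (Suc n)
 show ?case
 proof (cases "degree p = 0")
  case True
  then have "pderiv p = 0" by (simp add: pderiv_eq_0_iff)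
  moreover have "(pderiv ^^ n) (0 :: real poly) = 0" by (induction n) auto
  ultimately show ?thesis by (simp add: funpow_Suc_right del: funpow.simps)
 next
  case False
  then have "degree (pderiv p) < n" using Suc.prems by (simp add: degree_pderiv)
  then show ?thesis using Suc.IH[of "pderiv p"] by (simp add: funpow_Suc_right del: funpow.simps)
 qed
qed simp

lemma nth_deriv_poly: "nth_deriv S n (poly p) (poly ((pderiv ^^ n) p))"
proof (induction n arbitrary: p)
 case (Suc n)
 show ?case
  by (auto intro!: exI[of _ "poly (pderiv p)"] has_field_derivative_at_within[OF poly_DERIV]
    Suc.IH[of "pderiv p"] simp: funpow_Suc_right simp del: funpow.simps)
qed simp

text \<open>Rolle's theorem gives every derivative of order below \<open>n\<close> a zero.\<close>

lemma nth_deriv_zeros_bound: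
 assumes "nth_deriv {a..b} n f g" "finite Z" "card Z = n" "Z \<subseteq> {a..b}" "\<forall>z\<in>Z. f z = 0"
  and "\<forall>x\<in>{a..b}. \<bar>g x\<bar> <= B" and x: "x \<in> {a..b}"
 shows "\<bar>f x\<bar> <= (b - a) ^ n * B"
 using assms
proof (induction n arbitrary: f Z x)
 case (Suc n)
 obtain f' where d: "!!x. x \<in> {a..b} ==> (f has_real_derivative f' x) (at x within {a..b})"
  and n: "nth_deriv {a..b} n f' g" using Suc.prems(1) unfolding nth_deriv.simps by blast
 have rolle: "\<exists>z>u. z < v \<and> f' z = 0" if uv: "u \<in> {a..b}" "v \<in> {a..b}" "u < v" "f u = 0" "f v = 0" for u v
 proof -
  have "\<exists>z\<in>{u<..<v}. f v - f u = (*) (f' z) (v - u)"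
  proof (rule mvt_simple[OF uv(3)])
   fix y assume "u <= y" "y <= v"
   then have "(f has_real_derivative f' y) (at y within {u..v})"
    using uv by (intro DERIV_subset[OF d]) auto
   then show "(f has_derivative (*) (f' y)) (at y within {u..v})"
    by (simp add: has_field_derivative_def)
  qed
  then show ?thesis using uv by auto
 qed
 define zs where "zs = sorted_list_of_set Z"
 have zs: "length zs = Suc n" "set zs = Z" "sorted zs" "distinct zs"
  using Suc.prems by (auto simp: zs_def)
 have zin: "zs ! i \<in> Z" if "i <= n" for i using zs that by (metis le_imp_less_Suc nth_mem)
 have zlt: "zs ! i < zs ! j" if "i < j" "j <= n" for i j
  using sorted_nth_mono[OF zs(3), of i j] nth_eq_iff_index_eq[OF zs(4), of i j] zs(1) that by fastforce
 have "\<forall>i<n. \<exists>z. zs ! i < z \<and> z < zs ! Suc i \<and> f' z = 0"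
 proof (intro allI impI)
  fix i assume i: "i < n"
  show "\<exists>z. zs ! i < z \<and> z < zs ! Suc i \<and> f' z = 0"
  proof (rule rolle[of "zs ! i" "zs ! Suc i"])
   show "zs ! i \<in> {a..b}" "f (zs ! i) = 0" using zin[of i] i Suc.prems(4,5) by auto
   show "zs ! Suc i \<in> {a..b}" "f (zs ! Suc i) = 0" using zin[of "Suc i"] i Suc.prems(4,5) by auto
   show "zs ! i < zs ! Suc i" using zlt[of i "Suc i"] i by simp
  qed
 qed
 then obtain \<zeta> where \<zeta>: "!!i. i < n ==> zs ! i < \<zeta> i \<and> \<zeta> i < zs ! Suc i \<and> f' (\<zeta> i) = 0" by metis
 have \<zeta>lt: "\<zeta> i < \<zeta> j" if "i < j" "j < n" for i j
 proof -
  have "zs ! Suc i <= zs ! j" using zlt[of "Suc i" j] that by (cases "Suc i = j") auto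
  then show ?thesis using \<zeta>[of i] \<zeta>[of j] that by auto
 qed
 then have inj: "inj_on \<zeta> {..<n}" by (intro linorder_inj_onI) (auto simp: less_imp_neq)
 have sub: "\<zeta> ` {..<n} \<subseteq> {a..b}"
 proof
  fix y assume "y \<in> \<zeta> ` {..<n}"
  then obtain i where i: "i < n" "y = \<zeta> i" by auto
  then show "y \<in> {a..b}" using \<zeta>[of i] zin[of i] zin[of "Suc i"] Suc.prems(4) by fastforce
 qed
 have f'b: "\<bar>f' y\<bar> <= (b - a) ^ n * B" if "y \<in> {a..b}" for y
  by (rule Suc.IH[OF n, of "\<zeta> ` {..<n}"]) (use inj sub \<zeta> Suc.prems(6) that in \<open>auto simp: card_image\<close>)
 have z0: "zs ! 0 \<in> {a..b}" "f (zs ! 0) = 0" using zin[of 0] Suc.prems(4,5) by auto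
 have "\<bar>f x - f (zs ! 0)\<bar> <= (b - a) ^ n * B * \<bar>x - zs ! 0\<bar>"
  by (rule mvt_bound[OF d f'b]) (use z0 Suc.prems(7) in auto)
 also have "... <= (b - a) ^ n * B * (b - a)"
 proof (rule mult_left_mono)
  show "\<bar>x - zs ! 0\<bar> <= b - a" using z0 Suc.prems(7) by auto
  show "0 <= (b - a) ^ n * B" using f'b[OF z0(1)] by linarith
 qed
 finally show ?case using z0 by (simp add: mult_ac)
qed auto

text \<open>The continuous counterpart of \<open>slow\<close>: every derivative up to order n, taken
  within S, gains a factor eps. It is phrased recursively so that sums and products can be treated
  by induction on n.\<close>

fun smooth_upto :: "real set => real => nat => real => (real => real) => bool" where
 "smooth_upto S eps 0 A f \<longleftrightarrow> (\<forall>x\<in>S. \<bar>f x\<bar> <= A)"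
| "smooth_upto S eps (Suc n) A f \<longleftrightarrow> (\<forall>x\<in>S. \<bar>f x\<bar> <= A) \<and>
   (\<exists>f'. (\<forall>x\<in>S. (f has_real_derivative f' x) (at x within S)) \<and> smooth_upto S eps n (A * eps) f')"

lemma smooth_upto_bound: "smooth_upto S eps n A f ==> x \<in> S ==> \<bar>f x\<bar> <= A"
 by (cases n) auto

lemma smooth_upto_mono: "smooth_upto S eps n A f ==> A <= B ==> eps >= 0 ==> smooth_upto S eps n B f"
proof (induction n arbitrary: A B f)
 case (Suc n)
 then obtain f' where "\<forall>x\<in>S. (f has_real_derivative f' x) (at x within S)" "smooth_upto S eps n (A * eps) f'" by auto
 then show ?case using Suc.IH[of "A * eps" f' "B * eps"] Suc.prems by (force intro: mult_right_mono)
qed force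

lemma smooth_upto_Suc: "smooth_upto S eps (Suc n) A f ==> smooth_upto S eps n A f"
proof (induction n arbitrary: A f)
 case (Suc n)
 then obtain f' where "\<forall>x\<in>S. (f has_real_derivative f' x) (at x within S)" "smooth_upto S eps (Suc n) (A * eps) f'"
  using smooth_upto.simps(2) by blast
 then show ?case using Suc.IH[of "A * eps" f'] Suc.prems by auto
qed auto

lemma smooth_upto_add:
 "smooth_upto S eps n A f ==> smooth_upto S eps n B g ==> smooth_upto S eps n (A + B) (%x. f x + g x)"
proof (induction n arbitrary: A B f g)
 case 0
 then show ?case by (force intro: order_trans[OF abs_triangle_ineq] add_mono)
next
 case (Suc n)
 then obtain f' g' where "\<forall>x\<in>S. (f has_real_derivative f' x) (at x within S)" "smooth_upto S eps n (A * eps) f'"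
  "\<forall>x\<in>S. (g has_real_derivative g' x) (at x within S)" "smooth_upto S eps n (B * eps) g'" by auto
 then have "\<forall>x\<in>S. ((%x. f x + g x) has_real_derivative f' x + g' x) (at x within S)"
  "smooth_upto S eps n ((A + B) * eps) (%x. f' x + g' x)"
  using Suc.IH[of "A * eps" f' "B * eps" g'] by (auto intro!: derivative_intros simp: distrib_right)
 moreover have "\<bar>f x + g x\<bar> <= A + B" if "x \<in> S" for x
  using smooth_upto_bound[OF Suc.prems(1) that] smooth_upto_bound[OF Suc.prems(2) that] by linarith
 ultimately show ?case by auto
qed

text \<open>Leibniz rule; each order produces two products, hence the factor 2 ^ n.\<close>

lemma smooth_upto_mult:
 assumes "eps >= 0"
 shows "smooth_upto S eps n A f ==> smooth_upto S eps n B g ==> A >= 0 ==> B >= 0 ==>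
  smooth_upto S eps n (2 ^ n * A * B) (%x. f x * g x)"
proof (induction n arbitrary: A B f g)
 case 0
 then show ?case by (auto simp: abs_mult intro!: mult_mono')
next
 case (Suc n)
 then obtain f' g' where f': "\<forall>x\<in>S. (f has_real_derivative f' x) (at x within S)" "smooth_upto S eps n (A * eps) f'"
  and g': "\<forall>x\<in>S. (g has_real_derivative g' x) (at x within S)" "smooth_upto S eps n (B * eps) g'" by auto
 have d: "\<forall>x\<in>S. ((%x. f x * g x) has_real_derivative f' x * g x + f x * g' x) (at x within S)"
  using f' g' by (auto intro!: derivative_eq_intros)
 have "smooth_upto S eps n (2 ^ n * (A * eps) * B + 2 ^ n * A * (B * eps)) (%x. f' x * g x + f x * g' x)"
  using Suc.prems(3,4) assms
  by (intro smooth_upto_add Suc.IH f'(2) g'(2) smooth_upto_Suc[OF Suc.prems(1)] smooth_upto_Suc[OF Suc.prems(2)]) auto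
 then have s: "smooth_upto S eps n (2 ^ Suc n * A * B * eps) (%x. f' x * g x + f x * g' x)"
  by (simp add: algebra_simps)
 have b: "\<bar>f x * g x\<bar> <= 2 ^ Suc n * A * B" if "x \<in> S" for x
 proof -
  have "\<bar>f x * g x\<bar> <= A * B"
   using smooth_upto_bound[OF Suc.prems(1) that] smooth_upto_bound[OF Suc.prems(2) that]
   by (auto simp: abs_mult intro!: mult_mono')
  also have "A * B <= 2 ^ Suc n * (A * B)"
   using mult_right_mono[of 1 "2 ^ Suc n" "A * B"] Suc.prems by (simp add: one_le_power del: power_Suc)
  finally show ?thesis by (simp add: mult.assoc)
 qed
 show ?case using d s b by auto
qed

lemma smooth_upto_power:
 assumes "eps >= 0" "smooth_upto S eps n A f" "A >= 0"
 shows "smooth_upto S eps n ((2 ^ n * A) ^ p) (%x. f x ^ p)"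
proof (induction p)
 case 0
 have "smooth_upto S eps n A (%x. 0)" if "A >= 0" for n A
  using that by (induction n arbitrary: A) (auto intro!: exI[of _ "%x. 0"] simp: assms(1))
 then have "smooth_upto S eps n 1 (%x. 1)"
  by (cases n) (auto intro!: exI[of _ "%x. 0"] simp: assms(1))
 then show ?case by simp
next
 case (Suc p)
 show ?case using smooth_upto_mult[OF assms(1,2) Suc.IH assms(3)] assms(3) by (simp add: mult_ac)
qed

lemma smooth_upto_nth_deriv:
 "smooth_upto S eps n A f ==> \<exists>g. nth_deriv S n f g \<and> (\<forall>x\<in>S. \<bar>g x\<bar> <= A * eps ^ n)"
proof (induction n arbitrary: A f)
 case (Suc n)
 then obtain f' where f': "\<forall>x\<in>S. (f has_real_derivative f' x) (at x within S)" "smooth_upto S eps n (A * eps) f'" by auto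
 from Suc.IH[OF f'(2)] show ?case using f'(1) by (auto simp: mult_ac)
qed auto

lemma smooth_upto_zero: "eps >= 0 ==> A >= 0 ==> smooth_upto S eps n A (%x. 0)"
 by (induction n arbitrary: A) (auto intro!: exI[of _ "%x. 0"])

text \<open>A Newton term is a j-th difference, of size eps ^ j, times a polynomial of degree at
  most j in r. Its derivatives of order i <= j are at most of size eps ^ j <= eps ^ i, and the later
  ones vanish. So the interpolant of slow data is itself slow in r to every order.\<close>

lemma smooth_upto_poly:
 assumes S: "compact S"
 shows "degree p <= j ==> \<exists>C\<ge>0. \<forall>A eps w n. 0 <= A \<and> 0 <= eps \<and> eps <= 1 \<and> \<bar>w\<bar> <= A * eps ^ j \<longrightarrow> smooth_upto S eps n (C * A) (%x. w * poly p x)"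
proof (induction j arbitrary: p)
 case 0
 then obtain c where p: "p = [:c:]" by (metis le_zero_eq degree_eq_zeroE)
 show ?case
 proof (intro exI[of _ "\<bar>c\<bar>"] conjI allI impI)
  fix A eps w :: real and n assume h: "0 <= A \<and> 0 <= eps \<and> eps <= 1 \<and> \<bar>w\<bar> <= A * eps ^ 0"
  then have b: "\<bar>w * c\<bar> <= \<bar>c\<bar> * A" unfolding abs_mult by (subst mult.commute) (intro mult_left_mono, auto)
  have A: "A >= 0" using h by auto
  show "smooth_upto S eps n (\<bar>c\<bar> * A) (%x. w * poly p x)"
   using b h A by (cases n) (auto simp: p intro!: exI[of _ "%x. 0"] smooth_upto_zero)
 qed simp
next
 case (Suc j)
 have "degree (pderiv p) <= j" using Suc.prems by (simp add: degree_pderiv)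
 from Suc.IH[OF this] obtain C where C: "C >= 0" "!!A eps w n. 0 <= A ==> 0 <= eps ==> eps <= 1 ==> \<bar>w\<bar> <= A * eps ^ j ==>
  smooth_upto S eps n (C * A) (%x. w * poly (pderiv p) x)" by blast
 have "bounded (poly p ` S)"
  by (intro compact_imp_bounded compact_continuous_image S continuous_intros)
 then obtain B where B: "!!x. x \<in> S ==> \<bar>poly p x\<bar> <= B" unfolding bounded_iff by auto
 show ?case
 proof (intro exI[of _ "max C (max B 0)"] conjI allI impI)
  fix A eps w :: real and n assume h: "0 <= A \<and> 0 <= eps \<and> eps <= 1 \<and> \<bar>w\<bar> <= A * eps ^ Suc j"
  have "A * eps ^ Suc j <= A * 1" using h by (intro mult_left_mono power_le_one) auto
  then have wA: "\<bar>w\<bar> <= A \<and> A >= 0" using h by simp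
  show "smooth_upto S eps n (max C (max B 0) * A) (%x. w * poly p x)"
  proof -
   have b: "\<bar>w * poly p x\<bar> <= max C (max B 0) * A" if "x \<in> S" for x
    unfolding abs_mult using B[OF that] wA by (subst mult.commute) (intro mult_mono', auto)
   have "smooth_upto S eps m (C * (A * eps)) (%x. w * poly (pderiv p) x)" for m
    by (rule C(2)) (use h in \<open>auto simp: mult_ac\<close>)
   then have "smooth_upto S eps m (max C (max B 0) * A * eps) (%x. w * poly (pderiv p) x)" for m
    by (rule smooth_upto_mono) (use h wA in \<open>auto simp: mult.assoc intro!: mult_right_mono\<close>)
   then show ?thesis using b
    by (cases n) (auto intro!: exI[of _ "%x. w * poly (pderiv p) x"] derivative_eq_intros has_field_derivative_at_within[OF poly_DERIV])
  qed
 qed simp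
qed

lemma gbinomial_poly: "\<exists>p. degree p <= j \<and> (\<forall>x::real. poly p x = x gchoose j)"
proof (intro exI conjI allI)
 let ?p = "smult (1 / fact j) (\<Prod>i=0..<j. [:- real i, 1:])"
 have "degree (\<Prod>i=0..<j. [:- real i, 1:]) <= j"
  using degree_prod_sum_le[of "{0..<j}" "%i. [:- real i, 1:]"] by simp
 then show "degree ?p <= j" by simp
 show "poly ?p x = x gchoose j" for x
  by (simp add: gbinomial_prod_rev poly_prod)
qed

text \<open>The functions T ^ i D i (s + x T) are the successive x-derivatives of D 0 (s + x T); the
  sum over j <= N serves as one constant for all of them.\<close>

lemma der_chain_smooth_upto:
 assumes c: "der_chain eps K D" and T: "T >= 0" and e: "eps >= 0" and s: "s >= 0" and X: "X >= 0"
 shows "i + n <= N ==> smooth_upto {0..X} eps n ((\<Sum>j\<le>N. T ^ j * \<bar>K j\<bar>) * eps ^ i) (%x. T ^ i * D i (s + x * T))"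
proof (induction n arbitrary: i)
 case 0
 have "\<bar>T ^ i * D i (s + x * T)\<bar> <= (\<Sum>j\<le>N. T ^ j * \<bar>K j\<bar>) * eps ^ i" if "x \<in> {0..X}" "i <= N" for x i
 proof -
  have "\<bar>D i (s + x * T)\<bar> <= K i * eps ^ i" using c s that T by (auto simp: der_chain_def)
  also have "... <= \<bar>K i\<bar> * eps ^ i" using e by (intro mult_right_mono) auto
  finally have "\<bar>T ^ i * D i (s + x * T)\<bar> <= T ^ i * \<bar>K i\<bar> * eps ^ i"
   using T by (simp add: abs_mult mult.assoc mult_left_mono)
  also have "... <= (\<Sum>j\<le>N. T ^ j * \<bar>K j\<bar>) * eps ^ i"
   using that T e by (intro mult_right_mono member_le_sum[of i "{..N}" "%j. T ^ j * \<bar>K j\<bar>"]) auto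
  finally show ?thesis .
 qed
 then show ?case using 0 by auto
next
 case (Suc n)
 have b: "\<bar>T ^ i * D i (s + x * T)\<bar> <= (\<Sum>j\<le>N. T ^ j * \<bar>K j\<bar>) * eps ^ i" if "x \<in> {0..X}" for x
  using smooth_upto_bound[OF Suc.IH[of i], of x] Suc.prems that by simp
 have d: "((%x. T ^ i * D i (s + x * T)) has_real_derivative T ^ Suc i * D (Suc i) (s + x * T)) (at x within {0..X})"
  if x: "x \<in> {0..X}" for x
 proof -
  have "(D i has_real_derivative D (Suc i) (s + x * T)) (at (s + x * T) within (%x. s + x * T) ` {0..X})"
   by (rule DERIV_subset[of _ _ _ "{0..}"]) (use c s x T in \<open>auto simp: der_chain_def\<close>)
  moreover have "((%x. s + x * T) has_real_derivative T) (at x within {0..X})" by (auto intro!: derivative_eq_intros)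
  ultimately have "((%x. D i (s + x * T)) has_real_derivative D (Suc i) (s + x * T) * T) (at x within {0..X})"
   using DERIV_image_chain by (fastforce simp: o_def)
  from DERIV_cmult[OF this, of "T ^ i"] show ?thesis by (simp add: mult_ac)
 qed
 have "smooth_upto {0..X} eps n ((\<Sum>j\<le>N. T ^ j * \<bar>K j\<bar>) * eps ^ i * eps) (%x. T ^ Suc i * D (Suc i) (s + x * T))"
  using Suc.IH[of "Suc i"] Suc.prems by (simp add: mult_ac)
 then show ?case unfolding smooth_upto.simps
  by (intro conjI ballI b exI[of _ "%x. T ^ Suc i * D (Suc i) (s + x * T)"] d)
qed

lemma smooth_upto_sum:
 assumes "finite I" "eps >= 0" "!!i. i \<in> I ==> smooth_upto S eps n (A i) (f i)"
 shows "smooth_upto S eps n (\<Sum>i\<in>I. A i) (%x. \<Sum>i\<in>I. f i x)"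
 using assms by (induction I) (auto intro: smooth_upto_zero smooth_upto_add)

text \<open>Both expressions agree at r = 0, ..., M. The first is a polynomial of degree at most M
  in r, so its derivative of order M + 1 vanishes, while that of the second is O(eps^(M+1)). The
  Rolle estimate \<open>nth_deriv_zeros_bound\<close> then bounds the difference.\<close>

lemma nint_product_error:
 fixes M p :: nat and T A :: real
 assumes T: "T >= 0" and A: "A >= 0" and M: "M >= 1"
 shows "\<exists>C\<ge>0. \<forall>eps D w s r. 0 <= eps \<and> eps <= 1 \<and> der_chain eps K D \<and> s >= 0 \<and>
   (\<forall>j\<le>M. \<bar>(fdiff T ^^ j) w s\<bar> <= A * eps ^ j) \<and> 0 <= r \<and> r <= 1 \<longrightarrow>
   \<bar>nint M T r (%\<sigma>. D 0 \<sigma> * w \<sigma> ^ p) s - D 0 (s + r * T) * nint M T r w s ^ p\<bar> <= C * eps ^ Suc M"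
proof -
 obtain b :: "nat => real poly" where b: "!!j. degree (b j) <= j" "!!j x. poly (b j) x = x gchoose j"
  using gbinomial_poly by metis
 define S where "S = {0..real M}"
 have "\<exists>C\<ge>0. \<forall>A eps w n. 0 <= A \<and> 0 <= eps \<and> eps <= 1 \<and> \<bar>w\<bar> <= A * eps ^ j \<longrightarrow> smooth_upto S eps n (C * A) (%x. w * poly (b j) x)" for j
  by (rule smooth_upto_poly[OF _ b(1)]) (simp add: S_def)
 then obtain C where C: "!!j. C j >= 0" "!!j A eps w n. 0 <= A ==> 0 <= eps ==> eps <= 1 ==> \<bar>w\<bar> <= A * eps ^ j ==>
   smooth_upto S eps n (C j * A) (%x. w * poly (b j) x)" by metis
 define Cw where "Cw = (\<Sum>j\<le>M. C j * A)"
 define CD where "CD = (\<Sum>j\<le>Suc M. T ^ j * \<bar>K j\<bar>)"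
 define B where "B = 2 ^ Suc M * CD * (2 ^ Suc M * Cw) ^ p"
 have nn: "Cw >= 0" "CD >= 0" using C(1) A T by (auto simp: Cw_def CD_def simp del: sum.atMost_Suc intro!: sum_nonneg)
 have "real M ^ Suc M * B >= 0" using nn by (simp add: B_def)
 moreover have "\<bar>nint M T r (%\<sigma>. D 0 \<sigma> * w \<sigma> ^ p) s - D 0 (s + r * T) * nint M T r w s ^ p\<bar> \<le>
   real M ^ Suc M * B * eps ^ Suc M"
  if e: "0 <= eps" "eps <= 1" and c: "der_chain eps K D" and s: "s >= 0"
   and w: "!!j. j <= M ==> \<bar>(fdiff T ^^ j) w s\<bar> <= A * eps ^ j" and r: "0 <= r" "r <= 1" for eps D w s r
 proof -
  let ?F = "%\<sigma>. D 0 \<sigma> * w \<sigma> ^ p"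
  define q where "q = (%x. \<Sum>j\<le>M. (fdiff T ^^ j) w s * poly (b j) x)"
  define \<phi> where "\<phi> = (%x. D 0 (s + x * T) * q x ^ p)"
  define P where "P = (\<Sum>j\<le>M. smult ((fdiff T ^^ j) ?F s) (b j))"
  have q: "q x = nint M T x w s" for x by (simp add: q_def nint_def b mult.commute)
  have P: "poly P x = nint M T x ?F s" for x by (simp add: P_def nint_def b poly_sum mult.commute)
  have "degree P <= M" unfolding P_def
   by (intro degree_sum_le) (use b(1) in \<open>auto intro: order_trans[OF degree_smult_le] order_trans[OF b(1)]\<close>)
  then have P0: "(pderiv ^^ Suc M) P = 0" by (intro funpow_pderiv_eq_0) simp
  have sq: "smooth_upto S eps (Suc M) Cw q" unfolding q_def Cw_def
  proof (rule smooth_upto_sum)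
   show "smooth_upto S eps (Suc M) (C j * A) (%x. (fdiff T ^^ j) w s * poly (b j) x)" if "j \<in> {..M}" for j
    by (rule C(2)) (use A e w that in auto)
  qed (use e in auto)
  have sD: "smooth_upto S eps (Suc M) CD (%x. D 0 (s + x * T))"
   using der_chain_smooth_upto[OF c T e(1) s, of "real M" 0 "Suc M" "Suc M"] by (simp add: S_def CD_def del: sum.atMost_Suc)
  have "smooth_upto S eps (Suc M) B \<phi>" unfolding \<phi>_def B_def
   by (rule smooth_upto_mult[OF e(1) sD smooth_upto_power[OF e(1) sq nn(1)] nn(2)]) (use nn in simp)
  from smooth_upto_nth_deriv[OF this] obtain g where g: "nth_deriv S (Suc M) \<phi> g" "\<forall>x\<in>S. \<bar>g x\<bar> <= B * eps ^ Suc M" by auto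
  have nd: "nth_deriv S (Suc M) (%x. poly P x - \<phi> x) (%x. poly 0 x - g x)"
   using nth_deriv_diff[OF nth_deriv_poly[of S "Suc M" P] g(1)] by (simp only: P0)
  \<comment> \<open>The nodes span [0, M], and M >= 1 places r in this interval.\<close>
  have "\<bar>poly P r - \<phi> r\<bar> <= (real M - 0) ^ Suc M * (B * eps ^ Suc M)"
  proof (rule nth_deriv_zeros_bound[OF nd[unfolded S_def], where Z="real ` {..M}"])
   show "card (real ` {..M}) = Suc M" by (simp add: card_image)
   show "\<forall>z\<in>real ` {..M}. poly P z - \<phi> z = 0"
    by (auto simp: P \<phi>_def q nint_nat)
   show "\<forall>x\<in>{0..real M}. \<bar>poly 0 x - g x\<bar> <= B * eps ^ Suc M" using g(2) by (simp add: S_def)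
   show "r \<in> {0..real M}" using r M by auto
  qed auto
  then show ?thesis by (simp add: P \<phi>_def q mult_ac)
 qed
 ultimately show ?thesis by blast
qed

section \<open>Existence for the characteristic integral equation\<close>

text \<open>Rescaling to [0, 1] moves the end points into the integrand, so that parameter
  dependence, including that of the end points, is covered by the theorems for a fixed
  interval.\<close>

lemma prim_unit:
 assumes f: "continuous_on UNIV f"
 shows "prim f b - prim f a = (b - a) * integral {0..1} (%\<eta>. f (a + (b - a) * \<eta>))"
proof -
 have "((%\<eta>. (b - a) * f (a + (b - a) * \<eta>)) has_integral
   (%\<eta>. prim f (a + (b - a) * \<eta>)) 1 - (%\<eta>. prim f (a + (b - a) * \<eta>)) 0) {0..1}"
 proof (rule fundamental_theorem_of_calculus)
  fix x :: real
  have "((%\<eta>. prim f (a + (b - a) * \<eta>)) has_real_derivative f (a + (b - a) * x) * (b - a)) (at x within {0..1})"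
   by (rule DERIV_chain2[OF prim_deriv[OF f]]) (auto intro!: derivative_eq_intros)
  then show "((%\<eta>. prim f (a + (b - a) * \<eta>)) has_vector_derivative (b - a) * f (a + (b - a) * x)) (at x within {0..1})"
   by (simp add: has_real_derivative_iff_has_vector_derivative mult.commute)
 qed simp
 from integral_unique[OF this] show ?thesis by simp
qed

lemma continuous_on_prim:
 fixes f :: "'a::metric_space => real => real"
 assumes f: "continuous_on (X \<times> UNIV) (%(s, x). f s x)"
 shows "continuous_on (X \<times> UNIV) (%(s, z). prim (f s) z)"
proof -
 have "continuous_on (X \<times> UNIV) (%q. integral (cbox 0 1) (%\<eta>. f (fst q) (snd q * \<eta>)))"
 proof (rule integral_continuous_on_param)
  have "continuous_on ((X \<times> UNIV) \<times> cbox 0 1) (%q. (fst (fst q), snd (fst q) * (snd q :: real)))"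
   by (intro continuous_intros)
  from continuous_on_compose2[OF f this]
  have "continuous_on ((X \<times> UNIV) \<times> cbox 0 1) (%q. f (fst (fst q)) (snd (fst q) * (snd q :: real)))"
   by (simp add: case_prod_beta image_subset_iff)
  then show "continuous_on ((X \<times> UNIV) \<times> cbox 0 1) (%(q, \<eta>). f (fst q) (snd q * \<eta>))"
   by (simp add: case_prod_beta)
 qed
 then have c: "continuous_on (X \<times> UNIV) (%q. snd q * integral (cbox 0 1) (%\<eta>. f (fst q) (snd q * \<eta>)))"
  by (intro continuous_intros)
 have "prim (f s) z = z * integral (cbox 0 1) (%\<eta>. f s (z * \<eta>))" if "s \<in> X" for s z
  using prim_unit[OF continuous_on_slice[OF f that], of z 0] by simp
 then show ?thesis using c by (auto intro!: continuous_on_cong[THEN iffD1, OF refl _ c])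
qed

text \<open>The exponent is -2u with u = \<kappa> p (1 - \<rho>) / 2. One factor exp (-u) absorbs p
  (1 - \<rho>) through u exp (-u) <= 1, the other is integrated explicitly; each contributes 2 /
  \<kappa>.\<close>

lemma fixpoint_weight_bound:
 fixes \<kappa> p :: real
 assumes \<kappa>: "\<kappa> > 0" and p: "p >= 0"
 shows "integral {0..1} (%\<rho>. exp (- \<kappa> * p) * (p^2 * (1 - \<rho>) * exp (\<kappa> * (p * \<rho>)))) <= 4 / \<kappa>^2"
proof -
 have pt: "exp (- \<kappa> * p) * (p^2 * (1 - \<rho>) * exp (\<kappa> * (p * \<rho>))) <= 2 / \<kappa> * (p * exp (- (\<kappa> / 2) * p * (1 - \<rho>)))"
  if \<rho>: "\<rho> \<in> {0..1}" for \<rho>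
 proof -
  define u where "u = \<kappa> / 2 * (p * (1 - \<rho>))"
  have u: "u >= 0" using \<rho> p \<kappa> by (simp add: u_def)
  have "u * exp (- u) <= 1"
  proof -
   have "u <= exp u" using exp_ge_add_one_self[of u] by linarith
   then show ?thesis by (simp add: exp_minus field_simps)
  qed
  have e: "exp (- \<kappa> * p) * exp (\<kappa> * (p * \<rho>)) = exp (- u) * exp (- u)"
   unfolding exp_add[symmetric] by (rule arg_cong[where f=exp]) (simp add: u_def algebra_simps)
  have "exp (- \<kappa> * p) * (p^2 * (1 - \<rho>) * exp (\<kappa> * (p * \<rho>))) =
    p * (p * (1 - \<rho>)) * (exp (- \<kappa> * p) * exp (\<kappa> * (p * \<rho>)))" by (simp add: power2_eq_square mult_ac)
  also have "... = 2 / \<kappa> * (p * exp (- u)) * (u * exp (- u))"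
   unfolding e using \<kappa> by (simp add: u_def)
  also have "... <= 2 / \<kappa> * (p * exp (- u)) * 1"
   using \<open>u * exp (- u) <= 1\<close> \<kappa> p by (intro mult_left_mono) auto
  finally show ?thesis by (simp add: u_def mult_ac)
 qed
 define g where "g = (%\<rho>. (2 / \<kappa>) * (2 / \<kappa> * exp (- (\<kappa> / 2) * p * (1 - \<rho>))))"
 have "((%\<rho>. 2 / \<kappa> * (p * exp (- (\<kappa> / 2) * p * (1 - \<rho>)))) has_integral g 1 - g 0) {0..1}"
 proof (rule fundamental_theorem_of_calculus)
  fix x :: real
  show "(g has_vector_derivative 2 / \<kappa> * (p * exp (- (\<kappa> / 2) * p * (1 - x)))) (at x within {0..1})"
   unfolding g_def has_real_derivative_iff_has_vector_derivative[symmetric] using \<kappa>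
   by (auto intro!: derivative_eq_intros simp: field_simps)
 qed simp
 note I = this
 have "integral {0..1} (%\<rho>. exp (- \<kappa> * p) * (p^2 * (1 - \<rho>) * exp (\<kappa> * (p * \<rho>)))) \<le>
   integral {0..1} (%\<rho>. 2 / \<kappa> * (p * exp (- (\<kappa> / 2) * p * (1 - \<rho>))))"
 proof (rule integral_le)
  show "(%\<rho>. exp (- \<kappa> * p) * (p^2 * (1 - \<rho>) * exp (\<kappa> * (p * \<rho>)))) integrable_on {0..1}"
   by (intro integrable_continuous_real continuous_intros)
  show "(%\<rho>. 2 / \<kappa> * (p * exp (- (\<kappa> / 2) * p * (1 - \<rho>)))) integrable_on {0..1}"
   using \<kappa> by (intro integrable_continuous_real continuous_intros) auto
 qed (rule pt)
 also have "... = g 1 - g 0" by (rule integral_unique[OF I])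
 also have "... <= g 1" using \<kappa> by (simp add: g_def)
 also have "... = 4 / \<kappa>^2" by (simp add: g_def power2_eq_square)
 finally show ?thesis .
qed

text \<open>Duhamel's formula in the coordinate z = s + x, with the backward triangle mapped to the
  unit square. It is solved by Banach's theorem in an exponentially weighted sup norm, so that one
  contraction covers all s >= 0. The reflection symmetry and the period follow from uniqueness of
  the fixed point.\<close>

lemma characteristic_fixpoint:
 fixes F f0 :: "real => real => real"
 assumes F: "continuous_on ({0..} \<times> UNIV) (%(s, w). F s w)"
  and FB: "!!s w. s >= 0 ==> \<bar>F s w\<bar> <= B"
  and FL: "!!s w w'. s >= 0 ==> \<bar>F s w - F s w'\<bar> <= L * \<bar>w - w'\<bar>" and L: "L >= 0"
  and odd: "!!s w. s >= 0 ==> F s (- w) = - F s w"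
  and f0: "continuous_on UNIV (%(s, z). f0 s z)" and f0B: "!!s z. \<bar>f0 s z\<bar> <= B0"
  and f0a: "!!s z. f0 s (2 * s - z) = - f0 s z" and f0p: "!!s z. f0 s (z + T) = f0 s z"
 shows "\<exists>w. continuous_on UNIV (%(s, z). w s z) \<and> (\<forall>s\<ge>0. \<forall>z. w s (2 * s - z) = - w s z \<and> w s (z + T) = w s z \<and>
  w s z = f0 s z + integral {0..1} (%\<rho>. integral {0..1} (%\<eta>.
   s^2 * (1 - \<rho>) * F (s * \<rho>) (w (s * \<rho>) (z - 2 * (s * (1 - \<rho>)) * \<eta>)))))"
proof -
 \<comment> \<open>The contraction factor will be 4 L / \<kappa>^2, and 9 (L + 1)^2 exceeds 4
   L.\<close>
 define \<kappa> where "\<kappa> = 3 * (L + 1)"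
 have \<kappa>: "\<kappa> > 0" using L by (simp add: \<kappa>_def)
 have B: "B >= 0" using FB[of 0 0] by simp
 define G :: "((real \<times> real) \<Rightarrow>\<^sub>C real) => real => real => real => real => real" where
  "G = (%w p z \<rho> \<eta>. p^2 * (1 - \<rho>) * F (p * \<rho>) (exp (\<kappa> * (p * \<rho>)) * apply_bcontfun w (p * \<rho>, z - 2 * (p * (1 - \<rho>)) * \<eta>)))"
 define I where "I = (%w p z. integral {0..1} (%\<rho>. integral {0..1} (G w p z \<rho>)))"
 \<comment> \<open>The stored function is exp (- \<kappa> s) times the unknown, which makes it
   bounded; negative times are frozen at 0 so that it is continuous on the whole plane.\<close>
 define \<phi> where "\<phi> = (%w q. exp (- \<kappa> * max 0 (fst q)) * (f0 (max 0 (fst q)) (snd q) + I w (max 0 (fst q)) (snd q)))"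
 define X :: "((real \<times> real) \<times> real) set" where "X = UNIV \<times> {0..1}"
 have Gc: "continuous_on (X \<times> {0..1}) (%q. G w (max 0 (fst (fst (fst q)))) (snd (fst (fst q))) (snd (fst q)) (snd q))" for w
 proof -
  let ?p = "%q::((real \<times> real) \<times> real) \<times> real. max 0 (fst (fst (fst q)))"
  have c1: "continuous_on (X \<times> {0..1}) (%q. (?p q * snd (fst q), snd (fst (fst q)) - 2 * (?p q * (1 - snd (fst q))) * snd q))"
   by (intro continuous_intros)
  have c2: "continuous_on (X \<times> {0..1}) (%q. apply_bcontfun w (?p q * snd (fst q), snd (fst (fst q)) - 2 * (?p q * (1 - snd (fst q))) * snd q))"
   by (rule continuous_on_compose2[OF continuous_on_apply_bcontfun[of UNIV w] c1]) auto
  have c3: "continuous_on (X \<times> {0..1}) (%q. (?p q * snd (fst q), exp (\<kappa> * (?p q * snd (fst q))) *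
    apply_bcontfun w (?p q * snd (fst q), snd (fst (fst q)) - 2 * (?p q * (1 - snd (fst q))) * snd q)))"
   by (intro continuous_intros c2)
  have im: "(%q. (?p q * snd (fst q), exp (\<kappa> * (?p q * snd (fst q))) *
    apply_bcontfun w (?p q * snd (fst q), snd (fst (fst q)) - 2 * (?p q * (1 - snd (fst q))) * snd q))) ` (X \<times> {0..1}) \<subseteq> {0..} \<times> UNIV"
   by (auto simp: X_def)
  show ?thesis unfolding G_def
   by (intro continuous_intros) (use continuous_on_compose2[OF F c3 im] in \<open>simp add: case_prod_beta\<close>)
 qed
 have Ic1: "continuous_on X (%q. integral {0..1} (G w (max 0 (fst (fst q))) (snd (fst q)) (snd q)))" for w
  using integral_continuous_on_param[of X 0 1 "%q \<eta>. G w (max 0 (fst (fst q))) (snd (fst q)) (snd q) \<eta>"] Gc[of w]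
  by (simp add: case_prod_beta)
 have Ic2: "continuous_on UNIV (%q. I w (max 0 (fst q)) (snd q))" for w
  unfolding I_def using integral_continuous_on_param[of "UNIV :: (real \<times> real) set" 0 1
   "%q \<rho>. integral {0..1} (G w (max 0 (fst q)) (snd q) \<rho>)"] Ic1[of w]
  by (simp add: case_prod_beta X_def)
 have f0c: "continuous_on UNIV (%q. f0 (max 0 (fst q)) (snd q))"
  using continuous_on_compose2[OF f0, of UNIV "%q. (max 0 (fst q), snd q)"] by (simp add: continuous_intros)
 have \<phi>c: "continuous_on UNIV (\<phi> w)" for w
  unfolding \<phi>_def by (intro continuous_intros f0c Ic2)
 have Gci: "continuous_on {0..1} (G w p z \<rho>)" if "p >= 0" "\<rho> \<in> {0..1}" for w p z \<rho>
 proof -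
  have "continuous_on {0..1} (%\<eta>. (((p, z), \<rho>), \<eta>))" by (intro continuous_intros)
  from continuous_on_compose2[OF Gc[of w] this] show ?thesis using that by (simp add: X_def max_def image_subset_iff)
 qed
 have Gco: "continuous_on {0..1} (%\<rho>. integral {0..1} (G w p z \<rho>))" if "p >= 0" for w p z
 proof -
  have "continuous_on {0..1} (%\<rho>. ((p, z), \<rho>))" by (intro continuous_intros)
  from continuous_on_compose2[OF Ic1[of w] this] show ?thesis using that by (simp add: X_def max_def image_subset_iff)
 qed
 note Gii = integrable_continuous_real[OF Gci] and Goi = integrable_continuous_real[OF Gco]
 have IB: "\<bar>I w p z\<bar> <= p^2 * B" if p: "p >= 0" for w p z
 proof -
  have "\<bar>G w p z \<rho> \<eta>\<bar> <= p^2 * B" if "\<rho> \<in> {0..1}" for \<rho> \<eta>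
  proof -
   have "\<bar>G w p z \<rho> \<eta>\<bar> = p^2 * (1 - \<rho>) * \<bar>F (p * \<rho>) (exp (\<kappa> * (p * \<rho>)) * apply_bcontfun w (p * \<rho>, z - 2 * (p * (1 - \<rho>)) * \<eta>))\<bar>"
    using that by (simp add: G_def abs_mult)
   also have "... <= p^2 * 1 * B" using that p by (intro mult_mono FB) auto
   finally show ?thesis by simp
  qed
  then have "norm (integral {0..1} (G w p z \<rho>)) <= integral {0..1} (%x::real. p^2 * B)" if "\<rho> \<in> {0..1}" for \<rho>
   using that p by (intro integral_norm_bound_integral Gii) auto
  then have "norm (I w p z) <= integral {0..1} (%x::real. p^2 * B)" unfolding I_def
   using p by (intro integral_norm_bound_integral Goi) auto
  then show ?thesis by simp
 qed
 \<comment> \<open>The double integral grows at most like p^2, which the weight absorbs: exp (-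
   \<kappa> p) p^2 <= 2 / \<kappa>^2.\<close>
 have \<phi>B: "norm (\<phi> w q) <= B0 + 2 / \<kappa>^2 * B" for w q
 proof -
  define p where "p = max 0 (fst q)"
  have p: "p >= 0" by (simp add: p_def)
  have e: "exp (- \<kappa> * p) * p^2 <= 2 / \<kappa>^2"
  proof -
   have "(\<kappa> * p)^2 / 2 <= exp (\<kappa> * p)"
    using exp_lower_Taylor_quadratic[of "\<kappa> * p"] \<kappa> p by (smt (verit) mult_nonneg_nonneg)
   then show ?thesis using \<kappa> by (simp add: exp_minus field_simps)
  qed
  have "\<bar>\<phi> w q\<bar> <= exp (- \<kappa> * p) * \<bar>f0 p (snd q)\<bar> + exp (- \<kappa> * p) * \<bar>I w p (snd q)\<bar>"
   unfolding \<phi>_def p_def[symmetric] by (simp add: abs_mult distrib_left[symmetric] mult_left_mono abs_triangle_ineq)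
  also have "... <= 1 * B0 + exp (- \<kappa> * p) * (p^2 * B)"
   using \<kappa> p f0B[of p "snd q"] IB[OF p] by (intro add_mono mult_mono mult_left_mono) auto
  also have "exp (- \<kappa> * p) * (p^2 * B) <= 2 / \<kappa>^2 * B"
   using mult_right_mono[OF e B] by (simp add: mult.assoc)
  finally show ?thesis by simp
 qed
 have \<phi>b: "\<phi> w \<in> bcontfun" for w by (rule bcontfun_normI[OF \<phi>c \<phi>B])
 define \<Phi> where "\<Phi> = (%w. Bcontfun (\<phi> w))"
 have \<Phi>: "apply_bcontfun (\<Phi> w) = \<phi> w" for w unfolding \<Phi>_def by (rule Bcontfun_inverse[OF \<phi>b])
 have contr: "dist (\<Phi> v) (\<Phi> w) <= (4 * L / \<kappa>^2) * dist v w" for v w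
 proof (rule dist_bound)
  fix q :: "real \<times> real"
  define p z where "p = max 0 (fst q)" and "z = snd q"
  have p: "p >= 0" by (simp add: p_def)
  define d where "d = dist v w"
  have gd: "\<bar>G v p z \<rho> \<eta> - G w p z \<rho> \<eta>\<bar> <= (p^2 * (1 - \<rho>) * exp (\<kappa> * (p * \<rho>))) * (L * d)" if \<rho>: "\<rho> \<in> {0..1}" for \<rho> \<eta>
  proof -
   let ?x = "(p * \<rho>, z - 2 * (p * (1 - \<rho>)) * \<eta>)" and ?e = "exp (\<kappa> * (p * \<rho>))"
   have "\<bar>F (p * \<rho>) (?e * apply_bcontfun v ?x) - F (p * \<rho>) (?e * apply_bcontfun w ?x)\<bar> \<le>
     L * \<bar>?e * apply_bcontfun v ?x - ?e * apply_bcontfun w ?x\<bar>"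
    using p \<rho> by (intro FL) auto
   also have "... = L * (?e * dist (apply_bcontfun v ?x) (apply_bcontfun w ?x))"
    by (simp add: dist_real_def abs_mult flip: right_diff_distrib)
   also have "... <= L * (?e * d)" unfolding d_def
    using L by (intro mult_left_mono dist_bounded) auto
   finally have "p^2 * (1 - \<rho>) * \<bar>F (p * \<rho>) (?e * apply_bcontfun v ?x) - F (p * \<rho>) (?e * apply_bcontfun w ?x)\<bar>
     <= p^2 * (1 - \<rho>) * (L * (?e * d))" using \<rho> by (intro mult_left_mono) auto
   moreover have "\<bar>G v p z \<rho> \<eta> - G w p z \<rho> \<eta>\<bar> = p^2 * (1 - \<rho>) * \<bar>F (p * \<rho>) (?e * apply_bcontfun v ?x) - F (p * \<rho>) (?e * apply_bcontfun w ?x)\<bar>"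
    using \<rho> unfolding G_def right_diff_distrib[symmetric] abs_mult by simp
   ultimately show ?thesis by (simp add: mult_ac)
  qed
  have "\<bar>integral {0..1} (G v p z \<rho>) - integral {0..1} (G w p z \<rho>)\<bar> <= (p^2 * (1 - \<rho>) * exp (\<kappa> * (p * \<rho>))) * (L * d)" if \<rho>: "\<rho> \<in> {0..1}" for \<rho>
  proof -
   have "norm (integral {0..1} (%\<eta>. G v p z \<rho> \<eta> - G w p z \<rho> \<eta>)) <= integral {0..1} (%\<eta>::real. (p^2 * (1 - \<rho>) * exp (\<kappa> * (p * \<rho>))) * (L * d))"
    by (rule integral_norm_bound_integral)
     (use gd[OF \<rho>] Gii[OF p \<rho>] in \<open>auto intro!: Henstock_Kurzweil_Integration.integrable_diff\<close>)
   then show ?thesis using Gii[OF p \<rho>] by (simp add: HK_diff)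
  qed
  then have "norm (integral {0..1} (%\<rho>. integral {0..1} (G v p z \<rho>) - integral {0..1} (G w p z \<rho>))) \<le>
    integral {0..1} (%\<rho>. (p^2 * (1 - \<rho>) * exp (\<kappa> * (p * \<rho>))) * (L * d))"
   by (intro integral_norm_bound_integral Henstock_Kurzweil_Integration.integrable_diff Goi[OF p])
    (auto intro!: integrable_continuous_real continuous_intros)
  then have "\<bar>I v p z - I w p z\<bar> <= integral {0..1} (%\<rho>. (p^2 * (1 - \<rho>) * exp (\<kappa> * (p * \<rho>))) * (L * d))"
   using Goi[OF p] by (simp add: I_def HK_diff)
  then have "exp (- \<kappa> * p) * \<bar>I v p z - I w p z\<bar> <= exp (- \<kappa> * p) * (integral {0..1} (%\<rho>. p^2 * (1 - \<rho>) * exp (\<kappa> * (p * \<rho>))) * (L * d))"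
   by (intro mult_left_mono) auto
  also have "... = integral {0..1} (%\<rho>. exp (- \<kappa> * p) * (p^2 * (1 - \<rho>) * exp (\<kappa> * (p * \<rho>)))) * (L * d)"
   by simp
  also have "... <= 4 / \<kappa>^2 * (L * d)"
   by (rule mult_right_mono[OF fixpoint_weight_bound[OF \<kappa> p]]) (use L in \<open>simp add: d_def\<close>)
  finally have "exp (- \<kappa> * p) * \<bar>I v p z - I w p z\<bar> <= 4 * L / \<kappa>^2 * d" by simp
  moreover have "dist (\<phi> v q) (\<phi> w q) = exp (- \<kappa> * p) * \<bar>I v p z - I w p z\<bar>"
   unfolding \<phi>_def dist_real_def p_def z_def by (simp add: abs_mult flip: right_diff_distrib)
  ultimately show "dist (apply_bcontfun (\<Phi> v) q) (apply_bcontfun (\<Phi> w) q) <= 4 * L / \<kappa>^2 * dist v w"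
   by (simp add: \<Phi> d_def)
 qed
 have c: "0 <= 4 * L / \<kappa>^2" "4 * L / \<kappa>^2 < 1"
 proof -
  have "\<kappa>^2 = 9 * (L * L) + 18 * L + 9" by (simp add: \<kappa>_def power2_eq_square algebra_simps)
  moreover have "L * L >= 0" by simp
  ultimately have "4 * L < \<kappa>^2" using L by linarith
  then show "4 * L / \<kappa>^2 < 1" using \<kappa> by (simp add: divide_less_eq)
 qed (use L in simp)
 have "\<exists>!w. \<Phi> w = w" by (rule banach_fix_type[OF c]) (use contr in blast)
 then obtain w where w: "\<Phi> w = w" and uniq: "!!v. \<Phi> v = v ==> v = w" by blast
 have we: "apply_bcontfun w (s, z) = exp (- \<kappa> * s) * (f0 s z + I w s z)" if "s >= 0" for s z
  using \<Phi>[of w] that by (simp add: w \<phi>_def)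
 have wm: "apply_bcontfun w (s, z) = apply_bcontfun w (max 0 s, z)" for s z
  using \<Phi>[of w] by (simp add: w \<phi>_def)
 have wc: "continuous_on UNIV (apply_bcontfun w)" by simp
 obtain Bw where Bw: "!!q. norm (apply_bcontfun w q) <= Bw"
  using \<phi>B[of w] \<Phi>[of w] w by metis
 \<comment> \<open>The negative of the reflected fixed point. Oddness of F together with the
   substitution 1 - \<eta> for \<eta> shows that it is again a fixed point, hence equal to w; the
   translate \<open>v2\<close> below is treated in the same way.\<close>
 define v1 where "v1 = Bcontfun (%q. - apply_bcontfun w (max 0 (fst q), 2 * max 0 (fst q) - snd q))"
 have v1: "apply_bcontfun v1 = (%q. - apply_bcontfun w (max 0 (fst q), 2 * max 0 (fst q) - snd q))"
  unfolding v1_def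
  by (intro Bcontfun_inverse bcontfun_normI[where b=Bw] continuous_intros continuous_on_compose2[OF wc]) (use Bw in auto)
 have "\<Phi> v1 = v1"
 proof (rule bcontfun_eqI)
  fix q :: "real \<times> real"
  define p z where "p = max 0 (fst q)" and "z = snd q"
  have p: "p >= 0" by (simp add: p_def)
  have "integral {0..1} (G v1 p z \<rho>) = - integral {0..1} (G w p (2 * p - z) \<rho>)" if \<rho>: "\<rho> \<in> {0..1}" for \<rho>
  proof -
   have "G v1 p z \<rho> \<eta> = - G w p (2 * p - z) \<rho> (1 - \<eta>)" for \<eta>
   proof -
    have pos: "p * \<rho> >= 0" using p \<rho> by simp
    then have m: "max 0 (p * \<rho>) = p * \<rho>" by simp
    have e: "2 * (p * \<rho>) - (z - 2 * (p * (1 - \<rho>)) * \<eta>) = 2 * p - z - 2 * (p * (1 - \<rho>)) * (1 - \<eta>)"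
     by (simp add: algebra_simps)
    show ?thesis unfolding G_def v1 by (simp only: fst_conv snd_conv m e mult_minus_right odd[OF pos])
   qed
   then have fn: "G v1 p z \<rho> = (%\<eta>. - G w p (2 * p - z) \<rho> (1 - \<eta>))" by (rule ext)
   show ?thesis unfolding fn using integral_flip[of 0 1 "G w p (2 * p - z) \<rho>" 1] by simp
  qed
  then have "I v1 p z = - I w p (2 * p - z)" unfolding I_def
   by (subst HK_cong[where g="%\<rho>. - integral {0..1} (G w p (2 * p - z) \<rho>)"]) auto
  then show "apply_bcontfun (\<Phi> v1) q = apply_bcontfun v1 q"
   unfolding \<Phi> \<phi>_def v1 p_def[symmetric] z_def[symmetric] we[OF p] f0a by (simp add: algebra_simps)
 qed
 from uniq[OF this] have anti: "apply_bcontfun w (s, 2 * s - z) = - apply_bcontfun w (s, z)" if "s >= 0" for s z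
  using fun_cong[OF v1, of "(s, z)"] that by simp
 define v2 where "v2 = Bcontfun (%q. apply_bcontfun w (fst q, snd q + T))"
 have v2: "apply_bcontfun v2 = (%q. apply_bcontfun w (fst q, snd q + T))"
  unfolding v2_def
  by (intro Bcontfun_inverse bcontfun_normI[where b=Bw] continuous_intros continuous_on_compose2[OF wc]) (use Bw in auto)
 have "\<Phi> v2 = v2"
 proof (rule bcontfun_eqI)
  fix q :: "real \<times> real"
  define p z where "p = max 0 (fst q)" and "z = snd q"
  have p: "p >= 0" by (simp add: p_def)
  have "G v2 p z = G w p (z + T)" unfolding G_def v2 by (simp add: algebra_simps)
  then have "I v2 p z = I w p (z + T)" unfolding I_def by simp
  moreover have "apply_bcontfun v2 q = apply_bcontfun w (p, z + T)"
   unfolding v2 p_def z_def by (rule wm)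
  ultimately show "apply_bcontfun (\<Phi> v2) q = apply_bcontfun v2 q"
   unfolding \<Phi> \<phi>_def p_def[symmetric] z_def[symmetric] we[OF p] by (simp add: f0p we[OF p])
 qed
 from uniq[OF this] have per: "apply_bcontfun w (s, z + T) = apply_bcontfun w (s, z)" for s z
  using fun_cong[OF v2, of "(s, z)"] by simp
 \<comment> \<open>The weight is removed again.\<close>
 define W where "W = (%s z. exp (\<kappa> * max 0 s) * apply_bcontfun w (s, z))"
 have "continuous_on UNIV (%q. W (fst q) (snd q))"
  unfolding W_def by (intro continuous_intros continuous_on_compose2[OF wc]) auto
 then have "continuous_on UNIV (%(s, z). W s z)" by (simp add: case_prod_beta)
 moreover have "W s z = f0 s z + integral {0..1} (%\<rho>. integral {0..1} (%\<eta>.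
   s^2 * (1 - \<rho>) * F (s * \<rho>) (W (s * \<rho>) (z - 2 * (s * (1 - \<rho>)) * \<eta>))))" if s: "s >= 0" for s z
 proof -
  have "W s z = f0 s z + I w s z" using s by (simp add: W_def we exp_minus)
  also have "I w s z = integral {0..1} (%\<rho>. integral {0..1} (%\<eta>.
   s^2 * (1 - \<rho>) * F (s * \<rho>) (W (s * \<rho>) (z - 2 * (s * (1 - \<rho>)) * \<eta>))))"
   unfolding I_def G_def W_def using s by (intro HK_cong) simp
  finally show ?thesis .
 qed
 moreover have "W s (2 * s - z) = - W s z \<and> W s (z + T) = W s z" if "s >= 0" for s z
  using anti[OF that] per by (simp add: W_def)
 ultimately show ?thesis by blast
qed

text \<open>For a profile $P(s,\cdot)=P_0+\int_0^sn$ the field is $z(s,x)=\frac12\int_{s-x}^{s+x}P(s,y)\,dy$. In the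
characteristic coordinate $y=s+x$ this is \<open>wfld P0 n s y\<close>, and it solves the wave equation when $n(s,\cdot)$ is the
nonlinearity evaluated there; \<open>wpot P0 n s\<close> is the primitive of the profile.\<close>

definition tint :: "(real => real => real) => real => real => real" where
 "tint n s y = prim (%\<sigma>. n \<sigma> y) s"

definition wpot :: "(real => real) => (real => real => real) => real => real => real" where
 "wpot P0 n s z = prim P0 z + prim (tint n s) z"

definition wfld :: "(real => real) => (real => real => real) => real => real => real" where
 "wfld P0 n s z = (wpot P0 n s z - wpot P0 n s (2 * s - z)) / 2"

text \<open>The integral from y to 2 \<sigma> - y is symmetric about \<sigma> and therefore
  vanishes.\<close>

lemma prim_antisym:
 assumes f: "continuous_on UNIV f" and a: "!!y. f (2 * \<sigma> - y) = - f y"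
 shows "prim f (2 * \<sigma> - y) = prim f y"
proof -
 let ?g = "%\<eta>. f (y + (2 * \<sigma> - y - y) * \<eta>)"
 have "?g (1 - \<eta>) = - ?g \<eta>" for \<eta>
  using a[of "y + (2 * \<sigma> - y - y) * \<eta>"] by (simp add: algebra_simps)
 then have "integral {0..1} ?g = - integral {0..1} ?g"
  using integral_flip[of 0 1 ?g 1] by simp
 then show ?thesis using prim_unit[OF f, of "2 * \<sigma> - y" y] by simp
qed

lemma continuous_on_tint:
 assumes n: "continuous_on UNIV (%(s, z). n s z)"
 shows "continuous_on UNIV (%(s, z). tint n s z)"
proof -
 have "continuous_on (UNIV \<times> UNIV) (%(z, s). n s z)"
  using continuous_on_compose2[OF n continuous_on_swap[of UNIV]] by (simp add: case_prod_beta prod.swap_def)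
 from continuous_on_prim[OF this] have "continuous_on UNIV (%(z, s). tint n s z)" by (simp add: tint_def)
 from continuous_on_compose2[OF this continuous_on_swap[of UNIV]] show ?thesis by (simp add: case_prod_beta prod.swap_def)
qed

lemma continuous_on_flip_args:
 "continuous_on UNIV (%(s, z). n s z) ==> continuous_on UNIV (%\<sigma>. n \<sigma> y)"
 using continuous_on_compose2[of UNIV "%(s, z). n s z" UNIV "%\<sigma>. (\<sigma>, y)"] by (simp add: continuous_intros)

lemma continuous_on_snd_arg:
 "continuous_on UNIV (%(s, z). n s z) ==> continuous_on UNIV (n s)"
 using continuous_on_compose2[of UNIV "%(s, z). n s z" UNIV "%z. (s, z)"] by (simp add: continuous_intros)

text \<open>The fixed point w is the field generated by the profile P0 + \<integral> n with n = F(s,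
  w). To see this, interchange the integrals in the definition of \<open>wfld\<close> and fold the
  full characteristic interval onto the backward triangle by antisymmetry of n.\<close>

lemma wave_existence:
 fixes F :: "real => real => real"
 assumes T: "T > 0" and P0: "locL2 P0" "periodic T P0" "integral {0..T} P0 = 0"
  and F: "continuous_on ({0..} \<times> UNIV) (%(s, w). F s w)"
  and FB: "!!s w. s >= 0 ==> \<bar>F s w\<bar> <= B"
  and FL: "!!s w w'. s >= 0 ==> \<bar>F s w - F s w'\<bar> <= L * \<bar>w - w'\<bar>" and L: "L >= 0"
  and odd: "!!s w. s >= 0 ==> F s (- w) = - F s w"
 shows "\<exists>n. continuous_on UNIV (%(s, z). n s z) \<and> (\<forall>s z. \<bar>n s z\<bar> <= B) \<and>
  (\<forall>s\<ge>0. \<forall>z. n s (2 * s - z) = - n s z \<and> n s (z + T) = n s z \<and> n s z = F s (wfld P0 n s z))"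
proof -
 define f0 where "f0 = (%s z. (prim P0 z - prim P0 (2 * s - z)) / 2)"
 have li: "loc_int P0" by (rule locL2_loc_int[OF P0(1)])
 have pc: "continuous_on UNIV (prim P0)" by (rule prim_continuous[OF li])
 have pp: "periodic T (prim P0)" by (rule periodic_prim[OF P0(2) li _ P0(3)]) (use T in simp)
 have pm: "prim P0 (x - T) = prim P0 x" for x using periodic_D[OF pp, of "x - T"] by simp
 have "continuous_on UNIV (%q::real\<times>real. (prim P0 (snd q) - prim P0 (2 * fst q - snd q)) / 2)"
  by (intro continuous_intros continuous_on_compose2[OF pc]) auto
 then have f0c: "continuous_on UNIV (%(s, z). f0 s z)" by (simp add: f0_def case_prod_beta)
 have f0B: "\<bar>f0 s z\<bar> <= sqrt T * L2_norm {0..T} P0" for s z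
 proof -
  have "\<bar>x / 2\<bar> <= \<bar>x\<bar>" for x :: real by simp
  from order_trans[OF this periodic_abs_prim_le[OF P0(2,1) T P0(3), of z "2 * s - z"]]
  show ?thesis by (simp only: f0_def)
 qed
 have f0p: "f0 s (z + T) = f0 s z" for s z
 proof -
  have "2 * s - (z + T) = (2 * s - z) - T" by simp
  then show ?thesis unfolding f0_def by (simp only: periodic_D[OF pp] pm)
 qed
 have f0a: "f0 s (2 * s - z) = - f0 s z" for s z by (simp add: f0_def field_simps)
 obtain w where w: "continuous_on UNIV (%(s, z). w s z)"
  "!!s z. s >= 0 ==> w s (2 * s - z) = - w s z" "!!s z. s >= 0 ==> w s (z + T) = w s z"
  "!!s z. s >= 0 ==> w s z = f0 s z + integral {0..1} (%\<rho>. integral {0..1} (%\<eta>.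
   s^2 * (1 - \<rho>) * F (s * \<rho>) (w (s * \<rho>) (z - 2 * (s * (1 - \<rho>)) * \<eta>))))"
  using characteristic_fixpoint[OF F FB FL L odd f0c f0B f0a f0p] by blast
 \<comment> \<open>Freezing n for negative s gives a function that is continuous on the whole plane,
   as the later primitives in s require; only s >= 0 carries the equation.\<close>
 define n where "n = (%s z. F (max 0 s) (w (max 0 s) z))"
 have c1: "continuous_on UNIV (%q::real\<times>real. (max 0 (fst q), w (max 0 (fst q)) (snd q)))"
 proof -
  have "continuous_on UNIV (%q::real\<times>real. (max 0 (fst q), snd q))" by (intro continuous_intros)
  from continuous_on_compose2[OF w(1) this]
  have "continuous_on UNIV (%q::real\<times>real. w (max 0 (fst q)) (snd q))" by simp
  then show ?thesis by (intro continuous_intros)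
 qed
 have nc: "continuous_on UNIV (%(s, z). n s z)"
  using continuous_on_compose2[OF F c1] by (simp add: n_def case_prod_beta image_subset_iff)
 note ncz = continuous_on_snd_arg[OF nc] and ncs = continuous_on_flip_args[OF nc]
 have nB: "\<bar>n s z\<bar> <= B" for s z unfolding n_def by (rule FB) simp
 have na: "n s (2 * s - z) = - n s z" "n s (z + T) = n s z" if "s >= 0" for s z
  using that w(2,3)[OF that, of z] odd[OF that] by (simp_all add: n_def)
 have weq: "w s z = wfld P0 n s z" if s: "s >= 0" for s z
 proof -
  let ?a = "2 * s - z"
  note tc = continuous_on_snd_arg[OF continuous_on_tint[OF nc]]
  have "prim (tint n s) z - prim (tint n s) ?a = (z - ?a) * integral {0..1} (%\<eta>. tint n s (?a + (z - ?a) * \<eta>))"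
   by (rule prim_unit[OF tc])
  also have "... = (z - ?a) * integral {0..1} (%\<eta>. s * integral {0..1} (%\<rho>. n (s * \<rho>) (?a + (z - ?a) * \<eta>)))"
   using prim_unit[OF ncs, of _ s 0] by (simp add: tint_def)
  also have "... = s * ((z - ?a) * integral {0..1} (%\<eta>. integral {0..1} (%\<rho>. n (s * \<rho>) (?a + (z - ?a) * \<eta>))))"
   by simp
  also have "integral {0..1} (%\<eta>. integral {0..1} (%\<rho>. n (s * \<rho>) (?a + (z - ?a) * \<eta>))) =
    integral {0..1} (%\<rho>. integral {0..1} (%\<eta>. n (s * \<rho>) (?a + (z - ?a) * \<eta>)))"
  proof -
   have "continuous_on UNIV (%q::real\<times>real. (s * snd q, ?a + (z - ?a) * fst q))" by (intro continuous_intros)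
   from continuous_on_compose2[OF nc this]
   have "continuous_on UNIV (%(\<eta>, \<rho>). n (s * \<rho>) (?a + (z - ?a) * \<eta>))" by (simp add: case_prod_beta)
   from integral_swap_continuous[OF continuous_on_subset[OF this], of 0 0 1 1] show ?thesis by simp
  qed
  also have "s * ((z - ?a) * integral {0..1} (%\<rho>. integral {0..1} (%\<eta>. n (s * \<rho>) (?a + (z - ?a) * \<eta>)))) =
    integral {0..1} (%\<rho>. s * ((z - ?a) * integral {0..1} (%\<eta>. n (s * \<rho>) (?a + (z - ?a) * \<eta>))))"
   by simp
  also have "... = integral {0..1} (%\<rho>. 2 * integral {0..1} (%\<eta>.
   s^2 * (1 - \<rho>) * F (s * \<rho>) (w (s * \<rho>) (z - 2 * (s * (1 - \<rho>)) * \<eta>))))"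
  proof (rule HK_cong)
   fix \<rho> :: real assume \<rho>: "\<rho> \<in> {0..1}"
   let ?\<sigma> = "s * \<rho>"
   have \<sigma>: "?\<sigma> >= 0" using s \<rho> by simp
   have "(z - ?a) * integral {0..1} (%\<eta>. n ?\<sigma> (?a + (z - ?a) * \<eta>)) = prim (n ?\<sigma>) z - prim (n ?\<sigma>) ?a"
    by (rule prim_unit[OF ncz, symmetric])
   \<comment> \<open>Symmetry of the primitive about \<sigma> replaces the lower limit 2s - z by z -
     2 (s - \<sigma>): the part of the interval symmetric about \<sigma> contributes
     nothing.\<close>
   also have "prim (n ?\<sigma>) ?a = prim (n ?\<sigma>) (2 * ?\<sigma> - ?a)"
    by (rule prim_antisym[OF ncz na(1)[OF \<sigma>], symmetric])
   also have "2 * ?\<sigma> - ?a = z - 2 * (s * (1 - \<rho>))" by (simp add: algebra_simps)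
   also have "prim (n ?\<sigma>) z - prim (n ?\<sigma>) (z - 2 * (s * (1 - \<rho>))) =
     2 * (s * (1 - \<rho>)) * integral {0..1} (%\<eta>. n ?\<sigma> (z - 2 * (s * (1 - \<rho>)) * \<eta>))"
    using prim_unit[OF ncz, of ?\<sigma> "z - 2 * (s * (1 - \<rho>))" z] by simp
   finally show "s * ((z - ?a) * integral {0..1} (%\<eta>. n ?\<sigma> (?a + (z - ?a) * \<eta>))) =
    2 * integral {0..1} (%\<eta>. s^2 * (1 - \<rho>) * F ?\<sigma> (w ?\<sigma> (z - 2 * (s * (1 - \<rho>)) * \<eta>)))"
    using \<sigma> by (simp add: n_def power2_eq_square)
  qed
  finally have "prim (tint n s) z - prim (tint n s) ?a = 2 * (w s z - f0 s z)"
   using w(4)[OF s, of z] by simp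
  then show ?thesis by (simp add: wfld_def wpot_def f0_def field_simps)
 qed
 have "n s z = F s (wfld P0 n s z)" if "s >= 0" for s z
  using weq[OF that, of z] that by (simp add: n_def)
 then show ?thesis using nc nB na by blast
qed

text \<open>Fubini on a rectangle. One order of integration exhibits \<open>wpot\<close> as a
  primitive in z, the other gives its derivative in s.\<close>

lemma prim_prim_swap:
 assumes n: "continuous_on UNIV (%(s, z). n s z)"
 shows "prim (tint n s) z = prim (%\<sigma>. prim (n \<sigma>) z) s"
proof -
 have c1: "continuous_on UNIV (%(\<sigma>, z). prim (n \<sigma>) z)" using continuous_on_prim[of UNIV n] n by simp
 have "continuous_on UNIV (%q::real\<times>real. (s * snd q, z * fst q))" by (intro continuous_intros)
 from continuous_on_compose2[OF n this]
 have c: "continuous_on UNIV (%(\<eta>, \<rho>). n (s * \<rho>) (z * \<eta>))" by (simp add: case_prod_beta)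
 have "prim (tint n s) z = z * integral {0..1} (%\<eta>. tint n s (z * \<eta>))"
  using prim_unit[OF continuous_on_snd_arg[OF continuous_on_tint[OF n]], of s z 0] by simp
 also have "... = z * integral {0..1} (%\<eta>. s * integral {0..1} (%\<rho>. n (s * \<rho>) (z * \<eta>)))"
  using prim_unit[OF continuous_on_flip_args[OF n], of _ s 0] by (simp add: tint_def)
 also have "... = z * (s * integral {0..1} (%\<rho>. integral {0..1} (%\<eta>. n (s * \<rho>) (z * \<eta>))))"
  using integral_swap_continuous[OF continuous_on_subset[OF c], of 0 0 1 1] by simp
 also have "... = s * integral {0..1} (%\<rho>. z * integral {0..1} (%\<eta>. n (s * \<rho>) (z * \<eta>)))"
  by simp
 also have "... = s * integral {0..1} (%\<rho>. prim (n (s * \<rho>)) z)"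
  using prim_unit[OF continuous_on_snd_arg[OF n], of _ z 0] by simp
 also have "... = prim (%\<sigma>. prim (n \<sigma>) z) s"
  using prim_unit[OF continuous_on_flip_args[OF c1], of z s 0] by simp
 finally show ?thesis .
qed

section \<open>Products with bounded functions\<close>

lemma L2_mult_bounded:
 assumes S: "S \<in> lmeasurable" and f: "f \<in> L2_space S" and g: "g \<in> borel_measurable (lebesgue_on S)"
  and b: "!!x. x \<in> S ==> \<bar>g x\<bar> <= B" and B: "B >= 0"
 shows "(%x. f x * g x) \<in> L2_space S" "L2_norm S (%x. f x * g x) <= B * L2_norm S f"
proof -
 have m: "(%x. f x * g x) \<in> borel_measurable (lebesgue_on S)" using L2_measurable[OF f] g by measurable
 have le: "(f x * g x)^2 <= B^2 * (f x)^2" if "x \<in> S" for x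
  using mult_left_mono[OF power_mono[OF b[OF that] abs_ge_zero, of 2], of "(f x)^2"]
  by (simp add: power_mult_distrib mult.commute)
 have i: "integrable (lebesgue_on S) (%x. (f x * g x)^2)"
  by (rule Bochner_Integration.integrable_bound[where f="%x. B^2 * (f x)^2"])
   (use L2_sq_integrable[OF f] m le S in \<open>auto intro!: AE_I2\<close>)
 show "(%x. f x * g x) \<in> L2_space S" using m i by (simp add: L2_space_def)
 have "(LINT x|lebesgue_on S. (f x * g x)^2) <= (LINT x|lebesgue_on S. B^2 * (f x)^2)"
  by (rule integral_mono[OF i]) (use L2_sq_integrable[OF f] le in auto)
 also have "... = (B * L2_norm S f)^2" by (simp add: power_mult_distrib L2_norm_sq)
 finally show "L2_norm S (%x. f x * g x) <= B * L2_norm S f"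
  by (rule L2_norm_le_of_integral) (use B in simp)
qed

text \<open>The error of the quotient is (quotient of A - A') (A s + A t) + A' (A s - A t). The
  first factor tends to zero in norm against a bounded one, the second contains a uniformly small
  one. This provides the quartic part of the energy.\<close>

lemma L2_deriv_square:
 fixes A :: "real => real => real"
 assumes d: "has_L2_derivative {a..b} A A' t I" and A': "A' \<in> L2_space {a..b}"
  and c: "continuous_on (I \<times> {a..b}) (%(s, x). A s x)"
  and B: "!!s x. s \<in> I ==> x \<in> {a..b} ==> \<bar>A s x\<bar> <= B" and t: "t \<in> I" and ab: "a <= b"
 shows "has_L2_derivative {a..b} (%s x. (A s x)^2) (%x. 2 * A t x * A' x) t I"
proof -
 let ?S = "{a..b}" and ?F = "at t within I"
 let ?q = "%s x. (A s x - A t x) / (s - t) - A' x"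
 have B0: "B >= 0" using B[OF t, of a] ab by fastforce
 have Ac: "continuous_on ?S (A s)" if "s \<in> I" for s by (rule continuous_on_slice[OF c that])
 have AL: "A s \<in> L2_space ?S" if "s \<in> I" for s by (rule L2_continuous[OF Ac[OF that]])
 have Am: "A s \<in> borel_measurable (lebesgue_on ?S)" if "s \<in> I" for s by (rule L2_measurable[OF AL[OF that]])
 have qL: "?q s \<in> L2_space ?S" if "s \<in> I" for s by (intro L2_diff L2_divide AL that t A')
 show ?thesis unfolding has_L2_derivative_def
 proof (rule tendstoI)
  fix e :: real assume e: "e > 0"
  define \<eta> where "\<eta> = e / (2 * (L2_norm ?S A' + 1))"
  have nA: "0 < 2 * (L2_norm ?S A' + 1)" by (intro mult_pos_pos add_nonneg_pos) auto
  have \<eta>: "\<eta> > 0" using e nA by (simp add: \<eta>_def)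
  obtain X where X: "t \<in> X" "open X" "\<forall>s\<in>X \<inter> I. \<forall>x\<in>?S. dist (A s x) (A t x) <= \<eta>"
   using continuous_on_prod_compactE[OF c compact_Icc t \<eta>] by auto
  have "\<forall>\<^sub>F s in ?F. s \<in> X \<and> s \<in> I \<and> s \<noteq> t"
   using X by (auto simp: eventually_at_filter eventually_nhds)
  moreover have "\<forall>\<^sub>F s in ?F. dist (2 * B * L2_norm ?S (?q s)) 0 < e / 2"
  proof (rule tendstoD)
   show "((%s. 2 * B * L2_norm ?S (?q s)) \<longlongrightarrow> 0) ?F"
    using tendsto_mult[OF tendsto_const[of "2 * B"] d[unfolded has_L2_derivative_def]] by simp
  qed (use e in simp)
  ultimately show "\<forall>\<^sub>F s in ?F. dist (L2_norm ?S (%x. ((A s x)^2 - (A t x)^2) / (s - t) - 2 * A t x * A' x)) 0 < e"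
  proof eventually_elim
   case (elim s)
   have sI: "s \<in> I" using elim by simp
   have m1: "(%x. A s x + A t x) \<in> borel_measurable (lebesgue_on ?S)" "(%x. A s x - A t x) \<in> borel_measurable (lebesgue_on ?S)"
    using Am[OF sI] Am[OF t] by measurable
   have b1: "\<bar>A s x + A t x\<bar> <= 2 * B" if "x \<in> ?S" for x using B[OF sI that] B[OF t that] by linarith
   have b2: "\<bar>A s x - A t x\<bar> <= \<eta>" if "x \<in> ?S" for x using X(3) elim that by (auto simp: dist_real_def)
   have eq: "((A s x)^2 - (A t x)^2) / (s - t) - 2 * A t x * A' x = ?q s x * (A s x + A t x) + A' x * (A s x - A t x)" for x
    using elim by (simp add: power2_eq_square field_simps)
   have "L2_norm ?S (%x. ((A s x)^2 - (A t x)^2) / (s - t) - 2 * A t x * A' x) \<le>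
    L2_norm ?S (%x. ?q s x * (A s x + A t x)) + L2_norm ?S (%x. A' x * (A s x - A t x))"
    unfolding eq using B0 \<eta>
    by (intro L2_norm_triangle L2_mult_bounded(1)[OF lmeasurable_Icc qL[OF sI] m1(1) b1]
      L2_mult_bounded(1)[OF lmeasurable_Icc A' m1(2) b2]) auto
   also have "... <= 2 * B * L2_norm ?S (?q s) + \<eta> * L2_norm ?S A'"
    using B0 \<eta> by (intro add_mono L2_mult_bounded(2)[OF lmeasurable_Icc qL[OF sI] m1(1) b1]
      L2_mult_bounded(2)[OF lmeasurable_Icc A' m1(2) b2]) auto
   also have "\<eta> * L2_norm ?S A' <= e / 2"
   proof -
    have "\<eta> * L2_norm ?S A' <= \<eta> * (L2_norm ?S A' + 1)" using \<eta> by simp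
    also have "... = e / 2" using nA by (simp add: \<eta>_def field_simps)
    finally show ?thesis .
   qed
   finally have "L2_norm ?S (%x. ((A s x)^2 - (A t x)^2) / (s - t) - 2 * A t x * A' x) < e"
    using elim by (simp add: dist_real_def)
   then show ?case by simp
  qed
 qed
qed

text \<open>The weight P is only square integrable, so continuity is obtained from norm convergence
  of f rather than from a jointly continuous integrand.\<close>

lemma continuous_weighted_integral:
 fixes f :: "'a::metric_space => real => real"
 assumes P: "P \<in> L2_space {a..b}" and c: "continuous_on (X \<times> {a..b}) (%(q, x). f q x)" and ab: "a <= b"
 shows "continuous_on X (%q. integral {a..b} (%x. P x * f q x))"
proof -
 have fL: "f q \<in> L2_space {a..b}" if "q \<in> X" for q by (rule L2_continuous[OF continuous_on_slice[OF c that]])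
 have "((%q. LINT x|lebesgue_on {a..b}. P x * f q x) \<longlongrightarrow> (LINT x|lebesgue_on {a..b}. P x * f q0 x)) (at q0 within X)"
  if q0: "q0 \<in> X" for q0
  by (rule L2_lim_inner[OF _ L2_lim_jointly_continuous[OF c q0 ab]])
   (use P fL q0 in \<open>auto simp: eventually_at_filter\<close>)
 then have "continuous_on X (%q. LINT x|lebesgue_on {a..b}. P x * f q x)"
  by (simp add: continuous_on_def)
 then show ?thesis
  by (rule continuous_on_eq) (use P fL in \<open>auto intro!: LINT_eq_integral L2_mult_integrable\<close>)
qed

subsection \<open>Differentiating the Newton interpolant\<close>

text \<open>The binomial coefficient r choose j as a polynomial, so that it can be differentiated in
  r.\<close>

definition newton_poly :: "nat => real poly" where
 "newton_poly j = smult (1 / fact j) (\<Prod>i=0..<j. [:- real i, 1:])"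

lemma poly_newton_poly: "poly (newton_poly j) x = x gchoose j"
 by (simp add: newton_poly_def gbinomial_prod_rev poly_prod)

definition dnint :: "nat => real => real => (real => real) => real => real" where
 "dnint M T r f s = (\<Sum>j\<le>M. poly (pderiv (newton_poly j)) r * (fdiff T ^^ j) f s)"

lemma nint_poly: "nint M T r f s = (\<Sum>j\<le>M. poly (newton_poly j) r * (fdiff T ^^ j) f s)"
 by (simp add: nint_def poly_newton_poly)

lemma nint_deriv_r: "((%r. nint M T r f s) has_real_derivative dnint M T r f s) (at r within X)"
 unfolding nint_poly dnint_def
 by (auto intro!: derivative_eq_intros has_field_derivative_at_within[OF poly_DERIV] sum.cong)

lemma nint_deriv_s:
 assumes "T >= 0" "!!s. s >= 0 ==> (f has_real_derivative f' s) (at s within {0..})" "s >= 0"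
 shows "((%s. nint M T r f s) has_real_derivative nint M T r f' s) (at s within {0..})"
 unfolding nint_poly using fdiff_pow_deriv[OF assms]
 by (auto intro!: derivative_eq_intros sum.cong)

lemma dnint_deriv_s:
 assumes "T >= 0" "!!s. s >= 0 ==> (f has_real_derivative f' s) (at s within {0..})" "s >= 0"
 shows "((%s. dnint M T r f s) has_real_derivative dnint M T r f' s) (at s within {0..})"
 unfolding dnint_def using fdiff_pow_deriv[OF assms]
 by (auto intro!: derivative_eq_intros sum.cong)

lemma fdiff_pow_cong:
 assumes "!!i. i <= j ==> f (s + real i * T) = g (s + real i * T)"
 shows "(fdiff T ^^ j) f s = (fdiff T ^^ j) g s"
 using assms
proof (induction j arbitrary: s)
 case 0
 from 0[of 0] show ?case by simp
next
 case (Suc j)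
 have "(fdiff T ^^ j) f s = (fdiff T ^^ j) g s" by (rule Suc.IH) (use Suc.prems in simp)
 moreover have "(fdiff T ^^ j) f (s + T) = (fdiff T ^^ j) g (s + T)"
  by (rule Suc.IH) (use Suc.prems[of "Suc i" for i] in \<open>simp add: algebra_simps\<close>)
 ultimately show ?case by (simp only: fdiff_pow_Suc)
qed

lemma nint_cong:
 assumes "!!i. i <= M ==> f (s + real i * T) = g (s + real i * T)"
 shows "nint M T r f s = nint M T r g s" "dnint M T r f s = dnint M T r g s"
 unfolding nint_def dnint_def by (intro sum.cong refl arg_cong2[where f="(*)"] fdiff_pow_cong assms; simp)+

lemma nint_add: "nint M T r (%s. f s + g s) s = nint M T r f s + nint M T r g s"
 by (simp add: nint_def fdiff_pow_add distrib_left sum.distrib)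

lemma nint_diff: "nint M T r (%s. f s - g s) s = nint M T r f s - nint M T r g s"
 by (simp add: nint_def fdiff_pow_diff right_diff_distrib sum_subtractf)

lemma nint_cmult: "nint M T r (%s. c * f s) s = c * nint M T r f s"
 by (simp add: nint_def fdiff_pow_cmult sum_distrib_left mult_ac)

lemma nint_const: "nint M T r (%s. c) s = c"
proof -
 have "nint M T r (%s. c) s = (\<Sum>j\<le>M. if j = 0 then c else 0)"
  unfolding nint_def by (intro sum.cong) (auto simp: fdiff_pow_const)
 then show ?thesis by simp
qed

lemma dnint_add: "dnint M T r (%s. f s + g s) s = dnint M T r f s + dnint M T r g s"
 by (simp add: dnint_def fdiff_pow_add distrib_left sum.distrib)

lemma dnint_const: "dnint M T r (%s. c) s = 0"
proof -
 have "pderiv (newton_poly 0) = 0" by (simp add: newton_poly_def one_pCons pderiv_pCons)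
 then have "poly (pderiv (newton_poly j)) r * (fdiff T ^^ j) (%s. c) s = 0" for j
  by (simp add: fdiff_pow_const)
 then show ?thesis unfolding dnint_def by (intro sum.neutral) blast
qed

lemma continuous_on_fdiff_pow:
 fixes f :: "real => real => real"
 assumes f: "continuous_on UNIV (%(s, z). f s z)" and "continuous_on X a" "continuous_on X c"
 shows "continuous_on X (%q. (fdiff T ^^ j) (%\<sigma>. f \<sigma> (c q)) (a q))"
 using assms(2)
proof (induction j arbitrary: a)
 case 0
 have "continuous_on X (%q. (a q, c q))" using 0 assms(3) by (intro continuous_intros)
 from continuous_on_compose2[OF f this] show ?case by simp
next
 case (Suc j)
 show ?case unfolding fdiff_pow_Suc
  by (intro continuous_intros Suc.IH Suc.prems)
qed

lemma continuous_on_nint: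
 fixes f :: "real => real => real"
 assumes "continuous_on UNIV (%(s, z). f s z)" "continuous_on X a" "continuous_on X b" "continuous_on X c"
 shows "continuous_on X (%q. nint M T (b q) (%\<sigma>. f \<sigma> (c q)) (a q))"
  "continuous_on X (%q. dnint M T (b q) (%\<sigma>. f \<sigma> (c q)) (a q))"
 unfolding nint_poly dnint_def
 by (intro continuous_intros continuous_on_fdiff_pow[OF assms(1)] assms)+

text \<open>Differences act on the time and \<open>prim\<close> acts on z, so they commute; hence
  interpolated potentials are primitives of interpolated profiles.\<close>

lemma prim_fdiff_pow:
 assumes f: "continuous_on UNIV (%(s, z). f s z)"
 shows "prim (%y. (fdiff T ^^ j) (%\<sigma>. f \<sigma> y) s) z = (fdiff T ^^ j) (%\<sigma>. prim (f \<sigma>) z) s"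
proof (induction j arbitrary: s)
 case (Suc j)
 have i: "loc_int (%y. c * (fdiff T ^^ j) (%\<sigma>. f \<sigma> y) s)" for s c
  by (intro loc_int_continuous continuous_intros continuous_on_fdiff_pow[OF f, of UNIV "%q. s" "%q. q"])
 have "prim (%y. (fdiff T ^^ Suc j) (%\<sigma>. f \<sigma> y) s) z =
   prim (%y. 1 * (fdiff T ^^ j) (%\<sigma>. f \<sigma> y) (s + T) + (- 1) * (fdiff T ^^ j) (%\<sigma>. f \<sigma> y) s) z"
  unfolding fdiff_pow_Suc by simp
 also have "... = 1 * (fdiff T ^^ j) (%\<sigma>. prim (f \<sigma>) z) (s + T) + (- 1) * (fdiff T ^^ j) (%\<sigma>. prim (f \<sigma>) z) s"
  unfolding prim_add[OF i i] prim_cmult Suc.IH ..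
 finally show ?case unfolding fdiff_pow_Suc by simp
qed simp

lemma prim_sum:
 assumes "finite J" "!!j. j \<in> J ==> continuous_on UNIV (g j)"
 shows "prim (%y. \<Sum>j\<in>J. c j * g j y) z = (\<Sum>j\<in>J. c j * prim (g j) z)"
 using assms
proof (induction J)
 case empty
 then show ?case by (simp add: prim_def)
next
 case (insert j J)
 have "prim (%y. c j * g j y + (\<Sum>j\<in>J. c j * g j y)) z = prim (%y. c j * g j y) z + prim (%y. \<Sum>j\<in>J. c j * g j y) z"
  by (intro prim_add loc_int_continuous continuous_intros) (use insert in auto)
 then show ?case using insert by (simp add: prim_cmult)
qed

lemma prim_nint:
 assumes f: "continuous_on UNIV (%(s, z). f s z)"
 shows "prim (%y. nint M T r (%\<sigma>. f \<sigma> y) s) z = nint M T r (%\<sigma>. prim (f \<sigma>) z) s"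
  "prim (%y. dnint M T r (%\<sigma>. f \<sigma> y) s) z = dnint M T r (%\<sigma>. prim (f \<sigma>) z) s"
 unfolding nint_poly dnint_def
 by (simp_all add: prim_sum continuous_on_fdiff_pow[OF f, of UNIV "%q. s" "%q. q"] prim_fdiff_pow[OF f])

text \<open>The r-average extends over a single period, so bounds on [0, 1] suffice although the
  nodes reach up to M.\<close>

lemma newton_poly_bound: "\<exists>C\<ge>1. \<forall>j\<le>M. \<forall>r\<in>{0..1}. \<bar>poly (newton_poly j) r\<bar> <= C \<and> \<bar>poly (pderiv (newton_poly j)) r\<bar> <= C"
proof -
 have "\<exists>B. \<forall>r\<in>{0..1}. \<bar>poly p r\<bar> <= B" for p :: "real poly"
 proof -
  have "bounded (poly p ` {0..1})"
   by (intro compact_imp_bounded compact_continuous_image continuous_intros) auto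
  then show ?thesis unfolding bounded_iff by auto
 qed
 then obtain B where B: "!!p r. r \<in> {0..1} ==> \<bar>poly p r\<bar> <= B (p :: real poly)" by metis
 define C where "C = 1 + (\<Sum>j\<le>M. \<bar>B (newton_poly j)\<bar> + \<bar>B (pderiv (newton_poly j))\<bar>)"
 have *: "\<bar>B (newton_poly j)\<bar> + \<bar>B (pderiv (newton_poly j))\<bar> <= C" if "j <= M" for j
 proof -
  have "\<bar>B (newton_poly j)\<bar> + \<bar>B (pderiv (newton_poly j))\<bar> <= (\<Sum>j\<le>M. \<bar>B (newton_poly j)\<bar> + \<bar>B (pderiv (newton_poly j))\<bar>)"
   using that by (intro member_le_sum[of j "{..M}" "%j. \<bar>B (newton_poly j)\<bar> + \<bar>B (pderiv (newton_poly j))\<bar>"]) auto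
  then show ?thesis by (simp add: C_def)
 qed
 have "C >= 1" by (simp add: C_def sum_nonneg)
 moreover have "\<bar>poly (newton_poly j) r\<bar> <= C \<and> \<bar>poly (pderiv (newton_poly j)) r\<bar> <= C" if "j <= M" "r \<in> {0..1}" for j r
  using B[OF that(2), of "newton_poly j"] B[OF that(2), of "pderiv (newton_poly j)"] *[OF that(1)] by linarith
 ultimately show ?thesis by blast
qed

lemma fdiff_pow_bound:
 assumes "!!i. i <= j ==> \<bar>f (s + real i * T)\<bar> <= B"
 shows "\<bar>(fdiff T ^^ j) f s\<bar> <= 2 ^ j * B"
 using assms
proof (induction j arbitrary: s)
 case 0
 from 0[of 0] show ?case by simp
next
 case (Suc j)
 have "\<bar>(fdiff T ^^ j) f s\<bar> <= 2 ^ j * B" by (rule Suc.IH) (use Suc.prems in simp)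
 moreover have "\<bar>(fdiff T ^^ j) f (s + T)\<bar> <= 2 ^ j * B"
  by (rule Suc.IH) (use Suc.prems[of "Suc i" for i] in \<open>simp add: algebra_simps\<close>)
 ultimately show ?case by (simp only: fdiff_pow_Suc power_Suc)
qed

lemma nint_bound:
 assumes C: "!!j. j <= M ==> \<bar>poly (newton_poly j) r\<bar> <= C \<and> \<bar>poly (pderiv (newton_poly j)) r\<bar> <= C"
  and f: "!!i. i <= M ==> \<bar>f (s + real i * T)\<bar> <= B"
 shows "\<bar>nint M T r f s\<bar> <= (\<Sum>j\<le>M. C * 2 ^ j) * B" "\<bar>dnint M T r f s\<bar> <= (\<Sum>j\<le>M. C * 2 ^ j) * B"
proof -
 have d: "\<bar>(fdiff T ^^ j) f s\<bar> <= 2 ^ j * B" if "j <= M" for j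
  by (rule fdiff_pow_bound) (use f that in auto)
 have *: "\<bar>\<Sum>j\<le>M. c j * (fdiff T ^^ j) f s\<bar> <= (\<Sum>j\<le>M. C * 2 ^ j) * B"
  if c: "!!j. j <= M ==> \<bar>c j\<bar> <= C" for c
 proof -
  have "\<bar>\<Sum>j\<le>M. c j * (fdiff T ^^ j) f s\<bar> <= (\<Sum>j\<le>M. \<bar>c j * (fdiff T ^^ j) f s\<bar>)" by (rule sum_abs)
  also have "... <= (\<Sum>j\<le>M. C * (2 ^ j * B))"
  proof (rule sum_mono)
   fix j assume "j \<in> {..M}"
   then show "\<bar>c j * (fdiff T ^^ j) f s\<bar> <= C * (2 ^ j * B)"
    unfolding abs_mult using c[of j] d[of j] by (intro mult_mono) auto
  qed
  also have "... = (\<Sum>j\<le>M. C * 2 ^ j) * B" by (simp add: sum_distrib_right mult.assoc)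
  finally show ?thesis .
 qed
 show "\<bar>nint M T r f s\<bar> <= (\<Sum>j\<le>M. C * 2 ^ j) * B" unfolding nint_poly by (rule *) (use C in auto)
 show "\<bar>dnint M T r f s\<bar> <= (\<Sum>j\<le>M. C * 2 ^ j) * B" unfolding dnint_def by (rule *) (use C in auto)
qed

text \<open>Subtracting a constant does not change \<open>dnint\<close> and changes \<open>nint\<close> by that constant, so
 both only see the variation of \<open>f\<close> along the nodes.\<close>

lemma nint_variation_bound:
 assumes C: "!!j. j <= M ==> \<bar>poly (newton_poly j) r\<bar> <= C \<and> \<bar>poly (pderiv (newton_poly j)) r\<bar> <= C"
  and f: "!!i. i <= M ==> \<bar>f (s + real i * T) - f s\<bar> <= B"
 shows "\<bar>nint M T r f s - f s\<bar> <= (\<Sum>j\<le>M. C * 2 ^ j) * B" "\<bar>dnint M T r f s\<bar> <= (\<Sum>j\<le>M. C * 2 ^ j) * B"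
proof -
 have "nint M T r (%\<sigma>. f \<sigma> + - f s) s = nint M T r f s + - f s"
  by (simp only: nint_add nint_const)
 then have a: "nint M T r f s - f s = nint M T r (%\<sigma>. f \<sigma> + - f s) s" by simp
 have "dnint M T r (%\<sigma>. f \<sigma> + - f s) s = dnint M T r f s + 0"
  by (simp only: dnint_add dnint_const)
 then have b: "dnint M T r f s = dnint M T r (%\<sigma>. f \<sigma> + - f s) s" by simp
 show "\<bar>nint M T r f s - f s\<bar> <= (\<Sum>j\<le>M. C * 2 ^ j) * B" unfolding a
  by (rule nint_bound(1)) (use C f in auto)
 show "\<bar>dnint M T r f s\<bar> <= (\<Sum>j\<le>M. C * 2 ^ j) * B" unfolding b
  by (rule nint_bound(2)) (use C f in auto)
qed

subsection \<open>The characteristic form of the wave equation\<close>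

text \<open>With z = s + x the reflection z -> 2s - z is x -> -x. The two symmetries of n thus
  encode odd, T-periodic extension in x, which for T = 2l amounts to Dirichlet conditions at both
  ends of (0, l).\<close>

locale wave_flow =
 fixes T :: real and P0 :: "real => real" and n :: "real => real => real"
 assumes T: "T > 0"
  and P0: "locL2 P0" "periodic T P0" "integral {0..T} P0 = 0"
  and n_cont: "continuous_on UNIV (%(s, z). n s z)"
  and n_anti: "!!s z. s >= 0 ==> n s (2 * s - z) = - n s z"
  and n_per: "!!s z. s >= 0 ==> n s (z + T) = n s z"
begin

abbreviation "R \<equiv> tint n"
abbreviation "U \<equiv> wpot P0 n"
abbreviation "W \<equiv> wfld P0 n"

lemma R_cont: "continuous_on UNIV (%(s, z). R s z)"
 by (rule continuous_on_tint[OF n_cont])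

lemma R_deriv: "((%s. R s z) has_real_derivative n s z) (at s within X)"
 unfolding tint_def by (rule has_field_derivative_at_within[OF prim_deriv[OF continuous_on_flip_args[OF n_cont]]])

lemma prim_n_cont: "continuous_on UNIV (%(s, z). prim (n s) z)"
 using continuous_on_prim[of UNIV n] n_cont by simp

lemma U_eq: "U s z = prim P0 z + prim (%\<sigma>. prim (n \<sigma>) z) s"
 unfolding wpot_def prim_prim_swap[OF n_cont] ..

lemma U_deriv: "((%s. U s z) has_real_derivative prim (n s) z) (at s within X)"
 unfolding U_eq
 by (auto intro!: derivative_eq_intros has_field_derivative_at_within[OF prim_deriv[OF continuous_on_flip_args[OF prim_n_cont]]])

lemma P0_prim_cont: "continuous_on UNIV (prim P0)"
 by (rule prim_continuous[OF locL2_loc_int[OF P0(1)]])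

lemma U_cont: "continuous_on UNIV (%(s, z). U s z)"
proof -
 have "continuous_on UNIV (%(s, z). prim (R s) z)" using continuous_on_prim[of UNIV R] R_cont by simp
 then have "continuous_on UNIV (%q. prim P0 (snd q) + prim (R (fst q)) (snd q))"
  by (intro continuous_intros continuous_on_compose2[OF P0_prim_cont]) (auto simp: case_prod_beta)
 then show ?thesis by (simp add: wpot_def case_prod_beta)
qed

lemma n_periodic: "s >= 0 ==> periodic T (n s)"
 by (simp add: periodic_def n_per)

lemma n_loc_int: "loc_int (n s)"
 by (rule loc_int_continuous[OF continuous_on_snd_arg[OF n_cont]])

text \<open>Reflection about s preserves the integral over a period and changes the sign of
  n.\<close>

lemma n_mean: "s >= 0 ==> integral {0..T} (n s) = 0"
 using periodic_integral_flip[OF n_periodic n_loc_int, of s "2 * s"] T by (simp add: n_anti)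

lemma prim_n_periodic: "s >= 0 ==> periodic T (prim (n s))"
 by (rule periodic_prim[OF n_periodic n_loc_int]) (use T n_mean in auto)

lemma prim_cong_nonneg: "s >= 0 ==> (!!\<sigma>. \<sigma> >= 0 ==> f \<sigma> = g \<sigma>) ==> prim f s = prim g s"
 unfolding prim_def by (cases "s = 0") (auto intro: HK_cong)

lemma R_periodic: "s >= 0 ==> periodic T (R s)"
 unfolding periodic_def tint_def by (auto intro!: prim_cong_nonneg n_per)

lemma P0_prim_periodic: "periodic T (prim P0)"
 by (rule periodic_prim[OF P0(2) locL2_loc_int[OF P0(1)] _ P0(3)]) (use T in simp)

lemma U_periodic: "s >= 0 ==> periodic T (U s)"
 unfolding periodic_def U_eq
 using periodic_D[OF P0_prim_periodic] periodic_D[OF prim_n_periodic]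
 by (auto intro!: prim_cong_nonneg arg_cong2[where f="(+)"])

lemma R_loc_int: "loc_int (R s)"
 by (rule loc_int_continuous[OF continuous_on_snd_arg[OF R_cont]])

lemma R_mean: "s >= 0 ==> integral {0..T} (R s) = 0"
proof -
 assume s: "s >= 0"
 have "prim (R s) T = prim (%\<sigma>. prim (n \<sigma>) T) s" by (rule prim_prim_swap[OF n_cont])
 also have "... = prim (%\<sigma>. 0) s"
  using periodic_D[OF prim_n_periodic, of _ 0] by (intro prim_cong_nonneg s) simp
 finally show ?thesis using prim_diff[OF R_loc_int, of 0 T s] T by (simp add: prim_def)
qed

lemma R_locL2: "locL2 (R s)"
 by (rule locL2_continuous[OF continuous_on_snd_arg[OF R_cont]])

lemma P_locL2: "locL2 (%z. P0 z + R s z)"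
 by (rule locL2_add[OF P0(1) R_locL2])

lemma U_prim: "U s z = prim (%z. P0 z + R s z) z"
 by (simp add: wpot_def prim_add[OF locL2_loc_int[OF P0(1)] R_loc_int])

text \<open>The profile has mean zero, so its norm controls the oscillation of its primitive; this
  is the embedding of H1 into bounded functions on which all pointwise bounds rest.\<close>

lemma U_var_norm:
 assumes "0 <= s"
 shows "\<bar>U s z - U s y\<bar> <= sqrt T * L2_norm {0..T} (%z. P0 z + R s z)"
proof -
 have "periodic T (%z. P0 z + R s z)" using P0(2) R_periodic[OF assms] by (simp add: periodic_def)
 moreover have "integral {0..T} (%z. P0 z + R s z) = 0"
  using P0(3) R_mean[OF assms] loc_int_D[OF locL2_loc_int[OF P0(1)], of 0 T] loc_int_D[OF R_loc_int, of s 0 T]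
  by (simp add: HK_add)
 ultimately show ?thesis
  unfolding U_prim by (intro periodic_abs_prim_le P_locL2 T)
qed

lemma W_bound_norm:
 assumes "0 <= s"
 shows "\<bar>W s z\<bar> <= sqrt T * L2_norm {0..T} (%z. P0 z + R s z)"
proof -
 have "\<bar>x / 2\<bar> <= \<bar>x\<bar>" for x :: real by simp
 from order_trans[OF this U_var_norm[OF assms, of z "2 * s - z"]] show ?thesis by (simp only: wfld_def)
qed

end

text \<open>The bound K on [0, S] is an a priori assumption here and is recovered by the bootstrap
  in \<open>wave_long_time\<close>. Constants derived from T, K, KA, KB alone are uniform in eps, in
  the data and in S.\<close>

locale wave_data = wave_flow T P0 n
 for T K :: real and KA KB :: "nat => real" and eps :: real and DA DB :: "nat => real => real"
  and P0 :: "real => real" and n :: "real => real => real" and S :: real +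
 assumes eps: "0 < eps" "eps <= 1"
  and DA: "der_chain eps KA DA" and DB: "der_chain eps KB DB"
  and n_eq: "!!s z. 0 <= s ==> s <= S ==>
   n s z = eps^2 * (DB 0 s * wfld P0 n s z + DA 0 s * wfld P0 n s z ^ 3)"
  and energy: "!!s. 0 <= s ==> s <= S ==> L2_norm {0..T} (%z. P0 z + tint n s z) <= K"
  and S: "S >= 0"
begin

lemma K_nonneg: "K >= 0"
 using order_trans[OF L2_norm_nonneg energy[of 0]] S by simp

lemma U_var:
 assumes "0 <= s" "s <= S"
 shows "\<bar>U s z - U s y\<bar> <= sqrt T * K"
 by (rule order_trans[OF U_var_norm[OF assms(1)] mult_left_mono[OF energy[OF assms]]]) (use T in simp)

lemma U_bound: "0 <= s ==> s <= S ==> \<bar>U s z\<bar> <= sqrt T * K"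
 using U_var[of s z 0] by (simp add: wpot_def)

lemma W_bound: "0 <= s ==> s <= S ==> \<bar>W s z\<bar> <= sqrt T * K"
 using U_var[of s z "2 * s - z"] by (simp add: wfld_def)

lemma coefficient_bounds: "s >= 0 ==> \<bar>DA 0 s\<bar> <= \<bar>KA 0\<bar>" "s >= 0 ==> \<bar>DB 0 s\<bar> <= \<bar>KB 0\<bar>"
 using DA DB unfolding der_chain_def by (metis abs_ge_self mult.right_neutral order_trans power_0)+

definition Bn :: real where
 "Bn = \<bar>KB 0\<bar> * (sqrt T * K) + \<bar>KA 0\<bar> * (sqrt T * K) ^ 3"

lemma Bn_nonneg: "Bn >= 0"
 using K_nonneg T by (simp add: Bn_def)

lemma n_bound: "0 <= s ==> s <= S ==> \<bar>n s z\<bar> <= eps^2 * Bn"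
proof -
 assume s: "0 <= s" "s <= S"
 have "\<bar>DB 0 s * W s z + DA 0 s * W s z ^ 3\<bar> <= \<bar>DB 0 s\<bar> * \<bar>W s z\<bar> + \<bar>DA 0 s\<bar> * \<bar>W s z\<bar> ^ 3"
  by (metis abs_mult abs_triangle_ineq power_abs)
 also have "... <= Bn" unfolding Bn_def
  using coefficient_bounds[OF s(1)] W_bound[OF s] by (intro add_mono mult_mono power_mono) auto
 finally show ?thesis using n_eq[OF s, of z] eps by (simp add: abs_mult mult_left_mono)
qed

end

subsection \<open>Slow variation along the period map\<close>

text \<open>The representative z0 is the same for all T-periodic functions, so one choice serves all
  nodes s + iT at once.\<close>

lemma periodic_reduce:
 assumes T: "T > 0"
 obtains z0 where "z0 \<in> {0..T}" "!!f. periodic T f ==> f z = f z0"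
proof -
 define m where "m = \<lfloor>z / T\<rfloor>"
 define z0 where "z0 = z - of_int m * T"
 have "of_int m <= z / T" "z / T <= of_int m + 1" by (auto simp: m_def)
 then have z0: "z0 \<in> {0..T}" using T by (auto simp: z0_def field_simps)
 have "f z = f z0" if f: "periodic T f" for f
 proof (cases "m >= 0")
  case True
  then have "z = z0 + real (nat m) * T" by (simp add: z0_def)
  then show ?thesis using periodic_nat[OF f, of z0 "nat m"] by simp
 next
  case False
  then have "z0 = z + real (nat (- m)) * T" by (simp add: z0_def)
  then show ?thesis using periodic_nat[OF f, of z "nat (- m)"] by simp
 qed
 with z0 show ?thesis by (rule that)
qed

context wave_data begin

lemma node_nonneg: "s >= 0 ==> s + real i * T >= 0"
 using T by simp

text \<open>The reflected point 2 (s + iT) - z equals 2s - z modulo T. On the nodes the field is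
  therefore a fixed linear expression in U with frozen phase, and differences of W reduce to
  differences of U.\<close>

lemma W_node:
 assumes "s >= 0"
 shows "W (s + real i * T) z = (1/2) * (U (s + real i * T) z - U (s + real i * T) (2 * s - z))"
proof -
 have "2 * (s + real i * T) - z = (2 * s - z) + real (2 * i) * T" by (simp add: algebra_simps)
 then show ?thesis
  unfolding wfld_def by (simp only: periodic_nat[OF U_periodic[OF node_nonneg[OF assms]]])
qed

lemma W_fdiff:
 assumes "s >= 0"
 shows "(fdiff T ^^ j) (%\<sigma>. W \<sigma> z) s =
  (1/2) * ((fdiff T ^^ j) (%\<sigma>. U \<sigma> z) s - (fdiff T ^^ j) (%\<sigma>. U \<sigma> (2 * s - z)) s)"
proof -
 have "(fdiff T ^^ j) (%\<sigma>. W \<sigma> z) s = (fdiff T ^^ j) (%\<sigma>. (1/2) * (U \<sigma> z - U \<sigma> (2 * s - z))) s"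
  by (rule fdiff_pow_cong) (rule W_node[OF assms])
 then show ?thesis by (simp only: fdiff_pow_cmult fdiff_pow_diff)
qed

lemma W_slow:
 assumes "!!z. slow T eps S m A (%s. U s z)"
 shows "slow T eps S m A (%s. W s z)"
 unfolding slow_def
proof (intro allI impI)
 fix i s assume i: "i <= m" and s: "0 <= s \<and> s + real i * T <= S"
 have "\<bar>(fdiff T ^^ i) (%\<sigma>. U \<sigma> z) s\<bar> <= A * eps ^ i" "\<bar>(fdiff T ^^ i) (%\<sigma>. U \<sigma> (2 * s - z)) s\<bar> <= A * eps ^ i"
  using slow_D[OF assms i] s by auto
 then show "\<bar>(fdiff T ^^ i) (%\<sigma>. W \<sigma> z) s\<bar> <= A * eps ^ i"
  using W_fdiff[of s i z] s by (simp add: abs_le_iff)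
qed

lemma n_slow:
 assumes W: "!!z. slow T eps S m A (%s. W s z)" and A: "A >= 0"
 defines "sA \<equiv> (\<Sum>j\<le>m. T ^ j * \<bar>KA j\<bar>)" and "sB \<equiv> (\<Sum>j\<le>m. T ^ j * \<bar>KB j\<bar>)"
 shows "slow T eps S m (eps^2 * (2 ^ m * sB * A + 2 ^ m * sA * (2 ^ m * A * (2 ^ m * A * A)))) (%s. n s z)"
proof -
 have nn: "sA >= 0" "sB >= 0" using T by (auto simp: sA_def sB_def intro!: sum_nonneg)
 have T0: "T >= 0" and e0: "eps >= 0" using T eps by auto
 have a: "slow T eps S m sA (DA 0)" unfolding sA_def by (rule der_chain_slow[OF DA T0 e0])
 have b: "slow T eps S m sB (DB 0)" unfolding sB_def by (rule der_chain_slow[OF DB T0 e0])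
 have "slow T eps S m (\<bar>eps^2\<bar> * (2 ^ m * sB * A + 2 ^ m * sA * (2 ^ m * A * (2 ^ m * A * A))))
  (%s. eps^2 * (DB 0 s * W s z + DA 0 s * (W s z * (W s z * W s z))))"
  using nn A by (intro slow_cmult slow_add slow_mult a b W T0 e0) auto
 then have f: "slow T eps S m (eps^2 * (2 ^ m * sB * A + 2 ^ m * sA * (2 ^ m * A * (2 ^ m * A * A))))
  (%s. eps^2 * (DB 0 s * W s z + DA 0 s * (W s z * (W s z * W s z))))" by simp
 show ?thesis unfolding slow_def
 proof (intro allI impI)
  fix i s assume i: "i <= m" and s: "0 <= s \<and> s + real i * T <= S"
  have "(fdiff T ^^ i) (%s. n s z) s = (fdiff T ^^ i) (%s. eps^2 * (DB 0 s * W s z + DA 0 s * (W s z * (W s z * W s z)))) s"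
  proof (rule fdiff_pow_cong)
   fix k assume k: "k <= i"
   have "real k * T <= real i * T" using k T by simp
   then have "s + real k * T <= S" using s by linarith
   then show "n (s + real k * T) z = eps^2 * (DB 0 (s + real k * T) * W (s + real k * T) z +
     DA 0 (s + real k * T) * (W (s + real k * T) z * (W (s + real k * T) z * W (s + real k * T) z)))"
    using n_eq[OF node_nonneg, of s k z] s by (simp add: power3_eq_cube mult.assoc)
  qed
  then show "\<bar>(fdiff T ^^ i) (%s. n s z) s\<bar> \<le>
    eps^2 * (2 ^ m * sB * A + 2 ^ m * sA * (2 ^ m * A * (2 ^ m * A * A))) * eps ^ i"
   using slow_D[OF f i, of s] s by simp
 qed
qed

text \<open>One more difference of U is an integral over a period of the i-th difference of prim n,
  which is O(eps^2 eps^i) because n carries eps^2. Reducing z to [0, T] bounds the primitive. Only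
  one of the two new powers of eps is kept.\<close>

lemma U_slow_step:
 assumes n: "!!z. slow T eps S m (eps^2 * B) (%s. n s z)" and B: "B >= 0" and i: "i <= m"
  and s: "0 <= s" "s + real (Suc i) * T <= S"
 shows "\<bar>(fdiff T ^^ Suc i) (%\<sigma>. U \<sigma> z) s\<bar> <= T * T * B * eps ^ Suc i"
proof -
 obtain z0 where z0: "z0 \<in> {0..T}" "!!f. periodic T f ==> f z = f z0"
  using periodic_reduce[OF T] by blast
 have e: "(fdiff T ^^ Suc i) (%\<sigma>. U \<sigma> z) s = (fdiff T ^^ Suc i) (%\<sigma>. U \<sigma> z0) s"
  by (rule fdiff_pow_cong) (rule z0(2)[OF U_periodic[OF node_nonneg[OF s(1)]]])
 have d: "((fdiff T ^^ i) (%\<sigma>. U \<sigma> z0) has_real_derivative (fdiff T ^^ i) (%\<sigma>. prim (n \<sigma>) z0) \<sigma>) (at \<sigma> within {0..})"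
  if "\<sigma> >= 0" for \<sigma>
  by (rule fdiff_pow_deriv[OF less_imp_le[OF T] U_deriv that])
 have db: "\<bar>(fdiff T ^^ i) (%\<sigma>. prim (n \<sigma>) z0) \<sigma>\<bar> <= eps^2 * B * eps ^ i * T" if \<sigma>: "\<sigma> \<in> {s..s+T}" for \<sigma>
 proof -
  have \<sigma>2: "0 <= \<sigma>" "\<sigma> + real i * T <= S" using \<sigma> s by (auto simp: algebra_simps)
  have li: "loc_int (%y. (fdiff T ^^ i) (%\<sigma>. n \<sigma> y) \<sigma>)"
   by (intro loc_int_continuous continuous_on_fdiff_pow[OF n_cont, of UNIV "%q. \<sigma>" "%q. q"] continuous_intros)
  have "\<bar>prim (%y. (fdiff T ^^ i) (%\<sigma>. n \<sigma> y) \<sigma>) z0 - prim (%y. (fdiff T ^^ i) (%\<sigma>. n \<sigma> y) \<sigma>) 0\<bar> \<le>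
    eps^2 * B * eps ^ i * \<bar>z0 - 0\<bar>"
   by (rule prim_lipschitz[OF li]) (rule slow_D[OF n i \<sigma>2])
  also have "... <= eps^2 * B * eps ^ i * T"
   using z0(1) B eps by (intro mult_left_mono) auto
  finally show ?thesis by (simp add: prim_fdiff_pow[OF n_cont] fdiff_pow_const)
 qed
 have "\<bar>(fdiff T ^^ i) (%\<sigma>. U \<sigma> z0) (s + T) - (fdiff T ^^ i) (%\<sigma>. U \<sigma> z0) s\<bar> <= eps^2 * B * eps ^ i * T * \<bar>s + T - s\<bar>"
 proof (rule mvt_bound[where a=s and b="s+T"])
  show "((fdiff T ^^ i) (%\<sigma>. U \<sigma> z0) has_real_derivative (fdiff T ^^ i) (%\<sigma>. prim (n \<sigma>) z0) \<sigma>) (at \<sigma> within {s..s+T})"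
   if "\<sigma> \<in> {s..s+T}" for \<sigma>
   by (rule DERIV_subset[OF d]) (use that s in auto)
 qed (use db T in auto)
 then have "\<bar>(fdiff T ^^ Suc i) (%\<sigma>. U \<sigma> z0) s\<bar> <= eps^2 * (T * T * B * eps ^ i)"
  unfolding fdiff_pow_Suc using T by (simp add: mult_ac)
 also have "... <= eps * (T * T * B * eps ^ i)"
  using eps B T by (intro mult_right_mono) (auto simp: power2_eq_square mult_left_le)
 finally show ?thesis unfolding e by (simp add: mult_ac)
qed

end

text \<open>Induction in a loop: slowness of U to order m gives that of W and, with a factor eps^2,
  that of n, hence slowness of U to order m + 1. The constant is chosen before eps and the
  data.\<close>

lemma wave_potential_slow:
 fixes T K :: real and KA KB :: "nat => real"
 shows "\<exists>A\<ge>0. \<forall>eps DA DB P0 n S. wave_data T K KA KB eps DA DB P0 n S \<longrightarrow> (\<forall>z. slow T eps S m A (%s. wpot P0 n s z))"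
proof (induction m)
 case 0
 show ?case
 proof (intro exI[of _ "\<bar>sqrt T * K\<bar>"] conjI allI impI)
  fix eps DA DB P0 n S z assume w: "wave_data T K KA KB eps DA DB P0 n S"
  interpret wave_data T K KA KB eps DA DB P0 n S by (rule w)
  show "slow T eps S 0 \<bar>sqrt T * K\<bar> (%s. wpot P0 n s z)"
   unfolding slow_def by (auto intro: order_trans[OF U_bound])
 qed simp
next
 case (Suc m)
 then obtain A where A: "A >= 0" "!!eps DA DB P0 n S z. wave_data T K KA KB eps DA DB P0 n S ==> slow T eps S m A (%s. wpot P0 n s z)"
  by blast
 define sA sB where "sA = (\<Sum>j\<le>m. T ^ j * \<bar>KA j\<bar>)" and "sB = (\<Sum>j\<le>m. T ^ j * \<bar>KB j\<bar>)"
 define B where "B = 2 ^ m * sB * A + 2 ^ m * sA * (2 ^ m * A * (2 ^ m * A * A))"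
 show ?case
 proof (intro exI[of _ "A + \<bar>T * T * B\<bar>"] conjI allI impI)
  fix eps DA DB P0 n S z assume w: "wave_data T K KA KB eps DA DB P0 n S"
  interpret wave_data T K KA KB eps DA DB P0 n S by (rule w)
  have "sA >= 0" "sB >= 0" using T by (auto simp: sA_def sB_def intro!: sum_nonneg)
  then have B: "B >= 0" using A(1) by (simp add: B_def)
  have ns: "slow T eps S m (eps^2 * B) (%s. n s z)" for z
   unfolding B_def sA_def sB_def by (rule n_slow[OF W_slow[OF A(2)[OF w]] A(1)])
  show "slow T eps S (Suc m) (A + \<bar>T * T * B\<bar>) (%s. wpot P0 n s z)"
   unfolding slow_def
  proof (intro allI impI)
   fix j s assume j: "j <= Suc m" and s: "0 <= s \<and> s + real j * T <= S"
   show "\<bar>(fdiff T ^^ j) (%s. wpot P0 n s z) s\<bar> <= (A + \<bar>T * T * B\<bar>) * eps ^ j"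
   proof (cases "j = Suc m")
    case True
    have "\<bar>(fdiff T ^^ Suc m) (%s. wpot P0 n s z) s\<bar> <= T * T * B * eps ^ Suc m"
     by (rule U_slow_step[OF ns B]) (use s True in auto)
    also have "... <= (A + \<bar>T * T * B\<bar>) * eps ^ Suc m"
     using A(1) eps by (intro mult_right_mono) auto
    finally show ?thesis by (simp only: True)
   next
    case False
    then have "\<bar>(fdiff T ^^ j) (%s. wpot P0 n s z) s\<bar> <= A * eps ^ j"
     using j s by (intro slow_D[OF A(2)[OF w]]) auto
    also have "... <= (A + \<bar>T * T * B\<bar>) * eps ^ j"
     using eps by (intro mult_right_mono) auto
    finally show ?thesis .
   qed
  qed
 qed (use A(1) in simp)
qed

text \<open>The interpolated family solves the equation up to the error of interpolating the
  coefficient products. \<open>nint_product_error\<close> with exponents 1 and 3 gives eps^(M+1),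
  and the prefactor eps^2 raises this to eps^(M+3).\<close>

lemma interpolated_nonlinearity_error:
 fixes T K :: real and KA KB :: "nat => real"
 assumes M: "M >= 1" and T: "T > 0"
 shows "\<exists>C\<ge>0. \<forall>eps DA DB P0 n S s r z. wave_data T K KA KB eps DA DB P0 n S \<and> 0 <= s \<and> s + real M * T <= S \<and> 0 <= r \<and> r <= 1 \<longrightarrow>
  \<bar>nint M T r (%\<sigma>. n \<sigma> z) s - eps^2 * (DB 0 (s + r * T) * nint M T r (%\<sigma>. wfld P0 n \<sigma> z) s +
    DA 0 (s + r * T) * nint M T r (%\<sigma>. wfld P0 n \<sigma> z) s ^ 3)\<bar> <= C * eps ^ (M + 3)"
proof -
 obtain A where A: "A >= 0" "!!eps DA DB P0 n S z. wave_data T K KA KB eps DA DB P0 n S ==> slow T eps S M A (%s. wpot P0 n s z)"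
  using wave_potential_slow[of T K KA KB M] by blast
 have T0: "T >= 0" using T by simp
 obtain C1 where C1: "C1 >= 0" "!!eps D w s r. 0 <= eps ==> eps <= 1 ==> der_chain eps KB D ==> s >= 0 ==>
   (\<forall>j\<le>M. \<bar>(fdiff T ^^ j) w s\<bar> <= A * eps ^ j) ==> 0 <= r ==> r <= 1 ==>
   \<bar>nint M T r (%\<sigma>. D 0 \<sigma> * w \<sigma> ^ 1) s - D 0 (s + r * T) * nint M T r w s ^ 1\<bar> <= C1 * eps ^ Suc M"
  using nint_product_error[OF T0 A(1) M, of KB 1] by blast
 obtain C3 where C3: "C3 >= 0" "!!eps D w s r. 0 <= eps ==> eps <= 1 ==> der_chain eps KA D ==> s >= 0 ==>
   (\<forall>j\<le>M. \<bar>(fdiff T ^^ j) w s\<bar> <= A * eps ^ j) ==> 0 <= r ==> r <= 1 ==>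
   \<bar>nint M T r (%\<sigma>. D 0 \<sigma> * w \<sigma> ^ 3) s - D 0 (s + r * T) * nint M T r w s ^ 3\<bar> <= C3 * eps ^ Suc M"
  using nint_product_error[OF T0 A(1) M, of KA 3] by blast
 show ?thesis
 proof (intro exI[of _ "C1 + C3"] conjI allI impI)
  fix eps DA DB P0 n S and s r z :: real
  assume h: "wave_data T K KA KB eps DA DB P0 n S \<and> 0 <= s \<and> s + real M * T <= S \<and> 0 <= r \<and> r <= 1"
  then interpret wave_data T K KA KB eps DA DB P0 n S by blast
  let ?w = "%\<sigma>. wfld P0 n \<sigma> z"
  have Ws: "slow T eps S M A ?w" by (rule W_slow[OF A(2)]) (use h in blast)
  have wb: "\<forall>j\<le>M. \<bar>(fdiff T ^^ j) ?w s\<bar> <= A * eps ^ j"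
  proof (intro allI impI)
   fix j assume j: "j <= M"
   have "real j * T <= real M * T" using j T by simp
   then show "\<bar>(fdiff T ^^ j) ?w s\<bar> <= A * eps ^ j" using h by (intro slow_D[OF Ws j]) auto
  qed
  have b: "\<bar>nint M T r (%\<sigma>. DB 0 \<sigma> * ?w \<sigma> ^ 1) s - DB 0 (s + r * T) * nint M T r ?w s ^ 1\<bar> <= C1 * eps ^ Suc M"
   by (rule C1(2)[OF _ _ DB _ wb]) (use h eps in auto)
  have a: "\<bar>nint M T r (%\<sigma>. DA 0 \<sigma> * ?w \<sigma> ^ 3) s - DA 0 (s + r * T) * nint M T r ?w s ^ 3\<bar> <= C3 * eps ^ Suc M"
   by (rule C3(2)[OF _ _ DA _ wb]) (use h eps in auto)
  have "nint M T r (%\<sigma>. n \<sigma> z) s = nint M T r (%\<sigma>. eps^2 * (DB 0 \<sigma> * ?w \<sigma> ^ 1 + DA 0 \<sigma> * ?w \<sigma> ^ 3)) s"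
  proof (rule nint_cong(1))
   fix i assume i: "i <= M"
   have "real i * T <= real M * T" using i T by simp
   then have "s + real i * T <= S" using h by linarith
   then show "n (s + real i * T) z = eps^2 * (DB 0 (s + real i * T) * ?w (s + real i * T) ^ 1 + DA 0 (s + real i * T) * ?w (s + real i * T) ^ 3)"
    using n_eq[OF node_nonneg, of s i z] h by simp
  qed
  also have "... = eps^2 * (nint M T r (%\<sigma>. DB 0 \<sigma> * ?w \<sigma> ^ 1) s + nint M T r (%\<sigma>. DA 0 \<sigma> * ?w \<sigma> ^ 3) s)"
   by (simp only: nint_cmult nint_add)
  finally have "nint M T r (%\<sigma>. n \<sigma> z) s - eps^2 * (DB 0 (s + r * T) * nint M T r ?w s + DA 0 (s + r * T) * nint M T r ?w s ^ 3) =
   eps^2 * ((nint M T r (%\<sigma>. DB 0 \<sigma> * ?w \<sigma> ^ 1) s - DB 0 (s + r * T) * nint M T r ?w s ^ 1) +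
    (nint M T r (%\<sigma>. DA 0 \<sigma> * ?w \<sigma> ^ 3) s - DA 0 (s + r * T) * nint M T r ?w s ^ 3))"
   by (simp add: right_diff_distrib distrib_left)
  then have "\<bar>nint M T r (%\<sigma>. n \<sigma> z) s - eps^2 * (DB 0 (s + r * T) * nint M T r ?w s + DA 0 (s + r * T) * nint M T r ?w s ^ 3)\<bar>
   <= eps^2 * (C1 * eps ^ Suc M + C3 * eps ^ Suc M)"
   using a b by (simp add: abs_mult) (intro mult_left_mono order_trans[OF abs_triangle_ineq] add_mono; simp)
  also have "... = (C1 + C3) * eps ^ (M + 3)"
   by (simp add: power_add power2_eq_square power3_eq_cube algebra_simps)
  finally show "\<bar>nint M T r (%\<sigma>. n \<sigma> z) s - eps^2 * (DB 0 (s + r * T) * nint M T r ?w s + DA 0 (s + r * T) * nint M T r ?w s ^ 3)\<bar>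
   <= (C1 + C3) * eps ^ (M + 3)" .
 qed (use C1 C3 in simp)
qed

subsection \<open>An action functional that is nearly conserved\<close>

lemma L2_deriv_cmult:
 assumes "has_L2_derivative S A A' t I"
 shows "has_L2_derivative S (%s x. c * A s x) (%x. c * A' x) t I"
proof -
 have "(c * A s x - c * A t x) / (s - t) - c * A' x = c * ((A s x - A t x) / (s - t) - A' x)" for s x
  by (simp add: right_diff_distrib)
 then show ?thesis
  using L2_cmult_limit[OF assms[unfolded has_L2_derivative_def] tendsto_const[of c]]
  by (simp only: has_L2_derivative_def)
qed

lemma dnint_cmult: "dnint M T r (%s. c * f s) s = c * dnint M T r f s"
 by (simp add: dnint_def fdiff_pow_cmult sum_distrib_left mult_ac)

lemma dnint_diff: "dnint M T r (%s. f s - g s) s = dnint M T r f s - dnint M T r g s"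
 by (simp add: dnint_def fdiff_pow_diff right_diff_distrib sum_subtractf)

lemma L2_deriv_cong:
 assumes d: "has_L2_derivative S A A' t I" and t: "t \<in> I" and e: "!!s x. s \<in> I ==> A s x = B s x" "!!x. A' x = B' x"
 shows "has_L2_derivative S B B' t I"
 unfolding has_L2_derivative_def
 by (rule Lim_transform_eventually[OF d[unfolded has_L2_derivative_def]])
  (rule eventually_mono[OF eventually_at_within_in[where t=t and I=I]], simp add: e t)

text \<open>The moving end point contributes (\<phi> s' - \<phi> s) times a mean of f, and this mean
  is continuous in s'; no derivative of f in its second argument occurs.\<close>

lemma prim_chain:
 assumes f: "continuous_on (X \<times> UNIV) (%(s, y). f s y)" and s: "s \<in> X"
  and g: "((%s'. prim (f s') (\<phi> s)) has_real_derivative g1) (at s within X)"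
  and \<phi>: "(\<phi> has_real_derivative \<phi>') (at s within X)" and \<phi>c: "continuous_on X \<phi>"
 shows "((%s. prim (f s) (\<phi> s)) has_real_derivative g1 + f s (\<phi> s) * \<phi>') (at s within X)"
proof -
 define m where "m = (%s'. integral {0..1} (%\<eta>. f s' (\<phi> s + (\<phi> s' - \<phi> s) * \<eta>)))"
 have eq: "prim (f s') (\<phi> s') = prim (f s') (\<phi> s) + (\<phi> s' - \<phi> s) * m s'" if "s' \<in> X" for s'
  using prim_unit[OF continuous_on_slice[OF f that], of "\<phi> s'" "\<phi> s"] by (simp add: m_def)
 have "continuous_on X (%s'. integral (cbox 0 1) (%\<eta>. f s' (\<phi> s + (\<phi> s' - \<phi> s) * \<eta>)))"
 proof (rule integral_continuous_on_param)
  have c: "continuous_on (X \<times> cbox 0 1) (%q. (fst q, \<phi> s + (\<phi> (fst q) - \<phi> s) * (snd q::real)))"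
   by (intro continuous_intros continuous_on_compose2[OF \<phi>c]) auto
  have "(%q. (fst q, \<phi> s + (\<phi> (fst q) - \<phi> s) * snd q)) ` (X \<times> cbox 0 1) \<subseteq> X \<times> UNIV" by auto
  from continuous_on_compose2[OF f c this]
  show "continuous_on (X \<times> cbox 0 1) (%(s', \<eta>). f s' (\<phi> s + (\<phi> s' - \<phi> s) * \<eta>))"
   by (simp add: case_prod_beta)
 qed
 then have "continuous_on X m" by (simp add: m_def)
 then have mc: "(m \<longlongrightarrow> m s) (at s within X)" using s by (simp add: continuous_on_def)
 have ms: "m s = f s (\<phi> s)" by (simp add: m_def)
 have "((%s'. (\<phi> s' - \<phi> s) / (s' - s) * m s') \<longlongrightarrow> \<phi>' * f s (\<phi> s)) (at s within X)"
  using tendsto_mult[OF \<phi>[unfolded has_field_derivative_iff] mc] by (simp only: ms)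
 then have "((%s'. (\<phi> s' - \<phi> s) * m s') has_real_derivative \<phi>' * f s (\<phi> s)) (at s within X)"
  by (simp add: has_field_derivative_iff)
 from DERIV_add[OF g this, unfolded mult.commute[of \<phi>' "f s (\<phi> s)"]] show ?thesis
  by (rule has_field_derivative_transform_within[where d=1]) (use s eq in \<open>auto simp: mult.commute\<close>)
qed

text \<open>Up to S1 all M later nodes stay inside [0, S]. The error bound \<kappa> is kept abstract
  so that it can be followed through the conservation argument.\<close>

locale wave_window = wave_data T K KA KB eps DA DB P0 n S
 for T K :: real and KA KB :: "nat => real" and eps :: real and DA DB :: "nat => real => real"
  and P0 :: "real => real" and n :: "real => real => real" and S :: real +
 fixes M :: nat and S1 C \<kappa> :: real
 assumes M: "M >= 1" and S1: "0 <= S1" "S1 + real M * T <= S"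
  and C1: "C >= 1" and C: "!!j r. j <= M ==> r \<in> {0..1} ==> \<bar>poly (newton_poly j) r\<bar> <= C \<and> \<bar>poly (pderiv (newton_poly j)) r\<bar> <= C"
  and \<kappa>: "\<kappa> >= 0"
  and err: "!!s r z. 0 <= s ==> s <= S1 ==> 0 <= r ==> r <= 1 ==>
   \<bar>nint M T r (%\<sigma>. n \<sigma> z) s - eps^2 * (DB 0 (s + r * T) * nint M T r (%\<sigma>. wfld P0 n \<sigma> z) s +
    DA 0 (s + r * T) * nint M T r (%\<sigma>. wfld P0 n \<sigma> z) s ^ 3)\<bar> <= \<kappa>"
begin

text \<open>The interpolants at the slow phase \<open>r\<close> approximate the values at time \<open>s + r * T\<close>; \<open>\<rho>r\<close>, \<open>om\<close>,
\<open>dn\<close>, \<open>dw\<close> are the derivatives in \<open>r\<close>.\<close>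

definition "Rr s r z = nint M T r (%\<sigma>. R \<sigma> z) s"
definition "nr s r z = nint M T r (%\<sigma>. n \<sigma> z) s"
definition "Ur s r z = nint M T r (%\<sigma>. U \<sigma> z) s"
definition "wr s r z = nint M T r (%\<sigma>. W \<sigma> z) s"
definition "\<rho>r s r z = dnint M T r (%\<sigma>. R \<sigma> z) s"
definition "om s r z = dnint M T r (%\<sigma>. U \<sigma> z) s"
definition "dn s r z = dnint M T r (%\<sigma>. n \<sigma> z) s"
definition "dw s r z = dnint M T r (%\<sigma>. W \<sigma> z) s"
definition "mu s r z = nint M T r (%\<sigma>. prim (n \<sigma>) z) s"
definition "G s r z = eps^2 * (DB 0 (s + r * T) * wr s r z + DA 0 (s + r * T) * wr s r z ^ 3)"

lemma T0: "T >= 0" using T by simp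

lemma W_cont: "continuous_on UNIV (%(s, z). W s z)"
proof -
 have "continuous_on UNIV (%q::real \<times> real. (fst q, 2 * fst q - snd q))" by (intro continuous_intros)
 from continuous_on_compose2[OF U_cont this]
 have "continuous_on UNIV (%q::real \<times> real. (U (fst q) (snd q) - U (fst q) (2 * fst q - snd q)) / 2)"
  using U_cont by (intro continuous_intros) (auto simp: case_prod_beta)
 then show ?thesis by (simp add: wfld_def case_prod_beta)
qed

lemma coef_cont: "continuous_on {0..} (DA i)" "continuous_on {0..} (DB i)"
 using DA DB unfolding der_chain_def continuous_on_eq_continuous_within
 by (auto intro!: DERIV_continuous)

context
 fixes X :: "'x::metric_space set" and a b c :: "'x => real"
 assumes abc: "continuous_on X a" "continuous_on X b" "continuous_on X c"
begin

lemma window_cont: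
 "continuous_on X (%q. Rr (a q) (b q) (c q))" "continuous_on X (%q. nr (a q) (b q) (c q))"
 "continuous_on X (%q. Ur (a q) (b q) (c q))" "continuous_on X (%q. wr (a q) (b q) (c q))"
 "continuous_on X (%q. \<rho>r (a q) (b q) (c q))" "continuous_on X (%q. om (a q) (b q) (c q))"
 "continuous_on X (%q. dn (a q) (b q) (c q))" "continuous_on X (%q. dw (a q) (b q) (c q))"
 "continuous_on X (%q. mu (a q) (b q) (c q))"
 unfolding Rr_def nr_def Ur_def wr_def \<rho>r_def om_def dn_def dw_def mu_def
 by (intro continuous_on_nint abc R_cont n_cont U_cont W_cont prim_n_cont)+

lemma coef_window_cont:
 assumes "!!q. q \<in> X ==> a q >= 0 \<and> b q >= 0"
 shows "continuous_on X (%q. DA i (a q + b q * T))" "continuous_on X (%q. DB i (a q + b q * T))"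
 by (rule continuous_on_compose2[OF coef_cont(1)], use assms T0 in \<open>auto intro!: continuous_intros abc\<close>)
  (rule continuous_on_compose2[OF coef_cont(2)], use assms T0 in \<open>auto intro!: continuous_intros abc\<close>)

lemma G_cont:
 assumes "!!q. q \<in> X ==> a q >= 0 \<and> b q >= 0"
 shows "continuous_on X (%q. G (a q) (b q) (c q))"
 unfolding G_def by (intro continuous_intros coef_window_cont assms window_cont)

end

lemma wr_eq: "s >= 0 ==> wr s r z = (1/2) * (Ur s r z - Ur s r (2 * s - z))"
proof -
 assume s: "s >= 0"
 have "wr s r z = nint M T r (%\<sigma>. (1/2) * (U \<sigma> z - U \<sigma> (2 * s - z))) s"
  unfolding wr_def by (rule nint_cong(1)) (rule W_node[OF s])
 then show ?thesis by (simp only: nint_cmult nint_diff Ur_def)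
qed

lemma dw_eq: "s >= 0 ==> dw s r z = (1/2) * (om s r z - om s r (2 * s - z))"
proof -
 assume s: "s >= 0"
 have "dw s r z = dnint M T r (%\<sigma>. (1/2) * (U \<sigma> z - U \<sigma> (2 * s - z))) s"
  unfolding dw_def by (rule nint_cong(2)) (rule W_node[OF s])
 then show ?thesis by (simp only: dnint_cmult dnint_diff om_def)
qed

lemma Ur_prim: "Ur s r z = prim P0 z + prim (Rr s r) z"
proof -
 have "Rr s r = (%y. nint M T r (%\<sigma>. R \<sigma> y) s)" by (simp add: Rr_def fun_eq_iff)
 then show ?thesis by (simp add: Ur_def wpot_def nint_add nint_const prim_nint[OF R_cont])
qed

lemma om_prim: "om s r z = prim (\<rho>r s r) z"
proof -
 have "\<rho>r s r = (%y. dnint M T r (%\<sigma>. R \<sigma> y) s)" by (simp add: \<rho>r_def fun_eq_iff)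
 then show ?thesis by (simp add: om_def wpot_def dnint_add dnint_const prim_nint[OF R_cont])
qed

lemma mu_prim: "mu s r z = prim (nr s r) z"
proof -
 have "nr s r = (%y. nint M T r (%\<sigma>. n \<sigma> y) s)" by (simp add: nr_def fun_eq_iff)
 then show ?thesis by (simp add: mu_def prim_nint[OF n_cont])
qed

lemma window_periodic:
 assumes s: "s >= 0"
 shows "periodic T (Rr s r)" "periodic T (nr s r)" "periodic T (Ur s r)" "periodic T (om s r)" "periodic T (mu s r)"
 unfolding periodic_def Rr_def nr_def Ur_def om_def mu_def
 by (intro allI nint_cong periodic_D[OF R_periodic] n_per periodic_D[OF U_periodic] periodic_D[OF prim_n_periodic]
   node_nonneg s)+

lemma wr_anti: "s >= 0 ==> wr s r (2 * s - z) = - wr s r z"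
proof -
 assume s: "s >= 0"
 have e: "2 * s - (2 * s - z) = z" by simp
 show ?thesis by (simp only: wr_eq[OF s] e) (simp add: right_diff_distrib)
qed

lemma G_anti: "s >= 0 ==> G s r (2 * s - z) = - G s r z"
 by (simp only: G_def wr_anti power3_eq_cube) (simp add: algebra_simps)

lemma wr_periodic: "s >= 0 ==> periodic T (wr s r)"
proof -
 assume s: "s >= 0"
 have U: "periodic T (Ur s r)" by (rule window_periodic[OF s])
 have "Ur s r (2 * s - (z + T)) = Ur s r (2 * s - z)" for z
  using periodic_D[OF U, of "2 * s - (z + T)"] by (simp add: algebra_simps)
 then show ?thesis unfolding periodic_def wr_eq[OF s] using periodic_D[OF U] by simp
qed

lemma G_periodic: "s >= 0 ==> periodic T (G s r)"
 using periodic_D[OF wr_periodic] by (simp add: periodic_def G_def)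

lemma nr_anti: "s >= 0 ==> nr s r (2 * s - z) = - nr s r z"
proof -
 assume s: "s >= 0"
 have "n (s + real i * T) (2 * s - z) = (- 1) * n (s + real i * T) z" for i
 proof -
  have s': "s + real i * T >= 0" by (rule node_nonneg[OF s])
  have "2 * s - z + real (2 * i) * T = 2 * (s + real i * T) - z" by (simp add: algebra_simps)
  from periodic_nat[OF n_periodic[OF s'], of "2 * s - z" "2 * i", unfolded this]
  show ?thesis by (simp only: n_anti[OF s'] mult_minus1)
 qed
 then have "nr s r (2 * s - z) = nint M T r (%\<sigma>. (- 1) * n \<sigma> z) s"
  unfolding nr_def by (intro nint_cong(1))
 then show ?thesis by (simp only: nint_cmult nr_def)
qed

lemma cont_z:
 "continuous_on X (Rr s r)" "continuous_on X (nr s r)" "continuous_on X (Ur s r)" "continuous_on X (wr s r)"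
 "continuous_on X (\<rho>r s r)" "continuous_on X (om s r)" "continuous_on X (mu s r)" "continuous_on X (dw s r)"
 using window_cont[of X "%q. s" "%q. r" "%q. q"] by simp_all

lemma G_cont_z: "s >= 0 ==> r >= 0 ==> continuous_on X (G s r)"
 using G_cont[of X "%q. s" "%q. r" "%q. q"] by simp

lemma Rr_deriv: "s >= 0 ==> ((%s. Rr s r z) has_real_derivative nr s r z) (at s within {0..})"
 unfolding Rr_def nr_def by (rule nint_deriv_s[OF T0 R_deriv])

lemma Ur_deriv: "s >= 0 ==> ((%s. Ur s r z) has_real_derivative mu s r z) (at s within {0..})"
 unfolding Ur_def mu_def by (rule nint_deriv_s[OF T0 U_deriv])

lemma \<rho>r_deriv: "s >= 0 ==> ((%s. \<rho>r s r z) has_real_derivative dn s r z) (at s within {0..})"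
 unfolding \<rho>r_def dn_def by (rule dnint_deriv_s[OF T0 R_deriv])

lemma I_sub: "s \<in> {0..S1} ==> s >= 0" "{0..S1} \<subseteq> {0..}" by auto

lemma mu_anti: "s >= 0 ==> mu s r (2 * s - z) = mu s r z"
 unfolding mu_prim by (rule prim_antisym[OF cont_z(2) nr_anti])

text \<open>The interpolated profile, with primitive \<open>Ur\<close>. P0 enters unchanged because
  interpolation reproduces what does not depend on s.\<close>

definition "Q s r z = P0 z + Rr s r z"

lemma Q_locL2: "locL2 (Q s r)"
proof -
 have "Q s r = (%z. P0 z + Rr s r z)" by (simp add: Q_def fun_eq_iff)
 then show ?thesis using locL2_add[OF P0(1) locL2_continuous[OF cont_z(1)]] by simp
qed

lemma Q_periodic: "s >= 0 ==> periodic T (Q s r)"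
 using P0(2) window_periodic(1)[of s r] by (simp add: periodic_def Q_def)

lemma Q_L2_deriv:
 assumes s: "s \<in> {0..S1}"
 shows "has_L2_derivative {0..T} (%s. Q s r) (nr s r) s {0..S1}"
proof -
 have d: "has_L2_derivative {0..T} (%s. Rr s r) (nr s r) s {0..S1}"
 proof (rule L2_deriv_jointly_continuous)
  show "((%s. Rr s r x) has_real_derivative nr s r x) (at s within {0..S1})" if "s \<in> {0..S1}" for s x
   by (rule DERIV_subset[OF Rr_deriv I_sub(2)]) (use that in simp)
  have "continuous_on ({0..S1} \<times> {0..T}) (%q. nr (fst q) r (snd q))" by (intro window_cont continuous_intros)
  then show "continuous_on ({0..S1} \<times> {0..T}) (%(s, x). nr s r x)" by (simp add: case_prod_beta)
 qed (use s T0 cont_z in auto)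
 have "has_L2_derivative {0..T} (%s x. P0 x + Rr s r x) (%x. 0 + nr s r x) s {0..S1}"
  by (rule L2_deriv_add[OF L2_deriv_const _ _ d])
   (use s in \<open>auto intro: locL2_D[OF P0(1)] L2_continuous[OF cont_z(1)] L2_continuous[OF cont_z(2)] L2_zero\<close>)
 then show ?thesis by (rule L2_deriv_cong) (use s in \<open>auto simp: Q_def\<close>)
qed

text \<open>Differentiating U(z) - U(2s - z) in s gives two terms with \<open>mu\<close>, which
  cancel by symmetry of \<open>mu\<close> about s, and the motion of the end point, which leaves
  minus the reflected profile. The P0 part is only differentiable in the mean, the remaining part
  classically.\<close>

lemma wr_L2_deriv:
 assumes s: "s \<in> {0..S1}"
 shows "has_L2_derivative {0..T} (%s. wr s r) (%z. - Q s r (2 * s - z)) s {0..S1}"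
proof -
 define B where "B = (%s z. (1/2) * (prim (Rr s r) z - prim (Rr s r) (2 * s - z)))"
 have Rc: "continuous_on ({0..S1} \<times> UNIV) (%(s, y). Rr s r y)"
  using window_cont(1)[of "{0..S1} \<times> (UNIV::real set)" fst "%q. r" snd] by (simp add: case_prod_beta continuous_intros)
 have pR: "((%s. prim (Rr s r) y) has_real_derivative mu s r y) (at s within {0..S1})" if "s \<in> {0..S1}" for s y
 proof -
  have "((%s. Ur s r y - prim P0 y) has_real_derivative mu s r y - 0) (at s within {0..S1})"
   by (intro derivative_intros DERIV_subset[OF Ur_deriv I_sub(2)]) (use that in simp)
  then show ?thesis by (simp add: Ur_prim)
 qed
 have pc: "continuous_on UNIV (prim (Rr s r))" for s by (rule prim_continuous[OF loc_int_continuous[OF cont_z(1)]])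
 have Bc: "continuous_on X (B s)" for s X unfolding B_def
  by (intro continuous_intros continuous_on_compose2[OF pc]) auto
 have dB: "has_L2_derivative {0..T} B (%z. - Rr s r (2 * s - z)) s {0..S1}"
 proof (rule L2_deriv_jointly_continuous)
  fix \<sigma> z assume \<sigma>: "\<sigma> \<in> {0..S1}"
  have "((%s. prim (Rr s r) (2 * s - z)) has_real_derivative mu \<sigma> r (2 * \<sigma> - z) + Rr \<sigma> r (2 * \<sigma> - z) * 2) (at \<sigma> within {0..S1})"
   by (rule prim_chain[OF Rc \<sigma> pR[OF \<sigma>]]) (auto intro!: derivative_eq_intros continuous_intros)
  from DERIV_cmult[OF DERIV_diff[OF pR[OF \<sigma>, of z] this], of "1/2"]
  show "((%s. B s z) has_real_derivative - Rr \<sigma> r (2 * \<sigma> - z)) (at \<sigma> within {0..S1})"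
   using \<sigma> by (simp add: B_def mu_anti)
 next
  have "continuous_on ({0..S1} \<times> {0..T}) (%q. - Rr (fst q) r (2 * fst q - snd q))"
   by (intro continuous_intros window_cont)
  then show "continuous_on ({0..S1} \<times> {0..T}) (%(s, z). - Rr s r (2 * s - z))" by (simp add: case_prod_beta)
 qed (use s T0 Bc in auto)
 have p0: "prim P0 \<in> L2_space {0..T}" by (rule L2_continuous[OF continuous_on_subset[OF P0_prim_cont]]) simp
 have dA: "has_L2_derivative {0..T} (%s z. (-1/2) * prim P0 (2 * s - z)) (%z. (-1/2) * (2 * P0 (2 * s - z))) s {0..S1}"
  by (intro L2_deriv_cmult L2_deriv_flip P0(1) T0 s) simp
 have fl: "(%z. prim P0 (2 * s - z)) \<in> L2_space {0..T}" for s
  by (rule locL2_D[OF locL2_flip[OF locL2_continuous[OF P0_prim_cont]]])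
 have flP: "(%z. P0 (2 * s - z)) \<in> L2_space {0..T}" for s by (rule locL2_D[OF locL2_flip[OF P0(1)]])
 have flR: "(%z. Rr s r (2 * s - z)) \<in> L2_space {0..T}" for s
  by (rule locL2_D[OF locL2_flip[OF locL2_continuous[OF cont_z(1)]]])
 have d1: "has_L2_derivative {0..T} (%s z. (-1/2) * prim P0 (2 * s - z) + B s z)
   (%z. (-1/2) * (2 * P0 (2 * s - z)) + - Rr s r (2 * s - z)) s {0..S1}"
  by (rule L2_deriv_add[OF dA _ _ dB]) (intro L2_cmult fl flP L2_uminus flR L2_continuous[OF Bc] s)+
 have d2: "has_L2_derivative {0..T} (%s z. (1/2) * prim P0 z + ((-1/2) * prim P0 (2 * s - z) + B s z))
   (%z. 0 + ((-1/2) * (2 * P0 (2 * s - z)) + - Rr s r (2 * s - z))) s {0..S1}"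
  by (rule L2_deriv_add[OF L2_deriv_const _ _ d1])
   (intro L2_cmult p0 L2_zero L2_add fl L2_continuous[OF Bc] flP L2_uminus flR s)+
 show ?thesis
 proof (rule L2_deriv_cong[OF d2 s])
  show "(1/2) * prim P0 z + ((-1/2) * prim P0 (2 * \<sigma> - z) + B \<sigma> z) = wr \<sigma> r z" if "\<sigma> \<in> {0..S1}" for \<sigma> z
   using that by (simp add: wr_eq Ur_prim B_def algebra_simps)
  show "0 + ((-1/2) * (2 * P0 (2 * s - z)) + - Rr s r (2 * s - z)) = - Q s r (2 * s - z)" for z
   by (simp add: Q_def)
 qed
qed

text \<open>\<open>e - h\<close> is the Hamiltonian of the interpolated family at fixed r:
  \<open>e\<close> is quadratic in the profile, and \<open>h\<close> has the integrand of the
  potential whose gradient is \<open>G\<close>. \<open>hs\<close> is the derivative of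
  \<open>h\<close> through the coefficients alone.\<close>

definition "e s r = (LINT z|lebesgue_on {0..T}. Q s r z * Q s r z) / 2"
definition "h2 s r = integral {0..T} (%z. (wr s r z)^2)"
definition "h4 s r = integral {0..T} (%z. (wr s r z)^2 * (wr s r z)^2)"
definition "h s r = eps^2 * (DB 0 (s + r * T) / 2 * h2 s r + DA 0 (s + r * T) / 4 * h4 s r)"
definition "hs s r = eps^2 * (DB 1 (s + r * T) / 2 * h2 s r + DA 1 (s + r * T) / 4 * h4 s r)"

lemma wr_L2: "wr s r \<in> L2_space {0..T}" "(%z. (wr s r z)^2) \<in> L2_space {0..T}"
 by (auto intro!: L2_continuous continuous_intros cont_z)

lemma LINT_cont:
 fixes f :: "real => real"
 shows "continuous_on {0..T} f ==> (LINT z|lebesgue_on {0..T}. f z) = integral {0..T} f"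
 using LINT_eq_integral[OF L2_integrable[OF L2_continuous lmeasurable_Icc]] .

lemma coef_deriv_s:
 assumes "s >= 0" "r >= 0"
 shows "((%s. DA 0 (s + r * T)) has_real_derivative DA 1 (s + r * T)) (at s within {0..})"
  "((%s. DB 0 (s + r * T)) has_real_derivative DB 1 (s + r * T)) (at s within {0..})"
proof -
 have l: "((%s. s + r * T) has_real_derivative 1) (at s within {0..})" by (auto intro!: derivative_eq_intros)
 have p: "s + r * T >= 0" using assms T0 by simp
 have sub: "(%s. s + r * T) ` {0..} \<subseteq> {0..}" using assms T0 by auto
 have "(DA 0 has_real_derivative DA 1 (s + r * T)) (at (s + r * T) within (%s. s + r * T) ` {0..})"
  "(DB 0 has_real_derivative DB 1 (s + r * T)) (at (s + r * T) within (%s. s + r * T) ` {0..})"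
  using DA DB p by (auto simp: der_chain_def intro!: DERIV_subset[OF _ sub])
 from DERIV_image_chain[OF this(1) l] DERIV_image_chain[OF this(2) l]
 show "((%s. DA 0 (s + r * T)) has_real_derivative DA 1 (s + r * T)) (at s within {0..})"
  "((%s. DB 0 (s + r * T)) has_real_derivative DB 1 (s + r * T)) (at s within {0..})"
  by (simp_all add: o_def)
qed

lemma coef_deriv_r:
 assumes "s >= 0" "r \<in> {0..1}"
 shows "((%r. DA 0 (s + r * T)) has_real_derivative T * DA 1 (s + r * T)) (at r within {0..1})"
  "((%r. DB 0 (s + r * T)) has_real_derivative T * DB 1 (s + r * T)) (at r within {0..1})"
proof -
 have l: "((%r. s + r * T) has_real_derivative T) (at r within {0..1})" by (auto intro!: derivative_eq_intros)
 have p: "s + r * T >= 0" using assms T0 by simp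
 have sub: "(%r. s + r * T) ` {0..1} \<subseteq> {0..}" using assms T0 by auto
 have "(DA 0 has_real_derivative DA 1 (s + r * T)) (at (s + r * T) within (%r. s + r * T) ` {0..1})"
  "(DB 0 has_real_derivative DB 1 (s + r * T)) (at (s + r * T) within (%r. s + r * T) ` {0..1})"
  using DA DB p by (auto simp: der_chain_def intro!: DERIV_subset[OF _ sub])
 from DERIV_image_chain[OF this(1) l] DERIV_image_chain[OF this(2) l]
 show "((%r. DA 0 (s + r * T)) has_real_derivative T * DA 1 (s + r * T)) (at r within {0..1})"
  "((%r. DB 0 (s + r * T)) has_real_derivative T * DB 1 (s + r * T)) (at r within {0..1})"
  by (simp_all add: o_def mult.commute)
qed

text \<open>The substitution z -> 2s - z over a full period and antisymmetry of \<open>G\<close>.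
  This sign converts the reflected profile in the derivative of \<open>wr\<close> into the profile
  itself.\<close>

lemma G_flip:
 assumes s: "s >= 0" "r >= 0" and f: "periodic T f" "locL2 f"
 shows "integral {0..T} (%z. G s r z * f (2 * s - z)) = - integral {0..T} (%z. G s r z * f z)"
proof -
 have p: "periodic T (%z. G s r z * f z)" using f(1) G_periodic[OF s(1)] by (simp add: periodic_def)
 have "loc_int (%z. G s r z * f z)" unfolding loc_int_def
  using L2_mult_integrable[OF L2_continuous[OF G_cont_z[OF s]] locL2_D[OF f(2)]] by (auto intro: integrable_on_lebesgue_on)
 from periodic_integral_flip[OF p this T0, of "2 * s"] show ?thesis by (simp add: G_anti[OF s(1)])
qed

definition "k s r = integral {0..T} (%z. Q s r z * (nr s r z - G s r z)) - hs s r"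

text \<open>The derivative of \<open>e\<close> is the pairing of \<open>Q\<close> with
  \<open>nr\<close>; the derivative of \<open>h\<close> through the field is the pairing of
  \<open>Q\<close> with \<open>G\<close>. Their difference involves only the interpolation error,
  and the explicit s-dependence of the coefficients remains as \<open>hs\<close>.\<close>

lemma eh_deriv:
 assumes s: "s \<in> {0..S1}" and r: "r \<in> {0..1}"
 shows "((%s. e s r - h s r) has_real_derivative k s r) (at s within {0..S1})"
proof -
 have s0: "s >= 0" and r0: "r >= 0" using s r by auto
 have QL: "Q s r \<in> L2_space {0..T}" for s by (rule locL2_D[OF Q_locL2])
 have nL: "nr s r \<in> L2_space {0..T}" by (rule L2_continuous[OF cont_z(2)])
 have GL: "G s r \<in> L2_space {0..T}" by (rule L2_continuous[OF G_cont_z[OF s0 r0]])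
 have QfL: "(%z. - Q s r (2 * s - z)) \<in> L2_space {0..T}" by (rule L2_uminus[OF locL2_D[OF locL2_flip[OF Q_locL2]]])
 let ?M = "lebesgue_on {0..T}"
 have de: "((%s. e s r) has_real_derivative (LINT z|?M. Q s r z * nr s r z)) (at s within {0..S1})"
  unfolding e_def using DERIV_cdivide[OF L2_deriv_inner[OF Q_L2_deriv[OF s] QL nL Q_L2_deriv[OF s] QL nL s], of 2]
  by (simp add: mult.commute)
 have d2: "((%s. LINT z|?M. wr s r z * wr s r z) has_real_derivative
   (LINT z|?M. - Q s r (2 * s - z) * wr s r z) + (LINT z|?M. wr s r z * - Q s r (2 * s - z))) (at s within {0..S1})"
  by (rule L2_deriv_inner[OF wr_L2_deriv[OF s] wr_L2(1) QfL wr_L2_deriv[OF s] wr_L2(1) QfL s])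
 then have dh2: "((%s. h2 s r) has_real_derivative 2 * (LINT z|?M. - Q s r (2 * s - z) * wr s r z)) (at s within {0..S1})"
  by (simp add: h2_def LINT_cont cont_z continuous_intros power2_eq_square mult.commute)
 obtain B where B: "!!s x. s \<in> {0..S1} ==> x \<in> {0..T} ==> \<bar>wr s r x\<bar> <= B"
 proof -
  have "continuous_on ({0..S1} \<times> {0..T}) (%q. wr (fst q) r (snd q))" by (intro window_cont continuous_intros)
  then have "bounded ((%q. wr (fst q) r (snd q)) ` ({0..S1} \<times> {0..T}))"
   by (intro compact_imp_bounded compact_continuous_image compact_Times) auto
  then obtain B where "\<forall>q\<in>{0..S1} \<times> {0..T}. \<bar>wr (fst q) r (snd q)\<bar> <= B" unfolding bounded_iff by auto
  then show ?thesis using that by force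
 qed
 have wc: "continuous_on ({0..S1} \<times> {0..T}) (%(s, x). wr s r x)"
  using window_cont(4)[of "{0..S1} \<times> {0..T}" fst "%q. r" snd] by (simp add: case_prod_beta continuous_intros)
 have dsq: "has_L2_derivative {0..T} (%s x. (wr s r x)^2) (%x. 2 * wr s r x * - Q s r (2 * s - x)) s {0..S1}"
  by (rule L2_deriv_square[OF wr_L2_deriv[OF s] QfL wc B s T0])
 have sqL: "(%x. 2 * wr s r x * - Q s r (2 * s - x)) \<in> L2_space {0..T}"
 proof -
  have "(%x. - Q s r (2 * s - x) * (2 * wr s r x)) \<in> L2_space {0..T}"
  proof (rule L2_mult_bounded(1)[OF lmeasurable_Icc QfL, where B="\<bar>2 * B\<bar>"])
   show "(%x. 2 * wr s r x) \<in> borel_measurable (lebesgue_on {0..T})"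
    by (rule L2_measurable[OF L2_cmult[OF wr_L2(1)]])
   show "\<bar>2 * wr s r x\<bar> <= \<bar>2 * B\<bar>" if "x \<in> {0..T}" for x using B[OF s that] by simp
  qed simp
  then show ?thesis by (simp add: mult.commute)
 qed
 have d4: "((%s. LINT z|?M. (wr s r z)^2 * (wr s r z)^2) has_real_derivative
   (LINT z|?M. 2 * wr s r z * - Q s r (2 * s - z) * (wr s r z)^2) + (LINT z|?M. (wr s r z)^2 * (2 * wr s r z * - Q s r (2 * s - z)))) (at s within {0..S1})"
  by (rule L2_deriv_inner[OF dsq wr_L2(2) sqL dsq wr_L2(2) sqL s])
 have e4: "(LINT z|?M. 2 * wr s r z * - Q s r (2 * s - z) * (wr s r z)^2) = 2 * (LINT z|?M. - Q s r (2 * s - z) * wr s r z ^ 3)"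
  unfolding integral_mult_right_zero[symmetric]
  by (intro Bochner_Integration.integral_cong refl) (simp add: power2_eq_square power3_eq_cube)
 have e4': "(LINT z|?M. (wr s r z)^2 * (2 * wr s r z * - Q s r (2 * s - z))) = 2 * (LINT z|?M. - Q s r (2 * s - z) * wr s r z ^ 3)"
  unfolding integral_mult_right_zero[symmetric]
  by (intro Bochner_Integration.integral_cong refl) (simp add: power2_eq_square power3_eq_cube)
 have dh4: "((%s. h4 s r) has_real_derivative 4 * (LINT z|?M. - Q s r (2 * s - z) * wr s r z ^ 3)) (at s within {0..S1})"
  using d4 unfolding e4 e4' by (simp add: h4_def LINT_cont cont_z continuous_intros)
 note cA = DERIV_subset[OF coef_deriv_s(1)[OF s0 r0] I_sub(2)] and cB = DERIV_subset[OF coef_deriv_s(2)[OF s0 r0] I_sub(2)]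
 have w3: "(%z. wr s r z ^ 3) \<in> L2_space {0..T}" by (intro L2_continuous continuous_intros cont_z)
 have dh: "((%s. h s r) has_real_derivative hs s r + eps^2 * (DB 0 (s + r * T) * (LINT z|?M. - Q s r (2 * s - z) * wr s r z) +
   DA 0 (s + r * T) * (LINT z|?M. - Q s r (2 * s - z) * wr s r z ^ 3))) (at s within {0..S1})"
  unfolding h_def hs_def
  by (rule derivative_eq_intros cA cB dh2 dh4 refl | simp add: algebra_simps)+
 have "eps^2 * (DB 0 (s + r * T) * (LINT z|?M. - Q s r (2 * s - z) * wr s r z) +
   DA 0 (s + r * T) * (LINT z|?M. - Q s r (2 * s - z) * wr s r z ^ 3)) =
   (LINT z|?M. eps^2 * (DB 0 (s + r * T) * (- Q s r (2 * s - z) * wr s r z) + DA 0 (s + r * T) * (- Q s r (2 * s - z) * wr s r z ^ 3)))"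
  using L2_mult_integrable[OF QfL wr_L2(1)] L2_mult_integrable[OF QfL w3] by simp
 also have "... = (LINT z|?M. - (G s r z * Q s r (2 * s - z)))"
  by (intro Bochner_Integration.integral_cong refl) (simp add: G_def algebra_simps)
 also have "... = - integral {0..T} (%z. G s r z * Q s r (2 * s - z))"
  using LINT_eq_integral[OF L2_mult_integrable[OF GL locL2_D[OF locL2_flip[OF Q_locL2]]]] by simp
 also have "... = integral {0..T} (%z. G s r z * Q s r z)"
  using G_flip[OF s0 r0 Q_periodic[OF s0] Q_locL2] by simp
 also have "... = (LINT z|?M. Q s r z * G s r z)"
  using LINT_eq_integral[OF L2_mult_integrable[OF QL GL]] by (simp add: mult.commute)
 finally have dh': "((%s. h s r) has_real_derivative hs s r + (LINT z|?M. Q s r z * G s r z)) (at s within {0..S1})"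
  using dh by simp
 have "(LINT z|?M. Q s r z * nr s r z) - (LINT z|?M. Q s r z * G s r z) = (LINT z|?M. Q s r z * (nr s r z - G s r z))"
  using L2_mult_integrable[OF QL nL] L2_mult_integrable[OF QL GL] by (simp add: right_diff_distrib)
 also have "... = integral {0..T} (%z. Q s r z * (nr s r z - G s r z))"
  by (rule LINT_eq_integral[OF L2_mult_integrable[OF QL L2_diff[OF nL GL]]])
 finally have "(LINT z|?M. Q s r z * nr s r z) - (hs s r + (LINT z|?M. Q s r z * G s r z)) = k s r"
  by (simp add: k_def)
 with DERIV_diff[OF de dh'] show ?thesis by (simp only:)
qed

end

section \<open>Integrals depending on a parameter\<close>

lemma integral_swap_Icc:
 fixes f :: "real => real => real"
 assumes "continuous_on ({a..b} \<times> {c..d}) (%(x, y). f x y)"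
 shows "integral {a..b} (%x. integral {c..d} (f x)) = integral {c..d} (%y. integral {a..b} (%x. f x y))"
 using integral_swap_continuous[of a c b d f] assms by (simp add: cbox_Pair_eq)

lemma continuous_integral_param:
 fixes f :: "'a::metric_space => real => real"
 assumes "continuous_on (X \<times> {a..b}) (%(x, y). f x y)"
 shows "continuous_on X (%x. integral {a..b} (f x))"
 using integral_continuous_on_param[of X a b f] assms by simp

lemma leibniz_real:
 fixes f f' :: "real => real => real"
 assumes "!!x t. x \<in> X ==> t \<in> {a..b} ==> ((%x. f x t) has_real_derivative f' x t) (at x within X)"
  and "!!x. x \<in> X ==> continuous_on {a..b} (f x)"
  and "continuous_on (X \<times> {a..b}) (%(x, t). f' x t)" and "x0 \<in> X" "convex X"
 shows "((%x. integral {a..b} (f x)) has_real_derivative integral {a..b} (f' x0)) (at x0 within X)"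
 using leibniz_rule_field_derivative[of X a b f f' x0] assms by (simp add: integrable_continuous_real)

lemma integral_FTC_real:
 assumes "a <= b" "!!x. x \<in> {a..b} ==> (F has_real_derivative f x) (at x within {a..b})"
 shows "integral {a..b} f = F b - F a"
 using fundamental_theorem_of_calculus[OF assms(1), of F f] assms(2)
 by (simp add: has_real_derivative_iff_has_vector_derivative integral_unique)

section \<open>The Noether identity for shifts of the phase\<close>

context wave_window begin

text \<open>\<open>D\<close> is, up to sign, half the pairing of the r-derivative of the profile
  with its own primitive, integrated over 0 <= r <= 1: the symplectic action of the curve r ->
  \<open>Q s r\<close>. \<open>Lam\<close> is the boundary term that its s-derivative leaves at the
  ends of this curve.\<close>

definition "Lam s = - (1/2) * integral {0..T} (%z. n s z * U s z)"
definition "D s = - (1/2) * integral {0..T} (%z. integral {0..1} (%r. \<rho>r s r z * Ur s r z))"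

lemma endpoint_values:
 "nr s 0 z = n s z" "Ur s 0 z = U s z" "wr s 0 z = W s z" "nr s 1 z = n (s + T) z" "Ur s 1 z = U (s + T) z" "wr s 1 z = W (s + T) z"
 using nint_nat[of 0 M T _ s] nint_nat[of 1 M T _ s] M by (simp_all add: nr_def Ur_def wr_def)

lemma r_deriv:
 "((%r. nr s r z) has_real_derivative dn s r z) (at r within X)"
 "((%r. Ur s r z) has_real_derivative om s r z) (at r within X)"
 "((%r. wr s r z) has_real_derivative dw s r z) (at r within X)"
 unfolding nr_def dn_def Ur_def om_def wr_def dw_def by (rule nint_deriv_r)+

lemma zr_cont:
 assumes "continuous_on ({0..T} \<times> {0..1}) (%q. f (fst q) (snd q))"
 shows "continuous_on ({0..T} \<times> {0..1}) (%(z, r). f z r)" 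
 using assms by (simp add: case_prod_beta)

text \<open>The integrand of the derivative has two terms. Integration by parts in r
  (\<open>parts\<close>) and in z (\<open>zz\<close>) turns each of them into minus the pairing of
  \<open>nr\<close> with \<open>om\<close>; the first also leaves boundary values at r = 0 and r =
  1, while in z periodicity leaves none.\<close>

lemma D_deriv:
 assumes s: "s \<in> {0..S1}"
 shows "(D has_real_derivative (Lam (s + T) - Lam s + integral {0..1} (%r. integral {0..T} (%z. nr s r z * om s r z)))) (at s within {0..S1})"
proof -
 have s0: "s >= 0" using s by simp
 let ?f = "%s z r. dn s r z * Ur s r z + \<rho>r s r z * mu s r z"
 have c3: "continuous_on (({0..S1} \<times> {0..T}) \<times> {0..1}) (%q. ?f (fst (fst q)) (snd (fst q)) (snd q))"
  by (intro continuous_intros window_cont)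
 have d1: "((%s. integral {0..1} (%r. \<rho>r s r z * Ur s r z)) has_real_derivative integral {0..1} (?f \<sigma> z)) (at \<sigma> within {0..S1})"
  if \<sigma>: "\<sigma> \<in> {0..S1}" for \<sigma> z
 proof (rule leibniz_real)
  show "((%s. \<rho>r s r z * Ur s r z) has_real_derivative ?f x z r) (at x within {0..S1})" if "x \<in> {0..S1}" for x r
   using DERIV_mult[OF DERIV_subset[OF \<rho>r_deriv I_sub(2)] DERIV_subset[OF Ur_deriv I_sub(2)], of x r z] that
   by (simp add: mult.commute add.commute)
  show "continuous_on {0..1} (%r. \<rho>r x r z * Ur x r z)" for x by (intro continuous_intros window_cont)
  have "continuous_on ({0..S1} \<times> {0..1}) (%q. ?f (fst q) z (snd q))" by (intro continuous_intros window_cont)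
  then show "continuous_on ({0..S1} \<times> {0..1}) (%(x, r). ?f x z r)" by (simp add: case_prod_beta)
 qed (use \<sigma> in auto)
 have d2: "((%s. integral {0..T} (%z. integral {0..1} (%r. \<rho>r s r z * Ur s r z))) has_real_derivative
   integral {0..T} (%z. integral {0..1} (?f s z))) (at s within {0..S1})"
 proof (rule leibniz_real[OF d1])
  show "continuous_on {0..T} (%z. integral {0..1} (%r. \<rho>r x r z * Ur x r z))" for x
  proof (rule continuous_integral_param)
   have "continuous_on ({0..T} \<times> {0..1}) (%q. \<rho>r x (snd q) (fst q) * Ur x (snd q) (fst q))"
    by (intro continuous_intros window_cont)
   then show "continuous_on ({0..T} \<times> {0..1}) (%(z, r). \<rho>r x r z * Ur x r z)" by (simp add: case_prod_beta)
  qed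
  have "continuous_on ({0..S1} \<times> {0..T}) (%q. integral {0..1} (%r. ?f (fst q) (snd q) r))"
   by (rule continuous_integral_param) (use c3 in \<open>simp add: case_prod_beta\<close>)
  then show "continuous_on ({0..S1} \<times> {0..T}) (%(x, z). integral {0..1} (?f x z))" by (simp add: case_prod_beta)
 qed (use s in auto)
 have i1: "(%r. dn s r z * Ur s r z) integrable_on {0..1}" "(%r. nr s r z * om s r z) integrable_on {0..1}"
  "(%r. \<rho>r s r z * mu s r z) integrable_on {0..1}" for z
  by (intro integrable_continuous_real continuous_intros window_cont)+
 have parts: "integral {0..1} (%r. dn s r z * Ur s r z) =
   n (s + T) z * U (s + T) z - n s z * U s z - integral {0..1} (%r. nr s r z * om s r z)" for z
 proof -
  have "integral {0..1} (%r. dn s r z * Ur s r z + nr s r z * om s r z) = nr s 1 z * Ur s 1 z - nr s 0 z * Ur s 0 z"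
  proof (rule integral_FTC_real)
   fix r :: real
   show "((%r. nr s r z * Ur s r z) has_real_derivative dn s r z * Ur s r z + nr s r z * om s r z) (at r within {0..1})"
    using DERIV_mult[OF r_deriv(1) r_deriv(2)] by (simp add: mult.commute add.commute)
  qed simp
  then show ?thesis using i1(1,2)[of z] by (simp add: HK_add endpoint_values)
 qed
 have zz: "integral {0..T} (%z. \<rho>r s r z * mu s r z) = - integral {0..T} (%z. nr s r z * om s r z)" for r
 proof -
  have dom: "(om s r has_real_derivative \<rho>r s r z) (at z within X)" for z X
   unfolding om_prim by (rule has_field_derivative_at_within[OF prim_deriv[OF cont_z(5)]])
  have dmu: "(mu s r has_real_derivative nr s r z) (at z within X)" for z X
   unfolding mu_prim by (rule has_field_derivative_at_within[OF prim_deriv[OF cont_z(2)]])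
  have "integral {0..T} (%z. \<rho>r s r z * mu s r z + nr s r z * om s r z) = om s r T * mu s r T - om s r 0 * mu s r 0"
  proof (rule integral_FTC_real[OF T0])
   show "((%z. om s r z * mu s r z) has_real_derivative \<rho>r s r z * mu s r z + nr s r z * om s r z) (at z within {0..T})" for z
    using DERIV_mult[OF dom dmu] by (simp add: mult.commute add.commute)
  qed
  also have "... = 0"
   using periodic_D[OF window_periodic(4)[OF s0], of r 0] by (simp add: om_prim mu_prim)
  finally have "integral {0..T} (%z. \<rho>r s r z * mu s r z + nr s r z * om s r z) = 0" .
  moreover have "(%z. \<rho>r s r z * mu s r z) integrable_on {0..T}" "(%z. nr s r z * om s r z) integrable_on {0..T}"
   by (intro integrable_continuous_real continuous_intros cont_z)+
  ultimately show ?thesis by (simp add: HK_add)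
 qed
 have cA: "continuous_on ({0..T} \<times> {0..1}) (%(z, r). nr s r z * om s r z)"
  and cB: "continuous_on ({0..T} \<times> {0..1}) (%(z, r). \<rho>r s r z * mu s r z)"
  by (rule zr_cont, intro continuous_intros window_cont)+
 note iA = integrable_continuous_real[OF continuous_integral_param[OF cA]]
  and iB = integrable_continuous_real[OF continuous_integral_param[OF cB]]
 have nU: "continuous_on {0..T} (%z. n s z * U s z)" for s
  using continuous_on_snd_arg[OF n_cont, of s] continuous_on_snd_arg[OF U_cont, of s]
  by (intro continuous_intros) (auto intro: continuous_on_subset)
 have "integral {0..T} (%z. integral {0..1} (?f s z)) = integral {0..T} (%z. (n (s + T) z * U (s + T) z - n s z * U s z)
   - integral {0..1} (%r. nr s r z * om s r z) + integral {0..1} (%r. \<rho>r s r z * mu s r z))"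
  using i1 by (simp add: HK_add parts)
 also have "... = integral {0..T} (%z. n (s + T) z * U (s + T) z) - integral {0..T} (%z. n s z * U s z)
   - integral {0..T} (%z. integral {0..1} (%r. nr s r z * om s r z))
   + integral {0..T} (%z. integral {0..1} (%r. \<rho>r s r z * mu s r z))"
 proof -
  note i = integrable_continuous_real[OF nU]
  show ?thesis
   unfolding HK_add[OF Henstock_Kurzweil_Integration.integrable_diff[OF Henstock_Kurzweil_Integration.integrable_diff[OF i i] iA] iB]
    HK_diff[OF Henstock_Kurzweil_Integration.integrable_diff[OF i i] iA]
    HK_diff[OF i i] ..
 qed
 also have "integral {0..T} (%z. integral {0..1} (%r. nr s r z * om s r z)) = integral {0..1} (%r. integral {0..T} (%z. nr s r z * om s r z))"
  by (rule integral_swap_Icc[OF cA])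
 also have "integral {0..T} (%z. integral {0..1} (%r. \<rho>r s r z * mu s r z)) = integral {0..1} (%r. integral {0..T} (%z. \<rho>r s r z * mu s r z))"
  by (rule integral_swap_Icc[OF cB])
 also have "... = - integral {0..1} (%r. integral {0..T} (%z. nr s r z * om s r z))"
  unfolding zz by simp
 finally have X: "- (1/2) * integral {0..T} (%z. integral {0..1} (?f s z)) =
   Lam (s + T) - Lam s + integral {0..1} (%r. integral {0..T} (%z. nr s r z * om s r z))"
  by (simp add: Lam_def field_simps)
 have "(D has_real_derivative - (1/2) * integral {0..T} (%z. integral {0..1} (?f s z))) (at s within {0..S1})"
  using DERIV_cmult[OF d2, of "- (1/2)"] unfolding D_def[abs_def] .
 then show ?thesis unfolding X .
qed

lemma hr_cont:
 assumes s: "s >= 0"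
 shows "continuous_on {0..1} (%r. hs s r)" "continuous_on {0..1} (%r. integral {0..T} (%z. G s r z * om s r z))"
  "continuous_on {0..1} (%r. h s r)"
proof -
 have "continuous_on ({0..1} \<times> {0..T}) (%q. (wr s (fst q) (snd q))^2)" "continuous_on ({0..1} \<times> {0..T}) (%q. (wr s (fst q) (snd q))^2 * (wr s (fst q) (snd q))^2)"
  "continuous_on ({0..1} \<times> {0..T}) (%q. G s (fst q) (snd q) * om s (fst q) (snd q))"
  by (intro continuous_intros window_cont G_cont; use s in auto)+
 then have c: "continuous_on {0..1} (h2 s)" "continuous_on {0..1} (h4 s)" and g: "continuous_on {0..1} (%r. integral {0..T} (%z. G s r z * om s r z))"
  unfolding h2_def[abs_def] h4_def[abs_def] by (intro continuous_integral_param; simp add: case_prod_beta)+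
 show "continuous_on {0..1} (%r. integral {0..T} (%z. G s r z * om s r z))" by (rule g)
 have cc: "continuous_on {0..1} (%r. DA i (s + r * T))" "continuous_on {0..1} (%r. DB i (s + r * T))" for i
  by (rule coef_window_cont[of "{0..1}" "%q. s" "%q. q"]; use s in \<open>auto intro!: continuous_intros\<close>)+
 show "continuous_on {0..1} (%r. hs s r)" "continuous_on {0..1} (%r. h s r)"
  unfolding hs_def h_def by (intro continuous_intros c cc; simp)+
qed

text \<open>Along r, \<open>h\<close> changes through the coefficients, at rate T \<open>hs\<close>,
  and through the field, at the rate given by pairing \<open>G\<close> with \<open>dw\<close>. As
  \<open>dw\<close> is half of \<open>om\<close> minus its reflection, antisymmetry of
  \<open>G\<close> makes the latter the pairing with \<open>om\<close>.\<close>

lemma h_increment: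
 assumes s: "s >= 0"
 shows "integral {0..1} (%r. integral {0..T} (%z. G s r z * om s r z)) = h s 1 - h s 0 - T * integral {0..1} (%r. hs s r)"
proof -
 have dh: "((%r. h s r) has_real_derivative T * hs s r + integral {0..T} (%z. G s r z * om s r z)) (at r within {0..1})"
  if r: "r \<in> {0..1}" for r
 proof -
  have r0: "r >= 0" using r by simp
  have d2: "((%r. h2 s r) has_real_derivative integral {0..T} (%z. 2 * wr s r z * dw s r z)) (at r within {0..1})"
   unfolding h2_def
  proof (rule leibniz_real)
   show "((%r. (wr s r z)^2) has_real_derivative 2 * wr s x z * dw s x z) (at x within {0..1})" for x z
    using DERIV_power[OF r_deriv(3)[where s=s and z=z and r=x and X="{0..1}"], where n=2] by (simp add: mult_ac)
   have "continuous_on ({0..1} \<times> {0..T}) (%q. 2 * wr s (fst q) (snd q) * dw s (fst q) (snd q))"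
    by (intro continuous_intros window_cont)
   then show "continuous_on ({0..1} \<times> {0..T}) (%(x, z). 2 * wr s x z * dw s x z)" by (simp add: case_prod_beta)
  qed (use r in \<open>auto intro!: continuous_intros cont_z\<close>)
  have d4: "((%r. h4 s r) has_real_derivative integral {0..T} (%z. 4 * wr s r z ^ 3 * dw s r z)) (at r within {0..1})"
   unfolding h4_def
  proof (rule leibniz_real)
   fix x z
   have e: "a^2 * a^2 = a ^ 4" for a :: real by (simp flip: power_add)
   show "((%r. (wr s r z)^2 * (wr s r z)^2) has_real_derivative 4 * wr s x z ^ 3 * dw s x z) (at x within {0..1})"
    unfolding e using DERIV_power[OF r_deriv(3)[where s=s and z=z and r=x and X="{0..1}"], where n=4] by (simp add: mult_ac)
  next
   have "continuous_on ({0..1} \<times> {0..T}) (%q. 4 * wr s (fst q) (snd q) ^ 3 * dw s (fst q) (snd q))"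
    by (intro continuous_intros window_cont)
   then show "continuous_on ({0..1} \<times> {0..T}) (%(x, z). 4 * wr s x z ^ 3 * dw s x z)" by (simp add: case_prod_beta)
  qed (use r in \<open>auto intro!: continuous_intros cont_z\<close>)
  note cA = coef_deriv_r(1)[OF s r] and cB = coef_deriv_r(2)[OF s r]
  have i: "(%z. wr s r z * dw s r z) integrable_on {0..T}" "(%z. wr s r z ^ 3 * dw s r z) integrable_on {0..T}"
   by (intro integrable_continuous_real continuous_intros cont_z)+
  have e2: "integral {0..T} (%z. 2 * wr s r z * dw s r z) = 2 * integral {0..T} (%z. wr s r z * dw s r z)"
   by (simp add: mult.assoc)
  have e4: "integral {0..T} (%z. 4 * wr s r z ^ 3 * dw s r z) = 4 * integral {0..T} (%z. wr s r z ^ 3 * dw s r z)"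
   by (simp add: mult.assoc)
  let ?g = "eps^2 * (DB 0 (s + r * T) * integral {0..T} (%z. wr s r z * dw s r z) + DA 0 (s + r * T) * integral {0..T} (%z. wr s r z ^ 3 * dw s r z))"
  have d: "((%r. h s r) has_real_derivative T * hs s r + ?g) (at r within {0..1})"
   unfolding h_def hs_def
   by (rule derivative_eq_intros cA cB d2[unfolded e2] d4[unfolded e4] refl | simp add: algebra_simps)+
  have "?g = integral {0..T} (%z. eps^2 * (DB 0 (s + r * T) * (wr s r z * dw s r z) + DA 0 (s + r * T) * (wr s r z ^ 3 * dw s r z)))"
   using i by (simp add: HK_add integrable_on_mult_right)
  also have "... = integral {0..T} (%z. G s r z * dw s r z)"
   by (intro HK_cong) (simp add: G_def algebra_simps)
  also have "... = integral {0..T} (%z. (1/2) * (G s r z * om s r z) - (1/2) * (G s r z * om s r (2 * s - z)))"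
   by (intro HK_cong) (simp add: dw_eq[OF s] algebra_simps)
  also have "... = (1/2) * integral {0..T} (%z. G s r z * om s r z) - (1/2) * integral {0..T} (%z. G s r z * om s r (2 * s - z))"
  proof -
   have "continuous_on {0..T} (%z. om s r (2 * s - z))" by (intro window_cont continuous_intros)
   then have "(%z. (1/2) * (G s r z * om s r z)) integrable_on {0..T}" "(%z. (1/2) * (G s r z * om s r (2 * s - z))) integrable_on {0..T}"
    by (intro integrable_continuous_real continuous_intros cont_z G_cont_z s r0; assumption)+
   then show ?thesis by (simp add: HK_diff)
  qed
  also have "... = integral {0..T} (%z. G s r z * om s r z)"
   using G_flip[OF s r0 window_periodic(4)[OF s] locL2_continuous[OF cont_z(6)]] by simp
  finally have ge: "?g = integral {0..T} (%z. G s r z * om s r z)" .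
  from d show ?thesis unfolding ge .
 qed
 have "integral {0..1} (%r. T * hs s r + integral {0..T} (%z. G s r z * om s r z)) = h s 1 - h s 0"
  by (rule integral_FTC_real[OF _ dh]) simp
 moreover have "integral {0..1} (%r. T * hs s r + integral {0..T} (%z. G s r z * om s r z)) =
   T * integral {0..1} (%r. hs s r) + integral {0..1} (%r. integral {0..T} (%z. G s r z * om s r z))"
 proof -
  have "(%r. T * hs s r) integrable_on {0..1}"
   by (intro integrable_continuous_real continuous_intros hr_cont s)
  then show ?thesis
   using integrable_continuous_real[OF hr_cont(2)[OF s]] by (simp add: HK_add)
 qed
 ultimately show ?thesis by simp
qed

text \<open>The boundary contributions of \<open>D_deriv\<close> and \<open>h_increment\<close> at
  one end. Freezing at s = 0 makes the function continuous on the whole line, so its primitive is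
  differentiable everywhere.\<close>

definition "gbd s = Lam (max 0 s) + h (max 0 s) 0"
text \<open>\<open>J\<close> is the Noether integral for shifts of \<open>s\<close>: the energy \<open>e - h\<close> averaged over \<open>r\<close>, corrected by
the symplectic form term \<open>D\<close> and by the boundary terms at \<open>r = 0\<close> and \<open>r = 1\<close>, which combine to an integral over
one period because \<open>r = 1\<close> at \<open>s\<close> is \<open>r = 0\<close> at \<open>s + T\<close>.\<close>

definition "J s = T * integral {0..1} (%r. e s r - h s r) - D s + (prim gbd (s + T) - prim gbd s)"

lemma gbd_cont: "continuous_on UNIV gbd"
proof -
 have m: "continuous_on UNIV (%s::real. max 0 s)" by (intro continuous_intros)
 have "continuous_on (UNIV \<times> {0..T}) (%q. n (fst q) (snd q) * U (fst q) (snd q))"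
  using continuous_on_subset[OF n_cont] continuous_on_subset[OF U_cont] by (intro continuous_intros) (auto simp: case_prod_beta)
 then have "continuous_on UNIV (%s. integral {0..T} (%z. n s z * U s z))"
  by (intro continuous_integral_param) (simp add: case_prod_beta)
 then have "continuous_on UNIV Lam" unfolding Lam_def[abs_def] by (intro continuous_intros)
 from continuous_on_compose2[OF this m] have 1: "continuous_on UNIV (%s. Lam (max 0 s))" by simp
 have "continuous_on ({0..} \<times> {0..T}) (%q. (wr (fst q) 0 (snd q))^2)" "continuous_on ({0..} \<times> {0..T}) (%q. (wr (fst q) 0 (snd q))^2 * (wr (fst q) 0 (snd q))^2)"
  by (intro continuous_intros window_cont)+
 then have c: "continuous_on {0..} (%s. h2 s 0)" "continuous_on {0..} (%s. h4 s 0)"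
  unfolding h2_def h4_def by (intro continuous_integral_param; simp add: case_prod_beta)+
 have "continuous_on {0..} (%s. h s 0)" unfolding h_def
  using coef_cont by (intro continuous_intros c) (auto intro!: continuous_intros)
 from continuous_on_compose2[OF this m] have 2: "continuous_on UNIV (%s. h (max 0 s) 0)" by (simp add: image_subset_iff)
 show ?thesis unfolding gbd_def[abs_def] by (intro continuous_intros 1 2)
qed

text \<open>The profile is split into P0, which is merely square integrable and acts as a fixed
  weight, and the jointly continuous part \<open>Rr\<close>.\<close>

lemma k_cont: "continuous_on ({0..S1} \<times> {0..1}) (%(s, r). k s r)"
proof -
 let ?X = "{0..S1} \<times> {0..1::real}"
 have c1: "continuous_on (?X \<times> {0..T}) (%q. nr (fst (fst q)) (snd (fst q)) (snd q) - G (fst (fst q)) (snd (fst q)) (snd q))"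
  by (intro continuous_intros window_cont G_cont) auto
 have c2: "continuous_on (?X \<times> {0..T}) (%q. Rr (fst (fst q)) (snd (fst q)) (snd q) * (nr (fst (fst q)) (snd (fst q)) (snd q) - G (fst (fst q)) (snd (fst q)) (snd q)))"
  by (intro continuous_intros c1 window_cont)
 have c3: "continuous_on (?X \<times> {0..T}) (%q. (wr (fst (fst q)) (snd (fst q)) (snd q))^2)"
  "continuous_on (?X \<times> {0..T}) (%q. (wr (fst (fst q)) (snd (fst q)) (snd q))^2 * (wr (fst (fst q)) (snd (fst q)) (snd q))^2)"
  by (intro continuous_intros window_cont)+
 have w: "continuous_on ?X (%q. integral {0..T} (%z. P0 z * (nr (fst q) (snd q) z - G (fst q) (snd q) z)))"
  by (rule continuous_weighted_integral[OF locL2_D[OF P0(1)] _ T0]) (use c1 in \<open>simp add: case_prod_beta\<close>)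
 have v: "continuous_on ?X (%q. integral {0..T} (%z. Rr (fst q) (snd q) z * (nr (fst q) (snd q) z - G (fst q) (snd q) z)))"
  by (rule continuous_integral_param) (use c2 in \<open>simp add: case_prod_beta\<close>)
 have hh: "continuous_on ?X (%q. h2 (fst q) (snd q))" "continuous_on ?X (%q. h4 (fst q) (snd q))"
  unfolding h2_def h4_def by (rule continuous_integral_param, use c3 in \<open>simp add: case_prod_beta\<close>)+
 have cc: "continuous_on ?X (%q. DA 1 (fst q + snd q * T))" "continuous_on ?X (%q. DB 1 (fst q + snd q * T))"
  by (intro coef_window_cont continuous_intros; auto)+
 have "continuous_on ?X (%q. integral {0..T} (%z. P0 z * (nr (fst q) (snd q) z - G (fst q) (snd q) z)) +
   integral {0..T} (%z. Rr (fst q) (snd q) z * (nr (fst q) (snd q) z - G (fst q) (snd q) z)) - hs (fst q) (snd q))"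
  unfolding hs_def by (intro continuous_intros w v hh cc) auto
 then show ?thesis
 proof (rule continuous_on_eq)
  fix q assume q: "q \<in> ?X"
  have f: "continuous_on {0..T} (%z. nr (fst q) (snd q) z - G (fst q) (snd q) z)"
   by (intro continuous_intros cont_z G_cont_z) (use q in auto)
  have "(%z. P0 z * (nr (fst q) (snd q) z - G (fst q) (snd q) z)) integrable_on {0..T}"
   using L2_mult_integrable[OF locL2_D[OF P0(1)] L2_continuous[OF f]] by (auto intro: integrable_on_lebesgue_on)
  moreover have "(%z. Rr (fst q) (snd q) z * (nr (fst q) (snd q) z - G (fst q) (snd q) z)) integrable_on {0..T}"
   by (intro integrable_continuous_real continuous_on_mult cont_z f)
  ultimately show "integral {0..T} (%z. P0 z * (nr (fst q) (snd q) z - G (fst q) (snd q) z)) +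
   integral {0..T} (%z. Rr (fst q) (snd q) z * (nr (fst q) (snd q) z - G (fst q) (snd q) z)) - hs (fst q) (snd q) =
   (case q of (s, r) => k s r)"
   by (simp add: k_def Q_def case_prod_beta distrib_right HK_add)
 qed
qed

lemma e_cont: "continuous_on {0..1} (%r. e s r)"
proof -
 have "continuous_on ({0..1} \<times> {0..T}) (%q. Rr s (fst q) (snd q))" by (intro window_cont continuous_intros)
 then have c: "continuous_on ({0..1} \<times> {0..T}) (%(r, z). Rr s r z)" by (simp add: case_prod_beta)
 have QL: "Q s r \<in> L2_space {0..T}" for r by (rule locL2_D[OF Q_locL2])
 have "((%r. LINT z|lebesgue_on {0..T}. Q s r z * Q s r z) \<longlongrightarrow> (LINT z|lebesgue_on {0..T}. Q s r0 z * Q s r0 z)) (at r0 within {0..1})"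
  if r0: "r0 \<in> {0..1}" for r0
 proof -
  have l: "((%r. L2_norm {0..T} (%z. Q s r z - Q s r0 z)) \<longlongrightarrow> 0) (at r0 within {0..1})"
   using L2_lim_jointly_continuous[OF c r0 T0] by (simp add: Q_def)
  show ?thesis by (rule L2_lim_inner[OF l l]) (use QL in auto)
 qed
 then have "continuous_on {0..1} (%r. LINT z|lebesgue_on {0..T}. Q s r z * Q s r z)" by (simp add: continuous_on_def)
 then show ?thesis unfolding e_def by (intro continuous_intros) auto
qed

text \<open>In the sum the explicit coefficient terms T \<open>hs\<close> from
  \<open>eh_deriv\<close> and \<open>h_increment\<close> cancel, and the increments of
  \<open>Lam\<close> and \<open>h\<close> over one period are cancelled by \<open>gbd\<close>. What
  survives contains the factor \<open>nr\<close> - \<open>G\<close>, so \<open>J\<close> would be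
  conserved if the interpolant solved the equation exactly.\<close>

lemma J_deriv:
 assumes s: "s \<in> {0..S1}"
 shows "(J has_real_derivative integral {0..1} (%r. T * integral {0..T} (%z. Q s r z * (nr s r z - G s r z))
   - integral {0..T} (%z. (nr s r z - G s r z) * om s r z))) (at s within {0..S1})"
proof -
 have s0: "s >= 0" using s by simp
 have d1: "((%s. integral {0..1} (%r. e s r - h s r)) has_real_derivative integral {0..1} (k s)) (at s within {0..S1})"
  by (rule leibniz_real[OF eh_deriv _ k_cont s]) (auto intro!: continuous_intros e_cont hr_cont)
 have "(prim gbd has_real_derivative gbd (s + T)) (at (s + T))" by (rule prim_deriv[OF gbd_cont])
 then have "((%s. prim gbd (s + T)) has_real_derivative gbd (s + T) * 1) (at s within {0..S1})"
  by (rule DERIV_chain2) (auto intro!: derivative_eq_intros)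
 then have d2: "((%s. prim gbd (s + T) - prim gbd s) has_real_derivative gbd (s + T) - gbd s) (at s within {0..S1})"
  using DERIV_diff[OF _ has_field_derivative_at_within[OF prim_deriv[OF gbd_cont]]] by simp
 have d: "(J has_real_derivative T * integral {0..1} (k s) - (Lam (s + T) - Lam s + integral {0..1} (%r. integral {0..T} (%z. nr s r z * om s r z)))
   + (gbd (s + T) - gbd s)) (at s within {0..S1})"
  unfolding J_def[abs_def] by (intro DERIV_add DERIV_diff DERIV_cmult d1 d2 D_deriv s)
 have g: "gbd (s + T) - gbd s = Lam (s + T) - Lam s + (h s 1 - h s 0)"
  using s0 T0 by (simp add: gbd_def h_def h2_def h4_def endpoint_values)
 have ce: "continuous_on ({0..1} \<times> {0..T}) (%q. (nr s (fst q) (snd q) - G s (fst q) (snd q)) * om s (fst q) (snd q))"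
  by (intro continuous_intros window_cont G_cont) (use s0 in auto)
 have cem: "continuous_on {0..1} (%r. integral {0..T} (%z. (nr s r z - G s r z) * om s r z))"
  by (rule continuous_integral_param) (use ce in \<open>simp add: case_prod_beta\<close>)
 have split: "integral {0..T} (%z. nr s r z * om s r z) = integral {0..T} (%z. G s r z * om s r z) + integral {0..T} (%z. (nr s r z - G s r z) * om s r z)"
  if r: "r \<in> {0..1}" for r
 proof -
  have r0: "r >= 0" using r by simp
  have "(%z. G s r z * om s r z) integrable_on {0..T}" "(%z. (nr s r z - G s r z) * om s r z) integrable_on {0..T}"
   by (intro integrable_continuous_real continuous_intros cont_z G_cont_z s0 r0)+
  from HK_add[OF this] show ?thesis by (simp add: algebra_simps)
 qed
 have "integral {0..1} (%r. integral {0..T} (%z. nr s r z * om s r z)) =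
   integral {0..1} (%r. integral {0..T} (%z. G s r z * om s r z) + integral {0..T} (%z. (nr s r z - G s r z) * om s r z))"
  by (rule HK_cong) (rule split)
 also have "... = (h s 1 - h s 0 - T * integral {0..1} (%r. hs s r)) + integral {0..1} (%r. integral {0..T} (%z. (nr s r z - G s r z) * om s r z))"
  using integrable_continuous_real[OF hr_cont(2)[OF s0]] integrable_continuous_real[OF cem]
  by (simp add: HK_add h_increment[OF s0])
 finally have om_eq: "integral {0..1} (%r. integral {0..T} (%z. nr s r z * om s r z)) =
   (h s 1 - h s 0 - T * integral {0..1} (%r. hs s r)) + integral {0..1} (%r. integral {0..T} (%z. (nr s r z - G s r z) * om s r z))" .
 have ck: "continuous_on {0..1} (k s)" by (rule continuous_on_slice[OF k_cont s])
 have cq: "continuous_on {0..1} (%r. integral {0..T} (%z. Q s r z * (nr s r z - G s r z)))"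
 proof -
  have "continuous_on {0..1} (%r. k s r + hs s r)" by (intro continuous_intros ck hr_cont s0)
  then show ?thesis by (simp add: k_def)
 qed
 have "T * integral {0..1} (k s) + T * integral {0..1} (%r. hs s r) = T * integral {0..1} (%r. k s r + hs s r)"
  using integrable_continuous_real[OF ck] integrable_continuous_real[OF hr_cont(1)[OF s0]]
  by (simp add: HK_add distrib_left)
 then have kk: "T * integral {0..1} (k s) + T * integral {0..1} (%r. hs s r) = integral {0..1} (%r. T * integral {0..T} (%z. Q s r z * (nr s r z - G s r z)))"
  by (simp add: k_def)
 have "(%r. T * integral {0..T} (%z. Q s r z * (nr s r z - G s r z))) integrable_on {0..1}"
  by (intro integrable_continuous_real continuous_intros cq)
 from HK_diff[OF this integrable_continuous_real[OF cem]]
 have "T * integral {0..1} (k s) - (Lam (s + T) - Lam s + integral {0..1} (%r. integral {0..T} (%z. nr s r z * om s r z)))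
   + (gbd (s + T) - gbd s) = integral {0..1} (%r. T * integral {0..T} (%z. Q s r z * (nr s r z - G s r z))
   - integral {0..T} (%z. (nr s r z - G s r z) * om s r z))"
  unfolding g om_eq kk[symmetric] by simp
 with d show ?thesis by simp
qed

end

text \<open>A non-integrable function has integral 0 by convention, and the bound holds for that
  value too.\<close>

lemma abs_integral_le:
 fixes f :: "real => real"
 assumes ab: "a <= b" and f: "!!x. x \<in> {a..b} ==> \<bar>f x\<bar> <= B" and B: "B >= 0"
 shows "\<bar>integral {a..b} f\<bar> <= B * (b - a)"
proof (cases "f integrable_on {a..b}")
 case True
 show ?thesis
  using has_integral_bound_real[OF B _ integrable_integral[OF True], of "{}"] f ab by simp
next
 case False
 then show ?thesis using B ab by (simp add: not_integrable_integral)
qed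

section \<open>Variation of the norm over short times\<close>

context wave_data begin

definition "E s = (L2_norm {0..T} (%z. P0 z + R s z))^2 / 2"

lemma n_L2: "0 <= s ==> s <= S ==> L2_norm {0..T} (n s) <= eps^2 * Bn * sqrt T"
 using L2_norm_interval_le[of 0 T "n s" "eps^2 * Bn"] n_bound[of s] continuous_on_snd_arg[OF n_cont, of s] T Bn_nonneg
 by (auto intro: continuous_on_subset)

text \<open>The derivative of \<open>E\<close> is the pairing of the profile with n, hence O(eps^2).
  Over a bounded number of periods this already has the desired size.\<close>

lemma E_lipschitz:
 assumes "s \<in> {0..S}" "t \<in> {0..S}"
 shows "\<bar>E t - E s\<bar> <= K * (eps^2 * Bn * sqrt T) * \<bar>t - s\<bar>"
proof (rule mvt_bound[where f'="%s. LINT z|lebesgue_on {0..T}. (P0 z + R s z) * n s z"])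
 fix s assume s: "s \<in> {0..S}"
 have nL: "n s \<in> L2_space {0..T}" for s
  by (rule L2_continuous[OF continuous_on_subset[OF continuous_on_snd_arg[OF n_cont]]]) simp
 have Rc: "continuous_on {0..T} (R s)" for s
  by (rule continuous_on_subset[OF continuous_on_snd_arg[OF R_cont]]) simp
 have d: "has_L2_derivative {0..T} R (n s) s {0..S}"
  by (rule L2_deriv_jointly_continuous[OF R_deriv continuous_on_subset[OF n_cont] Rc]) (use s T in auto)
 have "has_L2_derivative {0..T} (%s x. P0 x + R s x) (%x. 0 + n s x) s {0..S}"
  by (rule L2_deriv_add[OF L2_deriv_const _ _ d]) (use s in \<open>auto intro: locL2_D[OF P0(1)] L2_continuous[OF Rc] nL L2_zero\<close>)
 then have d: "has_L2_derivative {0..T} (%s x. P0 x + R s x) (n s) s {0..S}" by simp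
 have PL: "(%x. P0 x + R s x) \<in> L2_space {0..T}" for s by (rule locL2_D[OF P_locL2])
 have "((%s. (LINT z|lebesgue_on {0..T}. (P0 z + R s z) * (P0 z + R s z)) / 2) has_real_derivative
   (LINT z|lebesgue_on {0..T}. (P0 z + R s z) * n s z)) (at s within {0..S})"
  using DERIV_cdivide[OF L2_deriv_inner[OF d PL nL d PL nL s], of 2] by (simp add: mult.commute)
 moreover have "E = (%s. (LINT z|lebesgue_on {0..T}. (P0 z + R s z) * (P0 z + R s z)) / 2)"
  unfolding fun_eq_iff E_def L2_norm_sq by (simp only: power2_eq_square) simp
 ultimately show "(E has_real_derivative (LINT z|lebesgue_on {0..T}. (P0 z + R s z) * n s z)) (at s within {0..S})"
  by simp
 have "\<bar>LINT z|lebesgue_on {0..T}. (P0 z + R s z) * n s z\<bar> <= L2_norm {0..T} (%z. P0 z + R s z) * L2_norm {0..T} (n s)"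
  by (rule L2_cauchy_schwarz[OF PL nL])
 also have "... <= K * (eps^2 * Bn * sqrt T)"
  using energy[of s] n_L2[of s] s K_nonneg by (intro mult_mono) auto
 finally show "\<bar>LINT z|lebesgue_on {0..T}. (P0 z + R s z) * n s z\<bar> <= K * (eps^2 * Bn * sqrt T)" .
qed (use assms in auto)

end

section \<open>Explicit bounds for the conserved quantity\<close>

context wave_window begin

text \<open>\<open>CM\<close> is the norm of the interpolation operators on data given at the nodes,
  eps^2 \<open>b1\<close> bounds the change of R over the M periods of the window, \<open>X\<close>
  bounds the interpolated potential and field, and eps^2 \<open>hb\<close> bounds
  \<open>h\<close>.\<close>

definition "CM = (\<Sum>j\<le>M. C * 2 ^ j)"
definition "b1 = real M * T * Bn"
definition "X = CM * (sqrt T * K)"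
definition "hb = \<bar>KB 0\<bar> / 2 * (X^2 * T) + \<bar>KA 0\<bar> / 4 * (X^2 * X^2 * T)"

lemma CM_ge: "CM >= 1"
proof -
 have "(1::real) <= C * 2 ^ 0" using C1 by simp
 also have "... <= CM" unfolding CM_def using C1 by (intro member_le_sum[of 0 "{..M}" "%j. C * 2 ^ j"]) auto
 finally show ?thesis .
qed

lemma b1_nonneg: "b1 >= 0" using T Bn_nonneg by (simp add: b1_def)

lemma TK_nonneg: "sqrt T * K >= 0" using T0 K_nonneg by simp

lemma X_ge: "X >= sqrt T * K" "X >= 0"
proof -
 show "X >= sqrt T * K" unfolding X_def using mult_right_mono[OF CM_ge TK_nonneg] by simp
 then show "X >= 0" using TK_nonneg by linarith
qed

lemma hb_nonneg: "hb >= 0" using T0 by (simp add: hb_def)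

lemma node_le: "s <= S1 ==> i <= M ==> s + real i * T <= S"
proof -
 assume "s <= S1" "i <= M"
 moreover from \<open>i <= M\<close> have "real i * T <= real M * T" using T0 by (intro mult_right_mono) auto
 ultimately show ?thesis using S1 by linarith
qed

lemma R_node_var:
 assumes s: "0 <= s" "s <= S1" and i: "i <= M"
 shows "\<bar>R (s + real i * T) z - R s z\<bar> <= eps^2 * b1"
proof -
 have le: "s + real i * T <= S" by (rule node_le[OF s(2) i])
 have iT: "0 <= real i * T" "real i * T <= real M * T" using T0 i by (auto intro: mult_right_mono)
 have "\<bar>R (s + real i * T) z - R s z\<bar> <= eps^2 * Bn * \<bar>s + real i * T - s\<bar>"
  by (rule mvt_bound[where a=s and b="s + real i * T" and f'="%\<sigma>. n \<sigma> z"])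
   (use R_deriv n_bound s le iT in auto)
 also have "... <= eps^2 * Bn * (real M * T)" using iT Bn_nonneg by (intro mult_left_mono) auto
 finally show ?thesis by (simp add: b1_def mult_ac)
qed

lemma U_node_var:
 assumes s: "0 <= s" "s <= S1" and i: "i <= M" and z: "z \<in> {0..T}"
 shows "\<bar>U (s + real i * T) z - U s z\<bar> <= T * (eps^2 * b1)"
proof -
 have le: "s + real i * T <= S" by (rule node_le[OF s(2) i])
 have iT: "0 <= real i * T" "real i * T <= real M * T" using T0 i by (auto intro: mult_right_mono)
 have pb: "\<bar>prim (n \<sigma>) z\<bar> <= eps^2 * Bn * T" if "\<sigma> \<in> {s..s + real i * T}" for \<sigma>
 proof -
  have "\<bar>prim (n \<sigma>) z - prim (n \<sigma>) 0\<bar> <= eps^2 * Bn * \<bar>z - 0\<bar>"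
   by (rule prim_lipschitz[OF n_loc_int]) (use n_bound that s le in auto)
  also have "... <= eps^2 * Bn * T" using z Bn_nonneg by (intro mult_left_mono) auto
  finally show ?thesis by simp
 qed
 have "\<bar>U (s + real i * T) z - U s z\<bar> <= eps^2 * Bn * T * \<bar>s + real i * T - s\<bar>"
  by (rule mvt_bound[where a=s and b="s + real i * T" and f'="%\<sigma>. prim (n \<sigma>) z"])
   (use U_deriv pb iT in auto)
 also have "... <= eps^2 * Bn * T * (real M * T)" using iT Bn_nonneg T0 by (intro mult_left_mono) auto
 finally show ?thesis by (simp add: b1_def mult_ac)
qed

lemma window_bounds:
 assumes s: "0 <= s" "s <= S1" and r: "r \<in> {0..1}"
 shows "\<bar>Rr s r z - R s z\<bar> <= CM * (eps^2 * b1)" "\<bar>\<rho>r s r z\<bar> <= CM * (eps^2 * b1)"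
  "\<bar>Ur s r z\<bar> <= X" "\<bar>wr s r z\<bar> <= X" "z \<in> {0..T} ==> \<bar>om s r z\<bar> <= CM * (T * (eps^2 * b1))"
proof -
 note c = C[OF _ r]
 show "\<bar>Rr s r z - R s z\<bar> <= CM * (eps^2 * b1)" "\<bar>\<rho>r s r z\<bar> <= CM * (eps^2 * b1)"
  unfolding Rr_def \<rho>r_def CM_def
  by (rule nint_variation_bound[where f="%\<sigma>. R \<sigma> z", OF c R_node_var[OF s]]; assumption)+
 show "\<bar>Ur s r z\<bar> <= X" unfolding Ur_def X_def CM_def
  by (rule nint_bound(1)[OF c U_bound]) (use node_le[OF s(2)] node_nonneg[OF s(1)] in auto)
 show "\<bar>wr s r z\<bar> <= X" unfolding wr_def X_def CM_def
  by (rule nint_bound(1)[OF c W_bound]) (use node_le[OF s(2)] node_nonneg[OF s(1)] in auto)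
 show "\<bar>om s r z\<bar> <= CM * (T * (eps^2 * b1))" if "z \<in> {0..T}"
  unfolding om_def CM_def
  by (rule nint_variation_bound(2)[where f="%\<sigma>. U \<sigma> z", OF c U_node_var[OF s _ that]])
qed

lemma e2b: "eps^2 * b1 <= b1" "0 <= eps^2 * b1"
 using eps b1_nonneg by (auto simp: mult_left_le_one_le power_le_one)

lemma Q_norm:
 assumes s: "0 <= s" "s <= S1" and r: "r \<in> {0..1}"
 shows "L2_norm {0..T} (%z. Q s r z - (P0 z + R s z)) <= CM * (eps^2 * b1) * sqrt T"
  "L2_norm {0..T} (Q s r) <= K + CM * b1 * sqrt T"
proof -
 have c: "continuous_on {0..T} (%z. Rr s r z - R s z)"
  by (intro continuous_intros cont_z continuous_on_subset[OF continuous_on_snd_arg[OF R_cont]]) simp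
 have "L2_norm {0..T} (%z. Rr s r z - R s z) <= CM * (eps^2 * b1) * sqrt (T - 0)"
  by (rule L2_norm_interval_le[OF c]) (use window_bounds(1)[OF s r] CM_ge e2b T0 in auto)
 then show 1: "L2_norm {0..T} (%z. Q s r z - (P0 z + R s z)) <= CM * (eps^2 * b1) * sqrt T"
  by (simp add: Q_def)
 have "L2_norm {0..T} (Q s r) - L2_norm {0..T} (%z. P0 z + R s z) <= CM * (eps^2 * b1) * sqrt T"
  using L2_norm_reverse_triangle[OF locL2_D[OF Q_locL2[of s r], of 0 T] locL2_D[OF P_locL2[of s], of 0 T]] 1 by linarith
 moreover have "CM * (eps^2 * b1) * sqrt T <= CM * b1 * sqrt T"
  using e2b CM_ge T0 by (intro mult_right_mono mult_left_mono) auto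
 moreover have "s <= S" using node_le[OF s(2), of 0] M by simp
 ultimately show "L2_norm {0..T} (Q s r) <= K + CM * b1 * sqrt T" using energy[OF s(1)] by linarith
qed

definition "cJ1 = T * ((K + CM * b1 * sqrt T) * sqrt T) + CM * (T * b1) * T"

text \<open>By \<open>J_deriv\<close> the rate is linear in the residual \<open>nr\<close> -
  \<open>G\<close>, bounded by \<kappa>. The two summands of \<open>cJ1\<close> come from pairing
  the residual with the profile by Cauchy-Schwarz and with \<open>om\<close> pointwise.\<close>

lemma J_drift:
 assumes s: "s \<in> {0..S1}"
 shows "\<bar>J s - J 0\<bar> <= \<kappa> * cJ1 * s"
proof -
 have "\<bar>J s - J 0\<bar> <= \<kappa> * cJ1 * \<bar>s - 0\<bar>"
 proof (rule mvt_bound[OF J_deriv])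
  fix t assume t: "t \<in> {0..S1}"
  then have t0: "0 <= t" "t <= S1" by auto
  have "\<bar>T * integral {0..T} (%z. Q t r z * (nr t r z - G t r z)) - integral {0..T} (%z. (nr t r z - G t r z) * om t r z)\<bar> <= \<kappa> * cJ1"
   if r: "r \<in> {0..1}" for r
  proof -
   have ec: "continuous_on {0..T} (%z. nr t r z - G t r z)"
    by (intro continuous_intros cont_z G_cont_z) (use r t in auto)
   have eb: "\<bar>nr t r z - G t r z\<bar> <= \<kappa>" for z
    using err[OF t0, of r z] r by (simp add: nr_def G_def wr_def)
   have en: "L2_norm {0..T} (%z. nr t r z - G t r z) <= \<kappa> * sqrt T"
    using L2_norm_interval_le[OF ec eb \<kappa> T0] by simp
   have "\<bar>LINT z|lebesgue_on {0..T}. Q t r z * (nr t r z - G t r z)\<bar> <= L2_norm {0..T} (Q t r) * L2_norm {0..T} (%z. nr t r z - G t r z)"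
    by (rule L2_cauchy_schwarz[OF locL2_D[OF Q_locL2] L2_continuous[OF ec]])
   also have "... <= (K + CM * b1 * sqrt T) * (\<kappa> * sqrt T)"
    by (rule mult_mono[OF Q_norm(2)[OF t0 r] en]) (use K_nonneg CM_ge b1_nonneg T0 in auto)
   also have "(LINT z|lebesgue_on {0..T}. Q t r z * (nr t r z - G t r z)) = integral {0..T} (%z. Q t r z * (nr t r z - G t r z))"
    by (rule LINT_eq_integral[OF L2_mult_integrable[OF locL2_D[OF Q_locL2] L2_continuous[OF ec]]])
   finally have 1: "\<bar>T * integral {0..T} (%z. Q t r z * (nr t r z - G t r z))\<bar> <= T * ((K + CM * b1 * sqrt T) * (\<kappa> * sqrt T))"
    using T0 by (simp add: abs_mult mult_left_mono)
   have "\<bar>integral {0..T} (%z. (nr t r z - G t r z) * om t r z)\<bar> <= \<kappa> * (CM * (T * b1)) * (T - 0)"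
   proof (rule abs_integral_le[OF T0])
    fix z assume z: "z \<in> {0..T}"
    have "\<bar>om t r z\<bar> <= CM * (T * (eps^2 * b1))" by (rule window_bounds(5)[OF t0 r z])
    also have "... <= CM * (T * b1)" using e2b CM_ge T0 by (intro mult_left_mono) auto
    finally show "\<bar>(nr t r z - G t r z) * om t r z\<bar> <= \<kappa> * (CM * (T * b1))"
     unfolding abs_mult using eb[of z] \<kappa> by (intro mult_mono) auto
   qed (use \<kappa> CM_ge T0 b1_nonneg in auto)
   then have 2: "\<bar>integral {0..T} (%z. (nr t r z - G t r z) * om t r z)\<bar> <= \<kappa> * (CM * (T * b1)) * T" by simp
   have "\<kappa> * cJ1 = T * ((K + CM * b1 * sqrt T) * (\<kappa> * sqrt T)) + \<kappa> * (CM * (T * b1)) * T"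
    by (simp add: cJ1_def algebra_simps)
   then show ?thesis using 1 2 by linarith
  qed
  moreover have "\<kappa> * cJ1 >= 0" using \<kappa> K_nonneg CM_ge b1_nonneg T0 by (simp add: cJ1_def)
  ultimately have "\<bar>integral {0..1} (%r. T * integral {0..T} (%z. Q t r z * (nr t r z - G t r z))
   - integral {0..T} (%z. (nr t r z - G t r z) * om t r z))\<bar> <= \<kappa> * cJ1 * (1 - 0)"
   by (intro abs_integral_le) auto
  then show "\<bar>integral {0..1} (%r. T * integral {0..T} (%z. Q t r z * (nr t r z - G t r z))
   - integral {0..T} (%z. (nr t r z - G t r z) * om t r z))\<bar> <= \<kappa> * cJ1" by simp
 qed (use s in auto)
 then show ?thesis using s by simp
qed

lemma h_bound:
 assumes s: "s >= 0" "r >= 0" and w: "!!z. z \<in> {0..T} ==> \<bar>wr s r z\<bar> <= X"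
 shows "\<bar>h s r\<bar> <= eps^2 * hb"
proof -
 have w2: "(wr s r z)^2 <= X^2" if "z \<in> {0..T}" for z
  using power_mono[OF w[OF that] abs_ge_zero, of 2] by simp
 have 2: "\<bar>h2 s r\<bar> <= X^2 * (T - 0)" unfolding h2_def
  by (rule abs_integral_le[OF T0]) (use w2 in auto)
 have 4: "\<bar>h4 s r\<bar> <= X^2 * X^2 * (T - 0)" unfolding h4_def
 proof (rule abs_integral_le[OF T0])
  fix z assume z: "z \<in> {0..T}"
  have "(wr s r z)^2 * (wr s r z)^2 <= X^2 * X^2" by (rule mult_mono[OF w2[OF z] w2[OF z]]) simp_all
  then show "\<bar>(wr s r z)^2 * (wr s r z)^2\<bar> <= X^2 * X^2" by (simp only: abs_mult abs_power2)
 qed simp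
 have sr: "s + r * T >= 0" using s T0 by simp
 have "\<bar>DB 0 (s + r * T) / 2 * h2 s r + DA 0 (s + r * T) / 4 * h4 s r\<bar> \<le>
   \<bar>DB 0 (s + r * T) / 2 * h2 s r\<bar> + \<bar>DA 0 (s + r * T) / 4 * h4 s r\<bar>" by (rule abs_triangle_ineq)
 also have "... = \<bar>DB 0 (s + r * T)\<bar> / 2 * \<bar>h2 s r\<bar> + \<bar>DA 0 (s + r * T)\<bar> / 4 * \<bar>h4 s r\<bar>"
  by (simp add: abs_mult)
 also have "... <= hb" unfolding hb_def
  using coefficient_bounds[OF sr] 2 4 by (intro add_mono mult_mono divide_right_mono) auto
 finally show ?thesis unfolding h_def abs_mult using eps by (auto intro!: mult_left_mono)
qed

lemma Lam_bound: "0 <= s ==> s <= S ==> \<bar>Lam s\<bar> <= eps^2 * (Bn * (sqrt T * K) * T)"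
proof -
 assume s: "0 <= s" "s <= S"
 have "\<bar>integral {0..T} (%z. n s z * U s z)\<bar> <= eps^2 * Bn * (sqrt T * K) * (T - 0)"
  by (rule abs_integral_le[OF T0])
   (use n_bound[OF s] U_bound[OF s] Bn_nonneg TK_nonneg in \<open>auto simp: abs_mult intro!: mult_mono\<close>)
 then show ?thesis unfolding Lam_def by (simp add: abs_mult mult_ac)
qed

definition "cJ2 = T * (CM * b1 * sqrt T * (2 * K + CM * b1 * sqrt T) + hb) + CM * b1 * X * T + (Bn * (sqrt T * K) * T + hb) * T"

text \<open>All corrections to T \<open>E\<close> are O(eps^2): the interpolated profile differs
  from the true one by O(eps^2), \<open>h\<close> and \<open>Lam\<close> carry eps^2 from the
  nonlinearity, and \<open>D\<close> contains the r-derivative \<open>\<rho>r\<close>, of the size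
  of the variation of R along the window.\<close>

lemma J_near_E:
 assumes s: "0 <= s" "s <= S1"
 shows "\<bar>J s - T * E s\<bar> <= eps^2 * cJ2"
proof -
 have sS: "s <= S" using node_le[OF s(2), of 0] M by simp
 have sT: "s + T <= S" using node_le[OF s(2) M] by simp
 have eE: "\<bar>e s r - E s\<bar> <= eps^2 * (CM * b1 * sqrt T * (2 * K + CM * b1 * sqrt T))" if r: "r \<in> {0..1}" for r
 proof -
  define q p where "q = L2_norm {0..T} (Q s r)" and "p = L2_norm {0..T} (%z. P0 z + R s z)"
  have ee: "e s r = q^2 / 2" unfolding e_def q_def L2_norm_sq by (simp only: power2_eq_square)
  have qp: "\<bar>q - p\<bar> <= CM * (eps^2 * b1) * sqrt T" unfolding q_def p_def
   by (rule order_trans[OF L2_norm_reverse_triangle[OF locL2_D[OF Q_locL2] locL2_D[OF P_locL2]] Q_norm(1)[OF s r]])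
  have nn: "0 <= q" "0 <= p" by (simp_all add: q_def p_def)
  have sum: "q + p <= 2 * K + CM * b1 * sqrt T"
   using Q_norm(2)[OF s r] energy[OF s(1) sS] unfolding q_def p_def by linarith
  have "\<bar>e s r - E s\<bar> = \<bar>q - p\<bar> * (q + p) / 2"
  proof -
   have eq: "e s r - E s = (q - p) * (q + p) / 2" by (simp add: ee E_def p_def power2_eq_square field_simps)
   show ?thesis unfolding eq abs_divide abs_mult using nn by simp
  qed
  also have "... <= \<bar>q - p\<bar> * (q + p)" using nn by simp
  also have "... <= CM * (eps^2 * b1) * sqrt T * (2 * K + CM * b1 * sqrt T)"
   using nn qp sum by (intro mult_mono) auto
  finally show ?thesis by (simp add: mult_ac)
 qed
 have hh: "\<bar>h s r\<bar> <= eps^2 * hb" if "r \<in> {0..1}" for r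
  by (rule h_bound) (use s that window_bounds(4)[OF s that] in auto)
 define c where "c = eps^2 * (CM * b1 * sqrt T * (2 * K + CM * b1 * sqrt T) + hb)"
 have c0: "c >= 0" using CM_ge b1_nonneg T0 K_nonneg hb_nonneg by (simp add: c_def)
 have "\<bar>integral {0..1} (%r. e s r - h s r - E s)\<bar> <= c * (1 - 0)"
 proof (rule abs_integral_le)
  fix r :: real assume "r \<in> {0..1}"
  from eE[OF this] hh[OF this] show "\<bar>e s r - h s r - E s\<bar> <= c" by (simp add: c_def distrib_left)
 qed (use c0 in auto)
 moreover have "integral {0..1} (%r. e s r - h s r - E s) = integral {0..1} (%r. e s r - h s r) - E s"
 proof -
  have "(%r. e s r - h s r) integrable_on {0..1}" by (intro integrable_continuous_real continuous_intros e_cont hr_cont s)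
  moreover have "(%r::real. E s) integrable_on {0..1}" by (intro integrable_continuous_real continuous_intros)
  ultimately have "integral {0..1} (%r. (e s r - h s r) - E s) = integral {0..1} (%r. e s r - h s r) - integral {0..1} (%r::real. E s)"
   by (rule HK_diff)
  then show ?thesis by simp
 qed
 ultimately have 1: "\<bar>T * integral {0..1} (%r. e s r - h s r) - T * E s\<bar> <= T * c"
  using T0 by (simp add: abs_mult mult_left_mono flip: right_diff_distrib)
 have "\<bar>integral {0..T} (%z. integral {0..1} (%r. \<rho>r s r z * Ur s r z))\<bar> <= CM * (eps^2 * b1) * X * (T - 0)"
 proof (rule abs_integral_le[OF T0])
  fix z
  have "\<bar>integral {0..1} (%r. \<rho>r s r z * Ur s r z)\<bar> <= CM * (eps^2 * b1) * X * (1 - 0)"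
   by (rule abs_integral_le)
    (use window_bounds(2,3)[OF s] CM_ge e2b X_ge in \<open>auto simp: abs_mult intro!: mult_mono\<close>)
  then show "\<bar>integral {0..1} (%r. \<rho>r s r z * Ur s r z)\<bar> <= CM * (eps^2 * b1) * X" by simp
 qed (use CM_ge e2b X_ge in auto)
 then have 2: "\<bar>D s\<bar> <= eps^2 * (CM * b1 * X * T)" by (simp add: D_def abs_mult mult_ac)
 have "\<bar>integral {s..s+T} gbd\<bar> <= eps^2 * (Bn * (sqrt T * K) * T + hb) * (s + T - s)"
 proof (rule abs_integral_le)
  fix t assume t: "t \<in> {s..s+T}"
  have t0: "0 <= t" "t <= S" using t s sT by auto
  have "\<bar>h t 0\<bar> <= eps^2 * hb"
   by (rule h_bound) (use t0 order_trans[OF W_bound[OF t0] X_ge(1)] in \<open>auto simp: endpoint_values\<close>)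
  then show "\<bar>gbd t\<bar> <= eps^2 * (Bn * (sqrt T * K) * T + hb)"
   using Lam_bound[OF t0] t0 by (simp add: gbd_def distrib_left max_def)
 qed (use T0 Bn_nonneg TK_nonneg hb_nonneg in auto)
 then have 3: "\<bar>prim gbd (s + T) - prim gbd s\<bar> <= eps^2 * ((Bn * (sqrt T * K) * T + hb) * T)"
  using prim_diff[OF loc_int_continuous[OF gbd_cont], of s "s + T"] T0 by simp
 have "eps^2 * cJ2 = T * c + eps^2 * (CM * b1 * X * T) + eps^2 * ((Bn * (sqrt T * K) * T + hb) * T)"
  by (simp add: cJ2_def c_def algebra_simps)
 then show ?thesis unfolding J_def using 1 2 3 by linarith
qed

lemma E_drift_window:
 assumes s: "0 <= s" "s <= S1"
 shows "T * \<bar>E s - E 0\<bar> <= \<kappa> * cJ1 * s + 2 * (eps^2 * cJ2)"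
proof -
 have "T * \<bar>E s - E 0\<bar> = \<bar>T * E s - T * E 0\<bar>" using T0 by (simp add: abs_mult flip: right_diff_distrib)
 then show ?thesis using J_drift[of s] J_near_E[OF s] J_near_E[of 0] s by force
qed

end

text \<open>The near-invariant requires M further periods of solution. It is therefore used only up
  to s - MT; the last M periods, and all s <= MT, are covered by the Lipschitz bound, at a cost
  O(eps^2).\<close>

theorem energy_drift:
 fixes T K :: real and KA KB :: "nat => real"
 assumes T: "T > 0" and M: "M >= 1"
 shows "\<exists>C\<ge>0. \<forall>eps DA DB P0 n S s. wave_data T K KA KB eps DA DB P0 n S \<and> 0 <= s \<and> s <= S \<longrightarrow>
  \<bar>(L2_norm {0..T} (%z. P0 z + tint n s z))^2 - (L2_norm {0..T} P0)^2\<bar> <= C * (eps^2 + s * eps ^ (M + 3))"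
proof -
 obtain C where C: "C >= 1" "!!j r. j <= M ==> r \<in> {0..1} ==> \<bar>poly (newton_poly j) r\<bar> <= C \<and> \<bar>poly (pderiv (newton_poly j)) r\<bar> <= C"
  using newton_poly_bound[of M] by blast
 obtain Ce where Ce: "Ce >= 0" "!!eps DA DB P0 n S s r z. wave_data T K KA KB eps DA DB P0 n S ==> 0 <= s ==> s + real M * T <= S ==> 0 <= r ==> r <= 1 ==>
  \<bar>nint M T r (%\<sigma>. n \<sigma> z) s - eps^2 * (DB 0 (s + r * T) * nint M T r (%\<sigma>. wfld P0 n \<sigma> z) s +
    DA 0 (s + r * T) * nint M T r (%\<sigma>. wfld P0 n \<sigma> z) s ^ 3)\<bar> <= Ce * eps ^ (M + 3)"
  using interpolated_nonlinearity_error[OF M T, of K KA KB] by blast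
 \<comment> \<open>The constants of the locales are repeated with T, K, KA, KB and M only, so that
   the final constant is visibly fixed before eps, the data and S.\<close>
 define BN where "BN = \<bar>KB 0\<bar> * (sqrt T * K) + \<bar>KA 0\<bar> * (sqrt T * K) ^ 3"
 define CM where "CM = (\<Sum>j\<le>M. C * 2 ^ j)"
 define b1 where "b1 = real M * T * BN"
 define X where "X = CM * (sqrt T * K)"
 define hb where "hb = \<bar>KB 0\<bar> / 2 * (X^2 * T) + \<bar>KA 0\<bar> / 4 * (X^2 * X^2 * T)"
 define c1 where "c1 = T * ((K + CM * b1 * sqrt T) * sqrt T) + CM * (T * b1) * T"
 define c2 where "c2 = T * (CM * b1 * sqrt T * (2 * K + CM * b1 * sqrt T) + hb) + CM * b1 * X * T + (BN * (sqrt T * K) * T + hb) * T"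
 define c3 where "c3 = K * (BN * sqrt T) * (real M * T)"
 define CC where "CC = 2 * (\<bar>c3\<bar> + (Ce * \<bar>c1\<bar> + 2 * \<bar>c2\<bar>) / T)"
 have CC0: "CC >= 0" using Ce T by (simp add: CC_def)
 have "\<bar>(L2_norm {0..T} (%z. P0 z + tint n s z))^2 - (L2_norm {0..T} P0)^2\<bar> <= CC * (eps^2 + s * eps ^ (M + 3))"
  if w: "wave_data T K KA KB eps DA DB P0 n S" and s: "0 <= s" "s <= S" for eps DA DB P0 n S s
 proof -
  interpret wave_data T K KA KB eps DA DB P0 n S by (rule w)
  have BN: "Bn = BN" by (simp add: Bn_def BN_def)
  have E2: "(L2_norm {0..T} (%z. P0 z + tint n s z))^2 - (L2_norm {0..T} P0)^2 = 2 * (E s - E 0)"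
   by (simp add: E_def tint_def field_simps)
  have crude: "\<bar>E t - E t'\<bar> <= eps^2 * \<bar>c3\<bar>" if t: "t \<in> {0..S}" "t' \<in> {0..S}" "\<bar>t - t'\<bar> <= real M * T" for t t'
  proof -
   have "\<bar>E t - E t'\<bar> <= K * (eps^2 * Bn * sqrt T) * \<bar>t - t'\<bar>" by (rule E_lipschitz[OF t(2,1)])
   also have "... <= K * (eps^2 * Bn * sqrt T) * (real M * T)"
    using t(3) K_nonneg Bn_nonneg T by (intro mult_left_mono) auto
   also have "... = eps^2 * c3" by (simp add: c3_def BN mult_ac)
   also have "... <= eps^2 * \<bar>c3\<bar>" by (intro mult_left_mono) auto
   finally show ?thesis .
  qed
  have e3: "0 <= s * eps ^ (M + 3)" using s eps by simp
  have main: "\<bar>E s - E 0\<bar> <= eps^2 * \<bar>c3\<bar> + (Ce * \<bar>c1\<bar> + 2 * \<bar>c2\<bar>) / T * (eps^2 + s * eps ^ (M + 3))"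
  proof (cases "s <= real M * T")
   case True
   then have "\<bar>E s - E 0\<bar> <= eps^2 * \<bar>c3\<bar>" using s S by (intro crude) auto
   moreover have "0 <= (Ce * \<bar>c1\<bar> + 2 * \<bar>c2\<bar>) / T * (eps^2 + s * eps ^ (M + 3))" using Ce T e3 by simp
   ultimately show ?thesis by linarith
  next
   case False
   \<comment> \<open>Starting M periods before s keeps every node at or before s, so the bound at s
     uses the solution on [0, s] only.\<close>
   define S1 where "S1 = s - real M * T"
   have S1: "0 <= S1" "S1 + real M * T <= S" "S1 <= s" using False s T by (auto simp: S1_def)
   interpret ww: wave_window T K KA KB eps DA DB P0 n S M S1 C "Ce * eps ^ (M + 3)"
   proof
    fix t r z assume "0 <= t" "t <= S1" "0 <= r" "r <= (1::real)"
    then show "\<bar>nint M T r (%\<sigma>. n \<sigma> z) t - eps^2 * (DB 0 (t + r * T) * nint M T r (%\<sigma>. W \<sigma> z) t +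
     DA 0 (t + r * T) * nint M T r (%\<sigma>. W \<sigma> z) t ^ 3)\<bar> <= Ce * eps ^ (M + 3)"
     by (intro Ce(2)[OF w]) (use S1 in auto)
   qed (use M S1 C Ce eps in auto)
   have cc: "ww.CM = CM" "ww.b1 = b1" "ww.X = X" by (simp_all add: ww.CM_def CM_def ww.b1_def b1_def BN ww.X_def X_def)
   have cc': "ww.hb = hb" by (simp add: ww.hb_def hb_def cc)
   have k1: "ww.cJ1 = c1" by (simp add: ww.cJ1_def c1_def cc)
   have k2: "ww.cJ2 = c2" by (simp add: ww.cJ2_def c2_def cc cc' BN)
   have "T * \<bar>E S1 - E 0\<bar> <= Ce * eps ^ (M + 3) * c1 * S1 + 2 * (eps^2 * c2)"
    using ww.E_drift_window[OF S1(1) order_refl] by (simp only: k1 k2)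
   also have "... <= Ce * \<bar>c1\<bar> * (eps^2 + s * eps ^ (M + 3)) + 2 * \<bar>c2\<bar> * (eps^2 + s * eps ^ (M + 3))"
   proof (rule add_mono)
    have "Ce * eps ^ (M + 3) * c1 * S1 <= Ce * eps ^ (M + 3) * \<bar>c1\<bar> * s"
     using Ce eps S1 by (intro mult_mono mult_left_mono) auto
    also have "... = Ce * \<bar>c1\<bar> * (s * eps ^ (M + 3))" by simp
    also have "... <= Ce * \<bar>c1\<bar> * (eps^2 + s * eps ^ (M + 3))" using Ce by (intro mult_left_mono) auto
    finally show "Ce * eps ^ (M + 3) * c1 * S1 <= Ce * \<bar>c1\<bar> * (eps^2 + s * eps ^ (M + 3))" .
    have "2 * (eps^2 * c2) <= 2 * \<bar>c2\<bar> * eps^2" using mult_right_mono[of c2 "\<bar>c2\<bar>" "eps^2"] by (simp add: mult.commute)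
    also have "... <= 2 * \<bar>c2\<bar> * (eps^2 + s * eps ^ (M + 3))" using e3 by (intro mult_left_mono) auto
    finally show "2 * (eps^2 * c2) <= 2 * \<bar>c2\<bar> * (eps^2 + s * eps ^ (M + 3))" .
   qed
   finally have "T * \<bar>E S1 - E 0\<bar> <= (Ce * \<bar>c1\<bar> + 2 * \<bar>c2\<bar>) * (eps^2 + s * eps ^ (M + 3))" by (simp only: distrib_right)
   then have "\<bar>E S1 - E 0\<bar> <= (Ce * \<bar>c1\<bar> + 2 * \<bar>c2\<bar>) / T * (eps^2 + s * eps ^ (M + 3))"
    using T by (simp add: field_simps)
   moreover have "\<bar>E s - E S1\<bar> <= eps^2 * \<bar>c3\<bar>"
   proof (rule crude)
    show "S1 \<in> {0..S}" using S1(1,3) s by simp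
   qed (use s T in \<open>auto simp: S1_def\<close>)
   ultimately show ?thesis by linarith
  qed
  have "eps^2 * \<bar>c3\<bar> <= \<bar>c3\<bar> * (eps^2 + s * eps ^ (M + 3))"
   using mult_left_mono[of "eps^2" "eps^2 + s * eps ^ (M + 3)" "\<bar>c3\<bar>"] e3 by (simp add: mult.commute)
  then have "\<bar>E s - E 0\<bar> <= (\<bar>c3\<bar> + (Ce * \<bar>c1\<bar> + 2 * \<bar>c2\<bar>) / T) * (eps^2 + s * eps ^ (M + 3))"
   using main by (simp only: distrib_right)
  then show ?thesis unfolding E2 CC_def abs_mult by (simp only: mult.assoc) simp
 qed
 with CC0 show ?thesis by blast
qed

subsection \<open>Long-time existence by truncation and bootstrap\<close>

text \<open>The truncation is an odd function, so it preserves the reflection symmetry that encodes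
  the boundary conditions.\<close>

definition clamp :: "real => real => real" where
 "clamp X w = max (- X) (min X w)"

lemma clamp_bound: "X >= 0 ==> \<bar>clamp X w\<bar> <= X"
 by (auto simp: clamp_def)

lemma clamp_id: "\<bar>w\<bar> <= X ==> clamp X w = w"
 by (auto simp: clamp_def)

lemma clamp_minus: "X >= 0 ==> clamp X (- w) = - clamp X w"
 by (auto simp: clamp_def max_def min_def)

lemma clamp_lipschitz: "\<bar>clamp X w - clamp X w'\<bar> <= \<bar>w - w'\<bar>"
 by (auto simp: clamp_def max_def min_def)

lemma cube_lipschitz:
 fixes a b X :: real
 assumes "\<bar>a\<bar> <= X" "\<bar>b\<bar> <= X"
 shows "\<bar>a ^ 3 - b ^ 3\<bar> <= 3 * X^2 * \<bar>a - b\<bar>"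
proof -
 have X: "X >= 0" using assms by linarith
 have e: "a ^ 3 - b ^ 3 = (a * a + a * b + b * b) * (a - b)" by (simp add: power3_eq_cube algebra_simps)
 have p: "\<bar>x * y\<bar> <= X^2" if "\<bar>x\<bar> <= X" "\<bar>y\<bar> <= X" for x y
  unfolding abs_mult power2_eq_square by (intro mult_mono that X) simp
 have "\<bar>a * a + a * b + b * b\<bar> <= \<bar>a * a\<bar> + \<bar>a * b\<bar> + \<bar>b * b\<bar>" by linarith
 also have "... <= 3 * X^2" using p[OF assms(1,1)] p[OF assms] p[OF assms(2,2)] by linarith
 finally show ?thesis unfolding e abs_mult by (intro mult_right_mono) auto
qed

text \<open>Clamping the field makes the cubic nonlinearity globally bounded and Lipschitz, so
  \<open>wave_existence\<close> applies on the whole half-line. The bound on n depends on the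
  clamping level X only, not on the size of the solution.\<close>

lemma truncated_wave_existence:
 fixes T eps X :: real
 assumes T: "T > 0" and e: "0 < eps" "eps <= 1" and DA: "der_chain eps KA DA" and DB: "der_chain eps KB DB"
  and P0: "locL2 P0" "periodic T P0" "integral {0..T} P0 = 0" and X: "X >= 0"
 shows "\<exists>n. wave_flow T P0 n \<and> (\<forall>s z. \<bar>n s z\<bar> <= eps^2 * (\<bar>KB 0\<bar> * X + \<bar>KA 0\<bar> * X ^ 3)) \<and>
  (\<forall>s\<ge>0. \<forall>z. n s z = eps^2 * (DB 0 s * clamp X (wfld P0 n s z) + DA 0 s * clamp X (wfld P0 n s z) ^ 3))"
proof -
 define F where "F = (%s w. eps^2 * (DB 0 s * clamp X w + DA 0 s * clamp X w ^ 3))"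
 have cb: "\<bar>DA 0 s\<bar> <= \<bar>KA 0\<bar>" "\<bar>DB 0 s\<bar> <= \<bar>KB 0\<bar>" if "s >= 0" for s
 proof -
  have "\<bar>DA 0 s\<bar> <= KA 0 * eps ^ 0" "\<bar>DB 0 s\<bar> <= KB 0 * eps ^ 0" using DA DB that unfolding der_chain_def by blast+
  then show "\<bar>DA 0 s\<bar> <= \<bar>KA 0\<bar>" "\<bar>DB 0 s\<bar> <= \<bar>KB 0\<bar>" by auto
 qed
 have cc: "continuous_on {0..} (DA 0)" "continuous_on {0..} (DB 0)"
  using DA DB unfolding der_chain_def continuous_on_eq_continuous_within by (auto intro!: DERIV_continuous)
 have Fc: "continuous_on ({0..} \<times> UNIV) (%(s, w). F s w)"
 proof -
  have "continuous_on ({0..} \<times> (UNIV :: real set)) (%q. DA 0 (fst q))" "continuous_on ({0..} \<times> (UNIV :: real set)) (%q. DB 0 (fst q))"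
   by (rule continuous_on_compose2[OF cc(1)], auto intro!: continuous_intros, rule continuous_on_compose2[OF cc(2)], auto intro!: continuous_intros)
  then have "continuous_on ({0..} \<times> UNIV) (%q. F (fst q) (snd q))"
   unfolding F_def clamp_def by (intro continuous_intros)
  then show ?thesis by (simp add: case_prod_beta)
 qed
 have e2: "eps^2 <= 1" using e by (simp add: power_le_one)
 have FB: "\<bar>F s w\<bar> <= eps^2 * (\<bar>KB 0\<bar> * X + \<bar>KA 0\<bar> * X ^ 3)" if s: "s >= 0" for s w
 proof -
  have "\<bar>DB 0 s * clamp X w + DA 0 s * clamp X w ^ 3\<bar> <= \<bar>DB 0 s * clamp X w\<bar> + \<bar>DA 0 s * clamp X w ^ 3\<bar>"
   by (rule abs_triangle_ineq)
  also have "... = \<bar>DB 0 s\<bar> * \<bar>clamp X w\<bar> + \<bar>DA 0 s\<bar> * \<bar>clamp X w\<bar> ^ 3" by (simp add: abs_mult power_abs)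
  also have "... <= \<bar>KB 0\<bar> * X + \<bar>KA 0\<bar> * X ^ 3"
   using cb[OF s] clamp_bound[OF X, of w] by (intro add_mono mult_mono power_mono) auto
  finally show ?thesis unfolding F_def abs_mult by (auto intro!: mult_left_mono)
 qed
 have FL: "\<bar>F s w - F s w'\<bar> <= (\<bar>KB 0\<bar> + \<bar>KA 0\<bar> * (3 * X^2)) * \<bar>w - w'\<bar>" if s: "s >= 0" for s w w'
 proof -
  let ?a = "clamp X w" and ?b = "clamp X w'"
  have "F s w - F s w' = eps^2 * (DB 0 s * (?a - ?b) + DA 0 s * (?a ^ 3 - ?b ^ 3))" by (simp add: F_def algebra_simps)
  then have "\<bar>F s w - F s w'\<bar> = eps^2 * \<bar>DB 0 s * (?a - ?b) + DA 0 s * (?a ^ 3 - ?b ^ 3)\<bar>" by (simp add: abs_mult)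
  also have "... <= 1 * (\<bar>DB 0 s\<bar> * \<bar>?a - ?b\<bar> + \<bar>DA 0 s\<bar> * \<bar>?a ^ 3 - ?b ^ 3\<bar>)"
   unfolding abs_mult[symmetric] by (intro mult_mono abs_triangle_ineq e2) auto
  also have "... <= 1 * (\<bar>KB 0\<bar> * \<bar>w - w'\<bar> + \<bar>KA 0\<bar> * (3 * X^2 * \<bar>w - w'\<bar>))"
  proof (intro mult_left_mono add_mono mult_mono cb s clamp_lipschitz)
   have "\<bar>?a ^ 3 - ?b ^ 3\<bar> <= 3 * X^2 * \<bar>?a - ?b\<bar>" by (rule cube_lipschitz[OF clamp_bound[OF X] clamp_bound[OF X]])
   also have "... <= 3 * X^2 * \<bar>w - w'\<bar>" by (intro mult_left_mono clamp_lipschitz) simp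
   finally show "\<bar>?a ^ 3 - ?b ^ 3\<bar> <= 3 * X^2 * \<bar>w - w'\<bar>" .
  qed auto
  finally show ?thesis by (simp add: algebra_simps)
 qed
 have odd: "F s (- w) = - F s w" if "s >= 0" for s w
  unfolding F_def clamp_minus[OF X] power3_eq_cube by (simp add: algebra_simps)
 obtain n where n: "continuous_on UNIV (%(s, z). n s z)" "\<forall>s z. \<bar>n s z\<bar> <= eps^2 * (\<bar>KB 0\<bar> * X + \<bar>KA 0\<bar> * X ^ 3)"
  "\<forall>s\<ge>0. \<forall>z. n s (2 * s - z) = - n s z \<and> n s (z + T) = n s z \<and> n s z = F s (wfld P0 n s z)"
  using wave_existence[OF T P0 Fc FB FL _ odd] by auto
 have "wave_flow T P0 n" by unfold_locales (use T P0 n in blast)+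
 then show ?thesis using n unfolding F_def by blast
qed

text \<open>While the norm is at most K = Eb + 1, the field stays below X and the truncation is
  inactive, so the drift estimate holds. It keeps the norm below Eb plus O(eps), strictly below K,
  and the bound on n allows only O(eps^2) growth in one further unit of time. The bound K therefore
  propagates by unit steps.\<close>

theorem wave_long_time:
 fixes T Eb :: real and KA KB :: "nat => real"
 assumes T: "T > 0" and M: "M >= 1" and Eb: "Eb >= 0"
 shows "\<exists>e0 C K. 0 < e0 \<and> e0 <= 1 \<and> C >= 0 \<and> (\<forall>eps DA DB P0. 0 < eps \<and> eps <= e0 \<and> der_chain eps KA DA \<and> der_chain eps KB DB \<and>
   locL2 P0 \<and> periodic T P0 \<and> integral {0..T} P0 = 0 \<and> L2_norm {0..T} P0 <= Eb \<longrightarrow>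
  (\<exists>n. wave_data T K KA KB eps DA DB P0 n (1 / eps ^ (M + 1)) \<and>
   (\<forall>s\<in>{0..1 / eps ^ (M + 1)}. \<bar>(L2_norm {0..T} (%z. P0 z + tint n s z))^2 - (L2_norm {0..T} P0)^2\<bar> <= C * eps^2)))"
proof -
 define K where "K = Eb + 1"
 define X where "X = sqrt T * K"
 have X: "X >= 0" using T Eb by (simp add: X_def K_def)
 define B where "B = \<bar>KB 0\<bar> * X + \<bar>KA 0\<bar> * X ^ 3"
 have B: "B >= 0" using X by (simp add: B_def)
 obtain C where C: "C >= 0" "!!eps DA DB P0 n S s. wave_data T K KA KB eps DA DB P0 n S ==> 0 <= s ==> s <= S ==>
  \<bar>(L2_norm {0..T} (%z. P0 z + tint n s z))^2 - (L2_norm {0..T} P0)^2\<bar> <= C * (eps^2 + s * eps ^ (M + 3))"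
  using energy_drift[OF T M, of K KA KB] by blast
 \<comment> \<open>The first summand times eps bounds the gain of the norm from the long-time drift,
   the second its growth during one unit step. For eps <= e0 their sum is at most 1, the gap between
   Eb and K.\<close>
 define q where "q = sqrt (2 * C) + B * sqrt T"
 have q: "q >= 0" using C B T by (simp add: q_def)
 define e0 where "e0 = 1 / (1 + q)"
 have e0: "0 < e0" "e0 <= 1" using q by (auto simp: e0_def)
 have main: "\<exists>n. wave_data T K KA KB eps DA DB P0 n (1 / eps ^ (M + 1)) \<and>
   (\<forall>s\<in>{0..1 / eps ^ (M + 1)}. \<bar>(L2_norm {0..T} (%z. P0 z + tint n s z))^2 - (L2_norm {0..T} P0)^2\<bar> <= (2 * C) * eps^2)"
  if e: "0 < eps" "eps <= e0" and DA: "der_chain eps KA DA" and DB: "der_chain eps KB DB"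
   and Pd: "locL2 P0" "periodic T P0" "integral {0..T} P0 = 0" "L2_norm {0..T} P0 <= Eb" for eps DA DB P0
 proof -
  have e1: "eps <= 1" using e e0 by linarith
  have qe: "q * eps <= 1"
  proof -
   have "q * eps <= q * e0" using e q by (intro mult_left_mono) auto
   also have "... <= 1" using q by (simp add: e0_def divide_le_eq)
   finally show ?thesis .
  qed
  obtain n where wf: "wave_flow T P0 n" and nB: "!!s z. \<bar>n s z\<bar> <= eps^2 * B"
   and ne: "!!s z. s >= 0 ==> n s z = eps^2 * (DB 0 s * clamp X (wfld P0 n s z) + DA 0 s * clamp X (wfld P0 n s z) ^ 3)"
   using truncated_wave_existence[OF T e(1) e1 DA DB Pd(1-3) X] unfolding B_def by blast
  interpret wave_flow T P0 n by (rule wf)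
  define Sm where "Sm = 1 / eps ^ (M + 1)"
  let ?N = "%s. L2_norm {0..T} (%z. P0 z + tint n s z)"
  have wd: "wave_data T K KA KB eps DA DB P0 n S" if S: "S >= 0" and en: "!!s. 0 <= s ==> s <= S ==> ?N s <= K" for S
  proof unfold_locales
   fix s z assume s: "0 <= s" "s <= S"
   have "\<bar>wfld P0 n s z\<bar> <= X" unfolding X_def
    by (rule order_trans[OF W_bound_norm[OF s(1)] mult_left_mono[OF en[OF s]]]) (use T in simp)
   then show "n s z = eps^2 * (DB 0 s * wfld P0 n s z + DA 0 s * wfld P0 n s z ^ 3)"
    using ne[OF s(1), of z] by (simp add: clamp_id)
  qed (use e e1 DA DB en S in auto)
  have drift: "\<bar>(?N s)^2 - (L2_norm {0..T} P0)^2\<bar> <= 2 * C * eps^2"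
   if S: "S >= 0" and en: "!!s. 0 <= s ==> s <= S ==> ?N s <= K" and s: "0 <= s" "s <= S" "s <= Sm" for S s
  proof -
   \<comment> \<open>At the end of the interval, s = eps^-(M+1), the accumulated residual has the
     size eps^2 of the fixed error, whence the factor 2.\<close>
   have "s * eps ^ (M + 3) <= Sm * eps ^ (M + 3)" using s e by (intro mult_right_mono) auto
   also have "... = eps^2" using e by (simp add: Sm_def power_add power2_eq_square power3_eq_cube)
   finally have "C * (eps^2 + s * eps ^ (M + 3)) <= C * (eps^2 + eps^2)" using C by (intro mult_left_mono) auto
   then show ?thesis using C(2)[OF wd[OF S en] s(1,2)] by simp
  qed
  have PL: "(%z. P0 z + tint n s z) \<in> L2_space {0..T}" for s by (rule locL2_D[OF P_locL2])
  have step: "?N s <= K" if S: "S >= 0" "S <= Sm" and en: "!!s. 0 <= s ==> s <= S ==> ?N s <= K" and s: "S <= s" "s <= S + 1" for S s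
  proof -
   have "(?N S)^2 <= (L2_norm {0..T} P0)^2 + 2 * C * eps^2" using drift[OF S(1) en S(1) order_refl S(2)] by linarith
   also have "... <= Eb^2 + 2 * C * eps^2" using power_mono[OF Pd(4) L2_norm_nonneg, of 2] by simp
   also have "... <= (Eb + sqrt (2 * C) * eps)^2"
    using C(1) Eb e by (simp add: power2_sum power_mult_distrib)
   finally have 1: "?N S <= Eb + sqrt (2 * C) * eps" by (rule power2_le_imp_le) (use C Eb e in simp)
   have "L2_norm {0..T} (%z. (P0 z + tint n s z) - (P0 z + tint n S z)) <= eps^2 * B * sqrt (T - 0)"
   proof (rule L2_norm_interval_le)
    show "continuous_on {0..T} (%z. P0 z + tint n s z - (P0 z + tint n S z))"
     by (simp, intro continuous_intros continuous_on_subset[OF continuous_on_snd_arg[OF R_cont]]) auto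
    fix z
    have "\<bar>tint n s z - tint n S z\<bar> <= eps^2 * B * \<bar>s - S\<bar>" unfolding tint_def
     by (rule prim_lipschitz[OF loc_int_continuous[OF continuous_on_flip_args[OF n_cont]] nB])
    also have "... <= eps^2 * B * 1" using s B by (intro mult_left_mono) auto
    finally show "\<bar>P0 z + tint n s z - (P0 z + tint n S z)\<bar> <= eps^2 * B" by simp
   qed (use B T in auto)
   moreover have "eps^2 * B * sqrt T <= B * sqrt T * eps"
   proof -
    have "eps * (eps * (B * sqrt T)) <= 1 * (eps * (B * sqrt T))" using e e1 B T by (intro mult_right_mono) auto
    then show ?thesis by (simp add: power2_eq_square mult_ac)
   qed
   ultimately have 2: "?N s - ?N S <= B * sqrt T * eps"
    using L2_norm_reverse_triangle[OF PL PL, of s S] by simp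
   have "sqrt (2 * C) * eps + B * sqrt T * eps <= 1" using qe by (simp add: q_def distrib_right)
   then show ?thesis using 1 2 by (simp add: K_def)
  qed
  have base: "?N 0 <= K" using Pd(4) by (simp add: tint_def K_def)
  have ind: "\<forall>s. 0 <= s \<and> s <= real m \<and> s <= Sm \<longrightarrow> ?N s <= K" for m
  proof (induction m)
   case 0
   show ?case using base by auto
  next
   case (Suc m)
   show ?case
   proof (intro allI impI)
    fix s assume s: "0 <= s \<and> s <= real (Suc m) \<and> s <= Sm"
    show "?N s <= K"
    proof (cases "s <= real m")
     case True
     then show ?thesis using Suc s by blast
    next
     case False
     show ?thesis by (rule step[of "real m"]) (use Suc s False in auto)
    qed
   qed
  qed
  have en: "?N s <= K" if "0 <= s" "s <= Sm" for s
  proof -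
   obtain m :: nat where "s <= real m" using real_arch_simple by blast
   with ind[of m] that show ?thesis by blast
  qed
  have Sm0: "Sm >= 0" using e by (simp add: Sm_def)
  have "wave_data T K KA KB eps DA DB P0 n Sm" by (rule wd[OF Sm0 en])
  moreover have "\<forall>s\<in>{0..Sm}. \<bar>(?N s)^2 - (L2_norm {0..T} P0)^2\<bar> <= 2 * C * eps^2"
   using drift[OF Sm0 en] by auto
  ultimately show ?thesis unfolding Sm_def by blast
 qed
 show ?thesis
  by (intro exI[of _ e0] exI[of _ "2 * C"] exI[of _ K] conjI e0 allI impI) (use C main in auto)
qed

section \<open>Test functions and weak derivatives on an interval\<close>

text \<open>The flat function exp (-1/y) together with all factors y^-j that its derivatives
  produce; the family spans a space closed under differentiation.\<close>

definition flat_exp :: "nat => real => real" where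
 "flat_exp j y = (if y > 0 then (1 / y) ^ j * exp (- (1 / y)) else 0)"

lemma flat_exp_limit: "((%h. flat_exp j h) \<longlongrightarrow> 0) (at 0)"
proof -
 have "((%h::real. inverse h ^ j / exp (inverse h)) \<longlongrightarrow> 0) (at_right 0)"
  by (rule filterlim_compose[OF tendsto_power_div_exp_0 filterlim_inverse_at_top_right])
 then have r: "(flat_exp j \<longlongrightarrow> 0) (at_right 0)"
  by (rule Lim_transform_eventually)
   (auto simp: flat_exp_def eventually_at_filter exp_minus divide_simps)
 have "(flat_exp j \<longlongrightarrow> 0) (at_left 0)"
  by (rule tendsto_eventually) (auto simp: flat_exp_def eventually_at_filter)
 with r show ?thesis by (simp add: filterlim_split_at)
qed

text \<open>At 0 the difference quotient of \<open>flat_exp j\<close> is \<open>flat_exp\<close> of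
  index j + 1, which tends to 0; elsewhere the usual rules apply on an open half-line.\<close>

lemma flat_exp_deriv: "(flat_exp j has_real_derivative flat_exp (j + 2) y - real j * flat_exp (j + 1) y) (at y)"
proof (cases "y = 0")
 case True
 have "((%h. (flat_exp j h - flat_exp j 0) / (h - 0)) \<longlongrightarrow> 0) (at 0)"
 proof (rule Lim_transform_eventually[OF flat_exp_limit[of "Suc j"]])
  show "\<forall>\<^sub>F h in at 0. flat_exp (Suc j) h = (flat_exp j h - flat_exp j 0) / (h - 0)"
   by (auto simp: flat_exp_def eventually_at_filter)
 qed
 then show ?thesis using True by (simp add: has_field_derivative_iff flat_exp_def)
next
 case False
 show ?thesis
 proof (cases "y > 0")
  case True
  have "((%y. (1 / y) ^ j * exp (- (1 / y))) has_real_derivative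
    real j * (1 / y) ^ (j - 1) * (- (1 / y^2)) * exp (- (1 / y)) + (1 / y) ^ j * (exp (- (1 / y)) * (1 / y^2))) (at y)"
   using True by (auto intro!: derivative_eq_intros simp: power2_eq_square)
  moreover have "real j * (1 / y) ^ (j - 1) * (- (1 / y^2)) * exp (- (1 / y)) + (1 / y) ^ j * (exp (- (1 / y)) * (1 / y^2)) =
    flat_exp (j + 2) y - real j * flat_exp (j + 1) y"
   using True by (cases j) (auto simp: flat_exp_def power2_eq_square field_simps)
  ultimately have "((%y. (1 / y) ^ j * exp (- (1 / y))) has_real_derivative flat_exp (j + 2) y - real j * flat_exp (j + 1) y) (at y)"
   by simp
  then show ?thesis
   by (rule has_field_derivative_transform_within_open[where S="{0<..}"]) (use True in \<open>auto simp: flat_exp_def\<close>)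
 next
  case neg: False
  then have y: "y < 0" using False by simp
  have "((%y. 0) has_real_derivative flat_exp (j + 2) y - real j * flat_exp (j + 1) y) (at y)"
   using y by (simp add: flat_exp_def)
  then show ?thesis
   by (rule has_field_derivative_transform_within_open[where S="{..<0}"]) (use y in \<open>auto simp: flat_exp_def\<close>)
 qed
qed

text \<open>An algebra closed under differentiation, so that differentiability of all iterates of
  \<open>deriv\<close>, as \<open>test_functions\<close> demands, follows by induction. It contains
  polynomials and the cutoff functions.\<close>

inductive_set smooth_alg :: "(real => real) set" where
 const: "(%x. c) \<in> smooth_alg"
| ident: "(%x. x) \<in> smooth_alg"
| flat: "(%x. flat_exp j (a * x + b)) \<in> smooth_alg"
| add: "f \<in> smooth_alg ==> g \<in> smooth_alg ==> (%x. f x + g x) \<in> smooth_alg"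
| mult: "f \<in> smooth_alg ==> g \<in> smooth_alg ==> (%x. f x * g x) \<in> smooth_alg"

lemma smooth_alg_cmult: "f \<in> smooth_alg ==> (%x. c * f x) \<in> smooth_alg"
 by (rule smooth_alg.mult[OF smooth_alg.const])

lemma smooth_alg_diff: "f \<in> smooth_alg ==> g \<in> smooth_alg ==> (%x. f x - g x) \<in> smooth_alg"
 using smooth_alg.add[OF _ smooth_alg_cmult[of g "-1"], of f] by simp

lemma smooth_alg_deriv: "f \<in> smooth_alg ==> \<exists>f'\<in>smooth_alg. \<forall>x. (f has_real_derivative f' x) (at x)"
proof (induction rule: smooth_alg.induct)
 case (const c)
 show ?case by (rule bexI[OF _ smooth_alg.const[of 0]]) simp
next
 case ident
 show ?case by (rule bexI[OF _ smooth_alg.const[of 1]]) simp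
next
 case (flat j a b)
 have "(%x. a * (flat_exp (j + 2) (a * x + b) - real j * flat_exp (j + 1) (a * x + b))) \<in> smooth_alg"
  by (intro smooth_alg_cmult smooth_alg_diff smooth_alg.flat)
 moreover have "((%x. flat_exp j (a * x + b)) has_real_derivative
   a * (flat_exp (j + 2) (a * x + b) - real j * flat_exp (j + 1) (a * x + b))) (at x)" for x
 proof -
  have "((%x. flat_exp j (a * x + b)) has_real_derivative
   (flat_exp (j + 2) (a * x + b) - real j * flat_exp (j + 1) (a * x + b)) * a) (at x)"
   by (rule DERIV_chain2[OF flat_exp_deriv]) (auto intro!: derivative_eq_intros)
  then show ?thesis by (simp only: mult.commute)
 qed
 ultimately show ?case
  by (intro bexI[of _ "%x. a * (flat_exp (j + 2) (a * x + b) - real j * flat_exp (j + 1) (a * x + b))"] allI)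
next
 case (add f g)
 then obtain f' g' where "f' \<in> smooth_alg" "\<forall>x. (f has_real_derivative f' x) (at x)"
  "g' \<in> smooth_alg" "\<forall>x. (g has_real_derivative g' x) (at x)" by blast
 then show ?case
  by (intro bexI[of _ "%x. f' x + g' x"] smooth_alg.add) (auto intro!: derivative_intros)
next
 case (mult f g)
 then obtain f' g' where "f' \<in> smooth_alg" "\<forall>x. (f has_real_derivative f' x) (at x)"
  "g' \<in> smooth_alg" "\<forall>x. (g has_real_derivative g' x) (at x)" by blast
 then show ?case using mult.hyps
  by (intro bexI[of _ "%x. f' x * g x + f x * g' x"] smooth_alg.add smooth_alg.mult)
   (auto intro!: derivative_eq_intros)
qed

lemma smooth_alg_continuous: "f \<in> smooth_alg ==> continuous_on X f"
 using smooth_alg_deriv[of f] by (metis DERIV_isCont continuous_at_imp_continuous_on)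

lemma deriv_smooth_alg: "f \<in> smooth_alg ==> deriv f \<in> smooth_alg"
proof -
 assume "f \<in> smooth_alg"
 then obtain f' where f': "f' \<in> smooth_alg" "!!x. (f has_real_derivative f' x) (at x)" using smooth_alg_deriv by blast
 then have "deriv f = f'" by (auto simp: fun_eq_iff intro: DERIV_imp_deriv)
 then show ?thesis using f' by simp
qed

lemma higher_deriv_smooth_alg: "f \<in> smooth_alg ==> (deriv ^^ k) f \<in> smooth_alg"
 by (induction k) (auto intro: deriv_smooth_alg)

lemma smooth_alg_differentiable: "f \<in> smooth_alg ==> f differentiable_on UNIV"
 using smooth_alg_deriv[of f]
 by (metis differentiable_at_imp_differentiable_on real_differentiable_def)

definition compact_smooth :: "real => (real => real) set" where
 "compact_smooth l = {f \<in> smooth_alg. \<exists>d>0. \<forall>x. x \<notin> {d..l - d} \<longrightarrow> f x = 0}"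

lemma test_functionsI:
 assumes d: "d > 0" and z: "!!x. x \<notin> {d..l - d} ==> f x = 0" and sm: "!!k. (deriv ^^ k) f differentiable_on UNIV"
 shows "f \<in> test_functions {0<..<l}"
proof -
 have "{x. f x \<noteq> 0} \<subseteq> {d..l - d}" using z by blast
 then have c: "closure {x. f x \<noteq> 0} \<subseteq> {d..l - d}" by (rule closure_minimal) simp
 then have "bounded (closure {x. f x \<noteq> 0})" by (rule bounded_subset[OF bounded_closed_interval])
 then have "compact (closure {x. f x \<noteq> 0})" by (simp add: compact_eq_bounded_closed)
 moreover have "closure {x. f x \<noteq> 0} \<subseteq> {0<..<l}" using c d by fastforce
 ultimately show ?thesis using sm by (simp add: test_functions_def)
qed

lemma compact_smooth_test: "f \<in> compact_smooth l ==> f \<in> test_functions {0<..<l}"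
 unfolding compact_smooth_def
 by (auto intro!: test_functionsI smooth_alg_differentiable higher_deriv_smooth_alg)

lemma compact_smooth_smooth: "f \<in> compact_smooth l ==> f \<in> smooth_alg"
 by (simp add: compact_smooth_def)

lemma compact_smooth_diff:
 assumes "f \<in> compact_smooth l" "g \<in> compact_smooth l"
 shows "(%x. f x - c * g x) \<in> compact_smooth l"
proof -
 obtain d e where de: "d > 0" "!!x. x \<notin> {d..l - d} ==> f x = 0" "e > 0" "!!x. x \<notin> {e..l - e} ==> g x = 0"
  using assms by (auto simp: compact_smooth_def)
 have "f x - c * g x = 0" if "x \<notin> {min d e..l - min d e}" for x
 proof -
  have "x \<notin> {d..l - d}" "x \<notin> {e..l - e}" using that by (auto simp: min_def split: if_splits)
  then show ?thesis using de by simp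
 qed
 then have "\<exists>d>0. \<forall>x. x \<notin> {d..l - d} \<longrightarrow> f x - c * g x = 0"
  using de by (intro exI[of _ "min d e"]) simp
 then show ?thesis using assms by (auto simp: compact_smooth_def intro: smooth_alg_diff smooth_alg_cmult)
qed

text \<open>Vanishing mean makes the primitive zero to the right of the support as well as to the
  left. Smoothness is inherited, since the derivative is f itself.\<close>

lemma prim_test_function:
 assumes f: "f \<in> compact_smooth l" and z: "integral {0..l} f = 0" and l: "l > 0"
 shows "prim f \<in> test_functions {0<..<l}" "deriv (prim f) = f"
proof -
 have fs: "f \<in> smooth_alg" by (rule compact_smooth_smooth[OF f])
 have fc: "continuous_on UNIV f" by (rule smooth_alg_continuous[OF fs])
 note d = prim_deriv[OF fc]
 show df: "deriv (prim f) = f" by (auto simp: fun_eq_iff intro: DERIV_imp_deriv d)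
 obtain \<delta> where \<delta>: "\<delta> > 0" "!!x. x \<notin> {\<delta>..l - \<delta>} ==> f x = 0" using f by (auto simp: compact_smooth_def)
 have li: "loc_int f" by (rule loc_int_continuous[OF fc])
 show "prim f \<in> test_functions {0<..<l}"
 proof (rule test_functionsI[OF \<delta>(1)])
  fix x assume x: "x \<notin> {\<delta>..l - \<delta>}"
  have zero: "integral {a..b} f = 0" if "!!y. y \<in> {a..b} ==> f y = 0" for a b
   using that by (metis HK_cong Henstock_Kurzweil_Integration.integral_0)
  have pl: "prim f l = 0" using prim_diff[OF li, of 0 l] l z by simp
  show "prim f x = 0"
  proof (cases "x < \<delta>")
   case True
   have "prim f (max 0 x) - prim f (min 0 x) = integral {min 0 x..max 0 x} f" by (rule prim_diff[OF li]) simp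
   also have "... = 0"
   proof (rule zero)
    fix y assume "y \<in> {min 0 x..max 0 x}"
    then have "y < \<delta>" using True \<delta>(1) by (auto simp: max_def split: if_splits)
    then show "f y = 0" by (intro \<delta>(2)) simp
   qed
   finally show ?thesis by (cases "0 <= x") (simp_all add: prim_0)
  next
   case False
   then have xl: "x > l - \<delta>" using x by auto
   have "prim f (max l x) - prim f (min l x) = integral {min l x..max l x} f" by (rule prim_diff[OF li]) simp
   also have "... = 0"
   proof (rule zero)
    fix y assume "y \<in> {min l x..max l x}"
    then have "l - \<delta> < y" using xl \<delta>(1) by (auto simp: min_def split: if_splits)
    then show "f y = 0" by (intro \<delta>(2)) simp
   qed
   finally show ?thesis using pl by (cases "l <= x") (simp_all add: max_def min_def)
  qed
 next
  fix k
  show "(deriv ^^ k) (prim f) differentiable_on UNIV"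
  proof (cases k)
   case 0
   then show ?thesis using d by (metis differentiable_at_imp_differentiable_on funpow_0 real_differentiable_def)
  next
   case (Suc m)
   then have "(deriv ^^ k) (prim f) = (deriv ^^ m) f" by (simp add: funpow_Suc_right df del: funpow.simps)
   then show ?thesis using smooth_alg_differentiable[OF higher_deriv_smooth_alg[OF fs]] by simp
  qed
 qed
qed

text \<open>A product of two flat factors: the left one vanishes for x <= 1 / (n + 1), the right one
  for x >= l - 1 / (n + 1), and both tend to 1 in the interior.\<close>

definition cutoff :: "real => nat => real => real" where
 "cutoff l n x = flat_exp 0 (real (Suc n) * x + - 1) * flat_exp 0 (- real (Suc n) * x + (real (Suc n) * l - 1))"

lemma cutoff_smooth: "cutoff l n \<in> smooth_alg"
 unfolding cutoff_def[abs_def] by (intro smooth_alg.mult smooth_alg.flat)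

lemma cutoff_support: "x \<notin> {1 / real (Suc n)..l - 1 / real (Suc n)} ==> cutoff l n x = 0"
 by (auto simp: cutoff_def flat_exp_def field_simps)

lemma cutoff_bounds: "0 <= cutoff l n x" "cutoff l n x <= 1"
proof -
 have *: "0 <= flat_exp 0 y \<and> flat_exp 0 y <= 1" for y by (auto simp: flat_exp_def)
 show "0 <= cutoff l n x" "cutoff l n x <= 1" unfolding cutoff_def using * by (auto intro!: mult_le_one)
qed

lemma cutoff_limit:
 assumes x: "x \<in> {0<..<l}"
 shows "(%n. cutoff l n x) \<longlonglongrightarrow> 1"
proof -
 have *: "(%n. flat_exp 0 (real (Suc n) * y - 1)) \<longlonglongrightarrow> 1" if y: "y > 0" for y
 proof -
  have t: "filterlim (%n. real (Suc n) * y - 1) at_top sequentially"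
  proof (rule filterlim_at_top_mono)
   show "filterlim (%n. real n * y + (y - 1)) at_top sequentially"
    using filterlim_tendsto_add_at_top[OF tendsto_const filterlim_at_top_mult_tendsto_pos[OF tendsto_const y filterlim_real_sequentially], of "y - 1"]
    by (simp add: add.commute)
   show "\<forall>\<^sub>F n in sequentially. real n * y + (y - 1) <= real (Suc n) * y - 1" by (simp add: algebra_simps)
  qed
  have "(%n. exp (- inverse (real (Suc n) * y - 1))) \<longlonglongrightarrow> exp (- 0)"
   by (intro tendsto_intros tendsto_inverse_0_at_top t)
  then have "(%n. exp (- inverse (real (Suc n) * y - 1))) \<longlonglongrightarrow> 1" by simp
  then show ?thesis
  proof (rule Lim_transform_eventually)
   show "\<forall>\<^sub>F n in sequentially. exp (- inverse (real (Suc n) * y - 1)) = flat_exp 0 (real (Suc n) * y - 1)"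
    using filterlim_at_top_dense[THEN iffD1, OF t, rule_format, of 0]
    by eventually_elim (simp add: flat_exp_def inverse_eq_divide)
  qed
 qed
 have "(%n. flat_exp 0 (real (Suc n) * x - 1) * flat_exp 0 (real (Suc n) * (l - x) - 1)) \<longlonglongrightarrow> 1 * 1"
  by (intro tendsto_mult *) (use x in auto)
 moreover have "cutoff l n x = flat_exp 0 (real (Suc n) * x - 1) * flat_exp 0 (real (Suc n) * (l - x) - 1)" for n
 proof -
  have "- real (Suc n) * x + (real (Suc n) * l - 1) = real (Suc n) * (l - x) - 1" by (simp add: algebra_simps)
  then show ?thesis unfolding cutoff_def by (simp only: add_uminus_conv_diff)
 qed
 ultimately show ?thesis by (simp only: mult_1_right)
qed

lemma real_polynomial_smooth: "real_polynomial_function p ==> p \<in> smooth_alg" for p :: "real => real"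
proof (induction rule: real_polynomial_function.induct)
 case (linear f)
 then obtain c where "f = (%x. x * c)" using real_bounded_linear by blast
 then show ?case using smooth_alg.mult[OF smooth_alg.ident smooth_alg.const] by simp
qed (auto intro: smooth_alg.intros)

text \<open>Approximate by a continuous function, then uniformly by a polynomial, then cut off near
  the end points; dominated convergence controls the last step.\<close>

lemma compact_smooth_dense:
 assumes g: "g \<in> L2_space {0..l}" and e: "e > 0" and l: "l > 0"
 obtains \<phi> where "\<phi> \<in> compact_smooth l" "L2_norm {0..l} (%x. g x - \<phi> x) < e"
proof -
 obtain h where h: "continuous_on UNIV h" "L2_norm {0..l} (%x. g x - h x) < e / 3"
  using L2_continuous_approx[OF g, of "e / 3"] e by auto
 have e3: "e / (3 * (sqrt l + 1)) > 0" using e l by (simp add: add_nonneg_pos)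
 obtain p where p: "real_polynomial_function p" "!!x. x \<in> {0..l} ==> \<bar>h x - p x\<bar> < e / (3 * (sqrt l + 1))"
  using Stone_Weierstrass_real_polynomial_function[OF compact_Icc continuous_on_subset[OF h(1)] e3, of 0 l] by auto
 have ps: "p \<in> smooth_alg" by (rule real_polynomial_smooth[OF p(1)])
 have pc: "continuous_on X p" for X by (rule smooth_alg_continuous[OF ps])
 have pL: "p \<in> L2_space {0..l}" by (rule L2_continuous[OF pc])
 have hL: "h \<in> L2_space {0..l}" by (rule L2_continuous[OF continuous_on_subset[OF h(1)]]) simp
 have hp: "L2_norm {0..l} (%x. h x - p x) < e / 3"
 proof -
  have "L2_norm {0..l} (%x. h x - p x) <= e / (3 * (sqrt l + 1)) * sqrt (l - 0)"
  proof (rule L2_norm_interval_le)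
   show "continuous_on {0..l} (%x. h x - p x)"
    by (intro continuous_on_diff pc continuous_on_subset[OF h(1)]) simp
  next
   fix x assume "x \<in> {0..l}"
   then show "\<bar>h x - p x\<bar> <= e / (3 * (sqrt l + 1))" by (rule less_imp_le[OF p(2)])
  qed (use l e3 in simp_all)
  also have "... < e / (3 * (sqrt l + 1)) * (sqrt l + 1)" by (rule mult_strict_left_mono[OF _ e3]) simp
  also have "... = e / 3"
  proof -
   have "sqrt l + 1 \<noteq> 0" using real_sqrt_ge_zero[of l] l by linarith
   then show ?thesis by (simp add: field_simps)
  qed
  finally show ?thesis .
 qed
 define \<phi> where "\<phi> = (%n x. p x * cutoff l n x)"
 have \<phi>s: "\<phi> n \<in> smooth_alg" for n unfolding \<phi>_def by (intro smooth_alg.mult ps cutoff_smooth)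
 have \<phi>t: "\<phi> n \<in> compact_smooth l" for n
  unfolding compact_smooth_def using \<phi>s cutoff_support[of _ n l] by (auto simp: \<phi>_def intro!: exI[of _ "1 / real (Suc n)"])
 have \<phi>L: "\<phi> n \<in> L2_space {0..l}" for n by (rule L2_continuous[OF smooth_alg_continuous[OF \<phi>s]])
 let ?M = "lebesgue_on {0..l}"
 have "(%n. LINT x|?M. (p x - \<phi> n x)^2) \<longlonglongrightarrow> (LINT x|?M. 0)"
 proof (rule integral_dominated_convergence[where w="%x. (p x)^2"])
  show "(%x. (p x - \<phi> n x)^2) \<in> borel_measurable ?M" for n
   using L2_measurable[OF pL] L2_measurable[OF \<phi>L] by measurable
  show "integrable ?M (%x. (p x)^2)" by (rule L2_sq_integrable[OF pL])
  have "{0, l} \<in> null_sets lebesgue" by (simp add: negligible_iff_null_sets[symmetric])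
  then have "AE x in lebesgue. x \<notin> {0, l}" by (rule AE_not_in)
  then have "AE x in lebesgue. x \<in> {0..l} \<longrightarrow> (%n. (p x - \<phi> n x)^2) \<longlonglongrightarrow> 0"
  proof eventually_elim
   case (elim x)
   show ?case
   proof
    assume "x \<in> {0..l}"
    then have "x \<in> {0<..<l}" using elim by auto
    from cutoff_limit[OF this] have "(%n. (p x - p x * cutoff l n x)^2) \<longlonglongrightarrow> (p x - p x * 1)^2"
     by (intro tendsto_intros)
    then show "(%n. (p x - \<phi> n x)^2) \<longlonglongrightarrow> 0" by (simp add: \<phi>_def)
   qed
  qed
  then show "AE x in ?M. (%n. (p x - \<phi> n x)^2) \<longlonglongrightarrow> 0" by (simp add: AE_restrict_space_iff)
  show "AE x in ?M. norm ((p x - \<phi> n x)^2) <= (p x)^2" for n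
  proof (rule AE_I2)
   fix x
   have "p x - \<phi> n x = p x * (1 - cutoff l n x)" by (simp add: \<phi>_def algebra_simps)
   then have "\<bar>p x - \<phi> n x\<bar> <= \<bar>p x\<bar> * 1"
    unfolding abs_mult using cutoff_bounds[of l n x] by (metis abs_ge_zero abs_mult abs_of_nonneg diff_ge_0_iff_ge diff_le_eq le_add_same_cancel1 mult_left_mono)
   from power_mono[OF this abs_ge_zero, of 2]
   show "norm ((p x - \<phi> n x)^2) <= (p x)^2" by (simp only: power2_abs real_norm_def abs_power2 mult_1_right)
  qed
 qed simp
 from tendsto_real_sqrt[OF this] have "(%n. L2_norm {0..l} (%x. p x - \<phi> n x)) \<longlonglongrightarrow> 0"
  by (simp add: L2_norm_def)
 then obtain n where n: "L2_norm {0..l} (%x. p x - \<phi> n x) < e / 3"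
  using LIMSEQ_D[of _ 0 "e/3"] e by fastforce
 have "L2_norm {0..l} (%x. g x - \<phi> n x) < e"
  using L2_norm_triangle'[OF g hL \<phi>L[of n]] L2_norm_triangle'[OF hL pL \<phi>L[of n]] h(2) hp n by linarith
 with \<phi>t[of n] show ?thesis by (rule that)
qed

text \<open>An arbitrary approximation has small mean, which is removed by subtracting a multiple of
  one fixed \<theta>. Choosing \<theta> close to 1 in norm ensures that its mean is
  positive.\<close>

lemma compact_smooth_mean_zero_dense:
 assumes g: "g \<in> L2_space {0..l}" and z: "integral {0..l} g = 0" and e: "e > 0" and l: "l > 0"
 obtains \<phi> where "\<phi> \<in> compact_smooth l" "integral {0..l} \<phi> = 0" "L2_norm {0..l} (%x. g x - \<phi> x) < e"
proof -
 have sL: "f \<in> L2_space {0..l}" if "f \<in> compact_smooth l" for f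
  by (rule L2_continuous[OF smooth_alg_continuous[OF compact_smooth_smooth[OF that]]])
 have oL: "(%x. 1) \<in> L2_space {0..l}" by (rule L2_continuous) simp
 have ii: "f integrable_on {0..l}" if "f \<in> L2_space {0..l}" for f
  using L2_integrable[OF that lmeasurable_Icc] by (auto intro: integrable_on_lebesgue_on)
 obtain \<theta> where \<theta>: "\<theta> \<in> compact_smooth l" "L2_norm {0..l} (%x. 1 - \<theta> x) < sqrt l / 2"
  using compact_smooth_dense[OF oL, of "sqrt l / 2"] l by auto
 define m where "m = integral {0..l} \<theta>"
 have "\<bar>integral {0..l} (%x. 1 - \<theta> x)\<bar> <= sqrt (l - 0) * L2_norm {0..l} (%x. 1 - \<theta> x)"
  by (rule L2_integral_cauchy_schwarz(2)[OF L2_diff[OF oL sL[OF \<theta>(1)]]]) (use l in simp)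
 also have "... <= sqrt l * (sqrt l / 2)" using \<theta>(2) l by (intro mult_mono) auto
 also have "... = l / 2" using l by simp
 also have "integral {0..l} (%x. 1 - \<theta> x) = l - m"
  using ii[OF oL] ii[OF sL[OF \<theta>(1)]] l by (simp add: HK_diff m_def)
 finally have m: "m > 0" using l by linarith
 define N where "N = L2_norm {0..l} \<theta>"
 have N: "N >= 0" by (simp add: N_def)
 \<comment> \<open>An approximation within \<eta> forces a coefficient of at most sqrt l \<eta> / m,
   so the corrected function is within \<eta> (1 + sqrt l N / m) = e / 2.\<close>
 define \<eta> where "\<eta> = e / (2 * (1 + sqrt l * N / m))"
 have D: "1 + sqrt l * N / m > 0" using l N m by (intro add_pos_nonneg) auto
 have \<eta>: "\<eta> > 0" using D e by (simp add: \<eta>_def)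
 obtain \<psi> where \<psi>: "\<psi> \<in> compact_smooth l" "L2_norm {0..l} (%x. g x - \<psi> x) < \<eta>"
  using compact_smooth_dense[OF g \<eta> l] by auto
 define c where "c = integral {0..l} \<psi> / m"
 have "\<bar>integral {0..l} (%x. g x - \<psi> x)\<bar> <= sqrt (l - 0) * L2_norm {0..l} (%x. g x - \<psi> x)"
  by (rule L2_integral_cauchy_schwarz(2)[OF L2_diff[OF g sL[OF \<psi>(1)]]]) (use l in simp)
 also have "integral {0..l} (%x. g x - \<psi> x) = - (c * m)"
  using ii[OF g] ii[OF sL[OF \<psi>(1)]] m by (simp add: HK_diff z c_def)
 also have "sqrt (l - 0) * L2_norm {0..l} (%x. g x - \<psi> x) <= sqrt l * \<eta>"
  using mult_left_mono[OF less_imp_le[OF \<psi>(2)], of "sqrt l"] l by simp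
 also have "\<bar>- (c * m)\<bar> = \<bar>c\<bar> * m" using m by (simp add: abs_mult)
 finally have "\<bar>c\<bar> * m <= sqrt l * \<eta>" .
 then have c: "\<bar>c\<bar> <= sqrt l * \<eta> / m" using m by (simp add: pos_le_divide_eq)
 let ?\<phi> = "%x. \<psi> x - c * \<theta> x"
 have t: "?\<phi> \<in> compact_smooth l" by (rule compact_smooth_diff[OF \<psi>(1) \<theta>(1)])
 have "integral {0..l} ?\<phi> = integral {0..l} \<psi> - c * m"
  using ii[OF sL[OF \<psi>(1)]] ii[OF L2_cmult[OF sL[OF \<theta>(1)]], of c] by (simp add: HK_diff m_def)
 then have iz: "integral {0..l} ?\<phi> = 0" using m by (simp add: c_def)
 have "L2_norm {0..l} (%x. (g x - \<psi> x) + c * \<theta> x) <= L2_norm {0..l} (%x. g x - \<psi> x) + L2_norm {0..l} (%x. c * \<theta> x)"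
  by (rule L2_norm_triangle[OF L2_diff[OF g sL[OF \<psi>(1)]] L2_cmult[OF sL[OF \<theta>(1)]]])
 also have "... < \<eta> + sqrt l * \<eta> / m * N"
  using \<psi>(2) mult_right_mono[OF c N] by (simp add: L2_norm_cmult N_def)
 also have "... = \<eta> * (1 + sqrt l * N / m)" by (simp add: distrib_left)
 also have "... = e / 2"
 proof -
  have "e / (2 * X) * X = e / 2" if "X > 0" for X :: real using that by simp
  from this[OF D] show ?thesis unfolding \<eta>_def .
 qed
 finally have "L2_norm {0..l} (%x. (g x - \<psi> x) + c * \<theta> x) < e" using e by simp
 moreover have "(%x. g x - ?\<phi> x) = (%x. (g x - \<psi> x) + c * \<theta> x)" by (simp add: fun_eq_iff)
 ultimately have "L2_norm {0..l} (%x. g x - ?\<phi> x) < e" by simp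
 with t iz show ?thesis by (rule that)
qed

section \<open>Passing between the open interval and its closure\<close>

lemma LINT_cong_space:
 "(!!x. x \<in> S ==> f x = g x) ==> (LINT x|lebesgue_on S. f x) = (LINT x|lebesgue_on S. g x)" for f g :: "real => real"
 by (intro Bochner_Integration.integral_cong) (auto simp: space_restrict_space)

lemma L2_norm_cong_space: "(!!x. x \<in> S ==> f x = g x) ==> L2_norm S f = L2_norm S g"
 unfolding L2_norm_def by (intro arg_cong[where f=sqrt] LINT_cong_space) simp

lemma L2_space_cong: "(!!x. x \<in> S ==> f x = g x) ==> f \<in> L2_space S ==> g \<in> L2_space S"
proof -
 assume eq: "!!x. x \<in> S ==> f x = g x" and f: "f \<in> L2_space S"
 have m: "g \<in> borel_measurable (lebesgue_on S)"
  using L2_measurable[OF f] by (rule measurable_cong[THEN iffD1, rotated]) (simp add: eq space_restrict_space)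
 show ?thesis by (rule L2_cong_AE[OF f m]) (auto intro!: AE_I2 simp: eq space_restrict_space)
qed

lemma LINT_Ioo:
 fixes f :: "real => real"
 assumes "integrable (lebesgue_on {a..b}) f"
 shows "integrable (lebesgue_on {a<..<b}) f" "(LINT x|lebesgue_on {a<..<b}. f x) = integral {a..b} f"
  "(LINT x|lebesgue_on {a<..<b}. f x) = (LINT x|lebesgue_on {a..b}. f x)"
proof -
 have "f absolutely_integrable_on {a..b}" using assms by (simp add: integrable_lebesgue_on_iff_abs)
 then have "f absolutely_integrable_on {a<..<b}" by (simp add: absolutely_integrable_on_Icc_iff_Ioo)
 then show i: "integrable (lebesgue_on {a<..<b}) f" by (simp add: integrable_lebesgue_on_iff_abs)
 have "(LINT x|lebesgue_on {a<..<b}. f x) = integral {a<..<b} f"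
  by (rule lebesgue_integral_eq_integral[OF i]) simp
 also have "... = integral {a..b} f" by (rule integral_open_interval_real[symmetric])
 finally show "(LINT x|lebesgue_on {a<..<b}. f x) = integral {a..b} f" .
 then show "(LINT x|lebesgue_on {a<..<b}. f x) = (LINT x|lebesgue_on {a..b}. f x)"
  by (simp only: LINT_eq_integral[OF assms])
qed

lemma L2_Ioo:
 assumes "f \<in> L2_space {a..b}"
 shows "f \<in> L2_space {a<..<b}" "L2_norm {a<..<b} f = L2_norm {a..b} f"
proof -
 show "f \<in> L2_space {a<..<b}" by (rule L2_subset[OF assms]) auto
 show "L2_norm {a<..<b} f = L2_norm {a..b} f"
  unfolding L2_norm_def using LINT_Ioo(3)[OF L2_sq_integrable[OF assms]] by simp
qed

lemma locL2_Ioo: "locL2 f ==> f \<in> L2_space {a<..<b}" "locL2 f ==> L2_norm {a<..<b} f = L2_norm {a..b} f"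
 using L2_Ioo[OF locL2_D] by auto

lemma LINT_mult_Ioo: "locL2 f ==> locL2 g ==> (LINT x|lebesgue_on {a<..<b}. f x * g x) = integral {a..b} (%x. f x * g x)"
 by (rule LINT_Ioo(2)[OF L2_mult_integrable]) (auto intro: locL2_D)

text \<open>Elements of L2 on the open interval may take any values outside it; extension by zero
  gives a function on the line to which \<open>prim\<close> and \<open>locL2\<close> apply.\<close>

definition zext :: "real => (real => real) => real => real" where
 "zext l f x = (if x \<in> {0<..<l} then f x else 0)"

lemma zext_eq: "x \<in> {0<..<l} ==> zext l f x = f x"
 by (simp add: zext_def)

lemma zext_locL2:
 assumes f: "f \<in> L2_space {0<..<l}"
 shows "locL2 (zext l f)"
proof -
 have z: "zext l g = (%x. if x \<in> {0<..<l} then g x else 0)" for g by (simp add: zext_def fun_eq_iff)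
 have m: "zext l f \<in> borel_measurable lebesgue"
  unfolding z by (rule borel_measurable_if_I[OF L2_measurable[OF f]]) simp
 have "(%x. (f x)^2) absolutely_integrable_on {0<..<l}"
  using L2_sq_integrable[OF f] by (simp add: integrable_lebesgue_on_iff_abs)
 then have "(%x. if x \<in> {0<..<l} then (f x)^2 else 0) absolutely_integrable_on UNIV"
  by (simp only: absolutely_integrable_restrict_UNIV)
 moreover have "(%x. if x \<in> {0<..<l} then (f x)^2 else 0) = (%x. (zext l f x)^2)" by (simp add: zext_def fun_eq_iff)
 ultimately have i: "(%x. (zext l f x)^2) absolutely_integrable_on UNIV" by simp
 show ?thesis unfolding locL2_def L2_space_def
 proof (intro allI CollectI conjI)
  fix a b :: real
  show "zext l f \<in> borel_measurable (lebesgue_on {a..b})" using m by (rule measurable_restrict_space1)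
  have "(%x. (zext l f x)^2) absolutely_integrable_on {a..b}"
   by (rule set_integrable_subset[OF i]) auto
  then show "integrable (lebesgue_on {a..b}) (%x. (zext l f x)^2)" by (simp add: integrable_lebesgue_on_iff_abs)
 qed
qed

lemma test_functionD:
 assumes "\<phi> \<in> test_functions {0<..<l}"
 shows "(\<phi> has_real_derivative deriv \<phi> x) (at x)" "continuous_on X \<phi>" "continuous_on X (deriv \<phi>)"
  "x \<notin> {0<..<l} ==> \<phi> x = 0" "locL2 \<phi>" "locL2 (deriv \<phi>)"
proof -
 have d: "(deriv ^^ k) \<phi> differentiable_on UNIV" for k using assms by (simp add: test_functions_def)
 show "(\<phi> has_real_derivative deriv \<phi> x) (at x)"
  using d[of 0] by (simp add: differentiable_on_def DERIV_deriv_iff_real_differentiable)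
 have c: "continuous_on UNIV \<phi>" "continuous_on UNIV (deriv \<phi>)"
  using differentiable_imp_continuous_on[OF d[of 0]] differentiable_imp_continuous_on[OF d[of 1]] by simp_all
 then show "continuous_on X \<phi>" "continuous_on X (deriv \<phi>)" by (auto intro: continuous_on_subset)
 show "locL2 \<phi>" "locL2 (deriv \<phi>)" using c by (auto intro: locL2_continuous)
 show "\<phi> x = 0" if "x \<notin> {0<..<l}"
 proof (rule ccontr)
  assume "\<phi> x \<noteq> 0"
  then have "x \<in> closure {x. \<phi> x \<noteq> 0}" using closure_subset by fastforce
  then show False using assms that by (auto simp: test_functions_def)
 qed
qed

lemma prim_locL2: "locL2 f ==> locL2 (prim f)"
 by (rule locL2_continuous[OF prim_continuous[OF locL2_loc_int]])

lemma L2_norm_prim_le: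
 assumes f: "locL2 f" and l: "l >= 0"
 shows "L2_norm {0..l} (prim f) <= l * L2_norm {0..l} f"
proof -
 have "L2_norm {0..l} (prim f) <= (sqrt l * L2_norm {0..l} f) * sqrt (l - 0)"
 proof (rule L2_norm_interval_le)
  show "continuous_on {0..l} (prim f)"
   by (rule continuous_on_subset[OF prim_continuous[OF locL2_loc_int[OF f]]]) simp
  fix x assume x: "x \<in> {0..l}"
  have "prim f x = integral {0..x} f" using prim_diff[OF locL2_loc_int[OF f], of 0 x] x by simp
  then have "\<bar>prim f x\<bar> <= sqrt (x - 0) * L2_norm {0..x} f"
   using L2_integral_cauchy_schwarz(2)[OF locL2_D[OF f], of 0 x] x by simp
  also have "... <= sqrt l * L2_norm {0..l} f"
   by (intro mult_mono L2_subset(2)[OF locL2_D[OF f]]) (use x in auto)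
  finally show "\<bar>prim f x\<bar> <= sqrt l * L2_norm {0..l} f" .
 qed (use l in auto)
 also have "... = (sqrt l * sqrt l) * L2_norm {0..l} f" by (simp only: mult.commute mult.left_commute diff_zero)
 finally show ?thesis using l by simp
qed

lemma le_of_all_eps:
 fixes x C :: real
 assumes "!!e. e > 0 ==> x <= C * e"
 shows "x <= 0"
proof -
 have "x <= \<bar>C\<bar> * e" if "e > 0" for e
  using assms[OF that] mult_right_mono[OF abs_ge_self[of C], of e] that by linarith
 then have *: "x <= \<bar>C\<bar> * e" if "e > 0" for e using that .
 have "x <= 0 + e" if e: "e > 0" for e
 proof -
  have "x <= \<bar>C\<bar> * (e / (\<bar>C\<bar> + 1))" by (rule *) (use e in \<open>simp add: add_nonneg_pos\<close>)
  also have "... <= (\<bar>C\<bar> + 1) * (e / (\<bar>C\<bar> + 1))" by (rule mult_right_mono) (use e in auto)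
  also have "... = e" using abs_ge_zero[of C] by (simp add: add_nonneg_eq_0_iff)
  finally show ?thesis by simp
 qed
 then show ?thesis by (rule field_le_epsilon)
qed

text \<open>For continuous g this is the product rule. Both sides depend continuously on g in norm,
  so the defect is at most a constant times any e > 0.\<close>

lemma prim_by_parts_test:
 assumes g: "locL2 g" and p: "\<phi> \<in> test_functions {0<..<l}" and l: "l > 0"
 shows "integral {0..l} (%x. prim g x * deriv \<phi> x) = - integral {0..l} (%x. g x * \<phi> x)"
proof -
 note t = test_functionD[OF p]
 let ?M = "lebesgue_on {0..l}"
 have mi: "integrable ?M (%x. f x * h x)" if "locL2 f" "locL2 h" for f h
  by (rule L2_mult_integrable[OF locL2_D[OF that(1)] locL2_D[OF that(2)]])
 define D where "D f = (LINT x|?M. prim f x * deriv \<phi> x) + (LINT x|?M. f x * \<phi> x)" for f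
 have D0: "D h = 0" if h: "continuous_on UNIV h" for h
 proof -
  have hL: "locL2 h" by (rule locL2_continuous[OF h])
  have "((%x. prim h x * deriv \<phi> x + h x * \<phi> x) has_integral prim h l * \<phi> l - prim h 0 * \<phi> 0) {0..l}"
  proof (rule fundamental_theorem_of_calculus)
   fix x
   have "((%x. prim h x * \<phi> x) has_real_derivative prim h x * deriv \<phi> x + h x * \<phi> x) (at x)"
    using DERIV_mult[OF prim_deriv[OF h] t(1)] by (simp add: add.commute mult.commute)
   then show "((%x. prim h x * \<phi> x) has_vector_derivative prim h x * deriv \<phi> x + h x * \<phi> x) (at x within {0..l})"
    by (simp add: has_field_derivative_at_within has_real_derivative_iff_has_vector_derivative[symmetric])
  qed (use l in simp)
  then have "integral {0..l} (%x. prim h x * deriv \<phi> x + h x * \<phi> x) = 0"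
   using t(4)[of l] by (simp add: integral_unique)
  moreover have "D h = (LINT x|?M. prim h x * deriv \<phi> x + h x * \<phi> x)"
   unfolding D_def using mi[OF prim_locL2[OF hL] t(6)] mi[OF hL t(5)] by simp
  ultimately show ?thesis
   using LINT_eq_integral[OF Bochner_Integration.integrable_add[OF mi[OF prim_locL2[OF hL] t(6)] mi[OF hL t(5)]]] by simp
 qed
 define C where "C = l * L2_norm {0..l} (deriv \<phi>) + L2_norm {0..l} \<phi>"
 have C: "C >= 0" using l by (simp add: C_def)
 have "\<bar>D g\<bar> <= C * e" if e: "e > 0" for e
 proof -
  obtain h where h: "continuous_on UNIV h" "L2_norm {0..l} (%x. g x - h x) < e"
   using L2_continuous_approx[OF locL2_D[OF g] e] by blast
  have hL: "locL2 h" by (rule locL2_continuous[OF h(1)])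
  define r where "r = (%x. g x - h x)"
  have r: "locL2 r" unfolding r_def by (rule locL2_diff[OF g hL])
  have "prim g x = prim r x + prim h x" for x
   using prim_add[OF locL2_loc_int[OF r] locL2_loc_int[OF hL]] by (simp add: r_def)
  moreover have "g x = r x + h x" for x by (simp add: r_def)
  ultimately have "D g = D r + D h"
   unfolding D_def using mi[OF prim_locL2[OF r] t(6)] mi[OF prim_locL2[OF hL] t(6)] mi[OF r t(5)] mi[OF hL t(5)]
   by (simp add: distrib_right)
  then have "\<bar>D g\<bar> <= \<bar>LINT x|?M. prim r x * deriv \<phi> x\<bar> + \<bar>LINT x|?M. r x * \<phi> x\<bar>"
   using D0[OF h(1)] by (simp add: D_def)
  also have "... <= L2_norm {0..l} (prim r) * L2_norm {0..l} (deriv \<phi>) + L2_norm {0..l} r * L2_norm {0..l} \<phi>"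
   by (intro add_mono L2_cauchy_schwarz locL2_D prim_locL2 r t)
  also have "... <= (l * L2_norm {0..l} r) * L2_norm {0..l} (deriv \<phi>) + L2_norm {0..l} r * L2_norm {0..l} \<phi>"
   by (intro add_mono mult_right_mono L2_norm_prim_le r) (use l in auto)
  also have "... = C * L2_norm {0..l} r" by (simp add: C_def distrib_right distrib_left mult_ac)
  also have "... <= C * e" using h(2) C by (intro mult_left_mono) (simp_all add: r_def)
  finally show ?thesis .
 qed
 then have "\<bar>D g\<bar> <= 0" by (rule le_of_all_eps)
 then show ?thesis
  unfolding D_def using LINT_eq_integral[OF mi[OF prim_locL2[OF g] t(6)]] LINT_eq_integral[OF mi[OF g t(5)]] by simp
qed

text \<open>The difference of two weak derivatives is orthogonal to all test functions; these are
  dense, so its norm is zero.\<close>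

lemma weak_derivative_unique:
 assumes g: "has_weak_derivative {0<..<l} f g" and h: "has_weak_derivative {0<..<l} f h" and l: "l > 0"
 shows "AE x in lebesgue_on {0<..<l}. g x = h x"
proof -
 let ?Q = "{0<..<l}"
 have gL: "g \<in> L2_space ?Q" and hL: "h \<in> L2_space ?Q" using g h by (auto simp: has_weak_derivative_def)
 define d where "d = (%x. g x - h x)"
 have dL: "d \<in> L2_space ?Q" unfolding d_def by (rule L2_diff[OF gL hL])
 have dz: "locL2 (zext l d)" by (rule zext_locL2[OF dL])
 have z: "(LINT x|lebesgue_on ?Q. d x * \<phi> x) = 0" if p: "\<phi> \<in> test_functions ?Q" for \<phi>
 proof -
  have pL: "\<phi> \<in> L2_space ?Q" by (rule locL2_Ioo(1)[OF test_functionD(5)[OF p]])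
  have "(LINT x|lebesgue_on ?Q. g x * \<phi> x) = (LINT x|lebesgue_on ?Q. h x * \<phi> x)"
  proof -
   have "- (LINT x|lebesgue_on ?Q. g x * \<phi> x) = (LINT x|lebesgue_on ?Q. f x * deriv \<phi> x)"
    "- (LINT x|lebesgue_on ?Q. h x * \<phi> x) = (LINT x|lebesgue_on ?Q. f x * deriv \<phi> x)"
    using g h p by (auto simp only: has_weak_derivative_def)
   then show ?thesis by (simp only: flip: neg_equal_iff_equal[of "LINT x|lebesgue_on ?Q. g x * \<phi> x"])
  qed
  then show ?thesis
   unfolding d_def left_diff_distrib
   using L2_mult_integrable[OF gL pL] L2_mult_integrable[OF hL pL] by simp
 qed
 have "L2_norm ?Q d <= 1 * e" if e: "e > 0" for e
 proof -
  obtain \<phi> where \<phi>: "\<phi> \<in> compact_smooth l" "L2_norm {0..l} (%x. zext l d x - \<phi> x) < e"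
   using compact_smooth_dense[OF locL2_D[OF dz] e l] by blast
  have p: "\<phi> \<in> test_functions ?Q" by (rule compact_smooth_test[OF \<phi>(1)])
  have pl: "locL2 \<phi>" by (rule test_functionD(5)[OF p])
  have pL: "\<phi> \<in> L2_space ?Q" by (rule locL2_Ioo(1)[OF pl])
  have "L2_norm ?Q (%x. d x - \<phi> x) = L2_norm ?Q (%x. zext l d x - \<phi> x)"
   by (rule L2_norm_cong_space) (simp add: zext_eq)
  also have "... < e" using \<phi>(2) locL2_Ioo(2)[OF locL2_diff[OF dz pl]] by simp
  finally have e': "L2_norm ?Q (%x. d x - \<phi> x) < e" .
  have "(L2_norm ?Q d)^2 = (LINT x|lebesgue_on ?Q. d x * (d x - \<phi> x))"
   unfolding L2_norm_sq right_diff_distrib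
   using L2_mult_integrable[OF dL dL] L2_mult_integrable[OF dL pL] z[OF p] by (simp add: power2_eq_square)
  also have "... <= L2_norm ?Q d * L2_norm ?Q (%x. d x - \<phi> x)"
   using L2_cauchy_schwarz[OF dL L2_diff[OF dL pL]] by linarith
  also have "... <= L2_norm ?Q d * e" using e' by (intro mult_left_mono) auto
  finally have "L2_norm ?Q d * L2_norm ?Q d <= L2_norm ?Q d * e" by (simp add: power2_eq_square)
  then show ?thesis using L2_norm_nonneg[of ?Q d] e by (cases "L2_norm ?Q d = 0") auto
 qed
 then have "L2_norm ?Q d <= 0" by (rule le_of_all_eps)
 then have "AE x in lebesgue_on ?Q. d x = 0" by (intro L2_norm_eq_0[OF dL]) (simp add: antisym)
 then show ?thesis by (simp add: d_def)
qed

text \<open>The representative chosen by \<open>SOME\<close> may be exchanged for any known weak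
  derivative, almost everywhere and in norms.\<close>

lemma weak_derivative_works:
 assumes g: "has_weak_derivative {0<..<l} f g" and l: "l > 0"
 shows "has_weak_derivative {0<..<l} f (weak_derivative {0<..<l} f)"
  "AE x in lebesgue_on {0<..<l}. weak_derivative {0<..<l} f x = g x"
  "L2_norm {0<..<l} (weak_derivative {0<..<l} f) = L2_norm {0<..<l} g"
proof -
 show w: "has_weak_derivative {0<..<l} f (weak_derivative {0<..<l} f)"
  unfolding weak_derivative_def by (rule someI[of "has_weak_derivative {0<..<l} f", OF g])
 show a: "AE x in lebesgue_on {0<..<l}. weak_derivative {0<..<l} f x = g x"
  by (rule weak_derivative_unique[OF w g l])
 show "L2_norm {0<..<l} (weak_derivative {0<..<l} f) = L2_norm {0<..<l} g"
  using w g by (intro L2_norm_cong_AE a) (auto simp: has_weak_derivative_def intro: L2_measurable)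
qed

lemma H1_norm_eq:
 assumes "has_weak_derivative {0<..<l} f g" and "l > 0"
 shows "H1_norm {0<..<l} f = sqrt ((L2_norm {0<..<l} f)^2 + (L2_norm {0<..<l} g)^2)"
 unfolding H1_norm_def weak_derivative_works(3)[OF assms] ..

lemma has_weak_derivative_diff:
 assumes "has_weak_derivative {0<..<l} f f'" "has_weak_derivative {0<..<l} g g'"
  and f: "f \<in> L2_space {0<..<l}" and g: "g \<in> L2_space {0<..<l}"
 shows "has_weak_derivative {0<..<l} (%x. f x - g x) (%x. f' x - g' x)"
proof -
 have f': "f' \<in> L2_space {0<..<l}" and g': "g' \<in> L2_space {0<..<l}" using assms by (auto simp: has_weak_derivative_def)
 show ?thesis unfolding has_weak_derivative_def
 proof (intro conjI ballI L2_diff f' g')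
  fix \<phi> assume p: "\<phi> \<in> test_functions {0<..<l}"
  note i = locL2_Ioo(1)[OF test_functionD(5)[OF p], of 0 l] locL2_Ioo(1)[OF test_functionD(6)[OF p], of 0 l]
  have "(LINT x|lebesgue_on {0<..<l}. f x * deriv \<phi> x) = - (LINT x|lebesgue_on {0<..<l}. f' x * \<phi> x)"
   "(LINT x|lebesgue_on {0<..<l}. g x * deriv \<phi> x) = - (LINT x|lebesgue_on {0<..<l}. g' x * \<phi> x)"
   using assms p by (auto simp: has_weak_derivative_def)
  then show "(LINT x|lebesgue_on {0<..<l}. (f x - g x) * deriv \<phi> x) = - (LINT x|lebesgue_on {0<..<l}. (f' x - g' x) * \<phi> x)"
   unfolding left_diff_distrib
   using L2_mult_integrable[OF f i(2)] L2_mult_integrable[OF g i(2)] L2_mult_integrable[OF f' i(1)] L2_mult_integrable[OF g' i(1)]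
   by simp
 qed
qed

lemma prim_weak_derivative:
 assumes g: "locL2 g" and l: "l > 0"
 shows "has_weak_derivative {0<..<l} (prim g) g"
 unfolding has_weak_derivative_def
proof (intro conjI ballI)
 show "g \<in> L2_space {0<..<l}" by (rule locL2_Ioo(1)[OF g])
 fix \<phi> assume p: "\<phi> \<in> test_functions {0<..<l}"
 note t = test_functionD[OF p]
 show "(LINT x|lebesgue_on {0<..<l}. prim g x * deriv \<phi> x) = - (LINT x|lebesgue_on {0<..<l}. g x * \<phi> x)"
  unfolding LINT_mult_Ioo[OF prim_locL2[OF g] t(6)] LINT_mult_Ioo[OF g t(5)] by (rule prim_by_parts_test[OF g p l])
qed

lemma H1_norm_prim_le:
 assumes g: "locL2 g" and l: "l > 0"
 shows "H1_norm {0<..<l} (prim g) <= (l + 1) * L2_norm {0..l} g"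
proof -
 have "H1_norm {0<..<l} (prim g) <= L2_norm {0<..<l} (prim g) + L2_norm {0<..<l} g"
  unfolding H1_norm_eq[OF prim_weak_derivative[OF g l] l] by (rule sqrt_sum_squares_le_sum) auto
 also have "... <= l * L2_norm {0..l} g + L2_norm {0..l} g"
  using L2_norm_prim_le[OF g, of l] l by (simp add: locL2_Ioo(2)[OF g] locL2_Ioo(2)[OF prim_locL2[OF g]])
 finally show ?thesis by (simp add: distrib_right)
qed

text \<open>Approximate g by compactly supported smooth functions of mean zero; their primitives are
  test functions and converge in the H1 norm by \<open>H1_norm_prim_le\<close>.\<close>

lemma H10_prim:
 assumes g: "locL2 g" and z: "integral {0..l} g = 0" and l: "l > 0"
 shows "prim g \<in> H10_space {0<..<l}"
proof -
 have "\<exists>\<psi>. \<psi> \<in> compact_smooth l \<and> integral {0..l} \<psi> = 0 \<and> L2_norm {0..l} (%x. g x - \<psi> x) < 1 / real (Suc n)" for n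
  using compact_smooth_mean_zero_dense[OF locL2_D[OF g] z _ l, of "1 / real (Suc n)"] by (metis zero_less_divide_1_iff of_nat_0_less_iff zero_less_Suc)
 then obtain \<psi> where \<psi>: "!!n. \<psi> n \<in> compact_smooth l" "!!n. integral {0..l} (\<psi> n) = 0"
  "!!n. L2_norm {0..l} (%x. g x - \<psi> n x) < 1 / real (Suc n)" by metis
 have \<psi>L: "locL2 (\<psi> n)" for n
  by (rule locL2_continuous[OF smooth_alg_continuous[OF compact_smooth_smooth[OF \<psi>(1)]]])
 have "(%n. H1_norm {0<..<l} (%x. prim (\<psi> n) x - prim g x)) \<longlonglongrightarrow> 0"
 proof (rule tendsto_of_norm_bound)
  show "(%n. (l + 1) * (1 / real (Suc n))) \<longlonglongrightarrow> 0"
   by (rule tendsto_mult_right_zero) (rule LIMSEQ_Suc[OF lim_1_over_n])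
  show "\<forall>\<^sub>F n in sequentially. \<bar>H1_norm {0<..<l} (%x. prim (\<psi> n) x - prim g x)\<bar> <= (l + 1) * (1 / real (Suc n))"
  proof (intro always_eventually allI)
   fix n
   have r: "locL2 (%x. \<psi> n x - g x)" by (rule locL2_diff[OF \<psi>L g])
   have "(%x. prim (\<psi> n) x - prim g x) = prim (%x. \<psi> n x - g x)"
    using prim_add[OF locL2_loc_int[OF r] locL2_loc_int[OF g]] by (simp add: fun_eq_iff)
   moreover have "H1_norm {0<..<l} (prim (%x. \<psi> n x - g x)) <= (l + 1) * L2_norm {0..l} (%x. \<psi> n x - g x)"
    by (rule H1_norm_prim_le[OF r l])
   moreover have "... <= (l + 1) * (1 / real (Suc n))"
    using \<psi>(3)[of n] l by (intro mult_left_mono) (simp_all add: L2_norm_commute[of _ "\<psi> n" g])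
   ultimately show "\<bar>H1_norm {0<..<l} (%x. prim (\<psi> n) x - prim g x)\<bar> <= (l + 1) * (1 / real (Suc n))"
    by (simp add: H1_norm_def)
  qed
 qed
 moreover have "prim (\<psi> n) \<in> test_functions {0<..<l}" for n
  by (rule prim_test_function(1)[OF \<psi>(1,2) l])
 ultimately have "\<exists>\<phi>. (\<forall>n. \<phi> n \<in> test_functions {0<..<l}) \<and>
   (%n. H1_norm {0<..<l} (%x. \<phi> n x - prim g x)) \<longlonglongrightarrow> 0"
  by (intro exI[of _ "%n. prim (\<psi> n)"] conjI allI)
 moreover have "\<exists>g'. has_weak_derivative {0<..<l} (prim g) g'" using prim_weak_derivative[OF g l] by blast
 ultimately show ?thesis
  unfolding H10_space_def H1_space_def using locL2_Ioo(1)[OF prim_locL2[OF g]] by simp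
qed

text \<open>Converse of \<open>H10_prim\<close>. Test functions are primitives of their derivatives,
  which have mean zero over (0, l); both facts survive the limit. Thus H10 consists, up to null
  sets, of primitives of mean-zero functions, which is how test elements are handled below.\<close>

lemma H10_elim:
 assumes f: "f \<in> H10_space {0<..<l}" and l: "l > 0"
 obtains g where "locL2 g" "has_weak_derivative {0<..<l} f g" "integral {0..l} g = 0"
  "AE x in lebesgue_on {0<..<l}. f x = prim g x" "!!x. x \<notin> {0<..<l} ==> g x = 0"
proof -
 let ?Q = "{0<..<l}"
 obtain g0 \<phi> where g0: "has_weak_derivative ?Q f g0" and fL: "f \<in> L2_space ?Q"
  and p: "!!n. \<phi> n \<in> test_functions ?Q" and lim: "(%n::nat. H1_norm ?Q (%x. \<phi> n x - f x)) \<longlonglongrightarrow> 0"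
  using f by (auto simp: H10_space_def H1_space_def)
 have g0L: "g0 \<in> L2_space ?Q" using g0 by (simp add: has_weak_derivative_def)
 define g where "g = zext l g0"
 have gL: "locL2 g" unfolding g_def by (rule zext_locL2[OF g0L])
 have gq: "!!x. x \<in> ?Q ==> g x = g0 x" by (simp add: g_def zext_eq)
 have gw: "has_weak_derivative ?Q f g"
 proof -
  have "(LINT x|lebesgue_on ?Q. g x * \<psi> x) = (LINT x|lebesgue_on ?Q. g0 x * \<psi> x)" for \<psi>
   by (rule LINT_cong_space) (simp only: gq)
  then show ?thesis
   using g0 L2_space_cong[OF gq[symmetric] g0L] unfolding has_weak_derivative_def by simp
 qed
 note t = test_functionD[OF p]
 have pp: "\<phi> n x = prim (deriv (\<phi> n)) x" if "x >= 0" for n x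
 proof -
  have "((deriv (\<phi> n)) has_integral \<phi> n x - \<phi> n 0) {0..x}"
   by (rule fundamental_theorem_of_calculus[OF that])
    (use t(1) in \<open>auto simp: has_real_derivative_iff_has_vector_derivative[symmetric] intro: has_field_derivative_at_within\<close>)
  then have "integral {0..x} (deriv (\<phi> n)) = \<phi> n x" using t(4)[of 0] by (simp add: integral_unique)
  then show ?thesis using prim_diff[OF locL2_loc_int[OF t(6)], of 0 x n] that by simp
 qed
 have pw: "has_weak_derivative ?Q (\<phi> n) (deriv (\<phi> n))" for n
 proof -
  have "(LINT x|lebesgue_on ?Q. \<phi> n x * deriv \<psi> x) = (LINT x|lebesgue_on ?Q. prim (deriv (\<phi> n)) x * deriv \<psi> x)" for \<psi>
   by (rule LINT_cong_space) (simp add: pp)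
  then show ?thesis using prim_weak_derivative[OF t(6) l, of n] by (simp add: has_weak_derivative_def)
 qed
 define H where "H n = H1_norm ?Q (%x. \<phi> n x - f x)" for n
 have pL: "\<phi> n \<in> L2_space ?Q" for n by (rule locL2_Ioo(1)[OF t(5)])
 have H: "H n = sqrt ((L2_norm ?Q (%x. \<phi> n x - f x))^2 + (L2_norm ?Q (%x. deriv (\<phi> n) x - g x))^2)" for n
  unfolding H_def by (rule H1_norm_eq[OF has_weak_derivative_diff[OF pw gw pL fL] l])
 have H1: "L2_norm ?Q (%x. \<phi> n x - f x) <= H n" "L2_norm ?Q (%x. deriv (\<phi> n) x - g x) <= H n" for n
  unfolding H by (rule real_sqrt_sum_squares_ge1, rule real_sqrt_sum_squares_ge2)
 have He: "\<exists>n. H n < e" if e: "e > 0" for e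
 proof -
  obtain no where "\<forall>n\<ge>no. norm (H1_norm ?Q (%x. \<phi> n x - f x) - 0) < e" using LIMSEQ_D[OF lim e] by blast
  then have "norm (H1_norm ?Q (%x. \<phi> no x - f x) - 0) < e" by blast
  then show ?thesis unfolding H_def by (intro exI[of _ no]) simp
 qed
 have rL: "locL2 (%x. deriv (\<phi> n) x - g x)" for n by (rule locL2_diff[OF t(6) gL])
 have r: "L2_norm {0..l} (%x. deriv (\<phi> n) x - g x) <= H n" for n
  using H1(2)[of n] locL2_Ioo(2)[OF rL, of 0 l n] by simp
 have ii: "h integrable_on {0..l}" if "locL2 h" for h by (rule loc_int_D[OF locL2_loc_int[OF that]])
 have "\<bar>integral {0..l} g\<bar> <= sqrt l * e" if e: "e > 0" for e
 proof -
  obtain n where n: "H n < e" using He[OF e] by blast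
  have "integral {0..l} (deriv (\<phi> n)) = 0"
   using pp[of l n] prim_diff[OF locL2_loc_int[OF t(6)], of 0 l n] t(4)[of l n] l by simp
  then have "integral {0..l} (%x. deriv (\<phi> n) x - g x) = - integral {0..l} g"
   by (simp add: HK_diff[OF ii[OF t(6)] ii[OF gL]])
  then have "\<bar>integral {0..l} g\<bar> <= sqrt (l - 0) * L2_norm {0..l} (%x. deriv (\<phi> n) x - g x)"
   using L2_integral_cauchy_schwarz(2)[OF locL2_D[OF rL], of 0 l n] l by simp
  also have "... <= sqrt l * e" using r[of n] n l by (intro mult_mono) auto
  finally show ?thesis .
 qed
 then have "\<bar>integral {0..l} g\<bar> <= 0" by (rule le_of_all_eps)
 then have gz: "integral {0..l} g = 0" by simp
 have primL: "prim g \<in> L2_space ?Q" by (rule locL2_Ioo(1)[OF prim_locL2[OF gL]])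
 have "L2_norm ?Q (%x. f x - prim g x) <= (1 + l) * e" if e: "e > 0" for e
 proof -
  obtain n where n: "H n < e" using He[OF e] by blast
  have "L2_norm ?Q (%x. \<phi> n x - prim g x) = L2_norm ?Q (prim (%x. deriv (\<phi> n) x - g x))"
   using prim_add[OF locL2_loc_int[OF rL] locL2_loc_int[OF gL]] by (intro L2_norm_cong_space) (simp add: pp)
  also have "... = L2_norm {0..l} (prim (%x. deriv (\<phi> n) x - g x))" by (rule locL2_Ioo(2)[OF prim_locL2[OF rL]])
  also have "... <= l * L2_norm {0..l} (%x. deriv (\<phi> n) x - g x)" by (rule L2_norm_prim_le[OF rL]) (use l in simp)
  also have "... <= l * e" using r[of n] n l by (intro mult_left_mono) auto
  finally have "L2_norm ?Q (%x. \<phi> n x - prim g x) <= l * e" .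
  moreover have "L2_norm ?Q (%x. f x - \<phi> n x) <= e" using H1(1)[of n] n by (simp add: L2_norm_commute[of _ f])
  ultimately have "L2_norm ?Q (%x. f x - prim g x) <= e + l * e"
   using L2_norm_triangle'[OF fL pL[of n] primL] by linarith
  then show ?thesis by (simp add: distrib_right)
 qed
 then have "L2_norm ?Q (%x. f x - prim g x) <= 0" by (rule le_of_all_eps)
 then have "AE x in lebesgue_on ?Q. f x - prim g x = 0"
  by (intro L2_norm_eq_0 L2_diff fL primL) (simp add: antisym)
 then have ae: "AE x in lebesgue_on ?Q. f x = prim g x" by simp
 show ?thesis by (rule that[OF gL gw gz ae]) (auto simp: g_def zext_def)
qed

lemma prim_vanish:
 assumes g: "loc_int g" and z: "integral {0..l} g = 0" and s: "!!x. x \<notin> {0<..<l} ==> g x = 0"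
  and x: "x \<notin> {0<..<l}" and l: "l > 0"
 shows "prim g x = 0"
proof (cases "x <= 0")
 case True
 have "integral {x..0} g = integral {x..0} (%x. 0)"
  by (rule HK_cong) (simp add: s)
 then show ?thesis using prim_diff[OF g True] by simp
next
 case False
 then have xl: "l <= x" using x by simp
 have "integral {l..x} g = integral {l..x} (%x. 0)"
  by (rule HK_cong) (simp add: s)
 then show ?thesis using prim_diff[OF g xl] prim_diff[OF g, of 0 l] z l by simp
qed

lemma integral_support:
 fixes f :: "real => real"
 assumes s: "!!x. x \<notin> {c..d} ==> f x = 0" and sub: "{c..d} \<subseteq> {a..b}" and i: "f integrable_on {c..d}"
 shows "integral {a..b} f = integral {c..d} f"
 using has_integral_on_superset[OF integrable_integral[OF i] s sub] by (rule integral_unique)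

lemma locL2_mult_loc_int: "locL2 f ==> locL2 g ==> loc_int (%x. f x * g x)"
 unfolding loc_int_def
 by (intro allI integrable_on_lebesgue_on L2_mult_integrable locL2_D) auto

lemma LINT_mult_Icc: "locL2 f ==> locL2 g ==> (LINT x|lebesgue_on {a..b}. f x * g x) = integral {a..b} (%x. f x * g x)"
 by (rule LINT_eq_integral[OF L2_mult_integrable]) (auto intro: locL2_D)

subsection \<open>The field on the interval\<close>

context wave_flow
begin

text \<open>d'Alembert's representation: \<open>pf\<close> is the profile, \<open>fz\<close> the
  field in the coordinate x, and \<open>fx\<close>, \<open>ft\<close> are its derivatives in x and
  s, written without differentiating the profile.\<close>

definition pf :: "real => real => real" where "pf s y = P0 y + R s y"
definition fx :: "real => real => real" where "fx s x = (pf s (s + x) + pf s (s - x)) / 2"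
definition ft :: "real => real => real" where "ft s x = (pf s (s + x) - pf s (s - x)) / 2"
definition fz :: "real => real => real" where "fz s x = W s (s + x)"

lemma pf_locL2: "locL2 (pf s)"
 unfolding pf_def[abs_def] by (rule P_locL2)

lemma pf_plus_locL2: "locL2 (%x. pf s (s + x))"
 using locL2_shift[OF pf_locL2, of s s] by (simp only: add.commute)

lemma pf_minus_locL2: "locL2 (%x. pf s (s - x))"
 by (rule locL2_flip[OF pf_locL2])

lemma fx_locL2: "locL2 (fx s)"
proof -
 have "fx s = (%x. (1 / 2) * (pf s (s + x) + pf s (s - x)))" by (simp add: fun_eq_iff fx_def)
 then show ?thesis using locL2_cmult[OF locL2_add[OF pf_plus_locL2 pf_minus_locL2]] by metis
qed

lemma ft_locL2: "locL2 (ft s)"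
proof -
 have "ft s = (%x. (1 / 2) * (pf s (s + x) - pf s (s - x)))" by (simp add: fun_eq_iff ft_def)
 then show ?thesis using locL2_cmult[OF locL2_diff[OF pf_plus_locL2 pf_minus_locL2]] by metis
qed

lemma fz_prim:
 assumes x: "x >= 0"
 shows "fz s x = prim (fx s) x"
proof -
 note li = locL2_loc_int[OF pf_locL2]
 have "integral {0..x} (%x. pf s (s + x)) = U s (s + x) - U s s"
  using integral_shift[of 0 x "pf s" s] prim_diff[OF li, of s "s + x" s] x
  by (simp add: U_prim pf_def[abs_def] add.commute)
 moreover have "integral {0..x} (%x. pf s (s - x)) = U s s - U s (s - x)"
  using integral_flip[of 0 x "pf s" s] prim_diff[OF li, of "s - x" s s] x
  by (simp add: U_prim pf_def[abs_def])
 moreover have "integral {0..x} (%x. pf s (s + x) + pf s (s - x)) =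
   integral {0..x} (%x. pf s (s + x)) + integral {0..x} (%x. pf s (s - x))"
  by (intro HK_add loc_int_D locL2_loc_int pf_plus_locL2 pf_minus_locL2)
 moreover have "prim (fx s) x = integral {0..x} (%x. pf s (s + x) + pf s (s - x)) / 2"
  using prim_diff[OF locL2_loc_int[OF fx_locL2] x, of s] by (simp add: fx_def[abs_def])
 ultimately show ?thesis by (simp add: fz_def wfld_def)
qed

text \<open>The mean is the value of the field at x = l, which vanishes because s + l and s - l
  differ by the period T = 2l.\<close>

lemma fx_mean:
 assumes "T = 2 * l" "s >= 0"
 shows "integral {0..l} (fx s) = 0"
proof -
 have l: "l >= 0" using T assms by simp
 have "integral {0..l} (fx s) = fz s l"
  using prim_diff[OF locL2_loc_int[OF fx_locL2] l, of s] fz_prim[OF l] by simp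
 also have "U s (s + l) = U s (s - l)"
  using periodic_D[OF U_periodic[OF assms(2)], of "s - l"] assms(1) by (simp add: add.commute)
 then have "fz s l = 0" by (simp add: fz_def wfld_def)
 finally show ?thesis .
qed

text \<open>The parallelogram identity in each point; the arguments s + x and s - x for x in [0, l]
  together run through one period of the profile.\<close>

lemma field_energy:
 assumes "T = 2 * l" "s >= 0"
 shows "(L2_norm {0..l} (fx s))^2 + (L2_norm {0..l} (ft s))^2 = (L2_norm {0..T} (pf s))^2 / 2"
proof -
 have l: "l >= 0" using T assms by simp
 have per: "periodic T (pf s)"
  using P0(2) R_periodic[OF assms(2)] by (simp add: periodic_def pf_def)
 have sq: "loc_int (%x. (pf s x)^2)" by (rule locL2_sq_loc_int[OF pf_locL2])
 have i1: "(%x. (fx s x)^2) integrable_on {0..l}" "(%x. (ft s x)^2) integrable_on {0..l}"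
  by (intro loc_int_D locL2_sq_loc_int fx_locL2 ft_locL2)+
 have i2: "(%x. (pf s (s + x))^2) integrable_on {0..l}" "(%x. (pf s (s - x))^2) integrable_on {0..l}"
  by (intro loc_int_D locL2_sq_loc_int pf_plus_locL2 pf_minus_locL2)+
 have "(L2_norm {0..l} (fx s))^2 + (L2_norm {0..l} (ft s))^2 = integral {0..l} (%x. (fx s x)^2 + (ft s x)^2)"
  by (simp add: L2_norm_sq_integral locL2_D fx_locL2 ft_locL2 HK_add[OF i1])
 also have "... = integral {0..l} (%x. (1 / 2) * ((pf s (s + x))^2 + (pf s (s - x))^2))"
  by (rule HK_cong) (simp add: fx_def ft_def power2_eq_square field_simps)
 also have "... = (1 / 2) * (integral {0..l} (%x. (pf s (s + x))^2) + integral {0..l} (%x. (pf s (s - x))^2))"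
  by (simp add: HK_add[OF i2])
 also have "integral {0..l} (%x. (pf s (s + x))^2) = integral {s..s + l} (%x. (pf s x)^2)"
  using integral_shift[of 0 l "%x. (pf s x)^2" s] by (simp add: add.commute)
 also have "integral {0..l} (%x. (pf s (s - x))^2) = integral {s - l..s} (%x. (pf s x)^2)"
  using integral_flip[of 0 l "%x. (pf s x)^2" s] by simp
 also have "integral {s..s + l} (%x. (pf s x)^2) + integral {s - l..s} (%x. (pf s x)^2) =
   integral {s - l..s - l + T} (%x. (pf s x)^2)"
  using prim_diff[OF sq, of s "s + l"] prim_diff[OF sq, of "s - l" s] prim_diff[OF sq, of "s - l" "s - l + T"] l assms(1)
  by (simp add: add.commute)
 also have "... = (L2_norm {0..T} (pf s))^2"
  using periodic_L2_norm[OF per pf_locL2, of "s - l"] T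
  by (simp flip: L2_norm_sq_integral[OF locL2_D[OF pf_locL2]])
 finally show ?thesis by simp
qed

text \<open>The rough part P0 moves by translation, which is continuous in the mean; the part
  generated by the nonlinearity is jointly continuous.\<close>

lemma pf_plus_continuous:
 assumes "l >= 0"
 shows "((%s. L2_norm {0..l} (%x. pf s (s + x) - pf t (t + x))) \<longlongrightarrow> 0) (at t within I)"
proof -
 have "((%s. L2_norm {0..l} (%x. (P0 (x + s) - P0 (x + t)) + (R s (s + x) - R t (t + x)))) \<longlongrightarrow> 0) (at t within I)"
 proof (rule L2_add_limit)
  show "((%s. L2_norm {0..l} (%x. P0 (x + s) - P0 (x + t))) \<longlongrightarrow> 0) (at t within I)"
   by (rule L2_translation_continuous_at[OF P0(1)])
  have c: "continuous_on UNIV (%(s, x). R s (s + x))"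
  proof -
   have "continuous_on UNIV (%p. (%(s, z). R s z) (fst p, fst p + snd p))"
    by (rule continuous_on_compose2[OF R_cont]) (auto intro!: continuous_intros)
   then show ?thesis by (simp add: case_prod_unfold)
  qed
  have "((%s. L2_norm {0..l} (%x. R s (s + x) - R t (t + x))) \<longlongrightarrow> 0) (at t within UNIV)"
   by (rule L2_lim_jointly_continuous[OF continuous_on_subset[OF c]]) (use assms in auto)
  then show "((%s. L2_norm {0..l} (%x. R s (s + x) - R t (t + x))) \<longlongrightarrow> 0) (at t within I)"
   by (rule tendsto_within_subset) simp
  have "locL2 (%x. R s (s + x))" for s using locL2_shift[OF R_locL2, of s s] by (simp only: add.commute)
  then show "\<forall>\<^sub>F s in at t within I. (%x. P0 (x + s) - P0 (x + t)) \<in> L2_space {0..l} \<and> (%x. R s (s + x) - R t (t + x)) \<in> L2_space {0..l}"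
   by (intro always_eventually allI conjI locL2_D locL2_diff locL2_shift P0(1))
 qed
 moreover have "(%x. (P0 (x + s) - P0 (x + t)) + (R s (s + x) - R t (t + x))) = (%x. pf s (s + x) - pf t (t + x))" for s
  by (simp add: fun_eq_iff pf_def add.commute)
 ultimately show ?thesis by simp
qed

lemma pf_minus_continuous:
 assumes "l >= 0"
 shows "((%s. L2_norm {0..l} (%x. pf s (s - x) - pf t (t - x))) \<longlongrightarrow> 0) (at t within I)"
proof -
 have "((%s. L2_norm {0..l} (%x. (P0 (s - x) - P0 (t - x)) + (R s (s - x) - R t (t - x)))) \<longlongrightarrow> 0) (at t within I)"
 proof (rule L2_add_limit)
  have "((%s. L2_norm {0..l} (%x. P0 (t - (x + (t - s))) - P0 (t - x))) \<longlongrightarrow> 0) (at t within I)"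
  proof (rule filterlim_compose[OF L2_translation_continuous[OF locL2_flip[OF P0(1)], of 0 l t]])
   show "((%s. t - s) \<longlongrightarrow> 0) (at t within I)" by (auto intro!: tendsto_eq_intros)
  qed
  then show "((%s. L2_norm {0..l} (%x. P0 (s - x) - P0 (t - x))) \<longlongrightarrow> 0) (at t within I)"
   by (simp add: diff_diff_eq2)
  have c: "continuous_on UNIV (%(s, x). R s (s - x))"
  proof -
   have "continuous_on UNIV (%p. (%(s, z). R s z) (fst p, fst p - snd p))"
    by (rule continuous_on_compose2[OF R_cont]) (auto intro!: continuous_intros)
   then show ?thesis by (simp add: case_prod_unfold)
  qed
  have "((%s. L2_norm {0..l} (%x. R s (s - x) - R t (t - x))) \<longlongrightarrow> 0) (at t within UNIV)"
   by (rule L2_lim_jointly_continuous[OF continuous_on_subset[OF c]]) (use assms in auto)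
  then show "((%s. L2_norm {0..l} (%x. R s (s - x) - R t (t - x))) \<longlongrightarrow> 0) (at t within I)"
   by (rule tendsto_within_subset) simp
  show "\<forall>\<^sub>F s in at t within I. (%x. P0 (s - x) - P0 (t - x)) \<in> L2_space {0..l} \<and> (%x. R s (s - x) - R t (t - x)) \<in> L2_space {0..l}"
   by (intro always_eventually allI conjI locL2_D locL2_diff locL2_flip P0(1) R_locL2)
 qed
 moreover have "(%x. (P0 (s - x) - P0 (t - x)) + (R s (s - x) - R t (t - x))) = (%x. pf s (s - x) - pf t (t - x))" for s
  by (simp add: fun_eq_iff pf_def)
 ultimately show ?thesis by simp
qed

lemma field_continuous:
 assumes l: "l >= 0"
 shows "((%s. L2_norm {0..l} (%x. fx s x - fx t x)) \<longlongrightarrow> 0) (at t within I)"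
  "((%s. L2_norm {0..l} (%x. ft s x - ft t x)) \<longlongrightarrow> 0) (at t within I)"
proof -
 have *: "((%s. L2_norm {0..l} (%x. (1 / 2) * (pf s (s + x) - pf t (t + x)) + k * (pf s (s - x) - pf t (t - x)))) \<longlongrightarrow> 0) (at t within I)" for k
  by (intro L2_add_limit L2_cmult_limit[OF pf_plus_continuous[OF l] tendsto_const]
    L2_cmult_limit[OF pf_minus_continuous[OF l] tendsto_const] always_eventually allI conjI locL2_D
    locL2_cmult locL2_diff pf_plus_locL2 pf_minus_locL2)
 have e: "(%x. fx s x - fx t x) = (%x. (1 / 2) * (pf s (s + x) - pf t (t + x)) + (1 / 2) * (pf s (s - x) - pf t (t - x)))"
  "(%x. ft s x - ft t x) = (%x. (1 / 2) * (pf s (s + x) - pf t (t + x)) + (- 1 / 2) * (pf s (s - x) - pf t (t - x)))" for s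
  by (simp_all add: fun_eq_iff fx_def ft_def field_simps)
 show "((%s. L2_norm {0..l} (%x. fx s x - fx t x)) \<longlongrightarrow> 0) (at t within I)"
  "((%s. L2_norm {0..l} (%x. ft s x - ft t x)) \<longlongrightarrow> 0) (at t within I)"
  unfolding e by (rule *)+
qed

text \<open>The rough part is differentiated as two translations in opposite directions, the smooth
  part classically. The terms prim (n s) at s + x and s - x cancel by symmetry about s.\<close>

lemma fz_L2_deriv:
 assumes l: "l >= 0" and t: "t >= 0"
 shows "has_L2_derivative {0..l} fz (ft t) t {0..}"
proof -
 have lc: "locL2 (prim P0)" by (rule locL2_continuous[OF P0_prim_cont])
 have d1: "has_L2_derivative {0..l} (%s x. prim P0 (x + s)) (%x. P0 (x + t)) t {0..}"
  by (rule L2_deriv_translation[OF P0(1) l])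
 have d2: "has_L2_derivative {0..l} (%s x. prim P0 (1 * s - x)) (%x. 1 * P0 (1 * t - x)) t {0..}"
  by (rule L2_deriv_flip[OF P0(1) l]) (use t in auto)
 define Y where "Y s x = (prim (R s) (s + x) - prim (R s) (s - x)) / 2" for s x
 define Y' where "Y' s x = (R s (s + x) - R s (s - x)) / 2" for s x
 have pc: "continuous_on UNIV (%(s, z). prim (R s) z)"
  using continuous_on_prim[of UNIV R] R_cont by simp
 have comp: "continuous_on UNIV (%p. f (fst p) (fst p + snd p))" "continuous_on UNIV (%p. f (fst p) (fst p - snd p))"
  if "continuous_on UNIV (%(s, z). f s z)" for f :: "real => real => real"
 proof -
  have "continuous_on UNIV (%p. (%(s, z). f s z) (fst p, fst p + snd p))"
   "continuous_on UNIV (%p. (%(s, z). f s z) (fst p, fst p - snd p))"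
   by (rule continuous_on_compose2[OF that]; auto intro!: continuous_intros)+
  then show "continuous_on UNIV (%p. f (fst p) (fst p + snd p))" "continuous_on UNIV (%p. f (fst p) (fst p - snd p))"
   by simp_all
 qed
 have Yc: "continuous_on UNIV (%(s, x). Y s x)" "continuous_on UNIV (%(s, x). Y' s x)"
  unfolding Y_def Y'_def case_prod_unfold
  by (intro continuous_on_divide continuous_on_diff comp pc R_cont continuous_on_const; simp)+
 have Yd: "((%s. Y s x) has_real_derivative Y' s x) (at s within {0..})" if s: "s \<in> {0..}" for s x
 proof -
  have gen: "((%s. prim (R s) (s + k)) has_real_derivative prim (n s) (s + k) + R s (s + k)) (at s within {0..})" for k
  proof -
   have "((%s. U s (s0 + k) - prim P0 (s0 + k)) has_real_derivative prim (n s) (s0 + k) - 0) (at s within {0..})" for s0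
    by (rule DERIV_diff[OF U_deriv DERIV_const])
   then have d: "((%s'. prim (R s') (s + k)) has_real_derivative prim (n s) (s + k)) (at s within {0..})"
    by (simp add: wpot_def)
   have Rc: "continuous_on ({0..} \<times> UNIV) (%(s, z). R s z)" by (rule continuous_on_subset[OF R_cont]) simp
   have "((%s. prim (R s) (s + k)) has_real_derivative prim (n s) (s + k) + R s (s + k) * 1) (at s within {0..})"
    by (rule prim_chain[OF Rc s, where \<phi>="%s. s + k"])
     (auto intro!: derivative_eq_intros continuous_intros d)
   then show ?thesis by simp
  qed
  have "prim (n s) (s + x) = prim (n s) (s - x)"
   using prim_antisym[of "n s" s "s + x"] n_anti s continuous_on_snd_arg[OF n_cont] by simp
  then show ?thesis unfolding Y_def Y'_def
   using DERIV_diff[OF gen[of x] gen[of "- x"], THEN DERIV_cdivide, of 2] by simp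
 qed
 have d3: "has_L2_derivative {0..l} Y (Y' t) t {0..}"
  by (rule L2_deriv_jointly_continuous[OF Yd continuous_on_subset[OF Yc(2)] continuous_on_subset[OF continuous_on_snd_arg[OF Yc(1)]]])
   (use l t in auto)
 have "has_L2_derivative {0..l} (%s x. (1 / 2) * prim P0 (x + s) + ((- 1 / 2) * prim P0 (1 * s - x) + Y s x))
   (%x. (1 / 2) * P0 (x + t) + ((- 1 / 2) * (1 * P0 (1 * t - x)) + Y' t x)) t {0..}"
  by (intro L2_deriv_add L2_deriv_cmult d1 d2 d3 L2_add L2_cmult locL2_D locL2_shift locL2_flip lc P0(1)
    locL2_continuous continuous_on_snd_arg[OF Yc(1)] continuous_on_snd_arg[OF Yc(2)]) (use t in auto)
 moreover have "(%s x. (1 / 2) * prim P0 (x + s) + ((- 1 / 2) * prim P0 (1 * s - x) + Y s x)) = fz"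
  by (simp add: fun_eq_iff fz_def wfld_def wpot_def Y_def field_simps)
 moreover have "(%x. (1 / 2) * P0 (x + t) + ((- 1 / 2) * (1 * P0 (1 * t - x)) + Y' t x)) = ft t"
  by (simp add: fun_eq_iff ft_def pf_def Y'_def field_simps)
 ultimately show ?thesis by simp
qed

lemma pf_L2_deriv:
 assumes ab: "a <= b" and t: "t \<in> {0..S}"
 shows "has_L2_derivative {a..b} pf (n t) t {0..S}"
proof -
 have "has_L2_derivative {a..b} R (n t) t {0..S}"
 proof (rule L2_deriv_jointly_continuous[OF R_deriv _ _ _ t ab])
  show "continuous_on ({0..S} \<times> {a..b}) (%(s, x). n s x)" by (rule continuous_on_subset[OF n_cont]) simp
  show "continuous_on {a..b} (R s)" for s by (rule continuous_on_subset[OF continuous_on_snd_arg[OF R_cont]]) simp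
 qed simp
 then have "has_L2_derivative {a..b} (%s x. P0 x + R s x) (%x. 0 + n t x) t {0..S}"
  by (intro L2_deriv_add L2_deriv_const locL2_D P0(1) R_locL2 L2_zero t
    locL2_continuous continuous_on_snd_arg[OF n_cont])
 then show ?thesis by (simp add: pf_def[abs_def])
qed

text \<open>The profile cannot be differentiated along its translation. Shifting the variable of
  integration lets the test function move instead, over the fixed interval [-l, S + l]; the
  enlargement is harmless because the test function vanishes outside (0, l).\<close>

lemma pf_pair_deriv:
 assumes \<psi>: "locL2 \<psi>" and z: "!!x. x \<notin> {0<..<l} ==> \<psi> x = 0 \<and> prim \<psi> x = 0" and l: "l > 0" and t: "t \<in> {0..S}"
 shows "((%s. integral {0..l} (%x. pf s (s + x) * prim \<psi> x)) has_real_derivative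
   integral {0..l} (%x. n t (t + x) * prim \<psi> x) - integral {0..l} (%x. pf t (t + x) * \<psi> x)) (at t within {0..S})"
  "((%s. integral {0..l} (%x. pf s (s - x) * prim \<psi> x)) has_real_derivative
   integral {0..l} (%x. n t (t - x) * prim \<psi> x) + integral {0..l} (%x. pf t (t - x) * \<psi> x)) (at t within {0..S})"
proof -
 define a b where "a = - l" and "b = S + l"
 have ab: "a <= b" using t l by (simp add: a_def b_def)
 have pL: "locL2 (prim \<psi>)" by (rule prim_locL2[OF \<psi>])
 have nL: "locL2 (n t)" by (rule locL2_continuous[OF continuous_on_snd_arg[OF n_cont]])
 have sh: "locL2 (%y. f (y - s))" if "locL2 f" for f s using locL2_shift[OF that, of "- s"] by simp
 have win1: "integral {a..b} (%y. F y * f (y - s)) = integral {0..l} (%x. F (s + x) * f x)"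
  if F: "locL2 F" and f: "locL2 f" and s: "s \<in> {0..S}" and fz: "!!x. x \<notin> {0<..<l} ==> f x = 0" for F f s
 proof -
  have "integral {a..b} (%y. F y * f (y - s)) = integral {s..s + l} (%y. F y * f (y - s))"
   by (rule integral_support[OF _ _ loc_int_D[OF locL2_mult_loc_int[OF F sh[OF f]]]])
    (use s l in \<open>auto simp: a_def b_def fz\<close>)
  also have "... = integral {0..l} (%x. F (s + x) * f x)"
   using integral_shift[of 0 l "%y. F y * f (y - s)" s] by (simp add: add.commute)
  finally show ?thesis .
 qed
 have win2: "integral {a..b} (%y. F y * f (s - y)) = integral {0..l} (%x. F (s - x) * f x)"
  if F: "locL2 F" and f: "locL2 f" and s: "s \<in> {0..S}" and fz: "!!x. x \<notin> {0<..<l} ==> f x = 0" for F f s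
 proof -
  have "integral {a..b} (%y. F y * f (s - y)) = integral {s - l..s} (%y. F y * f (s - y))"
   by (rule integral_support[OF _ _ loc_int_D[OF locL2_mult_loc_int[OF F locL2_flip[OF f]]]])
    (use s l in \<open>auto simp: a_def b_def fz\<close>)
  also have "... = integral {0..l} (%x. F (s - x) * f x)"
   using integral_flip[of 0 l "%y. F y * f (s - y)" s] by simp
  finally show ?thesis .
 qed
 have dp: "has_L2_derivative {a..b} pf (n t) t {0..S}" by (rule pf_L2_deriv[OF ab t])
 have d1: "has_L2_derivative {a..b} (%s y. 1 * prim \<psi> (y + - s)) (%y. 0 * prim \<psi> (y + - t) + 1 * (- 1) * \<psi> (y + - t)) t {0..S}"
 proof (rule L2_deriv_scale_comp[where A="%s y. prim \<psi> (y + s)" and \<sigma>="%s. - s" and k="%_. 1" and J=UNIV])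
  show "has_L2_derivative {a..b} (%s y. prim \<psi> (y + s)) (%y. \<psi> (y + - t)) (- t) UNIV"
   by (rule L2_deriv_translation[OF \<psi> ab])
 qed (use t in \<open>auto intro!: locL2_D locL2_shift pL sh \<psi> derivative_eq_intros simp: inj_on_def\<close>)
 then have d1: "has_L2_derivative {a..b} (%s y. prim \<psi> (y - s)) (%y. - \<psi> (y - t)) t {0..S}" by simp
 have d2: "has_L2_derivative {a..b} (%s y. prim \<psi> (s - y)) (%y. \<psi> (t - y)) t {0..S}"
  using L2_deriv_flip[OF \<psi> ab zero_less_one t] by simp
 have "((%s. LINT y|lebesgue_on {a..b}. pf s y * prim \<psi> (y - s)) has_real_derivative
   (LINT y|lebesgue_on {a..b}. n t y * prim \<psi> (y - t)) + (LINT y|lebesgue_on {a..b}. pf t y * - \<psi> (y - t))) (at t within {0..S})"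
  by (rule L2_deriv_inner[OF dp _ _ d1 _ _ t])
   (auto intro!: locL2_D pf_locL2 nL sh pL \<psi> L2_uminus)
 then have D1: "((%s. integral {a..b} (%y. pf s y * prim \<psi> (y - s))) has_real_derivative
   integral {a..b} (%y. n t y * prim \<psi> (y - t)) - integral {a..b} (%y. pf t y * \<psi> (y - t))) (at t within {0..S})"
  by (simp add: LINT_mult_Icc[OF pf_locL2 sh[OF pL]] LINT_mult_Icc[OF nL sh[OF pL]] LINT_mult_Icc[OF pf_locL2 sh[OF \<psi>]])
 have "((%s. LINT y|lebesgue_on {a..b}. pf s y * prim \<psi> (s - y)) has_real_derivative
   (LINT y|lebesgue_on {a..b}. n t y * prim \<psi> (t - y)) + (LINT y|lebesgue_on {a..b}. pf t y * \<psi> (t - y))) (at t within {0..S})"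
  by (rule L2_deriv_inner[OF dp _ _ d2 _ _ t])
   (auto intro!: locL2_D pf_locL2 nL locL2_flip pL \<psi>)
 then have D2: "((%s. integral {a..b} (%y. pf s y * prim \<psi> (s - y))) has_real_derivative
   integral {a..b} (%y. n t y * prim \<psi> (t - y)) + integral {a..b} (%y. pf t y * \<psi> (t - y))) (at t within {0..S})"
  by (simp add: LINT_mult_Icc[OF pf_locL2 locL2_flip[OF pL]] LINT_mult_Icc[OF nL locL2_flip[OF pL]] LINT_mult_Icc[OF pf_locL2 locL2_flip[OF \<psi>]])
 have z1: "!!x. x \<notin> {0<..<l} ==> \<psi> x = 0" and z2: "!!x. x \<notin> {0<..<l} ==> prim \<psi> x = 0" using z by blast+
 show "((%s. integral {0..l} (%x. pf s (s + x) * prim \<psi> x)) has_real_derivative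
   integral {0..l} (%x. n t (t + x) * prim \<psi> x) - integral {0..l} (%x. pf t (t + x) * \<psi> x)) (at t within {0..S})"
 proof (rule has_field_derivative_transform_within[OF _ zero_less_one t])
  show "((%s. integral {a..b} (%y. pf s y * prim \<psi> (y - s))) has_real_derivative
    integral {0..l} (%x. n t (t + x) * prim \<psi> x) - integral {0..l} (%x. pf t (t + x) * \<psi> x)) (at t within {0..S})"
  proof -
   have "integral {a..b} (%y. pf t y * \<psi> (y - t)) = integral {0..l} (%x. pf t (t + x) * \<psi> x)"
    by (rule win1[OF pf_locL2 \<psi> t z1])
   moreover have "integral {a..b} (%y. n t y * prim \<psi> (y - t)) = integral {0..l} (%x. n t (t + x) * prim \<psi> x)"
    by (rule win1[OF nL pL t z2])
   ultimately show ?thesis using D1 by simp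
  qed
  fix s assume "s \<in> {0..S}"
  then show "integral {a..b} (%y. pf s y * prim \<psi> (y - s)) = integral {0..l} (%x. pf s (s + x) * prim \<psi> x)"
   by (rule win1[OF pf_locL2 pL _ z2])
 qed
 show "((%s. integral {0..l} (%x. pf s (s - x) * prim \<psi> x)) has_real_derivative
   integral {0..l} (%x. n t (t - x) * prim \<psi> x) + integral {0..l} (%x. pf t (t - x) * \<psi> x)) (at t within {0..S})"
 proof (rule has_field_derivative_transform_within[OF _ zero_less_one t])
  show "((%s. integral {a..b} (%y. pf s y * prim \<psi> (s - y))) has_real_derivative
    integral {0..l} (%x. n t (t - x) * prim \<psi> x) + integral {0..l} (%x. pf t (t - x) * \<psi> x)) (at t within {0..S})"
  proof -
   have "integral {a..b} (%y. pf t y * \<psi> (t - y)) = integral {0..l} (%x. pf t (t - x) * \<psi> x)"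
    by (rule win2[OF pf_locL2 \<psi> t z1])
   moreover have "integral {a..b} (%y. n t y * prim \<psi> (t - y)) = integral {0..l} (%x. n t (t - x) * prim \<psi> x)"
    by (rule win2[OF nL pL t z2])
   ultimately show ?thesis using D2 by simp
  qed
  fix s assume "s \<in> {0..S}"
  then show "integral {a..b} (%y. pf s y * prim \<psi> (s - y)) = integral {0..l} (%x. pf s (s - x) * prim \<psi> x)"
   by (rule win2[OF pf_locL2 pL _ z2])
 qed
qed

text \<open>The weak form of z_ss = z_xx + n. Antisymmetry gives n(s - x) = - n(s + x), so half the
  difference of the two forcing terms is n itself.\<close>

lemma ft_pair_deriv:
 assumes \<psi>: "locL2 \<psi>" and z: "!!x. x \<notin> {0<..<l} ==> \<psi> x = 0 \<and> prim \<psi> x = 0" and l: "l > 0" and t: "t \<in> {0..S}"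
 shows "((%s. integral {0..l} (%x. ft s x * prim \<psi> x)) has_real_derivative
   integral {0..l} (%x. n t (t + x) * prim \<psi> x) - integral {0..l} (%x. fx t x * \<psi> x)) (at t within {0..S})"
proof -
 note d = DERIV_cdivide[OF DERIV_diff[OF pf_pair_deriv[OF \<psi> z l t]], of 2]
 have pL: "locL2 (prim \<psi>)" by (rule prim_locL2[OF \<psi>])
 have i: "(%x. pf s (s + x) * h x) integrable_on {0..l}" "(%x. pf s (s - x) * h x) integrable_on {0..l}" if "locL2 h" for s h
  using that by (intro loc_int_D locL2_mult_loc_int pf_plus_locL2 pf_minus_locL2; assumption)+
 have e1: "integral {0..l} (%x. ft s x * prim \<psi> x) =
   (integral {0..l} (%x. pf s (s + x) * prim \<psi> x) - integral {0..l} (%x. pf s (s - x) * prim \<psi> x)) / 2" for s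
 proof -
  have "integral {0..l} (%x. ft s x * prim \<psi> x) = integral {0..l} (%x. (pf s (s + x) * prim \<psi> x - pf s (s - x) * prim \<psi> x) / 2)"
   by (rule HK_cong) (simp add: ft_def left_diff_distrib)
  then show ?thesis by (simp add: HK_diff[OF i[OF pL]])
 qed
 have e2: "integral {0..l} (%x. fx t x * \<psi> x) =
   (integral {0..l} (%x. pf t (t + x) * \<psi> x) + integral {0..l} (%x. pf t (t - x) * \<psi> x)) / 2"
 proof -
  have "integral {0..l} (%x. fx t x * \<psi> x) = integral {0..l} (%x. (pf t (t + x) * \<psi> x + pf t (t - x) * \<psi> x) / 2)"
   by (rule HK_cong) (simp add: fx_def distrib_right)
  then show ?thesis by (simp add: HK_add[OF i[OF \<psi>]])
 qed
 have a: "n t (t - x) = - n t (t + x)" for x using n_anti[of t "t + x"] t by simp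
 have b: "integral {0..l} (%x. n t (t - x) * prim \<psi> x) = - integral {0..l} (%x. n t (t + x) * prim \<psi> x)"
  by (simp add: a)
 have "(X - Y - (- X + Z)) / 2 = X - (Y + Z) / 2" for X Y Z :: real by (simp add: field_simps)
 from DERIV_cong[OF d[unfolded b] this] show ?thesis unfolding e1 e2 .
qed

end

section \<open>The Liouville substitution\<close>

text \<open>All real powers of c are included so that the algebra contains g = c^(-1/2) and 1/c and
  is closed under differentiation; boundedness uses the lower bound c0 for negative
  exponents.\<close>

inductive_set coeff_alg :: "(real => real) => (real => real) set" for c where
 base: "smooth_bounded f ==> f \<in> coeff_alg c"
| powr: "(%\<tau>. c \<tau> powr q) \<in> coeff_alg c"
| add: "f \<in> coeff_alg c ==> g \<in> coeff_alg c ==> (%\<tau>. f \<tau> + g \<tau>) \<in> coeff_alg c"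
| mult: "f \<in> coeff_alg c ==> g \<in> coeff_alg c ==> (%\<tau>. f \<tau> * g \<tau>) \<in> coeff_alg c"

lemma smooth_bounded_const: "smooth_bounded (%\<tau>. k)"
 unfolding smooth_bounded_def
 by (rule exI[of _ "%i \<tau>. if i = 0 then k else 0"]) (auto simp: bounded_iff)

lemma coeff_alg_cmult: "f \<in> coeff_alg c ==> (%\<tau>. k * f \<tau>) \<in> coeff_alg c"
 by (rule coeff_alg.mult[OF coeff_alg.base[OF smooth_bounded_const]])

lemma smooth_bounded_deriv:
 assumes "smooth_bounded f"
 shows "\<exists>f'. smooth_bounded f' \<and> (\<forall>\<tau>\<ge>0. (f has_real_derivative f' \<tau>) (at \<tau> within {0..}))"
proof -
 obtain D where D: "D 0 = f" "!!k \<tau>. \<tau> >= 0 ==> (D k has_real_derivative D (Suc k) \<tau>) (at \<tau> within {0..})"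
  "!!k. bounded (D k ` {0..})"
  using assms unfolding smooth_bounded_def by blast
 have "smooth_bounded (D 1)"
  unfolding smooth_bounded_def by (rule exI[of _ "%k. D (Suc k)"]) (use D in auto)
 then show ?thesis using D(1) D(2)[of _ 0] by auto
qed

lemma smooth_bounded_bound:
 assumes "smooth_bounded f"
 shows "\<exists>B. \<forall>\<tau>\<ge>0. \<bar>f \<tau>\<bar> <= B"
proof -
 have "bounded (f ` {0..})" using assms unfolding smooth_bounded_def by metis
 then show ?thesis by (auto simp: bounded_iff)
qed

context
 fixes c :: "real => real" and c0 :: real
 assumes c: "smooth_bounded c" and c0: "c0 > 0" "!!\<tau>. \<tau> >= 0 ==> c \<tau> >= c0"
begin

lemma coeff_deriv:
 "f \<in> coeff_alg c ==> \<exists>f'\<in>coeff_alg c. \<forall>\<tau>\<ge>0. (f has_real_derivative f' \<tau>) (at \<tau> within {0..})"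
proof (induction rule: coeff_alg.induct)
 case (base f)
 then show ?case using smooth_bounded_deriv coeff_alg.base by metis
next
 case (powr q)
 obtain c' where c': "smooth_bounded c'" "\<forall>\<tau>\<ge>0. (c has_real_derivative c' \<tau>) (at \<tau> within {0..})"
  using smooth_bounded_deriv[OF c] by blast
 show ?case
 proof (intro bexI[of _ "%\<tau>. (q * c \<tau> powr (q - 1)) * c' \<tau>"] allI impI)
  show "(%\<tau>. (q * c \<tau> powr (q - 1)) * c' \<tau>) \<in> coeff_alg c"
   by (intro coeff_alg.mult coeff_alg_cmult coeff_alg.powr coeff_alg.base c'(1))
  fix \<tau> :: real assume t: "\<tau> >= 0"
  have "c \<tau> > 0" using c0(2)[OF t] c0(1) by linarith
  then show "((%\<tau>. c \<tau> powr q) has_real_derivative (q * c \<tau> powr (q - 1)) * c' \<tau>) (at \<tau> within {0..})"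
   using DERIV_chain'[OF c'(2)[rule_format, OF t] has_real_derivative_powr] by (simp add: mult.commute)
 qed
next
 case (add f g)
 then obtain f' g' where "f' \<in> coeff_alg c" "\<forall>\<tau>\<ge>0. (f has_real_derivative f' \<tau>) (at \<tau> within {0..})"
  "g' \<in> coeff_alg c" "\<forall>\<tau>\<ge>0. (g has_real_derivative g' \<tau>) (at \<tau> within {0..})" by blast
 then show ?case
  by (intro bexI[of _ "%\<tau>. f' \<tau> + g' \<tau>"] coeff_alg.add) (auto intro!: derivative_intros)
next
 case (mult f g)
 then obtain f' g' where "f' \<in> coeff_alg c" "\<forall>\<tau>\<ge>0. (f has_real_derivative f' \<tau>) (at \<tau> within {0..})"
  "g' \<in> coeff_alg c" "\<forall>\<tau>\<ge>0. (g has_real_derivative g' \<tau>) (at \<tau> within {0..})" by blast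
 then show ?case using mult.hyps
  by (intro bexI[of _ "%\<tau>. f' \<tau> * g \<tau> + f \<tau> * g' \<tau>"] coeff_alg.add coeff_alg.mult)
   (auto intro!: derivative_eq_intros)
qed

lemma coeff_bounded: "f \<in> coeff_alg c ==> \<exists>B. \<forall>\<tau>\<ge>0. \<bar>f \<tau>\<bar> <= B"
proof (induction rule: coeff_alg.induct)
 case (base f)
 then show ?case by (rule smooth_bounded_bound)
next
 case (powr q)
 obtain c1 where c1: "\<forall>\<tau>\<ge>0. \<bar>c \<tau>\<bar> <= c1" using smooth_bounded_bound[OF c] by blast
 have "c \<tau> powr q <= c0 powr q + c1 powr q" if t: "\<tau> >= 0" for \<tau>
 proof (cases "q >= 0")
  case True
  then have "c \<tau> powr q <= c1 powr q" using c1 t c0(1) c0(2)[OF t] by (intro powr_mono2) auto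
  then show ?thesis by (simp add: add_increasing)
 next
  case False
  then have "c \<tau> powr q <= c0 powr q" using c0(1) c0(2)[OF t] by (intro powr_mono2') auto
  then show ?thesis by (simp add: add_increasing2)
 qed
 then show ?case by (intro exI[of _ "c0 powr q + c1 powr q"]) simp
next
 case (add f g)
 then obtain A B where "\<forall>\<tau>\<ge>0. \<bar>f \<tau>\<bar> <= A" "\<forall>\<tau>\<ge>0. \<bar>g \<tau>\<bar> <= B" by blast
 then show ?case by (intro exI[of _ "A + B"]) (metis abs_triangle_ineq add_mono order_trans)
next
 case (mult f g)
 then obtain A B where AB: "\<forall>\<tau>\<ge>0. \<bar>f \<tau>\<bar> <= A" "\<forall>\<tau>\<ge>0. \<bar>g \<tau>\<bar> <= B" by blast
 have "\<bar>f \<tau> * g \<tau>\<bar> <= A * B" if "\<tau> >= 0" for \<tau>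
  unfolding abs_mult using AB that by (intro mult_mono) (auto intro: order_trans[OF abs_ge_zero])
 then show ?case by blast
qed

text \<open>The next member is the derivative divided by c, that is, the derivative with respect to
  the stretched time. Division by c stays within the algebra.\<close>

lemma coeff_chain:
 assumes f: "f \<in> coeff_alg c"
 shows "\<exists>F K. F 0 = f \<and> (\<forall>i::nat. \<forall>\<tau>\<ge>0. (F i has_real_derivative F (Suc i) \<tau> * c \<tau>) (at \<tau> within {0..}) \<and> \<bar>F i \<tau>\<bar> <= K i)"
proof -
 have "\<exists>F. F 0 = f \<and> (\<forall>i. F i \<in> coeff_alg c \<and> (\<forall>\<tau>\<ge>0. (F i has_real_derivative F (Suc i) \<tau> * c \<tau>) (at \<tau> within {0..})))"
 proof -
  have step: "\<exists>y. y \<in> coeff_alg c \<and> (\<forall>\<tau>\<ge>0. (x has_real_derivative y \<tau> * c \<tau>) (at \<tau> within {0..}))"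
   if "x \<in> coeff_alg c" for x
  proof -
   obtain x' where x': "x' \<in> coeff_alg c" "\<forall>\<tau>\<ge>0. (x has_real_derivative x' \<tau>) (at \<tau> within {0..})"
    using coeff_deriv[OF \<open>x \<in> coeff_alg c\<close>] by blast
   have e: "x' \<tau> * c \<tau> powr (- 1) * c \<tau> = x' \<tau>" if "\<tau> >= 0" for \<tau>
    using c0(1) c0(2)[OF that] by (simp add: powr_minus)
   show ?thesis
   proof (intro exI[of _ "%\<tau>. x' \<tau> * c \<tau> powr (- 1)"] conjI allI impI coeff_alg.mult x'(1) coeff_alg.powr)
    fix \<tau> :: real assume "\<tau> >= 0"
    then show "(x has_real_derivative x' \<tau> * c \<tau> powr (- 1) * c \<tau>) (at \<tau> within {0..})"
     using x'(2) by (simp only: e)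
   qed
  qed
  then obtain G where G: "!!x. x \<in> coeff_alg c ==> G x \<in> coeff_alg c \<and> (\<forall>\<tau>\<ge>0. (x has_real_derivative G x \<tau> * c \<tau>) (at \<tau> within {0..}))"
   by metis
  have m: "(G ^^ i) f \<in> coeff_alg c" for i by (induction i) (use f G in auto)
  show ?thesis by (rule exI[of _ "%i. (G ^^ i) f"]) (use m G in auto)
 qed
 then obtain F where F: "F 0 = f" "!!i. F i \<in> coeff_alg c"
  "!!i \<tau>. \<tau> >= 0 ==> (F i has_real_derivative F (Suc i) \<tau> * c \<tau>) (at \<tau> within {0..})" by blast
 have "\<forall>i. \<exists>B. \<forall>\<tau>\<ge>0. \<bar>F i \<tau>\<bar> <= B" using coeff_bounded[OF F(2)] by blast
 then obtain K where "!!i \<tau>. \<tau> >= 0 ==> \<bar>F i \<tau>\<bar> <= K i" by metis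
 with F show ?thesis by (intro exI[of _ F] exI[of _ K]) auto
qed

end

section \<open>Stretched time and initial profile\<close>

lemma time_change:
 fixes k :: "real => real"
 assumes k: "continuous_on UNIV k" and m: "m > 0" "!!t. k t >= m"
 obtains \<theta> where "!!t. \<theta> (prim k t) = t" "!!s. prim k (\<theta> s) = s"
  "!!s. (\<theta> has_real_derivative inverse (k (\<theta> s))) (at s)" "!!s. s >= 0 ==> \<theta> s >= 0" "strict_mono (prim k)"
proof -
 note d = prim_deriv[OF k]
 have gr: "prim k b - prim k a >= m * (b - a)" if "a <= b" for a b
 proof -
  have "prim k a - m * a <= prim k b - m * b"
  proof (rule DERIV_nonneg_imp_nondecreasing[OF that])
   fix x
   have "((%x. prim k x - m * x) has_real_derivative k x - m) (at x)" by (auto intro!: derivative_eq_intros d)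
   then show "\<exists>y. ((%x. prim k x - m * x) has_real_derivative y) (at x) \<and> 0 <= y" using m(2)[of x] by auto
  qed
  then show ?thesis by (simp add: right_diff_distrib)
 qed
 have sm: "strict_mono (prim k)"
 proof (rule strict_monoI)
  fix a b :: real assume "a < b"
  then have "m * (b - a) > 0" using m by simp
  then show "prim k a < prim k b" using gr[of a b] \<open>a < b\<close> by linarith
 qed
 have pc: "isCont (prim k) x" for x by (rule DERIV_isCont[OF d])
 have surj: "\<exists>t. prim k t = s" for s
 proof -
  define M where "M = \<bar>s\<bar> / m"
  have M: "M >= 0" "m * M = \<bar>s\<bar>" using m by (simp_all add: M_def)
  have "m * M <= - prim k (- M)" "m * M <= prim k M" using gr[of "- M" 0] gr[of 0 M] M(1) by simp_all
  then have "prim k (- M) <= s" "s <= prim k M" using M(2) by linarith+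
  then show ?thesis using IVT[of "prim k" "- M" s M] M(1) pc by auto
 qed
 define \<theta> where "\<theta> = inv (prim k)"
 have l: "\<theta> (prim k t) = t" for t unfolding \<theta>_def by (rule inv_f_f[OF strict_mono_imp_inj_on[OF sm]])
 have r: "prim k (\<theta> s) = s" for s
 proof -
  obtain t where "prim k t = s" using surj by blast
  then show ?thesis using l[of t] by simp
 qed
 have \<theta>c: "isCont \<theta> s" for s
  using isCont_inverse_function[of 1 "\<theta> s" \<theta> "prim k"] l pc r by simp
 have "(\<theta> has_real_derivative inverse (k (\<theta> s))) (at s)" for s
 proof (rule DERIV_inverse_function[where f="prim k" and a="s - 1" and b="s + 1"])
  show "k (\<theta> s) \<noteq> 0" using m(1) m(2)[of "\<theta> s"] by linarith
 qed (use d r \<theta>c in auto)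
 moreover have "\<theta> s >= 0" if "s >= 0" for s
 proof (rule ccontr)
  assume "\<not> \<theta> s >= 0"
  then have "prim k (\<theta> s) < prim k 0" by (intro strict_monoD[OF sm]) simp
  then show False using r[of s] that by simp
 qed
 ultimately show ?thesis using that[of \<theta>] l r sm by blast
qed

text \<open>The inverse time change has derivative 1/c, which cancels the factor c of
  \<open>coeff_chain\<close> and leaves exactly one factor eps per derivative in s.\<close>

lemma coeff_der_chain:
 assumes F: "!!i \<tau>. \<tau> >= 0 ==> (F i has_real_derivative F (Suc i) \<tau> * c \<tau>) (at \<tau> within {0..}) \<and> \<bar>F i \<tau>\<bar> <= K i"
  and \<theta>: "!!s. s >= 0 ==> (\<theta> has_real_derivative inverse (c (eps * \<theta> s))) (at s)" "!!s. s >= 0 ==> \<theta> s >= 0"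
  and e: "eps > 0" and c: "!!\<tau>. \<tau> >= 0 ==> c \<tau> \<noteq> 0"
 shows "der_chain eps K (%i s. F i (eps * \<theta> s) * eps ^ i)"
 unfolding der_chain_def
proof (intro allI impI conjI)
 fix i and s :: real assume s: "s >= 0"
 have n: "eps * \<theta> s >= 0" using e \<theta>(2)[OF s] by simp
 show "\<bar>F i (eps * \<theta> s) * eps ^ i\<bar> <= K i * eps ^ i"
  using F[OF n, of i] e by (simp add: abs_mult mult_right_mono)
 have inner: "((%s. eps * \<theta> s) has_real_derivative eps * inverse (c (eps * \<theta> s))) (at s within {0..})"
  by (rule has_field_derivative_at_within[OF DERIV_cmult[OF \<theta>(1)[OF s]]])
 have outer: "(F i has_real_derivative F (Suc i) (eps * \<theta> s) * c (eps * \<theta> s)) (at (eps * \<theta> s) within (%s. eps * \<theta> s) ` {0..})"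
 proof -
  have "(F i has_real_derivative F (Suc i) (eps * \<theta> s) * c (eps * \<theta> s)) (at (eps * \<theta> s) within {0..})"
   by (rule conjunct1[OF F[OF n]])
  moreover have "(%s. eps * \<theta> s) ` {0..} \<subseteq> {0..}"
   by (rule image_subsetI) (simp add: \<theta>(2) less_imp_le[OF e])
  ultimately show ?thesis by (rule DERIV_subset)
 qed
 have "(F i \<circ> (%s. eps * \<theta> s) has_real_derivative
   F (Suc i) (eps * \<theta> s) * c (eps * \<theta> s) * (eps * inverse (c (eps * \<theta> s)))) (at s within {0..})"
  by (rule DERIV_image_chain[where g="%s. eps * \<theta> s" and f="F i", OF outer inner])
 moreover have "F (Suc i) (eps * \<theta> s) * c (eps * \<theta> s) * (eps * inverse (c (eps * \<theta> s))) = F (Suc i) (eps * \<theta> s) * eps"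
  using c[OF n] by simp
 ultimately have "((%s. F i (eps * \<theta> s)) has_real_derivative F (Suc i) (eps * \<theta> s) * eps) (at s within {0..})"
  by (simp only: o_def)
 from DERIV_cmult_right[OF this, of "eps ^ i"]
 show "((%s. F i (eps * \<theta> s) * eps ^ i) has_real_derivative F (Suc i) (eps * \<theta> s) * eps ^ Suc i) (at s within {0..})"
  by (simp add: mult.assoc)
qed

text \<open>At s = 0 the profile must have even part F = z_x and odd part G = z_s on (-l, l). On the
  period [0, 2l] this means F + G on the first half and the reflection of F - G on the
  second.\<close>

lemma initial_profile:
 assumes F: "locL2 F" "!!x. x \<notin> {0<..<l} ==> F x = 0" "integral {0..l} F = 0"
  and G: "locL2 G" "!!x. x \<notin> {0<..<l} ==> G x = 0" and l: "l > 0"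
 obtains P0 where "locL2 P0" "periodic (2 * l) P0" "integral {0..2 * l} P0 = 0"
  "L2_norm {0..2 * l} P0 <= 2 * (L2_norm {0..l} F + L2_norm {0..l} G)"
  "!!x. x \<in> {0..l} ==> P0 x + P0 (- x) = 2 * F x \<and> P0 x - P0 (- x) = 2 * G x"
proof -
 \<comment> \<open>Since F and G vanish outside (0, l), only one bracket is active on each half of
   the period, and no case distinction is needed.\<close>
 define b where "b y = (F y + G y) + (F (2 * l - y) - G (2 * l - y))" for y
 define P0 where "P0 y = b (y - 2 * l * of_int \<lfloor>y / (2 * l)\<rfloor>)" for y
 have per: "periodic (2 * l) P0" unfolding periodic_def
 proof
  fix x
  have "(x + 2 * l) / (2 * l) = x / (2 * l) + 1" using l by (simp add: field_simps)
  then have "\<lfloor>(x + 2 * l) / (2 * l)\<rfloor> = \<lfloor>x / (2 * l)\<rfloor> + 1" by simp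
  then have "x + 2 * l - 2 * l * of_int \<lfloor>(x + 2 * l) / (2 * l)\<rfloor> = x - 2 * l * of_int \<lfloor>x / (2 * l)\<rfloor>"
   by (simp add: distrib_left)
  then show "P0 (x + 2 * l) = P0 x" by (simp only: P0_def)
 qed
 have P0b: "P0 y = b y" if y: "y \<in> {0..2 * l}" for y
 proof (cases "y = 2 * l")
  case True
  then show ?thesis using l F(2)[of 0] F(2)[of "2 * l"] G(2)[of 0] G(2)[of "2 * l"] by (simp add: P0_def b_def)
 next
  case False
  then have "\<lfloor>y / (2 * l)\<rfloor> = 0" using y l by (intro floor_unique) (auto simp: divide_simps)
  then show ?thesis by (simp add: P0_def)
 qed
 have bL: "locL2 b" unfolding b_def[abs_def] by (intro locL2_add locL2_diff locL2_flip F(1) G(1))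
 have P0L: "P0 \<in> L2_space {0..2 * l}"
 proof (rule L2_cong_AE[OF locL2_D[OF bL]])
  show "P0 \<in> borel_measurable (lebesgue_on {0..2 * l})"
   using L2_measurable[OF locL2_D[OF bL]] by (rule measurable_cong[THEN iffD1, rotated]) (simp add: P0b space_restrict_space)
  show "AE x in lebesgue_on {0..2 * l}. b x = P0 x" by (rule AE_I2) (simp add: P0b space_restrict_space)
 qed
 have loc: "locL2 P0" by (rule periodic_locL2[OF _ per P0L]) (use l in simp)
 have ii: "h integrable_on {0..2 * l}" if "locL2 h" for h by (rule loc_int_D[OF locL2_loc_int[OF that]])
 have "integral {0..2 * l} P0 = integral {0..2 * l} b"
  by (rule HK_cong) (simp add: P0b)
 also have "... = integral {0..2 * l} F + integral {0..2 * l} G + (integral {0..2 * l} (%y. F (2 * l - y)) - integral {0..2 * l} (%y. G (2 * l - y)))"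
  unfolding b_def[abs_def]
  by (simp add: HK_add HK_diff
    ii locL2_add locL2_diff locL2_flip F(1) G(1))
 also have "... = 2 * integral {0..2 * l} F" using integral_flip[of 0 "2 * l" _ "2 * l"] by simp
 also have "integral {0..2 * l} F = integral {0..l} F"
 proof (rule integral_unique[OF has_integral_on_superset[OF integrable_integral]])
  show "F integrable_on {0..l}" by (rule loc_int_D[OF locL2_loc_int[OF F(1)]])
 qed (use F(2) l in auto)
 finally have mean: "integral {0..2 * l} P0 = 0" using F(3) by simp
 have half: "L2_norm {0..2 * l} f = L2_norm {0..l} f" if f: "locL2 f" "!!x. x \<notin> {0<..<l} ==> f x = 0" for f
 proof -
  have "integral {0..2 * l} (%x. (f x)^2) = integral {0..l} (%x. (f x)^2)"
  proof (rule integral_unique[OF has_integral_on_superset[OF integrable_integral]])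
   show "(%x. (f x)^2) integrable_on {0..l}" by (rule loc_int_D[OF locL2_sq_loc_int[OF f(1)]])
  qed (use f(2) l in auto)
  then have "(L2_norm {0..2 * l} f)^2 = (L2_norm {0..l} f)^2" by (simp add: L2_norm_sq_integral locL2_D f(1))
  then show ?thesis by (simp add: power2_eq_iff_nonneg)
 qed
 have fl: "L2_norm {0..2 * l} (%y. f (2 * l - y)) = L2_norm {0..2 * l} f" if "locL2 f" for f
  using L2_flip(2)[where c="2 * l" and a=0 and b="2 * l", OF locL2_D[OF that]] by simp
 have "L2_norm {0..2 * l} P0 = L2_norm {0..2 * l} b"
  using P0L locL2_D[OF bL] by (intro L2_norm_cong_AE L2_measurable AE_I2) (simp_all add: P0b space_restrict_space)
 also have "... <= L2_norm {0..2 * l} (%y. F y + G y) + L2_norm {0..2 * l} (%y. F (2 * l - y) - G (2 * l - y))"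
  unfolding b_def[abs_def] by (intro L2_norm_triangle locL2_D locL2_add locL2_diff locL2_flip F(1) G(1))
 also have "... <= (L2_norm {0..2 * l} F + L2_norm {0..2 * l} G) +
   (L2_norm {0..2 * l} (%y. F (2 * l - y)) + L2_norm {0..2 * l} (%y. G (2 * l - y)))"
  by (intro add_mono L2_norm_triangle L2_norm_triangle_diff locL2_D locL2_flip F(1) G(1))
 also have "... = 2 * (L2_norm {0..l} F + L2_norm {0..l} G)"
  using half[OF F(1)] half[OF G(1)] F(2) G(2) by (simp add: fl F(1) G(1))
 finally have nb: "L2_norm {0..2 * l} P0 <= 2 * (L2_norm {0..l} F + L2_norm {0..l} G)" .
 have "P0 x + P0 (- x) = 2 * F x \<and> P0 x - P0 (- x) = 2 * G x" if x: "x \<in> {0..l}" for x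
 proof -
  have z: "F (2 * l - x) = 0" "G (2 * l - x) = 0" using F(2)[of "2 * l - x"] G(2)[of "2 * l - x"] x by auto
  have "P0 (- x) = P0 (2 * l - x)" using periodic_D[OF per, of "- x"] by simp
  then show ?thesis using P0b[of x] P0b[of "2 * l - x"] x l z by (simp add: b_def)
 qed
 then show ?thesis using that[OF loc per mean nb] by blast
qed

lemma integral_mult_add:
 assumes "locL2 f" "locL2 g" "locL2 h"
 shows "integral {a..b} (%x. (p * f x + q * g x) * h x) = p * integral {a..b} (%x. f x * h x) + q * integral {a..b} (%x. g x * h x)"
proof -
 have i: "(%x. f x * h x) integrable_on {a..b}" "(%x. g x * h x) integrable_on {a..b}"
  by (intro loc_int_D locL2_mult_loc_int assms)+
 have "integral {a..b} (%x. (p * f x + q * g x) * h x) = integral {a..b} (%x. p * (f x * h x) + q * (g x * h x))"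
  by (simp only: distrib_right mult.assoc)
 also have "... = integral {a..b} (%x. p * (f x * h x)) + integral {a..b} (%x. q * (g x * h x))"
  by (rule HK_add) (use i in \<open>auto intro: integrable_on_mult_right\<close>)
 finally show ?thesis by simp
qed

lemma LINT_mult_cong_AE:
 assumes "f \<in> L2_space S" "g \<in> L2_space S" "f' \<in> L2_space S" "g' \<in> L2_space S"
  and "AE x in lebesgue_on S. f x = f' x" "AE x in lebesgue_on S. g x = g' x"
 shows "(LINT x|lebesgue_on S. f x * g x) = (LINT x|lebesgue_on S. f' x * g' x)"
proof (rule integral_cong_AE)
 show "(%x. f x * g x) \<in> borel_measurable (lebesgue_on S)" "(%x. f' x * g' x) \<in> borel_measurable (lebesgue_on S)"
  using assms(1-4)[THEN L2_measurable] by measurable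
 show "AE x in lebesgue_on S. f x * g x = f' x * g' x" using assms(5,6) by eventually_elim simp
qed

text \<open>With G = g(eps t) and c = 1 / G^2 this is the cancellation behind the substitution: the
  coefficient of z_s (here Y) vanishes, and the term with g'' is absorbed by the linear part of the
  nonlinearity.\<close>

lemma liouville_identity:
 fixes G e :: real
 assumes "G \<noteq> 0"
 shows "e ^ 3 * h2 * Z + Y * (1 / G\<^sup>2) * (e\<^sup>2 * h1) + (- (e\<^sup>2 * h1) / G\<^sup>2 * Y +
   (e^2 * - (h2 * G ^ 3) * Z + e^2 * (A * G ^ 6) * Z3 - X) * (1 / G^2) * (e / G)) =
  - (1 / G\<^sup>2)\<^sup>2 * (e * G * X) + A * ((e * G) ^ 3 * Z3)"
proof -
 define i where "i = 1 / G"
 have i: "G * i = 1" using assms by (simp add: i_def)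
 have d: "x / G^2 = x * i^2" "x / G = x * i" for x
  by (simp_all add: i_def power_one_over divide_inverse power_inverse)
 have "e ^ 3 * h2 * Z + Y * i\<^sup>2 * (e\<^sup>2 * h1) + (- (e\<^sup>2 * h1) * i\<^sup>2 * Y +
   (e^2 * - (h2 * G ^ 3) * Z + e^2 * (A * G ^ 6) * Z3 - X) * i^2 * (e * i)) =
  e ^ 3 * h2 * Z * (1 - (G * i) ^ 3) + e ^ 3 * A * G ^ 3 * Z3 * (G * i) ^ 3 - X * e * i ^ 3"
  by algebra
 also have "... = e ^ 3 * A * G ^ 3 * Z3 - X * e * i ^ 3" by (simp add: i)
 finally have L: "e ^ 3 * h2 * Z + Y * i\<^sup>2 * (e\<^sup>2 * h1) + (- (e\<^sup>2 * h1) * i\<^sup>2 * Y +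
   (e^2 * - (h2 * G ^ 3) * Z + e^2 * (A * G ^ 6) * Z3 - X) * i^2 * (e * i)) =
  e ^ 3 * A * G ^ 3 * Z3 - X * e * i ^ 3" .
 have q: "(i^2)^2 * (e * G * X) = X * e * i ^ 3 * (G * i)" "A * ((e * G) ^ 3 * Z3) = e ^ 3 * A * G ^ 3 * Z3" by algebra+
 show ?thesis unfolding d mult_1_left unfolding L mult_minus_left[of "(i^2)^2"] q i by simp
qed

text \<open>For u = eps g(eps t) z(\<sigma>(t), x) with g = c^(-1/2) and \<sigma>' = c, the equation
  becomes z_ss = z_xx + eps^2 (- g'' g^3 z + a g^6 z^3); \<open>n_eq\<close> is its right-hand
  nonlinearity in characteristic coordinates.\<close>

locale liouville_wave = wave_flow T P0 n
 for T :: real and P0 :: "real => real" and n :: "real => real => real" +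
 fixes l :: real and c a g g1 g2 :: "real => real" and eps :: real and \<sigma> :: "real => real" and Te S :: real
 assumes l: "l > 0" and Tl: "T = 2 * l" and eps: "eps > 0" and Te: "Te >= 0"
  and g: "!!\<tau>. \<tau> >= 0 ==> g \<tau> > 0" and c: "!!\<tau>. \<tau> >= 0 ==> c \<tau> = 1 / (g \<tau>)^2"
  and g1: "!!\<tau>. \<tau> >= 0 ==> (g has_real_derivative g1 \<tau>) (at \<tau> within {0..})"
  and g2: "!!\<tau>. \<tau> >= 0 ==> (g1 has_real_derivative g2 \<tau>) (at \<tau> within {0..})"
  and \<sigma>: "!!t. t \<in> {0..Te} ==> (\<sigma> has_real_derivative c (eps * t)) (at t within {0..Te})"
   "inj_on \<sigma> {0..Te}" "!!t. t \<in> {0..Te} ==> \<sigma> t \<in> {0..S}"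
  and n_eq: "!!t y. t \<in> {0..Te} ==> n (\<sigma> t) y =
   eps^2 * (- (g2 (eps * t) * g (eps * t) ^ 3) * wfld P0 n (\<sigma> t) y + a (eps * t) * g (eps * t) ^ 6 * wfld P0 n (\<sigma> t) y ^ 3)"
begin

text \<open>\<open>k\<close> is the amplitude, \<open>k1\<close> its time derivative, and
  \<open>k2\<close> = \<open>k\<close> c the coefficient of z_s in the velocity. The field is
  written as a primitive of \<open>fx\<close> so that it belongs to H10 by \<open>H10_prim\<close>;
  on [0, l] it equals \<open>fz\<close>.\<close>

definition k where "k t = eps * g (eps * t)"
definition k1 where "k1 t = eps^2 * g1 (eps * t)"
definition k2 where "k2 t = eps / g (eps * t)"
definition u where "u t x = k t * prim (fx (\<sigma> t)) x"
definition v where "v t x = k1 t * prim (fx (\<sigma> t)) x + k2 t * ft (\<sigma> t) x"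

lemma scaled_deriv:
 assumes f: "!!\<tau>. \<tau> >= 0 ==> (f has_real_derivative f' \<tau>) (at \<tau> within {0..})" and t: "t \<in> {0..Te}"
 shows "((%t. f (eps * t)) has_real_derivative f' (eps * t) * eps) (at t within {0..Te})"
proof -
 have o: "(f has_real_derivative f' (eps * t)) (at (eps * t) within (%t. eps * t) ` {0..Te})"
 proof (rule DERIV_subset[OF f])
  show "0 <= eps * t" using t eps by simp
  show "(%t. eps * t) ` {0..Te} \<subseteq> {0..}" by (rule image_subsetI) (simp add: less_imp_le[OF eps])
 qed
 have i: "((%t. eps * t) has_real_derivative eps) (at t within {0..Te})" by (auto intro!: derivative_eq_intros)
 show ?thesis using DERIV_image_chain[where g="%t. eps * t" and f=f, OF o i] by (simp only: o_def)
qed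

lemma k_deriv:
 assumes t: "t \<in> {0..Te}"
 shows "(k has_real_derivative k1 t) (at t within {0..Te})"
  "(k1 has_real_derivative eps ^ 3 * g2 (eps * t)) (at t within {0..Te})"
  "(k2 has_real_derivative - k1 t / (g (eps * t))^2) (at t within {0..Te})"
proof -
 have p: "g (eps * t) > 0" using g t eps by simp
 show "(k has_real_derivative k1 t) (at t within {0..Te})"
  unfolding k_def[abs_def] k1_def using DERIV_cmult[OF scaled_deriv[OF g1 t], of eps]
  by (simp add: power2_eq_square mult_ac)
 show "(k1 has_real_derivative eps ^ 3 * g2 (eps * t)) (at t within {0..Te})"
  unfolding k1_def[abs_def] using DERIV_cmult[OF scaled_deriv[OF g2 t], of "eps^2"]
  by (simp add: power3_eq_cube power2_eq_square mult_ac)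
 show "(k2 has_real_derivative - k1 t / (g (eps * t))^2) (at t within {0..Te})"
  unfolding k2_def[abs_def] k1_def using p
  by (auto intro!: derivative_eq_intros scaled_deriv[OF g1 t] simp: power2_eq_square)
qed

lemma kc: "t \<in> {0..Te} ==> k t * c (eps * t) = k2 t"
 using g[of "eps * t"] c[of "eps * t"] eps by (simp add: k_def k2_def power2_eq_square)

lemma k_cont:
 assumes t: "t \<in> {0..Te}"
 shows "(k \<longlongrightarrow> k t) (at t within {0..Te})" "(k1 \<longlongrightarrow> k1 t) (at t within {0..Te})" "(k2 \<longlongrightarrow> k2 t) (at t within {0..Te})"
 using k_deriv[OF t, THEN DERIV_continuous] by (simp_all add: continuous_within)

lemma \<sigma>_filterlim:
 assumes t: "t \<in> {0..Te}"
 shows "filterlim \<sigma> (at (\<sigma> t) within {0..S}) (at t within {0..Te})"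
proof -
 have l: "(\<sigma> \<longlongrightarrow> \<sigma> t) (at t within {0..Te})"
  using DERIV_continuous[OF \<sigma>(1)[OF t]] by (simp add: continuous_within)
 have "\<forall>\<^sub>F s in at t within {0..Te}. \<sigma> s \<in> {0..S} \<and> \<sigma> s \<noteq> \<sigma> t"
 proof (rule eventually_mono[OF eventually_at_within_in])
  fix s assume "s \<in> {0..Te} \<and> s \<noteq> t"
  then show "\<sigma> s \<in> {0..S} \<and> \<sigma> s \<noteq> \<sigma> t" using \<sigma>(2) \<sigma>(3)[of s] t by (metis inj_onD)
 qed
 then show ?thesis unfolding filterlim_at using l by (rule conjI)
qed

lemma prim_fx_continuous:
 "((%s. L2_norm {0..l} (%x. prim (fx s) x - prim (fx t) x)) \<longlongrightarrow> 0) (at t within I)"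
proof (rule tendsto_of_norm_bound)
 show "((%s. l * L2_norm {0..l} (%x. fx s x - fx t x)) \<longlongrightarrow> 0) (at t within I)"
  by (rule tendsto_mult_right_zero[OF field_continuous(1)]) (use l in simp)
 show "\<forall>\<^sub>F s in at t within I. \<bar>L2_norm {0..l} (%x. prim (fx s) x - prim (fx t) x)\<bar> <= l * L2_norm {0..l} (%x. fx s x - fx t x)"
 proof (intro always_eventually allI)
  fix s
  have d: "locL2 (%x. fx s x - fx t x)" by (intro locL2_diff fx_locL2)
  have "(%x. prim (fx s) x - prim (fx t) x) = prim (%x. fx s x - fx t x)"
   using prim_add[OF locL2_loc_int[OF d] locL2_loc_int[OF fx_locL2[of t]]] by (simp add: fun_eq_iff)
  then show "\<bar>L2_norm {0..l} (%x. prim (fx s) x - prim (fx t) x)\<bar> <= l * L2_norm {0..l} (%x. fx s x - fx t x)"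
   using L2_norm_prim_le[OF d, of l] l by simp
 qed
qed

lemma scaled_continuous:
 assumes F: "((%s. L2_norm {0..l} (%x. F s x - F (\<sigma> t) x)) \<longlongrightarrow> 0) (at (\<sigma> t) within {0..S})"
  and FL: "!!s. locL2 (F s)" and h: "(h \<longlongrightarrow> h t) (at t within {0..Te})" and t: "t \<in> {0..Te}"
 shows "((%s. L2_norm {0..l} (%x. h s * F (\<sigma> s) x - h t * F (\<sigma> t) x)) \<longlongrightarrow> 0) (at t within {0..Te})"
proof -
 have 1: "((%s. L2_norm {0..l} (%x. h s * (F (\<sigma> s) x - F (\<sigma> t) x))) \<longlongrightarrow> 0) (at t within {0..Te})"
  by (rule L2_cmult_limit[OF filterlim_compose[OF F \<sigma>_filterlim[OF t]] h])
 have "((%s. \<bar>h s - h t\<bar> * L2_norm {0..l} (F (\<sigma> t))) \<longlongrightarrow> \<bar>h t - h t\<bar> * L2_norm {0..l} (F (\<sigma> t))) (at t within {0..Te})"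
  by (intro tendsto_intros h)
 then have 2: "((%s. L2_norm {0..l} (%x. (h s - h t) * F (\<sigma> t) x)) \<longlongrightarrow> 0) (at t within {0..Te})"
  by (simp add: L2_norm_cmult)
 have "((%s. L2_norm {0..l} (%x. h s * (F (\<sigma> s) x - F (\<sigma> t) x) + (h s - h t) * F (\<sigma> t) x)) \<longlongrightarrow> 0) (at t within {0..Te})"
  by (rule L2_add_limit[OF 1 2]) (intro always_eventually allI conjI locL2_D locL2_cmult locL2_diff FL)
 moreover have "(%x. h s * (F (\<sigma> s) x - F (\<sigma> t) x) + (h s - h t) * F (\<sigma> t) x) = (%x. h s * F (\<sigma> s) x - h t * F (\<sigma> t) x)" for s
  by (simp add: fun_eq_iff right_diff_distrib left_diff_distrib)
 ultimately show ?thesis by simp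
qed

lemma u_eq: "u t = prim (%x. k t * fx (\<sigma> t) x)"
 by (simp add: fun_eq_iff u_def prim_cmult)

lemma kfx_locL2: "locL2 (%x. k t * fx (\<sigma> t) x)"
 by (rule locL2_cmult[OF fx_locL2])

lemma u_locL2: "locL2 (u t)"
 unfolding u_eq by (rule prim_locL2[OF kfx_locL2])

lemma v_locL2: "locL2 (v t)"
 unfolding v_def[abs_def] by (intro locL2_add locL2_cmult prim_locL2 fx_locL2 ft_locL2)

lemma u_weak: "has_weak_derivative {0<..<l} (u t) (%x. k t * fx (\<sigma> t) x)"
 unfolding u_eq by (rule prim_weak_derivative[OF kfx_locL2 l])

lemma u_H10: "t \<in> {0..Te} ==> u t \<in> H10_space {0<..<l}"
 unfolding u_eq using \<sigma>(3)[of t] by (intro H10_prim[OF kfx_locL2 _ l]) (simp add: fx_mean[OF Tl])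

lemma u_H1_continuous:
 assumes t: "t \<in> {0..Te}"
 shows "((%s. H1_norm {0<..<l} (%x. u s x - u t x)) \<longlongrightarrow> 0) (at t within {0..Te})"
proof (rule tendsto_of_norm_bound)
 show "((%s. (l + 1) * L2_norm {0..l} (%x. k s * fx (\<sigma> s) x - k t * fx (\<sigma> t) x)) \<longlongrightarrow> 0) (at t within {0..Te})"
  by (rule tendsto_mult_right_zero[OF scaled_continuous[OF field_continuous(1) fx_locL2 k_cont(1)[OF t] t]]) (use l in simp)
 show "\<forall>\<^sub>F s in at t within {0..Te}. \<bar>H1_norm {0<..<l} (%x. u s x - u t x)\<bar> \<le>
   (l + 1) * L2_norm {0..l} (%x. k s * fx (\<sigma> s) x - k t * fx (\<sigma> t) x)"
 proof (intro always_eventually allI)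
  fix s
  have d: "locL2 (%x. k s * fx (\<sigma> s) x - k t * fx (\<sigma> t) x)" by (intro locL2_diff kfx_locL2)
  have e: "(%x. u s x - u t x) = prim (%x. k s * fx (\<sigma> s) x - k t * fx (\<sigma> t) x)"
   unfolding u_eq using prim_add[OF locL2_loc_int[OF d] locL2_loc_int[OF kfx_locL2[of t]]] by (simp add: fun_eq_iff)
  show "\<bar>H1_norm {0<..<l} (%x. u s x - u t x)\<bar> <= (l + 1) * L2_norm {0..l} (%x. k s * fx (\<sigma> s) x - k t * fx (\<sigma> t) x)"
   unfolding e using H1_norm_prim_le[OF d l] by (simp add: H1_norm_def)
 qed
qed

lemma v_L2_continuous:
 assumes t: "t \<in> {0..Te}"
 shows "((%s. L2_norm {0<..<l} (%x. v s x - v t x)) \<longlongrightarrow> 0) (at t within {0..Te})"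
proof -
 have "((%s. L2_norm {0..l} (%x. (k1 s * prim (fx (\<sigma> s)) x - k1 t * prim (fx (\<sigma> t)) x) + (k2 s * ft (\<sigma> s) x - k2 t * ft (\<sigma> t) x))) \<longlongrightarrow> 0) (at t within {0..Te})"
 proof (rule L2_add_limit)
  show "((%s. L2_norm {0..l} (%x. k1 s * prim (fx (\<sigma> s)) x - k1 t * prim (fx (\<sigma> t)) x)) \<longlongrightarrow> 0) (at t within {0..Te})"
   by (rule scaled_continuous[OF prim_fx_continuous prim_locL2[OF fx_locL2] k_cont(2)[OF t] t])
  show "((%s. L2_norm {0..l} (%x. k2 s * ft (\<sigma> s) x - k2 t * ft (\<sigma> t) x)) \<longlongrightarrow> 0) (at t within {0..Te})"
   by (rule scaled_continuous[OF field_continuous(2) ft_locL2 k_cont(3)[OF t] t]) (use l in simp)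
 qed (intro always_eventually allI conjI locL2_D locL2_cmult locL2_diff prim_locL2 fx_locL2 ft_locL2)
 moreover have "(%x. (k1 s * prim (fx (\<sigma> s)) x - k1 t * prim (fx (\<sigma> t)) x) + (k2 s * ft (\<sigma> s) x - k2 t * ft (\<sigma> t) x)) =
   (%x. v s x - v t x)" for s by (simp add: fun_eq_iff v_def)
 moreover have "L2_norm {0<..<l} (%x. v s x - v t x) = L2_norm {0..l} (%x. v s x - v t x)" for s
  by (rule locL2_Ioo(2)) (intro locL2_diff v_locL2)
 ultimately show ?thesis by simp
qed

lemma fz_continuous: "continuous_on UNIV (fz s)"
proof -
 have Uc: "continuous_on UNIV (U s)" by (rule continuous_on_snd_arg[OF U_cont])
 have "continuous_on UNIV (%x. U s (s + x))" "continuous_on UNIV (%x. U s (2 * s - (s + x)))"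
  by (rule continuous_on_compose2[OF Uc]; auto intro: continuous_intros)+
 then show ?thesis
  unfolding fz_def[abs_def] wfld_def by (intro continuous_on_divide continuous_on_diff continuous_on_const) simp_all
qed

lemma fz_locL2: "locL2 (fz s)"
 by (rule locL2_continuous[OF fz_continuous])

lemma u_L2_derivative:
 assumes t: "t \<in> {0..Te}"
 shows "((%s. L2_norm {0<..<l} (%x. (u s x - u t x) / (s - t) - v t x)) \<longlongrightarrow> 0) (at t within {0..Te})"
proof -
 have d: "has_L2_derivative {0..l} fz (ft (\<sigma> t)) (\<sigma> t) {0..}"
  by (rule fz_L2_deriv) (use l \<sigma>(3)[OF t] in auto)
 have "has_L2_derivative {0..l} (%s x. k s * fz (\<sigma> s) x) (%x. k1 t * fz (\<sigma> t) x + k t * c (eps * t) * ft (\<sigma> t) x) t {0..Te}"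
  by (rule L2_deriv_scale_comp[OF d _ _ k_deriv(1)[OF t] \<sigma>(1)[OF t] \<sigma>(2) _ t])
   (use \<sigma>(3) in \<open>auto intro: locL2_D fz_locL2 ft_locL2\<close>)
 then have "((%s. L2_norm {0..l} (%x. (k s * fz (\<sigma> s) x - k t * fz (\<sigma> t) x) / (s - t) - (k1 t * fz (\<sigma> t) x + k2 t * ft (\<sigma> t) x))) \<longlongrightarrow> 0) (at t within {0..Te})"
  by (simp only: has_L2_derivative_def kc[OF t])
 moreover have "L2_norm {0..l} (%x. (k s * fz (\<sigma> s) x - k t * fz (\<sigma> t) x) / (s - t) - (k1 t * fz (\<sigma> t) x + k2 t * ft (\<sigma> t) x)) =
   L2_norm {0..l} (%x. (u s x - u t x) / (s - t) - v t x)" for s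
  by (rule L2_norm_cong_space) (simp add: u_def v_def fz_prim)
 moreover have "L2_norm {0<..<l} (%x. (u s x - u t x) / (s - t) - v t x) = L2_norm {0..l} (%x. (u s x - u t x) / (s - t) - v t x)" for s
 proof -
  have "locL2 (%x. (1 / (s - t)) * (u s x - u t x) - v t x)" by (intro locL2_diff locL2_cmult u_locL2 v_locL2)
  then show ?thesis by (intro locL2_Ioo(2)) simp
 qed
 ultimately show ?thesis by simp
qed

text \<open>Testing reduces to pairing with prim \<psi>, where \<psi> is the weak derivative of
  \<phi>. The pairing with v is k1 Z + k2 Y; \<open>fz_L2_deriv\<close> differentiates Z,
  \<open>ft_pair_deriv\<close> differentiates Y, and \<open>liouville_identity\<close> collects the
  terms.\<close>

lemma weak_equation:
 assumes t: "t \<in> {0..Te}" and \<phi>: "\<phi> \<in> H10_space {0<..<l}"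
 shows "((%s. LINT x|lebesgue_on {0<..<l}. v s x * \<phi> x) has_real_derivative
   (- (c (eps * t))\<^sup>2 * (LINT x|lebesgue_on {0<..<l}. weak_derivative {0<..<l} (u t) x * weak_derivative {0<..<l} \<phi> x) +
    a (eps * t) * (LINT x|lebesgue_on {0<..<l}. (u t x) ^ 3 * \<phi> x))) (at t within {0..Te})"
proof -
 obtain \<psi> where \<psi>: "locL2 \<psi>" "has_weak_derivative {0<..<l} \<phi> \<psi>" "integral {0..l} \<psi> = 0"
  "AE x in lebesgue_on {0<..<l}. \<phi> x = prim \<psi> x" "!!x. x \<notin> {0<..<l} ==> \<psi> x = 0"
  using H10_elim[OF \<phi> l] by metis
 have z: "\<psi> x = 0 \<and> prim \<psi> x = 0" if "x \<notin> {0<..<l}" for x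
  using prim_vanish[OF locL2_loc_int[OF \<psi>(1)] \<psi>(3) \<psi>(5) that l] \<psi>(5)[OF that] by simp
 have pL: "locL2 (prim \<psi>)" by (rule prim_locL2[OF \<psi>(1)])
 have \<phi>L: "\<phi> \<in> L2_space {0<..<l}" using \<phi> by (simp add: H10_space_def H1_space_def)
 have test: "(LINT x|lebesgue_on {0<..<l}. f x * \<phi> x) = integral {0..l} (%x. f x * prim \<psi> x)" if f: "locL2 f" for f
 proof -
  have "(LINT x|lebesgue_on {0<..<l}. f x * \<phi> x) = (LINT x|lebesgue_on {0<..<l}. f x * prim \<psi> x)"
   by (rule LINT_mult_cong_AE[OF locL2_Ioo(1)[OF f] \<phi>L locL2_Ioo(1)[OF f] locL2_Ioo(1)[OF pL] _ \<psi>(4)]) simp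
  then show ?thesis by (simp add: LINT_mult_Ioo[OF f pL])
 qed
 define Z where "Z s = integral {0..l} (%x. fz s x * prim \<psi> x)" for s
 define Y where "Y s = integral {0..l} (%x. ft s x * prim \<psi> x)" for s
 define X where "X = integral {0..l} (%x. fx (\<sigma> t) x * \<psi> x)"
 define Z3 where "Z3 = integral {0..l} (%x. fz (\<sigma> t) x ^ 3 * prim \<psi> x)"
 define N where "N = integral {0..l} (%x. n (\<sigma> t) (\<sigma> t + x) * prim \<psi> x)"
 let ?g = "g (eps * t)"
 have gp: "?g > 0" using g t eps by simp
 have cg: "c (eps * t) = 1 / ?g^2" using c t eps by simp
 have pz: "integral {0..l} (%x. prim (fx s) x * h x) = integral {0..l} (%x. fz s x * h x)" for s h
  by (rule HK_cong) (simp add: fz_prim)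
 have vtest: "(LINT x|lebesgue_on {0<..<l}. v s x * \<phi> x) = k1 s * Z (\<sigma> s) + k2 s * Y (\<sigma> s)" for s
  unfolding test[OF v_locL2] unfolding v_def
  by (simp add: integral_mult_add[OF prim_locL2[OF fx_locL2] ft_locL2 pL] pz Z_def Y_def)
 have \<sigma>t: "\<sigma> t \<in> {0..S}" by (rule \<sigma>(3)[OF t])
 have fzL: "fz s \<in> L2_space {0..l}" for s by (rule locL2_D[OF fz_locL2])
 have "((%s. LINT x|lebesgue_on {0..l}. fz s x * prim \<psi> x) has_real_derivative
   (LINT x|lebesgue_on {0..l}. ft (\<sigma> t) x * prim \<psi> x) + (LINT x|lebesgue_on {0..l}. fz (\<sigma> t) x * 0)) (at (\<sigma> t) within {0..})"
  by (rule L2_deriv_inner[OF fz_L2_deriv fzL _ L2_deriv_const])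
   (use l \<sigma>t in \<open>auto intro: locL2_D ft_locL2 pL L2_zero\<close>)
 then have "(Z has_real_derivative Y (\<sigma> t)) (at (\<sigma> t) within {0..})"
  by (simp add: LINT_mult_Icc[OF fz_locL2 pL] LINT_mult_Icc[OF ft_locL2 pL] Z_def[abs_def] Y_def)
 then have dZ: "(Z has_real_derivative Y (\<sigma> t)) (at (\<sigma> t) within \<sigma> ` {0..Te})"
  by (rule DERIV_subset) (use \<sigma>(3) in auto)
 have "(Y has_real_derivative N - X) (at (\<sigma> t) within {0..S})"
  using ft_pair_deriv[OF \<psi>(1) z l \<sigma>t] by (simp add: Y_def[abs_def] N_def X_def)
 then have dY: "(Y has_real_derivative N - X) (at (\<sigma> t) within \<sigma> ` {0..Te})"
  by (rule DERIV_subset) (use \<sigma>(3) in auto)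
 note dZ' = DERIV_image_chain[where g=\<sigma> and f=Z, OF dZ \<sigma>(1)[OF t], unfolded o_def]
 note dY' = DERIV_image_chain[where g=\<sigma> and f=Y, OF dY \<sigma>(1)[OF t], unfolded o_def]
 note D = DERIV_add[OF DERIV_mult[OF k_deriv(2)[OF t] dZ'] DERIV_mult[OF k_deriv(3)[OF t] dY']]
 have z3L: "locL2 (%x. fz (\<sigma> t) x ^ 3)"
  by (rule locL2_continuous[OF continuous_on_power[OF fz_continuous]])
 have "N = integral {0..l} (%x. (eps^2 * - (g2 (eps * t) * ?g ^ 3) * fz (\<sigma> t) x + eps^2 * (a (eps * t) * ?g ^ 6) * fz (\<sigma> t) x ^ 3) * prim \<psi> x)"
  unfolding N_def n_eq[OF t] fz_def by (simp only: distrib_left mult.assoc)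
 then have N: "N = eps^2 * - (g2 (eps * t) * ?g ^ 3) * Z (\<sigma> t) + eps^2 * (a (eps * t) * ?g ^ 6) * Z3"
  by (simp only: integral_mult_add[OF fz_locL2 z3L pL] Z_def Z3_def)
 have wL: "(%x. k t * fx (\<sigma> t) x) \<in> L2_space {0<..<l}" by (rule locL2_Ioo(1)[OF kfx_locL2])
 have R1: "(LINT x|lebesgue_on {0<..<l}. weak_derivative {0<..<l} (u t) x * weak_derivative {0<..<l} \<phi> x) = k t * X"
 proof -
  have "(LINT x|lebesgue_on {0<..<l}. weak_derivative {0<..<l} (u t) x * weak_derivative {0<..<l} \<phi> x) =
    (LINT x|lebesgue_on {0<..<l}. (k t * fx (\<sigma> t) x) * \<psi> x)"
   using weak_derivative_works[OF u_weak[of t] l] weak_derivative_works[OF \<psi>(2) l]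
   by (intro LINT_mult_cong_AE wL locL2_Ioo(1)[OF \<psi>(1)]) (simp_all add: has_weak_derivative_def)
  then show ?thesis by (simp add: LINT_mult_Ioo[OF fx_locL2 \<psi>(1)] X_def mult.assoc)
 qed
 have R2: "(LINT x|lebesgue_on {0<..<l}. (u t x) ^ 3 * \<phi> x) = k t ^ 3 * Z3"
 proof -
  have uc: "continuous_on UNIV (u t)" unfolding u_eq by (rule prim_continuous[OF locL2_loc_int[OF kfx_locL2]])
  have "locL2 (%x. (u t x) ^ 3)" by (rule locL2_continuous) (intro continuous_intros uc)
  then have "(LINT x|lebesgue_on {0<..<l}. (u t x) ^ 3 * \<phi> x) = integral {0..l} (%x. (u t x) ^ 3 * prim \<psi> x)" by (rule test)
  also have "... = integral {0..l} (%x. k t ^ 3 * (fz (\<sigma> t) x ^ 3 * prim \<psi> x))"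
   by (rule HK_cong) (simp add: u_def fz_prim power_mult_distrib)
  finally show ?thesis by (simp add: Z3_def)
 qed
 show ?thesis
  unfolding vtest R1 R2
 proof (rule DERIV_cong[OF D])
  show "eps ^ 3 * g2 (eps * t) * Z (\<sigma> t) + Y (\<sigma> t) * c (eps * t) * k1 t +
    (- k1 t / ?g^2 * Y (\<sigma> t) + (N - X) * c (eps * t) * k2 t) =
    - (c (eps * t))\<^sup>2 * (k t * X) + a (eps * t) * (k t ^ 3 * Z3)"
   unfolding N cg k_def k1_def k2_def by (rule liouville_identity) (use gp in simp)
 qed
qed

lemma solution:
 assumes "AE x in lebesgue_on {0<..<l}. u 0 x = u0 x" "AE x in lebesgue_on {0<..<l}. v 0 x = u1 x"
 shows "wave_solution {0<..<l} c a eps Te u0 u1 u v"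
 unfolding wave_solution_def
 using assms u_H10 locL2_Ioo(1)[OF v_locL2] u_H1_continuous v_L2_continuous u_L2_derivative weak_equation by simp

text \<open>Here g v = eps \<open>ft\<close> + w with w = eps^2 g g' z. The leading parts give eps^2
  times the field energy, hence a quarter of the squared profile norm. The cross term is O(eps^3)
  and decides the error; the square of w is O(eps^4).\<close>

lemma invariant_estimate:
 assumes t: "t \<in> {0..Te}" and e1: "eps <= 1" and Gb: "\<bar>g (eps * t) * g1 (eps * t)\<bar> <= Gb"
  and K: "L2_norm {0..T} (pf (\<sigma> t)) <= K"
 shows "\<bar>adiabatic_invariant {0<..<l} c eps u v t - eps^2 * (L2_norm {0..T} (pf (\<sigma> t)))^2 / 4\<bar> \<le>
  (Gb * l + Gb^2 * l^2) * K^2 * eps ^ 3"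
proof -
 let ?g = "g (eps * t)" and ?N = "L2_norm {0..l}"
 have gp: "?g > 0" using g t eps by simp
 have cg: "c (eps * t) = 1 / ?g^2" using c t eps by simp
 have en: "(?N (fx (\<sigma> t)))^2 + (?N (ft (\<sigma> t)))^2 = (L2_norm {0..T} (pf (\<sigma> t)))^2 / 2"
  by (rule field_energy[OF Tl]) (use \<sigma>(3)[OF t] in simp)
 have K0: "K >= 0" by (rule order_trans[OF L2_norm_nonneg K])
 have K2: "(L2_norm {0..T} (pf (\<sigma> t)))^2 <= K^2" by (rule power_mono[OF K]) simp
 have bnd: "x <= K" if "x^2 + y^2 = (L2_norm {0..T} (pf (\<sigma> t)))^2 / 2" for x y
 proof (rule power2_le_imp_le[OF _ K0])
  show "x^2 <= K^2" using that K2 zero_le_power2[of y] zero_le_power2[of K] by linarith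
 qed
 have fxK: "?N (fx (\<sigma> t)) <= K" by (rule bnd[OF en])
 have ftK: "?N (ft (\<sigma> t)) <= K" by (rule bnd[OF trans[OF add.commute en]])
 define w where "w = (%x. eps^2 * (?g * g1 (eps * t)) * prim (fx (\<sigma> t)) x)"
 have wL: "locL2 w" unfolding w_def by (intro locL2_cmult prim_locL2 fx_locL2)
 have Gb0: "Gb >= 0" using Gb by linarith
 have wn: "?N w <= eps^2 * (Gb * l * K)"
 proof -
  have "?N w = eps^2 * (\<bar>?g * g1 (eps * t)\<bar> * ?N (prim (fx (\<sigma> t))))" unfolding w_def L2_norm_cmult by (simp add: abs_mult)
  also have "... <= eps^2 * (Gb * (l * K))"
  proof (intro mult_left_mono mult_mono Gb)
   have "?N (prim (fx (\<sigma> t))) <= l * ?N (fx (\<sigma> t))" by (rule L2_norm_prim_le[OF fx_locL2]) (use l in simp)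
   also have "... <= l * K" using fxK l by (intro mult_left_mono) auto
   finally show "?N (prim (fx (\<sigma> t))) <= l * K" .
  qed (use Gb0 in auto)
  finally show ?thesis by (simp add: mult.assoc)
 qed
 have ftc: "locL2 (%x. eps * ft (\<sigma> t) x)" by (intro locL2_cmult ft_locL2)
 have gv: "?g * L2_norm {0<..<l} (v t) = ?N (%x. w x + eps * ft (\<sigma> t) x)"
 proof -
  have "?g * L2_norm {0<..<l} (v t) = ?N (%x. ?g * v t x)"
   using gp by (simp add: locL2_Ioo(2)[OF v_locL2] L2_norm_cmult)
  also have "(%x. ?g * v t x) = (%x. w x + eps * ft (\<sigma> t) x)"
   using gp by (simp add: fun_eq_iff w_def v_def k1_def k2_def field_simps)
  finally show ?thesis .
 qed
 have ux: "L2_norm {0<..<l} (weak_derivative {0<..<l} (u t)) = eps * ?g * ?N (fx (\<sigma> t))"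
  using gp eps by (simp add: weak_derivative_works(3)[OF u_weak l] locL2_Ioo(2)[OF fx_locL2] L2_norm_cmult k_def)
 have inv: "adiabatic_invariant {0<..<l} c eps u v t =
   ((?g * L2_norm {0<..<l} (v t))^2 + eps^2 * (?N (fx (\<sigma> t)))^2) / 2"
  unfolding adiabatic_invariant_def ux cg using gp by (simp add: field_simps power2_eq_square)
 have sq: "(?N (%x. w x + eps * ft (\<sigma> t) x))^2 =
   (?N w)^2 + 2 * (LINT x|lebesgue_on {0..l}. w x * (eps * ft (\<sigma> t) x)) + eps^2 * (?N (ft (\<sigma> t)))^2"
  using L2_norm_add_sq[OF locL2_D[OF wL] locL2_D[OF ftc], of 0 l]
  by (simp add: L2_norm_cmult power_mult_distrib)
 have ip: "\<bar>LINT x|lebesgue_on {0..l}. w x * (eps * ft (\<sigma> t) x)\<bar> <= eps ^ 3 * (Gb * l * K^2)"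
 proof -
  have "\<bar>LINT x|lebesgue_on {0..l}. w x * (eps * ft (\<sigma> t) x)\<bar> <= ?N w * (eps * ?N (ft (\<sigma> t)))"
   using L2_cauchy_schwarz[OF locL2_D[OF wL] locL2_D[OF ftc], of 0 l] eps by (simp add: L2_norm_cmult)
  also have "... <= (eps^2 * (Gb * l * K)) * (eps * K)"
   by (intro mult_mono wn ftK) (use eps K0 Gb0 l in auto)
  finally show ?thesis by (simp add: power3_eq_cube power2_eq_square mult_ac)
 qed
 have wsq: "(?N w)^2 <= eps ^ 3 * (Gb^2 * l^2 * K^2)"
 proof -
  have "(?N w)^2 <= (eps^2 * (Gb * l * K))^2" by (rule power_mono[OF wn]) simp
  also have "... = eps ^ 4 * (Gb^2 * l^2 * K^2)" by (simp add: power_mult_distrib flip: power_mult)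
  also have "... <= eps ^ 3 * (Gb^2 * l^2 * K^2)"
   by (intro mult_right_mono power_decreasing) (use eps e1 in auto)
  finally show ?thesis .
 qed
 have fin: "\<bar>(w2 + 2 * ww + e * f + e * h) / 2 - e * p / 4\<bar> <= A + B"
  if "h + f = p / 2" "\<bar>ww\<bar> <= A" "w2 <= B" "w2 >= 0" for w2 ww e f h p A B :: real
 proof -
  have "e * f + e * h = e * p / 2" using that(1) by (metis add.commute distrib_left times_divide_eq_right)
  then have "(w2 + 2 * ww + e * f + e * h) / 2 - e * p / 4 = w2 / 2 + ww" by (simp add: field_simps)
  then show ?thesis using that(2-4) by linarith
 qed
 have "\<bar>adiabatic_invariant {0<..<l} c eps u v t - eps^2 * (L2_norm {0..T} (pf (\<sigma> t)))^2 / 4\<bar> \<le>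
   eps ^ 3 * (Gb * l * K^2) + eps ^ 3 * (Gb^2 * l^2 * K^2)"
  unfolding inv gv sq by (rule fin[OF en ip wsq]) simp
 also have "... = (Gb * l + Gb^2 * l^2) * K^2 * eps ^ 3" by (simp add: distrib_left distrib_right mult_ac)
 finally show ?thesis .
qed

end

lemma coeff_alg_power: "f \<in> coeff_alg c ==> (%\<tau>. f \<tau> ^ m) \<in> coeff_alg c"
proof (induction m)
 case 0
 show ?case using coeff_alg.base[OF smooth_bounded_const[of 1]] by simp
next
 case (Suc m)
 then show ?case by (auto intro: coeff_alg.mult)
qed

lemma smooth_bounded_continuous: "smooth_bounded f ==> continuous_on {0..} f"
 using smooth_bounded_deriv[of f] by (auto simp: continuous_on_eq_continuous_within intro: DERIV_continuous)

text \<open>One surplus power of eps absorbs the upper bound c1 of the wave speed when t is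
  converted into s.\<close>

lemma power_less_bound:
 fixes eps c1 :: real
 assumes "0 < eps" "eps <= 1 / c1" "c1 > 0"
 shows "c1 * (1 / eps ^ N) <= 1 / eps ^ (N + 1)"
proof -
 have "c1 * eps <= 1" using assms by (simp add: field_simps)
 then have "(c1 * eps) * (1 / eps ^ (N + 1)) <= 1 * (1 / eps ^ (N + 1))"
  by (rule mult_right_mono) (use assms in simp)
 moreover have "(c1 * eps) * (1 / eps ^ (N + 1)) = c1 * (1 / eps ^ N)" using assms by simp
 ultimately show ?thesis by simp
qed

theorem theorem1:
  fixes l c0 C0 :: real and c a :: "real \<Rightarrow> real" and Q :: "real set" and N :: nat
  assumes "l > 0" and "Q = {0<..<l}"
    and "smooth_bounded c" and "smooth_bounded a"
    and "c0 > 0" and "\<forall>\<tau>\<ge>0. c \<tau> \<ge> c0"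
    and "N \<ge> 1"
  shows "\<exists>\<epsilon>\<^sub>N>0. \<exists>C\<^sub>N. \<forall>\<epsilon>. 0 < \<epsilon> \<and> \<epsilon> \<le> \<epsilon>\<^sub>N \<longrightarrow>
    (\<forall>u0\<in>H10_space Q. \<forall>u1\<in>L2_space Q.
       L2_norm Q (weak_derivative Q u0) \<le> C0 * \<epsilon> \<and> L2_norm Q u1 \<le> C0 * \<epsilon> \<longrightarrow>
       (\<exists>u v. wave_solution Q c a \<epsilon> (1 / \<epsilon> ^ N) u0 u1 u v \<and>
          (\<forall>t\<in>{0..1 / \<epsilon> ^ N}.
             \<bar>adiabatic_invariant Q c \<epsilon> u v t - adiabatic_invariant Q c \<epsilon> u v 0\<bar> \<le> C\<^sub>N * \<epsilon> ^ 3)))"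
proof -
 note l = assms(1) and Q = assms(2) and c = assms(3) and a = assms(4) and c0 = assms(5)
 have cc0: "!!\<tau>. \<tau> >= 0 ==> c \<tau> >= c0" using assms(6) by blast
 define g where "g = (%\<tau>. c \<tau> powr (- 1 / 2))"
 have gA: "g \<in> coeff_alg c" unfolding g_def by (rule coeff_alg.powr)
 obtain g1 where g1: "g1 \<in> coeff_alg c" "\<forall>\<tau>\<ge>0. (g has_real_derivative g1 \<tau>) (at \<tau> within {0..})"
  using coeff_deriv[OF c c0 cc0 gA] by blast
 obtain g2 where g2: "g2 \<in> coeff_alg c" "\<forall>\<tau>\<ge>0. (g1 has_real_derivative g2 \<tau>) (at \<tau> within {0..})"
  using coeff_deriv[OF c c0 cc0 g1(1)] by blast
 have gpos: "g \<tau> > 0" and cg: "c \<tau> = 1 / (g \<tau>)^2" if "\<tau> >= 0" for \<tau>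
 proof -
  have p: "c \<tau> > 0" using cc0[OF that] c0 by linarith
  then show "g \<tau> > 0" by (simp add: g_def)
  have "(g \<tau>)^2 = c \<tau> powr (- 1)" unfolding g_def power2_eq_square by (simp flip: powr_add)
  then show "c \<tau> = 1 / (g \<tau>)^2" using p by (simp add: powr_minus inverse_eq_divide)
 qed
 \<comment> \<open>The coefficients of z^3 and z after the substitution, divided by eps^2, as
   functions of the slow time.\<close>
 define \<alpha> where "\<alpha> = (%\<tau>. a \<tau> * g \<tau> ^ 6)"
 define \<beta> where "\<beta> = (%\<tau>. (- 1) * (g2 \<tau> * g \<tau> ^ 3))"
 have AB: "\<alpha> \<in> coeff_alg c" "\<beta> \<in> coeff_alg c" unfolding \<alpha>_def \<beta>_def
  by (intro coeff_alg.mult coeff_alg_cmult coeff_alg_power coeff_alg.base a gA g2(1))+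
 obtain FA KA where FA: "FA 0 = \<alpha>"
   "!!i \<tau>. \<tau> >= 0 ==> (FA i has_real_derivative FA (Suc i) \<tau> * c \<tau>) (at \<tau> within {0..}) \<and> \<bar>FA i \<tau>\<bar> <= KA i"
  using coeff_chain[OF c c0 cc0 AB(1)] by blast
 obtain FB KB where FB: "FB 0 = \<beta>"
   "!!i \<tau>. \<tau> >= 0 ==> (FB i has_real_derivative FB (Suc i) \<tau> * c \<tau>) (at \<tau> within {0..}) \<and> \<bar>FB i \<tau>\<bar> <= KB i"
  using coeff_chain[OF c c0 cc0 AB(2)] by blast
 obtain Gb where Gb: "\<forall>\<tau>\<ge>0. \<bar>g \<tau> * g1 \<tau>\<bar> <= Gb"
  using coeff_bounded[OF c c0 cc0 coeff_alg.mult[OF gA g1(1)]] by blast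
 obtain c1' where c1': "\<forall>\<tau>\<ge>0. \<bar>c \<tau>\<bar> <= c1'" using smooth_bounded_bound[OF c] by blast
 define c1 where "c1 = max c1' 1"
 have c1: "c1 > 0" "!!\<tau>. \<tau> >= 0 ==> c \<tau> <= c1" using c1' by (auto simp: c1_def max_def)
 \<comment> \<open>The bound of \<open>initial_profile\<close> with the norms of F and G below
   inserted. The data are O(eps) and u carries a factor eps, so the bound does not depend on
   eps.\<close>
 define Eb where "Eb = 2 * (\<bar>C0\<bar> / g 0 + g 0 * (\<bar>C0\<bar> + \<bar>g1 0\<bar> * (l * (\<bar>C0\<bar> / g 0))))"
 have g0: "g 0 > 0" using gpos by simp
 have Eb: "Eb >= 0" unfolding Eb_def using g0 l by (intro mult_nonneg_nonneg add_nonneg_nonneg) auto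
 have T: "2 * l > 0" using l by simp
 obtain e0 C K where e0: "0 < e0" "e0 <= 1" and C: "C >= 0"
  and LT: "!!\<epsilon> DA DB P0. 0 < \<epsilon> ==> \<epsilon> <= e0 ==> der_chain \<epsilon> KA DA ==> der_chain \<epsilon> KB DB ==> locL2 P0 ==>
   periodic (2 * l) P0 ==> integral {0..2 * l} P0 = 0 ==> L2_norm {0..2 * l} P0 <= Eb ==>
   \<exists>n. wave_data (2 * l) K KA KB \<epsilon> DA DB P0 n (1 / \<epsilon> ^ (N + 1)) \<and>
    (\<forall>s\<in>{0..1 / \<epsilon> ^ (N + 1)}. \<bar>(L2_norm {0..2 * l} (%z. P0 z + tint n s z))^2 - (L2_norm {0..2 * l} P0)^2\<bar> <= C * \<epsilon>^2)"
  using wave_long_time[OF T assms(7) Eb, of KA KB] by (elim exE conjE) blast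
 define C1 where "C1 = (Gb * l + Gb^2 * l^2) * K^2"
 \<comment> \<open>The second entry ensures \<sigma>(eps^-N) <= eps^-(N+1), the length of the
   interval supplied by \<open>wave_long_time\<close> with M = N.\<close>
 define eN where "eN = min e0 (1 / c1)"
 have eN: "eN > 0" using e0 c1 by (simp add: eN_def)
 show ?thesis
 proof (rule exI[of _ eN], rule conjI[OF eN], rule exI[of _ "C / 4 + 2 * C1"], intro allI impI ballI)
  fix \<epsilon> u0 u1 assume \<epsilon>: "0 < \<epsilon> \<and> \<epsilon> <= eN" and u0: "u0 \<in> H10_space Q" and u1: "u1 \<in> L2_space Q"
   and ini: "L2_norm Q (weak_derivative Q u0) <= C0 * \<epsilon> \<and> L2_norm Q u1 <= C0 * \<epsilon>"
  have e: "\<epsilon> > 0" "\<epsilon> <= e0" "\<epsilon> <= 1 / c1" "\<epsilon> <= 1" using \<epsilon> e0 by (auto simp: eN_def)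
  define Te where "Te = 1 / \<epsilon> ^ N"
  define S where "S = 1 / \<epsilon> ^ (N + 1)"
  have Te: "Te >= 0" using e by (simp add: Te_def)
  obtain \<psi> where \<psi>: "locL2 \<psi>" "has_weak_derivative {0<..<l} u0 \<psi>" "integral {0..l} \<psi> = 0"
   "AE x in lebesgue_on {0<..<l}. u0 x = prim \<psi> x" "!!x. x \<notin> {0<..<l} ==> \<psi> x = 0"
   using H10_elim[OF u0[unfolded Q] l] by metis
  have u1z: "locL2 (zext l u1)" by (rule zext_locL2[OF u1[unfolded Q]])
  \<comment> \<open>F and G are z_x and z_s at time 0, obtained by solving u = eps g z and v = eps^2
    g' z + (eps / g) z_s at t = 0.\<close>
  define F where "F = (%x. 1 / (\<epsilon> * g 0) * \<psi> x)"
  define G where "G = (%x. g 0 * (1 / \<epsilon> * zext l u1 x + - (\<epsilon> * g1 0) * prim F x))"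
  have FL: "locL2 F" unfolding F_def by (rule locL2_cmult[OF \<psi>(1)])
  have Fz: "!!x. x \<notin> {0<..<l} ==> F x = 0" by (simp add: F_def \<psi>(5))
  have Fi: "integral {0..l} F = 0" by (simp add: F_def \<psi>(3))
  have pFL: "locL2 (prim F)" by (rule prim_locL2[OF FL])
  have GL: "locL2 G" unfolding G_def by (intro locL2_cmult locL2_add u1z pFL)
  have Gz: "G x = 0" if "x \<notin> {0<..<l}" for x
   using prim_vanish[OF locL2_loc_int[OF FL] Fi Fz that l] that by (auto simp: G_def zext_def)
  have nF: "L2_norm {0..l} F <= \<bar>C0\<bar> / g 0"
  proof -
   have "L2_norm {0..l} \<psi> <= C0 * \<epsilon>"
    using ini weak_derivative_works(3)[OF \<psi>(2) l] locL2_Ioo(2)[OF \<psi>(1)] by (simp add: Q)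
   also have "... <= \<bar>C0\<bar> * \<epsilon>" using e by (intro mult_right_mono) auto
   finally have "1 / (\<epsilon> * g 0) * L2_norm {0..l} \<psi> <= 1 / (\<epsilon> * g 0) * (\<bar>C0\<bar> * \<epsilon>)"
    by (rule mult_left_mono) (use e g0 in simp)
   then have "L2_norm {0..l} F <= 1 / (\<epsilon> * g 0) * (\<bar>C0\<bar> * \<epsilon>)"
    unfolding F_def L2_norm_cmult using e g0 by (simp only: abs_of_nonneg zero_le_divide_1_iff mult_nonneg_nonneg less_imp_le)
   then show ?thesis using e g0 by simp
  qed
  have nG: "L2_norm {0..l} G <= g 0 * (\<bar>C0\<bar> + \<bar>g1 0\<bar> * (l * (\<bar>C0\<bar> / g 0)))"
  proof -
   have "L2_norm {0..l} (%x. 1 / \<epsilon> * zext l u1 x) = 1 / \<epsilon> * L2_norm {0<..<l} u1"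
    using e L2_norm_cong_space[of "{0<..<l}" "zext l u1" u1] locL2_Ioo(2)[OF u1z, of 0 l]
    by (simp add: L2_norm_cmult[of _ "1 / \<epsilon>", simplified] zext_eq)
   also have "... <= 1 / \<epsilon> * (\<bar>C0\<bar> * \<epsilon>)"
   proof (rule mult_left_mono)
    show "L2_norm {0<..<l} u1 <= \<bar>C0\<bar> * \<epsilon>"
     using ini mult_right_mono[OF abs_ge_self[of C0] less_imp_le[OF e(1)]] by (simp only: Q) linarith
   qed (use e in simp)
   also have "... = \<bar>C0\<bar>" using e by simp
   finally have 1: "L2_norm {0..l} (%x. 1 / \<epsilon> * zext l u1 x) <= \<bar>C0\<bar>" .
   have "L2_norm {0..l} (%x. - (\<epsilon> * g1 0) * prim F x) = (\<epsilon> * \<bar>g1 0\<bar>) * L2_norm {0..l} (prim F)"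
    using e by (simp only: L2_norm_cmult abs_minus_cancel abs_mult abs_of_pos)
   also have "... <= (1 * \<bar>g1 0\<bar>) * (l * (\<bar>C0\<bar> / g 0))"
   proof (intro mult_mono)
    have "L2_norm {0..l} (prim F) <= l * L2_norm {0..l} F" by (rule L2_norm_prim_le[OF FL]) (use l in simp)
    also have "... <= l * (\<bar>C0\<bar> / g 0)" using nF l by (intro mult_left_mono) auto
    finally show "L2_norm {0..l} (prim F) <= l * (\<bar>C0\<bar> / g 0)" .
   qed (use e in auto)
   finally have 2: "L2_norm {0..l} (%x. - (\<epsilon> * g1 0) * prim F x) <= \<bar>g1 0\<bar> * (l * (\<bar>C0\<bar> / g 0))" by simp
   have "L2_norm {0..l} (%x. 1 / \<epsilon> * zext l u1 x + - (\<epsilon> * g1 0) * prim F x) <= \<bar>C0\<bar> + \<bar>g1 0\<bar> * (l * (\<bar>C0\<bar> / g 0))"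
    by (rule order_trans[OF L2_norm_triangle add_mono[OF 1 2]]) (intro locL2_D locL2_cmult u1z pFL)+
   then show ?thesis unfolding G_def L2_norm_cmult[of _ "g 0"] using g0 by simp
  qed
  obtain P0 where P0: "locL2 P0" "periodic (2 * l) P0" "integral {0..2 * l} P0 = 0"
   "L2_norm {0..2 * l} P0 <= 2 * (L2_norm {0..l} F + L2_norm {0..l} G)"
   "!!x. x \<in> {0..l} ==> P0 x + P0 (- x) = 2 * F x \<and> P0 x - P0 (- x) = 2 * G x"
   using initial_profile[OF FL Fz Fi GL Gz l] by blast
  have P0E: "L2_norm {0..2 * l} P0 <= Eb" using P0(4) nF nG by (simp add: Eb_def)
  \<comment> \<open>The speed is frozen for negative times, so that the time change is a bijection
    of the whole line with derivative at least c0.\<close>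
  define ch where "ch = (%t. c (max 0 (\<epsilon> * t)))"
  have chc: "continuous_on UNIV ch"
   unfolding ch_def by (rule continuous_on_compose2[OF smooth_bounded_continuous[OF c]]) (auto intro!: continuous_intros)
  have chm: "ch t >= c0" for t unfolding ch_def by (rule cc0) simp
  define \<sigma> where "\<sigma> = prim ch"
  obtain \<theta> where \<theta>: "!!t. \<theta> (\<sigma> t) = t" "!!s. (\<theta> has_real_derivative inverse (ch (\<theta> s))) (at s)"
   "!!s. s >= 0 ==> \<theta> s >= 0" and \<sigma>m: "strict_mono \<sigma>"
   using time_change[OF chc c0 chm] unfolding \<sigma>_def by metis
  have \<theta>d: "(\<theta> has_real_derivative inverse (c (\<epsilon> * \<theta> s))) (at s)" if "s >= 0" for s
   using \<theta>(2)[of s] \<theta>(3)[OF that] e by (simp add: ch_def)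
  have cn: "c \<tau> \<noteq> 0" if "\<tau> >= 0" for \<tau> using cc0[OF that] c0 by linarith
  have chA: "der_chain \<epsilon> KA (%i s. FA i (\<epsilon> * \<theta> s) * \<epsilon> ^ i)"
   by (rule coeff_der_chain[where c=c]) (fact FA(2) \<theta>d \<theta>(3) e(1) cn)+
  have chB: "der_chain \<epsilon> KB (%i s. FB i (\<epsilon> * \<theta> s) * \<epsilon> ^ i)"
   by (rule coeff_der_chain[where c=c]) (fact FB(2) \<theta>d \<theta>(3) e(1) cn)+
  obtain n where n: "wave_data (2 * l) K KA KB \<epsilon> (%i s. FA i (\<epsilon> * \<theta> s) * \<epsilon> ^ i) (%i s. FB i (\<epsilon> * \<theta> s) * \<epsilon> ^ i) P0 n S"
   and drift: "!!s. s \<in> {0..S} ==> \<bar>(L2_norm {0..2 * l} (%z. P0 z + tint n s z))^2 - (L2_norm {0..2 * l} P0)^2\<bar> <= C * \<epsilon>^2"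
   using LT[OF e(1,2) chA chB P0(1-3) P0E] unfolding S_def by blast
  interpret wd: wave_data "2 * l" K KA KB \<epsilon> "%i s. FA i (\<epsilon> * \<theta> s) * \<epsilon> ^ i" "%i s. FB i (\<epsilon> * \<theta> s) * \<epsilon> ^ i" P0 n S
   by (rule n)
  have \<sigma>0: "\<sigma> 0 = 0" by (simp add: \<sigma>_def)
  have \<sigma>S: "\<sigma> t \<in> {0..S}" if t: "t \<in> {0..Te}" for t
  proof -
   have "\<sigma> 0 <= \<sigma> t" using t strict_mono_mono[OF \<sigma>m] by (auto simp: mono_def)
   moreover have "\<bar>\<sigma> t - \<sigma> 0\<bar> <= c1 * \<bar>t - 0\<bar>"
    unfolding \<sigma>_def
   proof (rule prim_lipschitz[OF loc_int_continuous[OF chc]])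
    fix x show "\<bar>ch x\<bar> <= c1" using c1(2)[of "max 0 (\<epsilon> * x)"] chm[of x] c0 by (simp add: ch_def)
   qed
   moreover have "c1 * t <= c1 * Te" using t c1 by (intro mult_left_mono) auto
   moreover have "c1 * Te <= S" unfolding Te_def S_def by (rule power_less_bound[OF e(1,3) c1(1)])
   ultimately show ?thesis using t \<sigma>0 by simp
  qed
  interpret lw: liouville_wave "2 * l" P0 n l c a g g1 g2 \<epsilon> \<sigma> Te S
  proof unfold_locales
   fix t assume t: "t \<in> {0..Te}"
   have n0: "\<epsilon> * t >= 0" using t e by simp
   show "(\<sigma> has_real_derivative c (\<epsilon> * t)) (at t within {0..Te})"
   proof -
    have "ch t = c (\<epsilon> * t)" using n0 by (simp add: ch_def)
    then show ?thesis using has_field_derivative_at_within[OF prim_deriv[OF chc, of t], of "{0..Te}"] by (simp add: \<sigma>_def)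
   qed
   show "\<sigma> t \<in> {0..S}" by (rule \<sigma>S[OF t])
   fix y
   show "n (\<sigma> t) y = \<epsilon>^2 * (- (g2 (\<epsilon> * t) * g (\<epsilon> * t) ^ 3) * wfld P0 n (\<sigma> t) y + a (\<epsilon> * t) * g (\<epsilon> * t) ^ 6 * wfld P0 n (\<sigma> t) y ^ 3)"
    using wd.n_eq[of "\<sigma> t" y] \<sigma>S[OF t] by (simp add: FA(1) FB(1) \<theta>(1) \<alpha>_def \<beta>_def)
  next
   show "inj_on \<sigma> {0..Te}" by (rule inj_on_subset[OF strict_mono_imp_inj_on[OF \<sigma>m] subset_UNIV])
  qed (use l e Te gpos cg g1(2) g2(2) in auto)
  have pf0: "wd.pf 0 y = P0 y" for y by (simp add: wd.pf_def tint_def)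
  have fx0: "wd.fx 0 x = F x" and ft0: "wd.ft 0 x = G x" if "x \<in> {0..l}" for x
   using P0(5)[OF that] by (auto simp: wd.fx_def wd.ft_def pf0)
  have pfx: "prim (wd.fx 0) x = prim F x" if x: "x \<in> {0..l}" for x
  proof -
   have "integral {0..x} (wd.fx 0) = integral {0..x} F"
    by (rule HK_cong) (use x in \<open>simp add: fx0\<close>)
   then show ?thesis
    using prim_diff[OF locL2_loc_int[OF wd.fx_locL2], of 0 x 0] prim_diff[OF locL2_loc_int[OF FL], of 0 x] x by simp
  qed
  have u0eq: "AE x in lebesgue_on {0<..<l}. lw.u 0 x = u0 x"
  proof -
   have "lw.u 0 x = prim \<psi> x" if "x \<in> {0<..<l}" for x
   proof -
    have "prim F x = 1 / (\<epsilon> * g 0) * prim \<psi> x" unfolding F_def by (rule prim_cmult)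
    then show ?thesis using that e g0 by (simp add: lw.u_def lw.k_def \<sigma>0 pfx)
   qed
   then have "AE x in lebesgue_on {0<..<l}. lw.u 0 x = prim \<psi> x"
    by (intro AE_I2) (simp add: space_restrict_space)
   with \<psi>(4) show ?thesis by eventually_elim simp
  qed
  have v0eq: "AE x in lebesgue_on {0<..<l}. lw.v 0 x = u1 x"
  proof (rule AE_I2)
   fix x assume "x \<in> space (lebesgue_on {0<..<l})"
   then have x: "x \<in> {0<..<l}" by (simp add: space_restrict_space)
   have "lw.v 0 x = \<epsilon>^2 * g1 0 * prim F x + \<epsilon> / g 0 * G x"
    using x by (simp add: lw.v_def lw.k1_def lw.k2_def \<sigma>0 pfx ft0)
   also have "\<epsilon> / g 0 * G x = u1 x - \<epsilon>^2 * g1 0 * prim F x"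
    using e g0 by (simp add: G_def zext_eq[OF x] field_simps power2_eq_square)
   finally show "lw.v 0 x = u1 x" by simp
  qed
  have sol: "wave_solution Q c a \<epsilon> (1 / \<epsilon> ^ N) u0 u1 lw.u lw.v"
   using lw.solution[OF u0eq v0eq] by (simp add: Q Te_def)
  have est: "\<bar>adiabatic_invariant Q c \<epsilon> lw.u lw.v t - \<epsilon>^2 * (L2_norm {0..2 * l} (wd.pf (\<sigma> t)))^2 / 4\<bar> <= C1 * \<epsilon> ^ 3"
   if t: "t \<in> {0..Te}" for t
   unfolding C1_def Q
  proof (rule lw.invariant_estimate[OF t e(4)])
   show "\<bar>g (\<epsilon> * t) * g1 (\<epsilon> * t)\<bar> <= Gb" using Gb t e by simp
   show "L2_norm {0..2 * l} (wd.pf (\<sigma> t)) <= K"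
    using wd.energy[of "\<sigma> t"] \<sigma>S[OF t] by (simp add: wd.pf_def[abs_def])
  qed
  have "\<bar>adiabatic_invariant Q c \<epsilon> lw.u lw.v t - adiabatic_invariant Q c \<epsilon> lw.u lw.v 0\<bar> <= (C / 4 + 2 * C1) * \<epsilon> ^ 3"
   if t: "t \<in> {0..Te}" for t
  proof -
   define X where "X s = (L2_norm {0..2 * l} (wd.pf s))^2" for s
   have "\<bar>X (\<sigma> t) - X 0\<bar> <= C * \<epsilon>^2"
    using drift[OF \<sigma>S[OF t]] by (simp add: X_def pf0 wd.pf_def[abs_def] tint_def)
   then have "\<epsilon>^2 * \<bar>X (\<sigma> t) - X 0\<bar> <= \<epsilon>^2 * (C * \<epsilon>^2)" by (rule mult_left_mono) simp
   also have "... = C * \<epsilon> ^ 4" by (simp add: power2_eq_square eval_nat_numeral)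
   also have "... <= C * \<epsilon> ^ 3" using C e by (intro mult_left_mono power_decreasing) auto
   finally have d: "\<bar>\<epsilon>^2 * X (\<sigma> t) / 4 - \<epsilon>^2 * X 0 / 4\<bar> <= C * \<epsilon> ^ 3 / 4"
    by (simp add: abs_mult flip: right_diff_distrib diff_divide_distrib)
   have z: "0 \<in> {0..Te}" using Te by simp
   have tri: "\<bar>p - q\<bar> <= d + 2 * e" if "\<bar>p - p'\<bar> <= e" "\<bar>q - q'\<bar> <= e" "\<bar>p' - q'\<bar> <= d" for p q p' q' d e :: real
    using that by linarith
   have "\<bar>adiabatic_invariant Q c \<epsilon> lw.u lw.v t - adiabatic_invariant Q c \<epsilon> lw.u lw.v 0\<bar> <= C * \<epsilon> ^ 3 / 4 + 2 * (C1 * \<epsilon> ^ 3)"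
    by (rule tri[OF est[OF t] est[OF z, unfolded \<sigma>0] d[unfolded X_def]])
   then show ?thesis by (simp add: distrib_right)
  qed
  then show "\<exists>u v. wave_solution Q c a \<epsilon> (1 / \<epsilon> ^ N) u0 u1 u v \<and>
     (\<forall>t\<in>{0..1 / \<epsilon> ^ N}.
       \<bar>adiabatic_invariant Q c \<epsilon> u v t - adiabatic_invariant Q c \<epsilon> u v 0\<bar> <= (C / 4 + 2 * C1) * \<epsilon> ^ 3)"
   using sol unfolding Te_def by blast
 qed
qed

end
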